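(* Let $d \in \mathbb{N}$, $p, q \in [1,\infty]$ and $s \geq 0$. Then $M_{p,q}^s(\mathbb{R}^d) \cap M_{\infty,1}(\mathbb{R}^d)$ is a Banach $*$-algebra with respect to pointwise multiplication and complex conjugation; these operations are well-defined due to the continuous embedding $M_{\infty,1}(\mathbb{R}^d) \hookrightarrow C_{\mathrm{b}}(\mathbb{R}^d)$. Furthermore, if $q > 1$ and $s > d\left(1 - \frac1q\right)$, or if $q = 1$, then $M_{p,q}^s(\mathbb{R}^d) \hookrightarrow M_{\infty,1}(\mathbb{R}^d)$ (continuously), so in particular $M_{p,q}^s(\mathbb{R}^d)$ is a Banach $*$-algebra in that case.
   Context: Modulation spaces: fix a window $g \in \mathcal{S}(\mathbb{R}^d)\setminus\{0\}$. For $f \in \mathcal{S}'(\mathbb{R}^d)$ the short-time Fourier transform is $(V_g f)(x,\xi) = (2\pi)^{-d/2}\, \overline{\langle f, M_\xi S_x g\rangle}$, $x,\xi\in\mathbb{R}^d$, where $S_x g(y) = g(y-x)$, $(M_\xi g)(y) = e^{\mathrm{i}\xi\cdot y} g(y)$, and $\langle f, g\rangle = \int \overline{f(y)}\, g(y)\,dy$, extended to $f\in\mathcal{S}'$ (so for nice $f$, $(V_g f)(x,\xi) = (2\pi)^{-d/2}\int f(y)\overline{g(y-x)}e^{-\mathrm{i}\xi\cdot y}\,dy$). With $\langle\xi\rangle = \sqrt{1+|\xi|^2}$, set $\|f\|_{M_{p,q}^s(\mathbb{R}^d)} = \big\| \xi \mapsto \langle\xi\rangle^s \|V_g f(\cdot,\xi)\|_{L^p(\mathbb{R}^d)}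 \big\|_{L^q(\mathbb{R}^d)}$, $M_{p,q}^s(\mathbb{R}^d) = \{ f \in \mathcal{S}'(\mathbb{R}^d) : \|f\|_{M_{p,q}^s} < \infty\}$ and $M_{p,q} := M_{p,q}^0$. These are Banach spaces and different windows give equivalent norms. The intersection carries the usual intersection norm, e.g. $\|f\|_{M_{p,q}^s} + \|f\|_{M_{\infty,1}}$. $C_{\mathrm{b}}(\mathbb{R}^d)$ is the space of bounded complex-valued continuous functions on $\mathbb{R}^d$ with the supremum norm; the embedding means that each element of $M_{\infty,1}(\mathbb{R}^d)$ is (as a tempered distribution) given by a function in $C_{\mathrm{b}}(\mathbb{R}^d)$. A Banach $*$-algebra $X$ here is a Banach algebra over $\mathbb{C}$ with a continuous involution $*$, i.e. $(x+y)^* = x^*+y^*$, $(\lambda x)^* = \overline{\lambda}x^*$, $(xy)^* = y^*x^*$, $(x^* )^* = x$ for all $x,y\in X$, $\lambda\in\mathbb{C}$. Neither a unit nor $C=1$ in the estimates $\|xy\| \leq C\|x\|\|y\|$, $\|x^*\| \leq C\|x\|$ is required. *)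

theory Defs
  imports
    "HOL-Analysis.Analysis"
    "HOL-Probability.Essential_Supremum"
    "HOL-Library.Function_Algebras"
begin

section \<open>Banach *-algebras\<close>

text \<open>All structures live on a carrier \<open>X\<close> inside an ambient complex vector space, whose addition
  is that of the type class and whose scalar multiplication is \<open>scale\<close>.\<close>

locale complex_banach_space_on = vector_space scale
  for scale :: "complex \<Rightarrow> 'a::ab_group_add \<Rightarrow> 'a" +
  fixes X :: "'a set" and nrm :: "'a \<Rightarrow> real"
  assumes subspace_X: "subspace X"
    and nrm_nonneg: "x \<in> X \<Longrightarrow> 0 \<le> nrm x"
    and nrm_eq_0_iff: "x \<in> X \<Longrightarrow> nrm x = 0 \<longleftrightarrow> x = 0"
    and nrm_triangle: "x \<in> X \<Longrightarrow> y \<in> X \<Longrightarrow> nrm (x + y) \<le> nrm x + nrm y"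
    and nrm_scale: "x \<in> X \<Longrightarrow> nrm (scale c x) = cmod c * nrm x"
    and nrm_complete:
      "(\<And>n. u n \<in> X) \<Longrightarrow> (\<And>e. e > 0 \<Longrightarrow> \<exists>N. \<forall>m\<ge>N. \<forall>n\<ge>N. nrm (u m - u n) < e) \<Longrightarrow>
        \<exists>x\<in>X. (\<lambda>n::nat. nrm (u n - x)) \<longlonglongrightarrow> 0"

text \<open>No unit is required, and the constants in the norm estimates need not be \<open>1\<close>.\<close>

locale banach_star_algebra_on = complex_banach_space_on scale X nrm
  for scale :: "complex \<Rightarrow> 'a::ab_group_add \<Rightarrow> 'a" and X and nrm +
  fixes mult :: "'a \<Rightarrow> 'a \<Rightarrow> 'a" and star :: "'a \<Rightarrow> 'a"
  assumes mult_closed: "x \<in> X \<Longrightarrow> y \<in> X \<Longrightarrow> mult x y \<in> X"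
    and mult_assoc: "x \<in> X \<Longrightarrow> y \<in> X \<Longrightarrow> z \<in> X \<Longrightarrow> mult (mult x y) z = mult x (mult y z)"
    and mult_add_left: "x \<in> X \<Longrightarrow> y \<in> X \<Longrightarrow> z \<in> X \<Longrightarrow> mult (x + y) z = mult x z + mult y z"
    and mult_add_right: "x \<in> X \<Longrightarrow> y \<in> X \<Longrightarrow> z \<in> X \<Longrightarrow> mult x (y + z) = mult x y + mult x z"
    and mult_scale_left: "x \<in> X \<Longrightarrow> y \<in> X \<Longrightarrow> mult (scale c x) y = scale c (mult x y)"
    and mult_scale_right: "x \<in> X \<Longrightarrow> y \<in> X \<Longrightarrow> mult x (scale c y) = scale c (mult x y)"
    and mult_bounded: "\<exists>C. \<forall>x\<in>X. \<forall>y\<in>X. nrm (mult x y) \<le> C * nrm x * nrm y"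
    and star_closed: "x \<in> X \<Longrightarrow> star x \<in> X"
    and star_add: "x \<in> X \<Longrightarrow> y \<in> X \<Longrightarrow> star (x + y) = star x + star y"
    and star_scale: "x \<in> X \<Longrightarrow> star (scale c x) = scale (cnj c) (star x)"
    and star_mult: "x \<in> X \<Longrightarrow> y \<in> X \<Longrightarrow> star (mult x y) = mult (star y) (star x)"
    and star_star: "x \<in> X \<Longrightarrow> star (star x) = x"
    and star_bounded: "\<exists>C. \<forall>x\<in>X. nrm (star x) \<le> C * nrm x"

definition continuously_embedded :: "'a set \<Rightarrow> ('a \<Rightarrow> real) \<Rightarrow> 'a set \<Rightarrow> ('a \<Rightarrow> real) \<Rightarrow> bool" where
  "continuously_embedded X nX Y nY \<longleftrightarrow> X \<subseteq> Y \<and> (\<exists>C. \<forall>x\<in>X. nY x \<le> C * nX x)"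


section \<open>Schwartz functions and tempered distributions\<close>

definition japanese :: "real ^ 'd \<Rightarrow> real" where
  "japanese x = sqrt (1 + (norm x)\<^sup>2)"

definition partial_deriv :: "'d \<Rightarrow> (real ^ 'd \<Rightarrow> complex) \<Rightarrow> real ^ 'd \<Rightarrow> complex" where
  "partial_deriv i \<phi> x = frechet_derivative \<phi> (at x) (axis i 1)"

definition partial_derivs :: "'d list \<Rightarrow> (real ^ 'd \<Rightarrow> complex) \<Rightarrow> real ^ 'd \<Rightarrow> complex" where
  "partial_derivs \<beta> \<phi> = foldr partial_deriv \<beta> \<phi>"

text \<open>Smoothness: every iterated partial derivative is again (totally) differentiable.\<close>

definition schwartz :: "(real ^ 'd \<Rightarrow> complex) set" where
  "schwartz = {\<phi>. (\<forall>\<beta>. partial_derivs \<beta> \<phi> differentiable_on UNIV) \<and>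
     (\<forall>k \<beta>. bdd_above (range (\<lambda>x. japanese x ^ k * cmod (partial_derivs \<beta> \<phi> x))))}"

definition schwartz_seminorm :: "nat \<Rightarrow> 'd list \<Rightarrow> (real ^ 'd \<Rightarrow> complex) \<Rightarrow> real" where
  "schwartz_seminorm k \<beta> \<phi> = (SUP x. japanese x ^ k * cmod (partial_derivs \<beta> \<phi> x))"

text \<open>A tempered distribution is a \<^emph>\<open>linear\<close> functional on the Schwartz space that is continuous,
  i.e. bounded by finitely many of the defining seminorms. Outside of the Schwartz space it is
  \<open>0\<close> by convention, so that distributions are equal iff they agree on Schwartz functions.\<close>

type_synonym 'd functional = "(real ^ 'd \<Rightarrow> complex) \<Rightarrow> complex"

definition tempered_distributions :: "('d::finite) functional set" where
  "tempered_distributions = {f.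
     (\<forall>\<phi>. \<phi> \<notin> schwartz \<longrightarrow> f \<phi> = 0) \<and>
     (\<forall>\<phi>\<in>schwartz. \<forall>\<psi>\<in>schwartz. f (\<lambda>x. \<phi> x + \<psi> x) = f \<phi> + f \<psi>) \<and>
     (\<forall>c. \<forall>\<phi>\<in>schwartz. f (\<lambda>x. c * \<phi> x) = c * f \<phi>) \<and>
     (\<exists>C k m. \<forall>\<phi>\<in>schwartz.
        cmod (f \<phi>) \<le> C * (\<Sum>\<beta> | length \<beta> \<le> m. schwartz_seminorm k \<beta> \<phi>))}"

text \<open>Addition of functionals is the pointwise one of \<^theory>\<open>HOL-Library.Function_Algebras\<close>.\<close>

definition scale_distr :: "complex \<Rightarrow> ('d::finite) functional \<Rightarrow> ('d::finite) functional" where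
  "scale_distr c f = (\<lambda>\<phi>. c * f \<phi>)"

definition distr_of_fun :: "(real ^ 'd \<Rightarrow> complex) \<Rightarrow> ('d::finite) functional" where
  "distr_of_fun u = (\<lambda>\<phi>. if \<phi> \<in> schwartz then (LINT y|lborel. u y * \<phi> y) else 0)"

text \<open>The sesquilinear extension of \<open>\<langle>f, \<phi>\<rangle> = \<integral> cnj (f y) * \<phi> y dy\<close>, antilinear in \<open>f\<close>. As \<open>f\<close> acts
  by \<open>\<phi> \<mapsto> \<integral> f y * \<phi> y dy\<close>, both arguments have to be conjugated.\<close>

definition pairing :: "('d::finite) functional \<Rightarrow> (real ^ 'd \<Rightarrow> complex) \<Rightarrow> complex" where
  "pairing f \<phi> = cnj (f (\<lambda>y. cnj (\<phi> y)))"


section \<open>Modulation spaces\<close>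

definition shift :: "real ^ 'd \<Rightarrow> (real ^ 'd \<Rightarrow> complex) \<Rightarrow> real ^ 'd \<Rightarrow> complex" where
  "shift x g = (\<lambda>y. g (y - x))"

definition modulate :: "real ^ 'd \<Rightarrow> (real ^ 'd \<Rightarrow> complex) \<Rightarrow> real ^ 'd \<Rightarrow> complex" where
  "modulate \<xi> g = (\<lambda>y. exp (\<i> * complex_of_real (\<xi> \<bullet> y)) * g y)"

definition stft :: "(real ^ 'd \<Rightarrow> complex) \<Rightarrow> ('d::finite) functional \<Rightarrow> real ^ 'd \<Rightarrow> real ^ 'd \<Rightarrow> complex" where
  "stft g f x \<xi> = complex_of_real ((2 * pi) powr (- real CARD('d) / 2)) *
     cnj (pairing f (modulate \<xi> (shift x g)))"

definition ennreal_powr :: "ennreal \<Rightarrow> real \<Rightarrow> ennreal" where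
  "ennreal_powr a r = (if a = \<infinity> then \<infinity> else ennreal (enn2real a powr r))"

definition Lp_norm :: "ennreal \<Rightarrow> (real ^ 'd \<Rightarrow> ennreal) \<Rightarrow> ennreal" where
  "Lp_norm p h =
     (if p = \<infinity> then esssup lborel h
      else ennreal_powr (\<integral>\<^sup>+x. ennreal_powr (h x) (enn2real p) \<partial>lborel) (1 / enn2real p))"

definition modulation_enorm ::
    "(real ^ 'd \<Rightarrow> complex) \<Rightarrow> ennreal \<Rightarrow> ennreal \<Rightarrow> real \<Rightarrow> ('d::finite) functional \<Rightarrow> ennreal" where
  "modulation_enorm g p q s f =
     Lp_norm q (\<lambda>\<xi>. ennreal (japanese \<xi> powr s) *
       Lp_norm p (\<lambda>x. ennreal (cmod (stft g f x \<xi>))))"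

definition modulation_space ::
    "(real ^ 'd \<Rightarrow> complex) \<Rightarrow> ennreal \<Rightarrow> ennreal \<Rightarrow> real \<Rightarrow> ('d::finite) functional set" where
  "modulation_space g p q s = {f \<in> tempered_distributions. modulation_enorm g p q s f < \<infinity>}"

definition modulation_norm ::
    "(real ^ 'd \<Rightarrow> complex) \<Rightarrow> ennreal \<Rightarrow> ennreal \<Rightarrow> real \<Rightarrow> ('d::finite) functional \<Rightarrow> real" where
  "modulation_norm g p q s f = enn2real (modulation_enorm g p q s f)"


section \<open>Pointwise operations on distributions given by bounded continuous functions\<close>

definition Cb_rep :: "('d::finite) functional \<Rightarrow> (real ^ 'd) \<Rightarrow>\<^sub>C complex" where
  "Cb_rep f = (THE u. distr_of_fun (apply_bcontfun u) = f)"

definition distr_mult :: "('d::finite) functional \<Rightarrow> ('d::finite) functional \<Rightarrow> ('d::finite) functional" where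
  "distr_mult f h =
     distr_of_fun (\<lambda>x. apply_bcontfun (Cb_rep f) x * apply_bcontfun (Cb_rep h) x)"

definition distr_cnj :: "('d::finite) functional \<Rightarrow> ('d::finite) functional" where
  "distr_cnj f = distr_of_fun (\<lambda>x. cnj (apply_bcontfun (Cb_rep f) x))"

end

theory Submission imports Defs "HOL-Probability.Probability" begin

text \<open>Everything rests on two pointwise bounds for the short-time Fourier transform \<open>V\<close>. The reproducing
  formula, which writes a test function as a superposition of time-frequency shifts of the window,
  bounds \<open>\<bar>V f\<bar>\<close> by its convolution with a kernel that decays as fast as one likes. By Minkowski's and
  Peetre's inequalities such a convolution acts boundedly on all the mixed norms. It also maps \<open>L\<^sup>p\<close> to
  \<open>L\<^sup>\<infinity>\<close> in \<open>x\<close>, and Hoelder's inequality with the weight \<open>\<langle>\<xi>\<rangle>\<^sup>-\<^sup>s\<close> then yields the embedding into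
  \<open>M\<^sub>\<infinity>\<^sub>,\<^sub>1\<close>. There the reproducing formula converges absolutely, to a bounded continuous function.

  For a product, \<open>\<bar>V (u v)\<bar> (x, \<cdot>)\<close> is bounded by the convolution of \<open>\<bar>V u\<bar> (z, \<cdot>)\<close> and \<open>\<bar>V v\<bar> (z, \<cdot>)\<close>,
  averaged over \<open>z\<close> near \<open>x\<close> and up to a rapidly decaying error in frequency. Distributing
  \<open>\<langle>\<eta> + \<zeta>\<rangle>\<^sup>s\<close> to \<open>\<langle>\<eta>\<rangle>\<^sup>s + \<langle>\<zeta>\<rangle>\<^sup>s\<close> and taking the supremum in \<open>z\<close> of the other factor, one gets
  \<open>\<parallel>u v\<parallel> \<le> C (\<parallel>u\<parallel> \<parallel>v\<parallel>\<^sub>\<infinity>\<^sub>,\<^sub>1 + \<parallel>u\<parallel>\<^sub>\<infinity>\<^sub>,\<^sub>1 \<parallel>v\<parallel>)\<close>. For completeness, a Cauchy sequence converges uniformly, hence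
  its transforms converge pointwise, and Fatou's lemma controls the norm of the limit.\<close>

section \<open>Lebesgue norms of extended nonnegative functions\<close>

text \<open>All norms are extended nonnegative numbers and the norm estimates are estimates of
  nonnegative integrals. Minkowski's and Tonelli's theorems then require measurability only, so the
  convolution bounds hold without knowing that any norm is finite. The obstacle to the reproducing
  formula is that a tempered distribution is merely a functional on Schwartz functions and cannot
  simply be moved inside an integral over phase space. What makes this possible is that the
  integrand is a continuous curve in the Schwartz space, dominated in every seminorm by an
  integrable function of the parameter. The domination comes from the joint rapid decay of
  \<open>corr\<close>, which outweighs the polynomial growth of the seminorms of time-frequency
  shifts. The window stays fixed. Conjugation turns \<open>g\<close> into its conjugate, and this
  change of window is another instance of the reproducing formula. Since transforms are continuous,
  the essential supremum over positions is a bound at every point; the product estimate, which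
  evaluates both transforms at the same position, relies on this.\<close>

lemma ennreal_powr_top [simp]: "ennreal_powr \<infinity> r = \<infinity>" "ennreal_powr top r = top"
  by (simp_all add: ennreal_powr_def)

lemma ennreal_powr_ennreal: "0 \<le> a \<Longrightarrow> ennreal_powr (ennreal a) r = ennreal (a powr r)"
  by (simp add: ennreal_powr_def)

lemma ennreal_powr_0 [simp]: "ennreal_powr 0 r = 0"
  by (simp add: ennreal_powr_def)

lemma ennreal_powr_1 [simp]: "ennreal_powr a 1 = a"
  by (cases a) (auto simp: ennreal_powr_def)

lemma ennreal_powr_mono: "a \<le> b \<Longrightarrow> 0 \<le> r \<Longrightarrow> ennreal_powr a r \<le> ennreal_powr b r"
  by (cases a; cases b) (auto simp: ennreal_powr_ennreal ennreal_le_iff2 powr_mono2 top_unique ennreal_powr_def)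

lemma ennreal_powr_powr: "ennreal_powr (ennreal_powr a r) t = ennreal_powr a (r * t)"
  by (cases a) (auto simp: ennreal_powr_ennreal powr_powr)

lemma ennreal_powr_mult: "0 < r \<Longrightarrow> ennreal_powr (a * b) r = ennreal_powr a r * ennreal_powr b r"
proof (cases a; cases b)
  fix x y assume "0 < r" "0 \<le> x" "0 \<le> y" and [simp]: "a = ennreal x" "b = ennreal y"
  then show ?thesis
    by (simp add: ennreal_mult'[symmetric] ennreal_powr_ennreal powr_mult del: ennreal_mult)
qed (auto simp: ennreal_powr_ennreal ennreal_mult_top ennreal_top_mult ennreal_powr_def)

lemma measurable_ennreal_powr [measurable]:
  assumes [measurable]: "f \<in> borel_measurable M"
  shows "(\<lambda>x. ennreal_powr (f x) r) \<in> borel_measurable M"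
  unfolding ennreal_powr_def by measurable

text \<open>Convexity: the graph of \<open>t powr r\<close> lies above its tangent at
  \<open>a\<close>. After scaling by \<open>a\<close> this is Young's inequality with the weights
  \<open>1 / r\<close> and \<open>1 - 1 / r\<close>.\<close>

lemma powr_tangent:
  fixes t a r :: real
  assumes "0 \<le> t" "0 < a" "1 \<le> r"
  shows "r * a powr (r - 1) * t \<le> t powr r + (r - 1) * a powr r"
proof (cases "t = 0")
  case False
  define b where "b = t / a"
  have b: "b > 0" "t = a * b" using assms False by (auto simp: b_def)
  have *: "r * (b - 1) \<le> b powr r - 1"
  proof -
    have "b \<le> b powr r / r + (1 - 1 / r)"
      using Youngs_inequality_0[of "1 / r" "1 - 1 / r" "b powr r" 1] b(1) assms by (simp add: powr_powr)
    then have "b * r \<le> (b powr r / r + (1 - 1 / r)) * r"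
      using assms by (intro mult_right_mono) auto
    also have "\<dots> = b powr r + r - 1" using assms by (simp add: algebra_simps)
    finally show ?thesis by (simp add: algebra_simps)
  qed
  have "a powr (r - 1) * a = a powr r"
    using assms by (simp add: powr_diff)
  moreover have "t powr r = a powr r * b powr r"
    using b assms by (simp add: powr_mult)
  moreover have "a powr r * (r * (b - 1)) \<le> a powr r * (b powr r - 1)"
    by (rule mult_left_mono[OF *]) simp
  moreover have "r * a powr (r - 1) * t = r * (a powr (r - 1) * a) * b"
    by (simp add: b(2) mult_ac)
  ultimately have "r * a powr (r - 1) * t - t powr r \<le> (r - 1) * a powr r"
    unfolding b(2) by (simp only:) (simp add: algebra_simps)
  then show ?thesis by simp
next
  case True then show ?thesis using assms by simp
qed


text \<open>Integrating the tangent inequality at the mean \<open>a\<close> against the probability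
  density \<open>w\<close> makes the constant terms combine to \<open>a powr r\<close>. An infinite
  mean is covered by \<open>t \<le> 1 + t powr r\<close>.\<close>

lemma jensen_nn_integral_aux:
  assumes [measurable]: "h \<in> borel_measurable M" "w \<in> borel_measurable M"
    and w: "(\<integral>\<^sup>+x. w x \<partial>M) = 1" and r: "1 \<le> r"
  shows "ennreal_powr (\<integral>\<^sup>+x. h x * w x \<partial>M) r \<le> (\<integral>\<^sup>+x. ennreal_powr (h x) r * w x \<partial>M)"
proof (cases "(\<integral>\<^sup>+x. h x * w x \<partial>M)")
  case (real a)
  show ?thesis
  proof (cases "a = 0")
    case False
    with real have a: "a > 0" by simp
    have *: "ennreal (r * a powr (r - 1)) * t \<le> ennreal_powr t r + ennreal ((r - 1) * a powr r)" for t
    proof (cases t)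
      case t: (real t')
      show ?thesis
        using powr_tangent[OF \<open>0 \<le> t'\<close> a r] r t
        by (simp add: ennreal_powr_ennreal ennreal_mult[symmetric] ennreal_plus[symmetric] del: ennreal_plus ennreal_mult)
    qed simp
    have "ennreal (r * a powr (r - 1)) * ennreal a = (\<integral>\<^sup>+x. ennreal (r * a powr (r - 1)) * (h x * w x) \<partial>M)"
      by (subst nn_integral_cmult) (use real in auto)
    also have "\<dots> \<le> (\<integral>\<^sup>+x. ennreal_powr (h x) r * w x + ennreal ((r - 1) * a powr r) * w x \<partial>M)"
      by (intro nn_integral_mono, subst mult.assoc[symmetric], subst distrib_right[symmetric])
         (intro mult_right_mono *, simp)
    also have "\<dots> = (\<integral>\<^sup>+x. ennreal_powr (h x) r * w x \<partial>M) + ennreal ((r - 1) * a powr r)"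
      by (simp add: nn_integral_add nn_integral_cmult w)
    finally have "ennreal (r * a powr (r - 1) * a) \<le> \<dots>"
      using r a by (subst ennreal_mult) auto
    moreover have "r * a powr (r - 1) * a = a powr r + (r - 1) * a powr r"
      using a by (simp add: powr_diff algebra_simps)
    ultimately have "ennreal (a powr r) + ennreal ((r - 1) * a powr r) \<le>
      (\<integral>\<^sup>+x. ennreal_powr (h x) r * w x \<partial>M) + ennreal ((r - 1) * a powr r)"
      using r by (simp add: ennreal_plus[symmetric] del: ennreal_plus)
    then show ?thesis
      using real by (simp add: ennreal_powr_ennreal ennreal_add_left_cancel_le add.commute)
  qed (use real in simp)
next
  case top
  have *: "t \<le> 1 + ennreal_powr t r" for t
  proof (cases t)
    case (real t')
    have "t' \<le> 1 + t' powr r"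
      using powr_tangent[of t' 1 r] real r ge_one_powr_ge_zero[of t' r] powr_mono[of 1 r t']
      by (cases "t' \<le> 1") (auto simp: add_increasing2)
    then show ?thesis using real by (simp add: ennreal_powr_ennreal ennreal_plus[symmetric] ennreal_1[symmetric] del: ennreal_plus ennreal_1)
  qed simp
  have "\<infinity> = (\<integral>\<^sup>+x. h x * w x \<partial>M)" using top by simp
  also have "\<dots> \<le> (\<integral>\<^sup>+x. w x + ennreal_powr (h x) r * w x \<partial>M)"
  proof (rule nn_integral_mono)
    show "h x * w x \<le> w x + ennreal_powr (h x) r * w x" for x
      using mult_right_mono[OF *[of "h x"], of "w x"] by (simp add: distrib_right)
  qed
  also have "\<dots> = 1 + (\<integral>\<^sup>+x. ennreal_powr (h x) r * w x \<partial>M)"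
    by (simp add: nn_integral_add w)
  finally have "(\<integral>\<^sup>+x. ennreal_powr (h x) r * w x \<partial>M) = \<infinity>"
    by (simp add: top_unique ennreal_add_eq_top)
  then show ?thesis by simp
qed

text \<open>The previous inequality for the density \<open>w / W\<close>. By homogeneity one side
  contributes \<open>W powr r\<close> and the other one \<open>1 / W\<close>, whence the exponent
  \<open>r - 1\<close>. In this form it serves as Hoelder's inequality below.\<close>

lemma jensen_nn_integral:
  assumes [measurable]: "h \<in> borel_measurable M" "w \<in> borel_measurable M"
    and W: "(\<integral>\<^sup>+x. w x \<partial>M) = ennreal W" "0 \<le> W" and r: "1 \<le> r"
  shows "ennreal_powr (\<integral>\<^sup>+x. h x * w x \<partial>M) r
     \<le> ennreal (W powr (r - 1)) * (\<integral>\<^sup>+x. ennreal_powr (h x) r * w x \<partial>M)"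
proof (cases "W = 0")
  case True
  then have "AE x in M. w x = 0" using W by (simp add: nn_integral_0_iff_AE)
  then have "(\<integral>\<^sup>+x. h x * w x \<partial>M) = 0" by (subst nn_integral_0_iff_AE) auto
  then show ?thesis by simp
next
  case False
  with W have W0: "W > 0" by simp
  let ?c = "ennreal (1 / W)"
  let ?I = "\<integral>\<^sup>+x. h x * w x \<partial>M" and ?K = "\<integral>\<^sup>+x. ennreal_powr (h x) r * w x \<partial>M"
  have "ennreal_powr (\<integral>\<^sup>+x. h x * (?c * w x) \<partial>M) r \<le> (\<integral>\<^sup>+x. ennreal_powr (h x) r * (?c * w x) \<partial>M)"
    using W0 r by (intro jensen_nn_integral_aux) (auto simp: nn_integral_cmult W ennreal_mult[symmetric] simp del: ennreal_mult)
  also have "(\<integral>\<^sup>+x. h x * (?c * w x) \<partial>M) = ?c * ?I"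
    by (subst nn_integral_cmult[symmetric]) (auto simp: mult_ac)
  also have "(\<integral>\<^sup>+x. ennreal_powr (h x) r * (?c * w x) \<partial>M) = ?c * ?K"
    by (subst nn_integral_cmult[symmetric]) (auto simp: mult_ac)
  finally have 1: "ennreal_powr (?c * ?I) r \<le> ?c * ?K" .
  have "?I = ennreal W * (?c * ?I)"
    using W0 by (simp add: mult.assoc[symmetric] ennreal_mult[symmetric] del: ennreal_mult)
  then have "ennreal_powr ?I r = ennreal (W powr r) * ennreal_powr (?c * ?I) r"
    using W0 r ennreal_powr_mult[of r "ennreal W" "?c * ?I"] by (simp add: ennreal_powr_ennreal)
  also have "\<dots> \<le> ennreal (W powr r) * (?c * ?K)"
    by (intro mult_left_mono 1) simp
  also have "\<dots> = ennreal (W powr (r - 1)) * ?K"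
    using W0 by (simp add: mult.assoc[symmetric] ennreal_mult[symmetric] powr_diff del: ennreal_mult)
  finally show ?thesis .
qed

lemma Lp_norm_top: "Lp_norm top h = esssup lborel h" "Lp_norm \<infinity> h = esssup lborel h"
  by (simp_all add: Lp_norm_def)

text \<open>Moves the outer root to the other side, so that bounds for finite \<open>p\<close>
  become comparisons of integrals of powers.\<close>

lemma Lp_norm_finite_le_iff:
  assumes "1 \<le> p" "p \<noteq> top"
  shows "Lp_norm p h \<le> c \<longleftrightarrow>
    (\<integral>\<^sup>+x. ennreal_powr (h x) (enn2real p) \<partial>lborel) \<le> ennreal_powr c (enn2real p)"
proof -
  from assms obtain r where r: "p = ennreal r" "1 \<le> r"
    by (cases p) (auto simp: one_ennreal_def[symmetric])
  have "(ennreal_powr a (1 / r) \<le> c) = (a \<le> ennreal_powr c r)" for a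
    using ennreal_powr_mono[of "ennreal_powr a (1/r)" c r] ennreal_powr_mono[of a "ennreal_powr c r" "1/r"] r
    by (auto simp: ennreal_powr_powr)
  then show ?thesis using assms r by (simp add: Lp_norm_def)
qed

lemma Lp_norm_top_le_iff:
  assumes [measurable]: "h \<in> borel_measurable borel"
  shows "Lp_norm top h \<le> c \<longleftrightarrow> (AE x in lborel. h x \<le> c)"
  using esssup_AE[of h lborel] by (auto simp: Lp_norm_top esssup_I elim: eventually_mono)

lemma Lp_norm_powr:
  assumes "1 \<le> p" "p \<noteq> top"
  shows "ennreal_powr (Lp_norm p h) (enn2real p) = (\<integral>\<^sup>+x. ennreal_powr (h x) (enn2real p) \<partial>lborel)"
proof -
  from assms obtain r where r: "p = ennreal r" "1 \<le> r"
    by (cases p) (auto simp: one_ennreal_def[symmetric])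
  then show ?thesis by (simp add: Lp_norm_def ennreal_powr_powr)
qed

lemma Lp_norm_1: "Lp_norm 1 h = (\<integral>\<^sup>+x. h x \<partial>lborel)"
  by (simp add: Lp_norm_def)

lemma enn2real_ge_1: "1 \<le> p \<Longrightarrow> p \<noteq> top \<Longrightarrow> 1 \<le> enn2real p"
  by (cases p) (auto simp: one_ennreal_def[symmetric])

lemma Lp_norm_mono_AE:
  assumes p: "1 \<le> p" and [measurable]: "h \<in> borel_measurable borel" "k \<in> borel_measurable borel"
    and le: "AE x in lborel. h x \<le> k x"
  shows "Lp_norm p h \<le> Lp_norm p k"
proof (cases "p = top")
  case True
  then show ?thesis
    using esssup_AE[of k lborel] le by (simp add: Lp_norm_top_le_iff) (auto simp: Lp_norm_top)
next
  case False
  show ?thesis using p False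
    by (simp add: Lp_norm_finite_le_iff Lp_norm_powr)
       (intro nn_integral_mono_AE eventually_mono[OF le] ennreal_powr_mono, auto)
qed

lemma Lp_norm_mono:
  assumes "1 \<le> p" "h \<in> borel_measurable borel" "k \<in> borel_measurable borel" "\<And>x. h x \<le> k x"
  shows "Lp_norm p h \<le> Lp_norm p k"
  using assms by (intro Lp_norm_mono_AE) auto

lemma Lp_norm_cmult_le:
  assumes p: "1 \<le> p" and [measurable]: "h \<in> borel_measurable borel"
  shows "Lp_norm p (\<lambda>x. c * h x) \<le> c * Lp_norm p h"
proof (cases "p = top")
  case True
  then show ?thesis
    using esssup_AE[of h lborel] by (simp add: Lp_norm_top_le_iff) (auto simp: Lp_norm_top elim!: eventually_mono intro: mult_left_mono)
next
  case False
  have "0 < enn2real p" using enn2real_ge_1[OF p False] by simp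
  then show ?thesis using p False
    by (simp add: Lp_norm_finite_le_iff Lp_norm_powr ennreal_powr_mult nn_integral_cmult)
qed

lemma Lp_norm_cmult:
  assumes p: "1 \<le> p" and [measurable]: "h \<in> borel_measurable borel"
  shows "Lp_norm p (\<lambda>x. ennreal c * h x) = ennreal c * Lp_norm p h"
proof (cases "c > 0")
  case True
  have *: "ennreal (1/c) * ennreal c = 1" "ennreal c * ennreal (1/c) = 1"
    using True by (simp_all add: ennreal_mult[symmetric] del: ennreal_mult)
  have "ennreal c * Lp_norm p h = ennreal c * Lp_norm p (\<lambda>x. ennreal (1/c) * (ennreal c * h x))"
    by (simp add: mult.assoc[symmetric] *)
  also have "\<dots> \<le> ennreal c * (ennreal (1/c) * Lp_norm p (\<lambda>x. ennreal c * h x))"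
    by (intro mult_left_mono Lp_norm_cmult_le p) auto
  also have "\<dots> = Lp_norm p (\<lambda>x. ennreal c * h x)"
    by (simp add: mult.assoc[symmetric] *)
  finally show ?thesis using Lp_norm_cmult_le[OF p, of h "ennreal c"] by (intro antisym) auto
next
  case False
  then have "ennreal c = 0" by (simp add: ennreal_neg)
  then show ?thesis using Lp_norm_cmult_le[OF p, of h 0] by simp
qed

lemma Lp_norm_affine_le:
  fixes h :: "real ^ 'd \<Rightarrow> ennreal"
  assumes p: "1 \<le> p" and [measurable]: "h \<in> borel_measurable borel" and e: "\<bar>e\<bar> = 1"
  shows "Lp_norm p (\<lambda>x. h (a + e *\<^sub>R x)) \<le> Lp_norm p h"
proof -
  have e0: "e \<noteq> 0" using e by auto
  have D: "lborel = distr lborel borel (\<lambda>x::real^'d. a + e *\<^sub>R x)"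
    by (subst lborel_affine[OF e0, of a]) (simp add: e density_1)
  show ?thesis
  proof (cases "p = top")
    case True
    have "AE x in lborel. h x \<le> Lp_norm top h"
      using esssup_AE[of h lborel] by (simp add: Lp_norm_top)
    then have "AE x in distr lborel borel (\<lambda>x::real^'d. a + e *\<^sub>R x). h x \<le> Lp_norm top h"
      by (subst D[symmetric])
    then show ?thesis using True by (simp add: Lp_norm_top_le_iff AE_distr_iff)
  next
    case False
    have "(\<integral>\<^sup>+x. ennreal_powr (h x) (enn2real p) \<partial>lborel) = 
      (\<integral>\<^sup>+x. ennreal_powr (h x) (enn2real p) \<partial>distr lborel borel (\<lambda>x::real^'d. a + e *\<^sub>R x))"
      by (subst D[symmetric]) (rule refl)
    also have "\<dots> = (\<integral>\<^sup>+x. ennreal_powr (h (a + e *\<^sub>R x)) (enn2real p) \<partial>lborel)"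
      by (subst nn_integral_distr) auto
    finally show ?thesis using p False by (simp add: Lp_norm_finite_le_iff Lp_norm_powr)
  qed
qed

text \<open>For \<open>p = \<infinity>\<close> the sublevel sets are described by null sections: the
  essential supremum of \<open>F t\<close> is at most \<open>c\<close> iff the section at
  \<open>t\<close> of the set where \<open>F > c\<close> has measure zero, and the measure of a
  section is measurable in \<open>t\<close>.\<close>

lemma measurable_Lp_norm:
  fixes F :: "'t \<Rightarrow> real ^ 'd \<Rightarrow> ennreal"
  assumes p: "1 \<le> p" and F[measurable]: "(\<lambda>(t, x). F t x) \<in> borel_measurable (M \<Otimes>\<^sub>M lborel)"
  shows "(\<lambda>t. Lp_norm p (F t)) \<in> borel_measurable M"
proof (cases "p = top")
  case True
  have Ft[measurable]: "F t \<in> borel_measurable borel" if "t \<in> space M" for t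
    using measurable_compose[OF measurable_Pair1'[OF that, of lborel] F] by simp
  show ?thesis
  proof (rule borel_measurableI_le)
    fix c
    have m: "(\<lambda>t. emeasure lborel (Pair t -` {z \<in> space (M \<Otimes>\<^sub>M lborel). (\<lambda>(t, x). F t x) z > c})) \<in> borel_measurable M"
      by (intro lborel.measurable_emeasure_Pair) measurable
    have "{t \<in> space M. Lp_norm p (F t) \<le> c} = {t \<in> space M. emeasure lborel (Pair t -` {z \<in> space (M \<Otimes>\<^sub>M lborel). (\<lambda>(t, x). F t x) z > c}) = 0}"
    proof (intro Collect_cong conj_cong refl)
      fix t assume t: "t \<in> space M"
      have "Pair t -` {z \<in> space (M \<Otimes>\<^sub>M lborel). (\<lambda>(t, x). F t x) z > c} = {x. F t x > c}"
        using t by (auto simp: space_pair_measure)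
      moreover have "Lp_norm p (F t) \<le> c \<longleftrightarrow> emeasure lborel {x. F t x > c} = 0"
        using t by (simp add: True Lp_norm_top_le_iff AE_iff_measurable[OF _ refl] not_le)
      ultimately show "(Lp_norm p (F t) \<le> c) = (emeasure lborel (Pair t -` {z \<in> space (M \<Otimes>\<^sub>M lborel). (\<lambda>(t, x). F t x) z > c}) = 0)"
        by simp
    qed
    also have "\<dots> \<in> sets M" using m by measurable
    finally show "{t \<in> space M. Lp_norm p (F t) \<le> c} \<in> sets M" .
  qed
next
  case False
  have [measurable]: "(\<lambda>t. \<integral>\<^sup>+x. ennreal_powr (F t x) (enn2real p) \<partial>lborel) \<in> borel_measurable M"
    by (rule lborel.borel_measurable_nn_integral) measurable
  show ?thesis using False by (simp add: Lp_norm_def)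
qed

text \<open>Minkowski's integral inequality is Jensen's inequality for the weight
  \<open>t \<mapsto> \<parallel>F t\<parallel>\<close> applied to the normalised functions \<open>F t / \<parallel>F t\<parallel>\<close>.\<close>

lemma Minkowski_integral:
  fixes F :: "'t \<Rightarrow> real ^ 'd \<Rightarrow> ennreal"
  assumes p: "1 \<le> p" and M: "sigma_finite_measure M"
    and F[measurable]: "(\<lambda>(t, x). F t x) \<in> borel_measurable (M \<Otimes>\<^sub>M lborel)"
  shows "Lp_norm p (\<lambda>x. \<integral>\<^sup>+t. F t x \<partial>M) \<le> (\<integral>\<^sup>+t. Lp_norm p (F t) \<partial>M)"
proof -
  interpret M: sigma_finite_measure M by fact
  interpret P: pair_sigma_finite M lborel by standard
  define n where "n t = Lp_norm p (F t)" for t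
  define N where "N = (\<integral>\<^sup>+t. n t \<partial>M)"
  have n[measurable]: "n \<in> borel_measurable M" unfolding n_def by (rule measurable_Lp_norm[OF p F])
  have Ft[measurable]: "F t \<in> borel_measurable borel" if "t \<in> space M" for t
    using measurable_compose[OF measurable_Pair1'[OF that, of lborel] F] by simp
  have Fsw[measurable]: "(\<lambda>(x, t). F t x) \<in> borel_measurable (lborel \<Otimes>\<^sub>M M)"
    using measurable_compose[OF measurable_pair_swap' F] by (simp add: split_def)
  have [measurable]: "(\<lambda>x. \<integral>\<^sup>+t. F t x \<partial>M) \<in> borel_measurable borel"
    using M.borel_measurable_nn_integral[OF Fsw] by simp
  \<comment> \<open>As \<open>N\<close> is finite, \<open>n t\<close> is finite for almost all
    \<open>t\<close>. What holds for almost all \<open>x\<close> whenever \<open>n t\<close> is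
    finite can therefore be read in the other order, by Fubini for null sets.\<close>
  have swap: "AE x in lborel. AE t in M. Q t x"
    if Q: "\<And>t. t \<in> space M \<Longrightarrow> n t \<noteq> \<infinity> \<Longrightarrow> AE x in lborel. Q t x" and "N \<noteq> \<infinity>"
      and m: "Measurable.pred (M \<Otimes>\<^sub>M lborel) (\<lambda>(t, x). Q t x)" for Q
  proof -
    have "AE t in M. n t \<noteq> \<infinity>"
      using \<open>N \<noteq> \<infinity>\<close> unfolding N_def by (intro nn_integral_PInf_AE) auto
    then have *: "AE t in M. AE x in lborel. Q t x"
      by (rule AE_mp) (use Q in auto)
    have "{x \<in> space (M \<Otimes>\<^sub>M lborel). Q (fst x) (snd x)} \<in> sets (M \<Otimes>\<^sub>M lborel)"
      using m by (simp add: split_def pred_def)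
    then show ?thesis using P.AE_commute[of Q] * by simp
  qed
  show ?thesis
  proof (cases "N = \<infinity>")
    case False
    show ?thesis
    proof (cases "p = top")
      case True
      have "AE x in lborel. AE t in M. F t x \<le> n t"
      proof (rule swap[OF _ False])
        show "AE x in lborel. F t x \<le> n t" for t
          using esssup_AE[of "F t" lborel] by (simp add: n_def True Lp_norm_top)
      qed measurable
      then have "AE x in lborel. (\<integral>\<^sup>+t. F t x \<partial>M) \<le> N"
        unfolding N_def by eventually_elim (rule nn_integral_mono_AE)
      then show ?thesis by (simp add: True Lp_norm_top_le_iff N_def n_def)
    next
      case p': False
      define r where "r = enn2real p"
      have r: "1 \<le> r" using enn2real_ge_1[OF p p'] by (simp add: r_def)
      obtain N' where N': "N = ennreal N'" "0 \<le> N'" using False by (cases N) auto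
      \<comment> \<open>Normalising by \<open>n t\<close> loses nothing: if \<open>n t = 0\<close>,
        the function \<open>F t\<close> vanishes almost everywhere, and infinite values of
        \<open>n t\<close> are excluded by \<open>swap\<close>.\<close>
      have "AE x in lborel. AE t in M. F t x = F t x / n t * n t"
      proof (rule swap[OF _ False])
        fix t assume t: "t \<in> space M" "n t \<noteq> \<infinity>"
        show "AE x in lborel. F t x = F t x / n t * n t"
        proof (cases "n t = 0")
          case True
          then have "(\<integral>\<^sup>+x. ennreal_powr (F t x) r \<partial>lborel) = 0"
            using Lp_norm_powr[OF p p', of "F t"] by (simp add: n_def r_def)
          then have "AE x in lborel. ennreal_powr (F t x) r = 0"
            using t by (subst (asm) nn_integral_0_iff_AE) auto
          then show ?thesis
          proof eventually_elim
            fix x assume "ennreal_powr (F t x) r = 0"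
            then have "ennreal_powr (ennreal_powr (F t x) r) (1 / r) = 0" by simp
            then show "F t x = F t x / n t * n t" using r by (simp add: ennreal_powr_powr)
          qed
        next
          case False
          then show ?thesis using t by (simp add: ennreal_divide_times ennreal_times_divide top_unique mult_divide_eq_ennreal ennreal_mult_divide_eq)
        qed
      qed measurable
      then have "AE x in lborel. ennreal_powr (\<integral>\<^sup>+t. F t x \<partial>M) r \<le>
         ennreal (N' powr (r - 1)) * (\<integral>\<^sup>+t. ennreal_powr (F t x / n t) r * n t \<partial>M)"
      proof eventually_elim
        fix x assume "AE t in M. F t x = F t x / n t * n t"
        then have "(\<integral>\<^sup>+t. F t x \<partial>M) = (\<integral>\<^sup>+t. F t x / n t * n t \<partial>M)"
          by (rule nn_integral_cong_AE)
        moreover have [measurable]: "(\<lambda>t. F t x) \<in> borel_measurable M"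
          using measurable_compose[OF measurable_Pair1' Fsw] by simp
        ultimately show "ennreal_powr (\<integral>\<^sup>+t. F t x \<partial>M) r \<le>
         ennreal (N' powr (r - 1)) * (\<integral>\<^sup>+t. ennreal_powr (F t x / n t) r * n t \<partial>M)"
          using jensen_nn_integral[of "\<lambda>t. F t x / n t" M n N' r] r N' by (simp add: N_def)
      qed
      then have "(\<integral>\<^sup>+x. ennreal_powr (\<integral>\<^sup>+t. F t x \<partial>M) r \<partial>lborel) \<le>
        (\<integral>\<^sup>+x. ennreal (N' powr (r - 1)) * (\<integral>\<^sup>+t. ennreal_powr (F t x / n t) r * n t \<partial>M) \<partial>lborel)"
        by (rule nn_integral_mono_AE)
      also have "\<dots> = ennreal (N' powr (r - 1)) * (\<integral>\<^sup>+t. (\<integral>\<^sup>+x. ennreal_powr (F t x / n t) r * n t \<partial>lborel) \<partial>M)"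
        by (subst nn_integral_cmult, simp, subst P.Fubini') auto
      also have "\<dots> \<le> ennreal (N' powr (r - 1)) * (\<integral>\<^sup>+t. n t \<partial>M)"
      proof (intro mult_left_mono nn_integral_mono)
        fix t assume t: "t \<in> space M"
        show "(\<integral>\<^sup>+x. ennreal_powr (F t x / n t) r * n t \<partial>lborel) \<le> n t"
        proof (cases "n t = 0 \<or> n t = \<infinity>")
          case False
          have "ennreal_powr (Lp_norm p (\<lambda>x. inverse (n t) * F t x)) r \<le> ennreal_powr (inverse (n t) * n t) r"
            unfolding n_def using r by (intro ennreal_powr_mono Lp_norm_cmult_le p) (use t in auto)
          also have "inverse (n t) * n t = 1" 
            using False ennreal_divide_self[of "n t"] by (simp add: divide_ennreal_def mult.commute top.not_eq_extremum)
          finally have "(\<integral>\<^sup>+x. ennreal_powr (F t x / n t) r \<partial>lborel) \<le> 1"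
            using Lp_norm_powr[OF p p', of "\<lambda>x. inverse (n t) * F t x"] ennreal_powr_ennreal[of 1 r]
            by (simp add: r_def divide_ennreal_def mult.commute)
          then have "(\<integral>\<^sup>+x. ennreal_powr (F t x / n t) r \<partial>lborel) * n t \<le> 1 * n t"
            by (rule mult_right_mono) simp
          then show ?thesis using t by (simp add: nn_integral_multc)
        qed auto
      qed simp
      also have "\<dots> = ennreal_powr N r"
        using N' r by (cases "N' = 0") (auto simp: N_def[symmetric] ennreal_powr_ennreal ennreal_mult[symmetric] powr_diff simp del: ennreal_mult)
      finally show ?thesis
        by (simp add: Lp_norm_finite_le_iff[OF p p'] r_def N_def n_def)
    qed
  qed (simp add: N_def n_def)
qed

text \<open>Minkowski's integral inequality for the counting measure on a two-point space.\<close>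

lemma Lp_norm_triangle:
  fixes h k :: "real ^ 'd \<Rightarrow> ennreal"
  assumes p: "1 \<le> p" and [measurable]: "h \<in> borel_measurable borel" "k \<in> borel_measurable borel"
  shows "Lp_norm p (\<lambda>x. h x + k x) \<le> Lp_norm p h + Lp_norm p k"
proof -
  have "Lp_norm p (\<lambda>x. \<integral>\<^sup>+b. (if b then h x else k x) \<partial>count_space UNIV)
     \<le> (\<integral>\<^sup>+b. Lp_norm p (if b then h else k) \<partial>count_space (UNIV::bool set))"
  proof (rule order_trans[OF Minkowski_integral[OF p, where F="\<lambda>b x. if b then h x else k x"]])
    show "(\<lambda>(b, x). if b then h x else k x) \<in> borel_measurable (count_space (UNIV::bool set) \<Otimes>\<^sub>M lborel)"
      by measurable
    show "(\<integral>\<^sup>+t. Lp_norm p (\<lambda>x. if t then h x else k x) \<partial>count_space UNIV)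
    \<le> (\<integral>\<^sup>+b. Lp_norm p (if b then h else k) \<partial>count_space UNIV)"
      by (intro nn_integral_mono) auto
  qed (auto intro: sigma_finite_measure_count_space)
  then show ?thesis by (simp add: nn_integral_count_space_finite UNIV_bool add_ac)
qed

text \<open>Substitution moves the translation from \<open>w\<close> to \<open>h\<close>;
  Minkowski's inequality and the translation invariance of the norm do the rest.\<close>

lemma Young_Lp:
  fixes h w :: "real ^ 'd \<Rightarrow> ennreal"
  assumes p: "1 \<le> p" and [measurable]: "h \<in> borel_measurable borel" "w \<in> borel_measurable borel"
  shows "Lp_norm p (\<lambda>x. \<integral>\<^sup>+y. w (x - y) * h y \<partial>lborel) \<le> (\<integral>\<^sup>+x. w x \<partial>lborel) * Lp_norm p h"
proof -
  have D: "lborel = distr lborel borel (\<lambda>t::real^'d. x + (-1) *\<^sub>R t)" for x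
    using lborel_affine[of "-1" x] by (simp add: density_1)
  have "(\<integral>\<^sup>+y. w (x - y) * h y \<partial>lborel) = (\<integral>\<^sup>+t. w t * h (x + (-1) *\<^sub>R t) \<partial>lborel)" for x
  proof -
    have "(\<integral>\<^sup>+y. w (x - y) * h y \<partial>lborel) = (\<integral>\<^sup>+y. w (x - y) * h y \<partial>distr lborel borel (\<lambda>t::real^'d. x + (-1) *\<^sub>R t))"
      by (rule arg_cong[where f="\<lambda>M. nn_integral M _", OF D])
    then show ?thesis by (simp add: nn_integral_distr)
  qed
  then have "Lp_norm p (\<lambda>x. \<integral>\<^sup>+y. w (x - y) * h y \<partial>lborel) 
     = Lp_norm p (\<lambda>x. \<integral>\<^sup>+t. w t * h (x + (-1) *\<^sub>R t) \<partial>lborel)" by simp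
  also have "\<dots> \<le> (\<integral>\<^sup>+t. Lp_norm p (\<lambda>x. w t * h (x + (-1) *\<^sub>R t)) \<partial>lborel)"
    by (rule Minkowski_integral[OF p]) (auto intro: lborel.sigma_finite_measure_axioms)
  also have "\<dots> \<le> (\<integral>\<^sup>+t. w t * Lp_norm p h \<partial>lborel)"
  proof (rule nn_integral_mono)
    fix t
    have "Lp_norm p (\<lambda>x. w t * h (x + (-1) *\<^sub>R t)) \<le> w t * Lp_norm p (\<lambda>x. h (x + (-1) *\<^sub>R t))"
      by (rule Lp_norm_cmult_le[OF p]) simp
    also have "\<dots> \<le> w t * Lp_norm p h"
      using Lp_norm_affine_le[OF p, of h 1 "- t"] by (intro mult_left_mono) (auto simp: add.commute)
    finally show "Lp_norm p (\<lambda>x. w t * h (x + (-1) *\<^sub>R t)) \<le> w t * Lp_norm p h" .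
  qed
  also have "\<dots> = (\<integral>\<^sup>+x. w x \<partial>lborel) * Lp_norm p h" by (simp add: nn_integral_multc)
  finally show ?thesis .
qed

text \<open>Fatou's lemma for all exponents. The bound is required from \<open>m0\<close> on only,
  which is what a Cauchy sequence supplies.\<close>

lemma Lp_norm_liminf_le:
  fixes h :: "real ^ 'd \<Rightarrow> ennreal"
  assumes p: "1 \<le> p" and [measurable]: "h \<in> borel_measurable borel" "\<And>m. k m \<in> borel_measurable borel"
    and le: "AE x in lborel. h x \<le> liminf (\<lambda>m. k m x)"
    and c: "\<And>m. m \<ge> m0 \<Longrightarrow> Lp_norm p (k m) \<le> c"
  shows "Lp_norm p h \<le> c"
proof (cases "p = top")
  case True
  have "AE x in lborel. \<forall>m\<ge>m0. k m x \<le> c"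
    using c by (simp add: AE_all_countable True Lp_norm_top_le_iff)
  then have "AE x in lborel. liminf (\<lambda>m. k m x) \<le> c"
  proof eventually_elim
    fix x assume "\<forall>m\<ge>m0. k m x \<le> c"
    then have "liminf (\<lambda>m. k m x) \<le> liminf (\<lambda>m. c)"
      by (intro Liminf_mono eventually_sequentiallyI[of m0]) auto
    then show "liminf (\<lambda>m. k m x) \<le> c" by (simp add: Liminf_const)
  qed
  then have "AE x in lborel. h x \<le> c" using le by eventually_elim auto
  then show ?thesis by (simp add: True Lp_norm_top_le_iff)
next
  case False
  define r where "r = enn2real p"
  have r: "1 \<le> r" using enn2real_ge_1[OF p False] by (simp add: r_def)
  \<comment> \<open>The power and its inverse with exponent \<open>1 / r\<close> are both monotone,
    so a bound for the powers of the tail infima is a bound for the tail infima themselves.\<close>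
  have *: "ennreal_powr (liminf a) r \<le> liminf (\<lambda>m. ennreal_powr (a m) r)" for a
  proof -
    let ?c = "liminf (\<lambda>m. ennreal_powr (a m) r)"
    have "Inf (a ` {n..}) \<le> ennreal_powr ?c (1 / r)" for n
    proof -
      have "ennreal_powr (Inf (a ` {n..})) r \<le> (INF m\<in>{n..}. ennreal_powr (a m) r)"
        using r by (intro INF_greatest ennreal_powr_mono INF_lower) auto
      also have "\<dots> \<le> ?c" unfolding liminf_SUP_INF by (rule SUP_upper) simp
      finally have "ennreal_powr (ennreal_powr (Inf (a ` {n..})) r) (1 / r) \<le> ennreal_powr ?c (1 / r)"
        using r by (intro ennreal_powr_mono) auto
      then show ?thesis using r by (simp add: ennreal_powr_powr)
    qed
    then have "liminf a \<le> ennreal_powr ?c (1 / r)" unfolding liminf_SUP_INF by (intro SUP_least) auto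
    then have "ennreal_powr (liminf a) r \<le> ennreal_powr (ennreal_powr ?c (1 / r)) r"
      using r by (intro ennreal_powr_mono) auto
    then show ?thesis using r by (simp add: ennreal_powr_powr)
  qed
  have "(\<integral>\<^sup>+x. ennreal_powr (h x) r \<partial>lborel) \<le> (\<integral>\<^sup>+x. liminf (\<lambda>m. ennreal_powr (k m x) r) \<partial>lborel)"
    using r by (intro nn_integral_mono_AE eventually_mono[OF le] order_trans[OF ennreal_powr_mono *]) auto
  also have "\<dots> \<le> liminf (\<lambda>m. \<integral>\<^sup>+x. ennreal_powr (k m x) r \<partial>lborel)"
    by (rule nn_integral_liminf) auto
  also have "\<dots> \<le> liminf (\<lambda>m. ennreal_powr c r)"
    using c by (intro Liminf_mono eventually_sequentiallyI[of m0]) (simp add: Lp_norm_finite_le_iff[OF p False] r_def)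
  finally show ?thesis by (simp add: Lp_norm_finite_le_iff[OF p False] r_def Liminf_const)
qed

text \<open>A weight in both \<open>L\<^sup>1\<close> and \<open>L\<^sup>\<infinity>\<close> lies in
  every dual space. For finite \<open>p\<close> this is Jensen's inequality with \<open>w\<close> as
  the measure, and \<open>w \<le> 1\<close> removes the weight from the right-hand side.\<close>

lemma integral_weight_le_Lp:
  fixes w :: "real ^ 'd \<Rightarrow> ennreal"
  assumes p: "1 \<le> p" and [measurable]: "w \<in> borel_measurable borel"
    and w: "(\<integral>\<^sup>+x. w x \<partial>lborel) < \<infinity>" "\<And>x. w x \<le> 1"
  shows "\<exists>C\<ge>0. \<forall>h. h \<in> borel_measurable borel \<longrightarrow> (\<integral>\<^sup>+x. w x * h x \<partial>lborel) \<le> ennreal C * Lp_norm p h"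
proof -
  obtain W where W: "(\<integral>\<^sup>+x. w x \<partial>lborel) = ennreal W" "0 \<le> W" using w(1) by (cases "\<integral>\<^sup>+x. w x \<partial>lborel") auto
  show ?thesis
  proof (cases "p = top")
    case True
    show ?thesis
    proof (intro exI conjI allI impI)
      fix h :: "real ^ 'd \<Rightarrow> ennreal" assume [measurable]: "h \<in> borel_measurable borel"
      have "(\<integral>\<^sup>+x. w x * h x \<partial>lborel) \<le> (\<integral>\<^sup>+x. w x * Lp_norm p h \<partial>lborel)"
        using esssup_AE[of h lborel] by (intro nn_integral_mono_AE) (auto simp: True Lp_norm_top elim!: eventually_mono intro: mult_left_mono)
      then show "(\<integral>\<^sup>+x. w x * h x \<partial>lborel) \<le> ennreal W * Lp_norm p h" by (simp add: nn_integral_multc W)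
    qed fact
  next
    case False
    define r where "r = enn2real p"
    have r: "1 \<le> r" using enn2real_ge_1[OF p False] by (simp add: r_def)
    define C where "C = (W powr (r - 1)) powr (1 / r)"
    show ?thesis
    proof (intro exI conjI allI impI)
      fix h :: "real ^ 'd \<Rightarrow> ennreal" assume [measurable]: "h \<in> borel_measurable borel"
      have "ennreal_powr (\<integral>\<^sup>+x. h x * w x \<partial>lborel) r \<le> ennreal (W powr (r - 1)) * (\<integral>\<^sup>+x. ennreal_powr (h x) r * w x \<partial>lborel)"
        by (rule jensen_nn_integral) (use W r in auto)
      also have "\<dots> \<le> ennreal (W powr (r - 1)) * (\<integral>\<^sup>+x. ennreal_powr (h x) r \<partial>lborel)"
        using mult_left_mono[OF w(2)] by (intro mult_left_mono nn_integral_mono) fastforce+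
      also have "\<dots> = ennreal (W powr (r - 1)) * ennreal_powr (Lp_norm p h) r"
        by (simp add: Lp_norm_powr[OF p False] r_def)
      finally have "ennreal_powr (ennreal_powr (\<integral>\<^sup>+x. h x * w x \<partial>lborel) r) (1 / r) \<le> ennreal_powr (ennreal (W powr (r - 1)) * ennreal_powr (Lp_norm p h) r) (1 / r)"
        using r by (intro ennreal_powr_mono) auto
      then show "(\<integral>\<^sup>+x. w x * h x \<partial>lborel) \<le> ennreal C * Lp_norm p h"
        using r by (simp add: ennreal_powr_mult ennreal_powr_powr ennreal_powr_ennreal C_def mult.commute)
    qed (simp add: C_def)
  qed
qed

section \<open>Polynomial weights and Fourier inversion\<close>

lemma japanese_ge_1: "1 \<le> japanese x"
  by (simp add: japanese_def)

lemma japanese_pos [simp]: "0 < japanese x"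
  using japanese_ge_1[of x] by linarith

lemma japanese_nonneg [simp]: "0 \<le> japanese x"
  using japanese_ge_1[of x] by linarith

lemma japanese_neq_0 [simp]: "japanese x \<noteq> 0"
  using japanese_pos[of x] by linarith

lemma japanese_minus [simp]: "japanese (- x) = japanese x"
  by (simp add: japanese_def)

lemma japanese_diff_commute: "japanese (x - y) = japanese (y - x)"
  by (simp add: japanese_def norm_minus_commute)

lemma continuous_on_japanese [continuous_intros]:
  "continuous_on A f \<Longrightarrow> continuous_on A (\<lambda>x. japanese (f x))"
  unfolding japanese_def by (intro continuous_intros)

lemma measurable_japanese [measurable]: "japanese \<in> borel_measurable borel"
  by (intro borel_measurable_continuous_onI continuous_intros)

lemma japanese_power2: "(japanese x)\<^sup>2 = 1 + (norm x)\<^sup>2"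
  by (simp add: japanese_def)

lemma norm_le_japanese: "norm x \<le> japanese x"
  by (rule power2_le_imp_le) (simp_all add: japanese_power2)

lemma japanese_add_le: "japanese (x + y) \<le> japanese x + japanese y"
proof (rule power2_le_imp_le)
  have "(norm (x + y))\<^sup>2 \<le> (norm x + norm y)\<^sup>2"
    by (intro power_mono norm_triangle_ineq) auto
  moreover have "norm x * norm y \<le> japanese x * japanese y"
    by (intro mult_mono norm_le_japanese) auto
  ultimately show "(japanese (x + y))\<^sup>2 \<le> (japanese x + japanese y)\<^sup>2"
    by (simp add: japanese_power2 power2_sum)
qed auto

lemma japanese_add_le_mult: "japanese (x + y) \<le> 2 * japanese x * japanese y"
proof -
  have "japanese x * 1 \<le> japanese x * japanese y" "1 * japanese y \<le> japanese x * japanese y"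
    using mult_mono[OF order_refl japanese_ge_1[of y], of "japanese x"] mult_mono[OF japanese_ge_1[of x] order_refl, of "japanese y"] by simp_all
  then show ?thesis using japanese_add_le[of x y] unfolding mult.assoc by linarith
qed

text \<open>Here \<open>r\<close> will be a frequency defect
  \<open>\<xi> - (\<eta> + \<zeta>)\<close>. One factor \<open>2\<close> comes from Peetre's
  inequality, which splits off \<open>r\<close>, the other one from \<open>japanese (a + b)\<close>
  being at most twice the maximum.\<close>

lemma japanese_powr_sum_le:
  assumes "0 \<le> s"
  shows "japanese (r + a + b) powr s \<le> 4 powr s * japanese r powr s * (japanese a powr s + japanese b powr s)"
proof -
  let ?m = "max (japanese a) (japanese b)"
  have "japanese (r + (a + b)) \<le> 2 * japanese r * japanese (a + b)" by (rule japanese_add_le_mult)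
  also have "\<dots> \<le> 2 * japanese r * (2 * ?m)"
    using japanese_add_le[of a b] by (intro mult_left_mono) auto
  finally have "japanese (r + a + b) powr s \<le> (4 * japanese r * ?m) powr s"
    using assms by (intro powr_mono2) (auto simp: add.assoc)
  also have "\<dots> = 4 powr s * japanese r powr s * ?m powr s"
    by (simp add: powr_mult le_max_iff_disj)
  also have "?m powr s \<le> japanese a powr s + japanese b powr s"
    by (auto simp: max_def)
  finally show ?thesis by (simp add: mult_left_mono)
qed

text \<open>Since \<open>1 + t\<^sup>2\<close> is at least \<open>(1 + t)\<^sup>2 / 2\<close>, the
  integrand has a majorant with an elementary antiderivative.\<close>

lemma nn_integral_one_plus_square_powr_half_line:
  assumes a: "1 < a"
  shows "(\<integral>\<^sup>+t. ennreal ((1 + t\<^sup>2) powr (- a / 2)) * indicator {0::real..} t \<partial>lborel) < \<infinity>"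
proof -
  have le: "(1 + t\<^sup>2) powr (- a / 2) \<le> 2 powr (a / 2) * (1 + t) powr - a" if "0 \<le> t" for t :: real
  proof -
    have "(1 + t)\<^sup>2 \<le> 2 * (1 + t\<^sup>2)" using sum_squares_bound[of 1 t] by (simp add: power2_sum)
    then have "((1 + t)\<^sup>2 / 2) \<le> 1 + t\<^sup>2" by simp
    then have "(1 + t\<^sup>2) powr (- a / 2) \<le> ((1 + t)\<^sup>2 / 2) powr (- a / 2)"
      using a that by (intro powr_mono2') auto
    also have "\<dots> = 2 powr (a / 2) * (1 + t) powr - a"
    proof -
      have "((1 + t)\<^sup>2) powr (- a / 2) = (1 + t) powr - a"
        using that by (simp add: powr_powr flip: powr_numeral)
      then show ?thesis using that by (simp add: powr_divide powr_minus field_simps)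
    qed
    finally show ?thesis .
  qed
  have "(\<integral>\<^sup>+t. ennreal ((1 + t\<^sup>2) powr (- a / 2)) * indicator {0::real..} t \<partial>lborel)
    \<le> (\<integral>\<^sup>+t. ennreal (2 powr (a / 2) * (1 + t) powr - a) * indicator {0::real..} t \<partial>lborel)"
    using le by (intro nn_integral_mono) (auto split: split_indicator)
  also have "\<dots> = ennreal (0 - (2 powr (a / 2) * (- ((1 + 0) powr (1 - a)) / (a - 1))))"
  proof (rule nn_integral_FTC_atLeast)
    show "DERIV (\<lambda>t. 2 powr (a / 2) * (- ((1 + t) powr (1 - a)) / (a - 1))) t :> 2 powr (a / 2) * (1 + t) powr - a"
      if "0 \<le> t" for t
    proof -
      have "((\<lambda>t. (1 + t) powr (1 - a)) has_real_derivative (1 - a) * (1 + t) powr (1 - a - 1)) (at t)"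
        using that by (auto intro!: derivative_eq_intros)
      then have "((\<lambda>t. 2 powr (a / 2) * (- ((1 + t) powr (1 - a)) / (a - 1))) has_real_derivative
           2 powr (a / 2) * (- ((1 - a) * (1 + t) powr (1 - a - 1)) / (a - 1))) (at t)"
        by (intro DERIV_cmult DERIV_cdivide DERIV_minus)
      moreover have "- ((1 - a) * (1 + t) powr (1 - a - 1)) / (a - 1) = (1 + t) powr - a"
        using a by (simp add: field_simps)
      ultimately show ?thesis by (simp only:)
    qed
    have "((\<lambda>t. (1 + t) powr (1 - a)) \<longlongrightarrow> 0) at_top"
      using a by (intro tendsto_neg_powr filterlim_tendsto_add_at_top[OF tendsto_const filterlim_ident]) auto
    from tendsto_mult[OF tendsto_const tendsto_divide[OF tendsto_minus[OF this] tendsto_const]]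
    show "((\<lambda>t. 2 powr (a / 2) * (- ((1 + t) powr (1 - a)) / (a - 1))) \<longlongrightarrow> 0) at_top"
      using a by force
  qed auto
  also have "\<dots> < \<infinity>" by simp
  finally show ?thesis .
qed

lemma nn_integral_one_plus_square_powr:
  assumes a: "1 < a"
  shows "(\<integral>\<^sup>+t. ennreal ((1 + t\<^sup>2) powr (- a / 2)) \<partial>(lborel :: real measure)) < \<infinity>"
proof -
  let ?f = "\<lambda>t::real. ennreal ((1 + t\<^sup>2) powr (- a / 2))"
  have "(\<integral>\<^sup>+t. ?f t \<partial>lborel) \<le> (\<integral>\<^sup>+t. ?f t * indicator {0..} t + ?f t * indicator {..0} t \<partial>lborel)"
    by (intro nn_integral_mono) (auto split: split_indicator)
  also have "\<dots> = (\<integral>\<^sup>+t. ?f t * indicator {0..} t \<partial>lborel) + (\<integral>\<^sup>+t. ?f t * indicator {..0} t \<partial>lborel)"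
    by (rule nn_integral_add) auto
  also have "(\<integral>\<^sup>+t. ?f t * indicator {..0} t \<partial>lborel) = (\<integral>\<^sup>+t. ?f t * indicator {0..} t \<partial>lborel)"
    by (subst nn_integral_real_affine[where c="-1" and t=0]) (auto intro!: nn_integral_cong split: split_indicator)
  finally show ?thesis
    using nn_integral_one_plus_square_powr_half_line[OF a] by (simp add: order_le_less_trans)
qed

text \<open>The exponent is distributed evenly over the coordinates: with
  \<open>a = r / d > 1\<close> the integrand is at most a product of \<open>d\<close>
  one-dimensional ones of exponent \<open>a\<close>. This avoids polar coordinates and still reaches
  the sharp threshold \<open>r > d\<close>.\<close>

lemma nn_integral_japanese_powr:
  assumes r: "real CARD('d) < r"
  shows "(\<integral>\<^sup>+x. ennreal (japanese (x :: real ^ 'd) powr - r) \<partial>lborel) < \<infinity>"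
proof -
  let ?d = "real CARD('d)"
  have d: "0 < ?d" by simp
  define a where "a = r / ?d"
  have a: "1 < a" using r d by (simp add: a_def)
  have le: "japanese x powr - r \<le> (\<Prod>b\<in>Basis. (1 + (x \<bullet> b)\<^sup>2) powr (- a / 2))" for x :: "real ^ 'd"
  proof -
    have "japanese x powr - r = (1 + (norm x)\<^sup>2) powr (- r / 2)"
      by (simp add: japanese_def powr_half_sqrt[symmetric] powr_powr)
    also have "\<dots> = (\<Prod>b\<in>(Basis :: (real ^ 'd) set). (1 + (norm x)\<^sup>2) powr (- a / 2))"
    proof -
      have "1 + (norm x)\<^sup>2 > 0" by (simp add: add_pos_nonneg)
      then show ?thesis by (simp add: powr_power a_def)
    qed
    also have "\<dots> \<le> (\<Prod>b\<in>Basis. (1 + (x \<bullet> b)\<^sup>2) powr (- a / 2))"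
    proof (rule prod_mono, safe)
      fix b :: "real ^ 'd" assume b: "b \<in> Basis"
      have "(x \<bullet> b)\<^sup>2 \<le> (norm x)\<^sup>2" using power_mono[OF Basis_le_norm[OF b, of x], of 2] by simp
      then show "(1 + (norm x)\<^sup>2) powr (- a / 2) \<le> (1 + (x \<bullet> b)\<^sup>2) powr (- a / 2)"
        using a by (intro powr_mono2') (auto simp: add_pos_nonneg)
    qed simp
    finally show ?thesis .
  qed
  have "(\<integral>\<^sup>+x. ennreal (japanese (x :: real ^ 'd) powr - r) \<partial>lborel)
      \<le> (\<integral>\<^sup>+x. (\<Prod>b\<in>Basis. ennreal ((1 + ((x :: real ^ 'd) \<bullet> b)\<^sup>2) powr (- a / 2))) \<partial>lborel)"
    by (intro nn_integral_mono) (use le in \<open>auto simp: prod_ennreal intro: ennreal_leI\<close>)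
  also have "\<dots> = (\<Prod>b\<in>(Basis :: (real ^ 'd) set). (\<integral>\<^sup>+t. ennreal ((1 + t\<^sup>2) powr (- a / 2)) \<partial>lborel))"
    by (rule nn_integral_lborel_prod) auto
  also have "\<dots> < \<infinity>"
    using nn_integral_one_plus_square_powr[OF a] by (simp add: power_less_top_ennreal)
  finally show ?thesis .
qed

text \<open>Integer orders suffice, since the kernels below decay to every order; a weight of real
  exponent \<open>s\<close> is absorbed by rounding \<open>s\<close> up.\<close>

definition decay :: "nat \<Rightarrow> real ^ 'd \<Rightarrow> real" where
  "decay N x = 1 / japanese x ^ N"

lemma decay_pos [simp]: "0 < decay N x"
  by (simp add: decay_def)

lemma decay_nonneg [simp]: "0 \<le> decay N x"
  by (simp add: decay_def)

lemma decay_le_1: "decay N x \<le> 1"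
  by (simp add: decay_def japanese_ge_1)

lemma decay_minus [simp]: "decay N (- x) = decay N x"
  by (simp add: decay_def)

lemma decay_diff_commute: "decay N (x - y) = decay N (y - x)"
  by (simp add: decay_def japanese_diff_commute)

lemma decay_add: "decay (M + N) x = decay M x * decay N x"
  by (simp add: decay_def power_add)

lemma continuous_on_decay [continuous_intros]:
  "continuous_on A f \<Longrightarrow> continuous_on A (\<lambda>x. decay N (f x))"
  unfolding decay_def by (intro continuous_intros) auto

lemma measurable_decay [measurable]: "decay N \<in> borel_measurable borel"
  by (intro borel_measurable_continuous_onI continuous_intros)

text \<open>Peetre's inequality, from \<open>x = (x + y) + (- y)\<close>: a translation keeps the
  order of decay and costs as many powers of \<open>japanese y\<close>.\<close>

lemma decay_Peetre: "decay N (x + y) \<le> 2 ^ N * decay N x * japanese y ^ N"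
proof -
  have "japanese x \<le> 2 * japanese (x + y) * japanese y"
    using japanese_add_le_mult[of "x + y" "- y"] by simp
  then have "japanese x ^ N \<le> (2 * japanese (x + y) * japanese y) ^ N"
    by (rule power_mono) simp
  then show ?thesis by (simp add: decay_def field_simps power_mult_distrib)
qed

lemma nn_integral_decay:
  assumes "CARD('d) < N"
  shows "(\<integral>\<^sup>+x. ennreal (decay N (x :: real ^ 'd)) \<partial>lborel) < \<infinity>"
  using nn_integral_japanese_powr[where 'd='d and r="real N"] assms
  by (simp add: decay_def powr_minus powr_realpow divide_inverse)

lemma integrable_decay [simp]:
  assumes "CARD('d) < N"
  shows "integrable lborel (decay N :: real ^ 'd \<Rightarrow> real)"
  using nn_integral_decay[OF assms] by (intro integrableI_bounded) auto

lemma integrable_decay_bound: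
  fixes f :: "real ^ 'd \<Rightarrow> complex"
  assumes [measurable]: "f \<in> borel_measurable borel" and N: "CARD('d) < N"
    and le: "\<And>x. cmod (f x) \<le> C * decay N (a + x)"
  shows "integrable lborel f"
proof (rule Bochner_Integration.integrable_bound)
  have "integrable lborel (\<lambda>x. decay N (a + x :: real ^ 'd))"
    using integrable_distr[of "\<lambda>x. a + x" lborel borel "decay N"] N
    by (simp add: lborel_distr_plus)
  then show "integrable lborel (\<lambda>x. C * decay N (a + x))" by simp
  show "AE x in lborel. norm (f x) \<le> norm (C * decay N (a + x))"
    using le by (auto intro: order_trans[OF le abs_ge_self])
qed simp

text \<open>Hoelder's inequality against \<open>japanese \<xi> powr - s\<close>; the condition on
  \<open>s\<close> says exactly that this weight lies in the space dual to
  \<open>L\<^sup>q\<close>.\<close>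

lemma integral_le_weighted_Lp:
  fixes q :: ennreal
  assumes q: "1 \<le> q" and s: "0 \<le> s"
    and *: "(q > 1 \<and> s > real CARD('d) * (1 - enn2real (1 / q))) \<or> q = 1"
  shows "\<exists>C\<ge>0. \<forall>A. A \<in> borel_measurable borel \<longrightarrow>
    (\<integral>\<^sup>+\<xi>. A \<xi> \<partial>lborel) \<le> ennreal C * Lp_norm q (\<lambda>\<xi> :: real ^ 'd. ennreal (japanese \<xi> powr s) * A \<xi>)"
proof (cases "q = 1 \<or> q = top")
  case True
  then show ?thesis
  proof
    assume "q = 1"
    show ?thesis
    proof (rule exI[of _ 1], intro conjI allI impI)
      fix A :: "real ^ 'd \<Rightarrow> ennreal" assume [measurable]: "A \<in> borel_measurable borel"
      have "1 * A \<xi> \<le> ennreal (japanese \<xi> powr s) * A \<xi>" for \<xi>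
        using ge_one_powr_ge_zero[OF japanese_ge_1 s] by (intro mult_right_mono) auto
      then have "(\<integral>\<^sup>+\<xi>. A \<xi> \<partial>lborel) \<le> (\<integral>\<^sup>+\<xi>. ennreal (japanese \<xi> powr s) * A \<xi> \<partial>lborel)"
        by (intro nn_integral_mono) simp
      then show "(\<integral>\<^sup>+\<xi>. A \<xi> \<partial>lborel) \<le> ennreal 1 * Lp_norm q (\<lambda>\<xi>. ennreal (japanese \<xi> powr s) * A \<xi>)"
        by (simp add: \<open>q = 1\<close> Lp_norm_1)
    qed simp
  next
    assume top: "q = top"
    then have s': "real CARD('d) < s" using * by auto
    obtain C where C: "C \<ge> 0" "\<And>h. h \<in> borel_measurable borel \<Longrightarrow>
       (\<integral>\<^sup>+x. ennreal (japanese (x :: real ^ 'd) powr - s) * h x \<partial>lborel) \<le> ennreal C * Lp_norm q h"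
      using integral_weight_le_Lp[OF q, of "\<lambda>x :: real ^ 'd. ennreal (japanese x powr - s)"] nn_integral_japanese_powr[OF s']
        s powr_mono2'[of "-s" 1, OF _ _ japanese_ge_1] by auto
    show ?thesis
    proof (intro exI conjI allI impI)
      fix A :: "real ^ 'd \<Rightarrow> ennreal" assume [measurable]: "A \<in> borel_measurable borel"
      have "ennreal (japanese \<xi> powr - s) * (ennreal (japanese \<xi> powr s) * A \<xi>) = A \<xi>" for \<xi>
        by (simp add: mult.assoc[symmetric] ennreal_mult[symmetric] powr_add[symmetric] del: ennreal_mult)
      then show "(\<integral>\<^sup>+\<xi>. A \<xi> \<partial>lborel) \<le> ennreal C * Lp_norm q (\<lambda>\<xi>. ennreal (japanese \<xi> powr s) * A \<xi>)"
        using C(2)[of "\<lambda>\<xi>. ennreal (japanese \<xi> powr s) * A \<xi>"] by simp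
    qed fact
  qed
next
  case False
  then have q': "q \<noteq> top" "1 < q" using q by auto
  define r where "r = enn2real q"
  have qr: "q = ennreal r" using q' by (simp add: r_def less_top)
  have r: "1 < r" using q' by (simp add: qr one_ennreal_def[symmetric] ennreal_less_iff[symmetric, of 1] flip: ennreal_1)
  have "1 / q = ennreal (1 / r)" using r by (simp add: qr divide_ennreal[symmetric] ennreal_1[symmetric] del: ennreal_1)
  then have s': "real CARD('d) * (1 - 1 / r) < s" using * False r by simp
  \<comment> \<open>This is \<open>s\<close> times the conjugate exponent of \<open>r\<close>, so
    that \<open>\<sigma> > d\<close> is the hypothesis on \<open>s\<close>. Jensen's inequality is
    used with the weight \<open>japanese x powr - \<sigma>\<close>, and
    \<open>\<sigma> * r - \<sigma> = s * r\<close> restores the weight \<open>s\<close> inside the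
    power.\<close>
  define \<sigma> where "\<sigma> = s * r / (r - 1)"
  have \<sigma>: "real CARD('d) < \<sigma>" using s' r by (simp add: \<sigma>_def field_simps)
  have \<sigma>2: "\<sigma> * r - \<sigma> = s * r"
  proof -
    have "\<sigma> * r - \<sigma> = \<sigma> * (r - 1)" by (simp add: algebra_simps)
    then show ?thesis using r by (simp add: \<sigma>_def)
  qed
  obtain W where W: "(\<integral>\<^sup>+x. ennreal (japanese (x :: real ^ 'd) powr - \<sigma>) \<partial>lborel) = ennreal W" "0 \<le> W"
    using nn_integral_japanese_powr[OF \<sigma>] by (cases "\<integral>\<^sup>+x. ennreal (japanese (x :: real ^ 'd) powr - \<sigma>) \<partial>lborel") auto
  define C where "C = (W powr (r - 1)) powr (1 / r)"
  show ?thesis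
  proof (intro exI conjI allI impI)
    fix A :: "real ^ 'd \<Rightarrow> ennreal" assume [measurable]: "A \<in> borel_measurable borel"
    let ?h = "\<lambda>x :: real ^ 'd. ennreal (japanese x powr \<sigma>) * A x" and ?w = "\<lambda>x :: real ^ 'd. ennreal (japanese x powr - \<sigma>)"
    have 1: "?h x * ?w x = A x" for x
    proof -
      have "ennreal (japanese x powr \<sigma>) * ennreal (japanese x powr - \<sigma>) = 1"
        by (simp add: ennreal_mult[symmetric] powr_add[symmetric] del: ennreal_mult)
      then show ?thesis by (metis mult.assoc mult.commute mult_1)
    qed
    have 2: "ennreal_powr (?h x) r * ?w x = ennreal_powr (ennreal (japanese x powr s) * A x) r" for x
    proof -
      have "ennreal ((japanese x powr \<sigma>) powr r) * ennreal (japanese x powr - \<sigma>) = ennreal ((japanese x powr s) powr r)"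
        by (simp add: ennreal_mult[symmetric] powr_add[symmetric] powr_powr \<sigma>2 del: ennreal_mult)
      then show ?thesis using r by (simp add: ennreal_powr_mult ennreal_powr_ennreal) (metis mult.assoc mult.commute)
    qed
    have "ennreal_powr (\<integral>\<^sup>+x. A x \<partial>lborel) r \<le> ennreal (W powr (r - 1)) * (\<integral>\<^sup>+x. ennreal_powr (ennreal (japanese x powr s) * A x) r \<partial>lborel)"
      using jensen_nn_integral[of ?h lborel ?w W r] W r unfolding 1 2 by simp
    also have "\<dots> = ennreal (W powr (r - 1)) * ennreal_powr (Lp_norm q (\<lambda>\<xi>. ennreal (japanese \<xi> powr s) * A \<xi>)) r"
      using Lp_norm_powr[OF q q'(1), of "\<lambda>\<xi>. ennreal (japanese \<xi> powr s) * A \<xi>"] by (simp add: r_def)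
    finally have "ennreal_powr (ennreal_powr (\<integral>\<^sup>+x. A x \<partial>lborel) r) (1 / r) \<le>
        ennreal_powr (ennreal (W powr (r - 1)) * ennreal_powr (Lp_norm q (\<lambda>\<xi>. ennreal (japanese \<xi> powr s) * A \<xi>)) r) (1 / r)"
      using r by (intro ennreal_powr_mono) auto
    then show "(\<integral>\<^sup>+\<xi>. A \<xi> \<partial>lborel) \<le> ennreal C * Lp_norm q (\<lambda>\<xi>. ennreal (japanese \<xi> powr s) * A \<xi>)"
      using r by (simp add: ennreal_powr_mult ennreal_powr_powr ennreal_powr_ennreal C_def)
  qed (simp add: C_def)
qed

section \<open>Characters, and Fourier inversion by Gaussian regularisation\<close>

lemma measurable_cnj [measurable]: "cnj \<in> borel_measurable borel"
  by (intro borel_measurable_continuous_onI continuous_intros)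

definition chr :: "'a::real_inner \<Rightarrow> 'a \<Rightarrow> complex" where
  "chr \<xi> y = exp (\<i> * complex_of_real (\<xi> \<bullet> y))"

lemma norm_chr [simp]: "cmod (chr \<xi> y) = 1"
  by (simp add: chr_def)

lemma chr_add_left: "chr (\<xi> + \<eta>) y = chr \<xi> y * chr \<eta> y"
  by (simp add: chr_def inner_add_left distrib_left exp_add)

lemma chr_add_right: "chr \<xi> (y + z) = chr \<xi> y * chr \<xi> z"
  by (simp add: chr_def inner_add_right distrib_left exp_add)

lemma chr_minus_left: "chr (- \<xi>) y = cnj (chr \<xi> y)"
  by (simp add: chr_def exp_cnj)

lemma chr_minus_right: "chr \<xi> (- y) = cnj (chr \<xi> y)"
  by (simp add: chr_def exp_cnj)

lemma chr_commute: "chr \<xi> y = chr y \<xi>"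
  by (simp add: chr_def inner_commute)

lemma chr_cnj_mult [simp]: "chr \<xi> y * cnj (chr \<xi> y) = 1"
  using complex_norm_square[of "chr \<xi> y"] by simp

lemma continuous_on_chr [continuous_intros]:
  "continuous_on A f \<Longrightarrow> continuous_on A g \<Longrightarrow> continuous_on A (\<lambda>x. chr (f x) (g x))"
  unfolding chr_def by (intro continuous_intros)

lemma measurable_chr [measurable (raw)]:
  fixes f g :: "'b \<Rightarrow> 'a::euclidean_space"
  shows "f \<in> borel_measurable M \<Longrightarrow> g \<in> borel_measurable M \<Longrightarrow> (\<lambda>x. chr (f x) (g x)) \<in> borel_measurable M"
  unfolding chr_def by measurable

lemma has_bochner_integral_lborel_prod:
  fixes f :: "'a::euclidean_space \<Rightarrow> real \<Rightarrow> complex"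
  assumes f: "\<And>b. b \<in> Basis \<Longrightarrow> integrable lborel (f b)"
  shows "(LINT x|lborel. (\<Prod>b\<in>Basis. f b (x \<bullet> b))) = (\<Prod>b\<in>Basis. (LINT t|lborel. f b t))"
    and "integrable lborel (\<lambda>x. (\<Prod>b\<in>Basis. f b (x \<bullet> b)))"
proof -
  interpret product_sigma_finite "\<lambda>_::'a. lborel :: real measure"
    by standard
  have [measurable]: "b \<in> Basis \<Longrightarrow> f b \<in> borel_measurable borel" for b
    using borel_measurable_integrable[OF f] by simp
  have eq: "(\<Prod>b\<in>Basis. f b ((\<Sum>b\<in>Basis. x b *\<^sub>R b) \<bullet> b)) = (\<Prod>b\<in>Basis. f b (x b))" for x :: "'a \<Rightarrow> real"
    by (intro prod.cong) auto
  show "(LINT x|lborel. (\<Prod>b\<in>Basis. f b (x \<bullet> b))) = (\<Prod>b\<in>Basis. (LINT t|lborel. f b t))"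
    by (subst lborel_eq, subst integral_distr) (auto simp only: eq product_integral_prod[OF finite_Basis f], measurable)
  show "integrable lborel (\<lambda>x. (\<Prod>b\<in>Basis. f b (x \<bullet> b)))"
    by (subst lborel_eq, subst integrable_distr_eq) (auto simp only: eq product_integrable_prod[OF finite_Basis f], measurable)
qed

definition gauss :: "'a::euclidean_space \<Rightarrow> real" where
  "gauss v = exp (- (norm v)\<^sup>2 / 2)"

text \<open>Gaussian and character both factor over the coordinates. Each factor is the
  characteristic function of the standard normal distribution, rescaled by
  \<open>sqrt (2 * pi)\<close>.\<close>

lemma gauss_FT:
  fixes t :: "'a::euclidean_space"
  shows "(LINT v|lborel. complex_of_real (gauss v) * chr v t) = complex_of_real (sqrt (2 * pi) ^ DIM('a) * gauss t)"
    and "integrable lborel (\<lambda>v::'a. complex_of_real (gauss v) * chr v t)"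
proof -
  define f where "f b x = complex_of_real (exp (- x\<^sup>2 / 2)) * iexp ((t \<bullet> b) * x)" for b and x :: real
  have f_eq: "f b x = sqrt (2 * pi) *\<^sub>R (std_normal_density x *\<^sub>R iexp ((t \<bullet> b) * x))" for b x
    by (simp add: f_def std_normal_density_def scaleR_conv_of_real)
  have i: "integrable lborel (f b)" for b
    unfolding f_eq
  proof (rule integrable_scaleR_right, rule Bochner_Integration.integrable_bound)
    show "integrable lborel std_normal_density" by (rule integrable_normal_density) simp
  qed auto
  have "char std_normal_distribution u = (LINT x|lborel. std_normal_density x *\<^sub>R iexp (u * x))" for u
    unfolding char_def by (rule integral_density) auto
  then have v: "(LINT x|lborel. f b x) = complex_of_real (sqrt (2 * pi) * exp (- (t \<bullet> b)\<^sup>2 / 2))" for b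
    unfolding f_eq integral_scaleR_right by (simp add: char_std_normal_distribution scaleR_conv_of_real)
  have prod: "complex_of_real (gauss v) * chr v t = (\<Prod>b\<in>Basis. f b (v \<bullet> b))" for v
  proof -
    have 1: "gauss v = (\<Prod>b\<in>Basis. exp (- (v \<bullet> b)\<^sup>2 / 2))" for v :: 'a
      unfolding gauss_def by (subst exp_sum[symmetric])
        (auto simp: power2_norm_eq_inner euclidean_inner[of v v] sum_negf sum_divide_distrib[symmetric] simp flip: power2_eq_square)
    have 2: "chr v t = (\<Prod>b\<in>Basis. iexp ((t \<bullet> b) * (v \<bullet> b)))"
      unfolding chr_def by (subst exp_sum[symmetric])
        (auto simp: euclidean_inner[of v t] sum_distrib_left[symmetric] mult_ac simp flip: of_real_sum of_real_mult)
    show ?thesis unfolding 1 2 f_def by (simp add: prod.distrib)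
  qed
  show "(LINT v|lborel. complex_of_real (gauss v) * chr v t) = complex_of_real (sqrt (2 * pi) ^ DIM('a) * gauss t)"
    unfolding prod has_bochner_integral_lborel_prod(1)[OF i] v
    unfolding gauss_def by (simp add: prod.distrib exp_sum[symmetric] power2_norm_eq_inner euclidean_inner[of t t]
        sum_negf sum_divide_distrib[symmetric] flip: power2_eq_square of_real_prod of_real_mult of_real_power)
  show "integrable lborel (\<lambda>v::'a. complex_of_real (gauss v) * chr v t)"
    unfolding prod by (rule has_bochner_integral_lborel_prod(2)[OF i])
qed


lemma integral_lborel_affine:
  fixes f :: "'a::euclidean_space \<Rightarrow> complex"
  assumes [measurable]: "f \<in> borel_measurable borel" and c: "c \<noteq> 0"
  shows "(LINT x|lborel. f x) = complex_of_real (\<bar>c\<bar> ^ DIM('a)) * (LINT x|lborel. f (t + c *\<^sub>R x))"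
proof -
  have "(LINT x|lborel. f x) = (LINT x|density (distr lborel borel (\<lambda>x. t + c *\<^sub>R x)) (\<lambda>_. ennreal (\<bar>c\<bar> ^ DIM('a))). f x)"
    by (rule arg_cong[where f="\<lambda>M. integral\<^sup>L M f", OF lborel_affine[OF c]])
  also have "\<dots> = (LINT x|distr lborel borel (\<lambda>x. t + c *\<^sub>R x). (\<bar>c\<bar> ^ DIM('a)) *\<^sub>R f x)"
    by (rule integral_density) auto
  also have "\<dots> = (LINT x|lborel. (\<bar>c\<bar> ^ DIM('a)) *\<^sub>R f (t + c *\<^sub>R x))"
    by (rule integral_distr) auto
  finally show ?thesis by (simp add: scaleR_conv_of_real)
qed

lemma integrable_lborel_affine:
  fixes f :: "'a::euclidean_space \<Rightarrow> complex"
  assumes f: "integrable lborel f" and c: "c \<noteq> 0"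
  shows "integrable lborel (\<lambda>x. f (t + c *\<^sub>R x))"
proof -
  have [measurable]: "f \<in> borel_measurable borel" using borel_measurable_integrable[OF f] by simp
  have "integrable (density (distr lborel borel (\<lambda>x. t + c *\<^sub>R x)) (\<lambda>_. ennreal (\<bar>c\<bar> ^ DIM('a)))) f"
    using f lborel_affine[OF c, of t] by metis
  then have "integrable (distr lborel borel (\<lambda>x. t + c *\<^sub>R x)) (\<lambda>x. (\<bar>c\<bar> ^ DIM('a)) *\<^sub>R f x)"
    by (subst (asm) integrable_density) auto
  then have "integrable lborel (\<lambda>x. (\<bar>c\<bar> ^ DIM('a)) *\<^sub>R f (t + c *\<^sub>R x))"
    by (simp add: integrable_distr_eq)
  then have "integrable lborel (\<lambda>x. (1 / \<bar>c\<bar> ^ DIM('a)) *\<^sub>R (\<bar>c\<bar> ^ DIM('a)) *\<^sub>R f (t + c *\<^sub>R x))"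
    by (rule integrable_scaleR_right)
  then show ?thesis using c by simp
qed

lemma gauss_nonneg [simp]: "0 \<le> gauss v" and gauss_le_1: "gauss v \<le> 1"
  by (simp_all add: gauss_def)

lemma continuous_on_gauss [continuous_intros]:
  "continuous_on A f \<Longrightarrow> continuous_on A (\<lambda>x. gauss (f x))"
  unfolding gauss_def by (intro continuous_intros) auto

lemma measurable_gauss [measurable]: "gauss \<in> borel_measurable borel"
  by (intro borel_measurable_continuous_onI continuous_intros)

lemma
  shows integral_gauss: "(LINT v|lborel. complex_of_real (gauss (v::'a::euclidean_space))) = complex_of_real (sqrt (2 * pi) ^ DIM('a))"
    and integrable_gauss: "integrable lborel (\<lambda>v::'a::euclidean_space. complex_of_real (gauss v))"
  using gauss_FT[of "0::'a"] by (simp_all add: chr_def gauss_def)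

lemma gauss_FT_scaled:
  fixes z :: "'a::euclidean_space"
  assumes e: "e > 0"
  shows "(LINT \<xi>|lborel. complex_of_real (gauss (e *\<^sub>R \<xi>)) * chr \<xi> z) =
     complex_of_real (sqrt (2 * pi) ^ DIM('a) / e ^ DIM('a) * gauss (z /\<^sub>R e))"
proof -
  have "(LINT \<xi>|lborel. complex_of_real (gauss (e *\<^sub>R \<xi>)) * chr \<xi> z) =
    complex_of_real (\<bar>1 / e\<bar> ^ DIM('a)) * (LINT \<xi>|lborel. complex_of_real (gauss (e *\<^sub>R (0 + (1 / e) *\<^sub>R \<xi>))) * chr (0 + (1 / e) *\<^sub>R \<xi>) z)"
    using e by (intro integral_lborel_affine) auto
  also have "(LINT \<xi>|lborel. complex_of_real (gauss (e *\<^sub>R (0 + (1 / e) *\<^sub>R \<xi>))) * chr (0 + (1 / e) *\<^sub>R \<xi>) z) =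
     (LINT \<xi>|lborel. complex_of_real (gauss \<xi>) * chr \<xi> (z /\<^sub>R e))"
    using e by (intro Bochner_Integration.integral_cong) (auto simp: chr_def inverse_eq_divide)
  finally show ?thesis using e by (simp add: gauss_FT(1) power_divide)
qed

text \<open>Unnormalised, which puts the whole factor \<open>(2 * pi) ^ DIM('a)\<close> into the
  inversion formula.\<close>

definition ft :: "('a::euclidean_space \<Rightarrow> complex) \<Rightarrow> 'a \<Rightarrow> complex" where
  "ft \<phi> \<xi> = (LINT y|lborel. \<phi> y * cnj (chr \<xi> y))"

lemma integrable_mult_chr:
  fixes f :: "'a::euclidean_space \<Rightarrow> complex"
  assumes "integrable lborel f"
  shows "integrable lborel (\<lambda>y. f y * chr \<xi> y)" "integrable lborel (\<lambda>y. f y * cnj (chr \<xi> y))"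
proof -
  have [measurable]: "f \<in> borel_measurable borel" using borel_measurable_integrable[OF assms] by simp
  show "integrable lborel (\<lambda>y. f y * chr \<xi> y)" 
    by (rule Bochner_Integration.integrable_bound[OF assms]) (auto simp: norm_mult)
  show "integrable lborel (\<lambda>y. f y * cnj (chr \<xi> y))" 
    by (rule Bochner_Integration.integrable_bound[OF assms]) (auto simp: norm_mult)
qed

text \<open>Damping the frequency integral by \<open>gauss (e n *\<^sub>R \<xi>)\<close> makes
  Fubini applicable. The transform then falls on the Gaussian and yields an approximate identity at
  \<open>y\<close>: continuity and boundedness of \<open>\<phi>\<close> give the limit on that side,
  integrability of \<open>ft \<phi>\<close> on the other.\<close>

lemma fourier_inversion:
  fixes \<phi> :: "'a::euclidean_space \<Rightarrow> complex"
  assumes i: "integrable lborel \<phi>" and c: "continuous_on UNIV \<phi>" and b: "\<And>y. cmod (\<phi> y) \<le> B"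
    and ih: "integrable lborel (ft \<phi>)"
  shows "(LINT \<xi>|lborel. ft \<phi> \<xi> * chr \<xi> y) = complex_of_real ((2 * pi) ^ DIM('a)) * \<phi> y"
proof -
  let ?d = "DIM('a)"
  define e where "e n = 1 / real (Suc n)" for n
  have e: "e n > 0" for n by (simp add: e_def)
  have elim: "e \<longlonglongrightarrow> 0" unfolding e_def by (rule LIMSEQ_Suc[OF lim_1_over_n])
  have [measurable]: "\<phi> \<in> borel_measurable borel" using c by (rule borel_measurable_continuous_onI)
  have [measurable]: "ft \<phi> \<in> borel_measurable borel" using borel_measurable_integrable[OF ih] by simp
  define A where "A n = (LINT \<xi>|lborel. complex_of_real (gauss (e n *\<^sub>R \<xi>)) * (ft \<phi> \<xi> * chr \<xi> y))" for n
  define B' where "B' n = (LINT v|lborel. \<phi> (y + e n *\<^sub>R v) * complex_of_real (gauss v))" for n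
  have limA: "A \<longlonglongrightarrow> (LINT \<xi>|lborel. ft \<phi> \<xi> * chr \<xi> y)"
    unfolding A_def
  proof (rule integral_dominated_convergence)
    show "integrable lborel (\<lambda>\<xi>. cmod (ft \<phi> \<xi>))" using ih by simp
    show "AE x in lborel. (\<lambda>n. complex_of_real (gauss (e n *\<^sub>R x)) * (ft \<phi> x * chr x y)) \<longlonglongrightarrow> ft \<phi> x * chr x y"
    proof (rule AE_I2)
      fix x :: 'a
      have "(\<lambda>n. exp (- (norm (e n *\<^sub>R x))\<^sup>2 / 2)) \<longlonglongrightarrow> exp (- (norm (0 *\<^sub>R x))\<^sup>2 / 2)"
        by (intro tendsto_intros elim) auto
      then have "(\<lambda>n. complex_of_real (gauss (e n *\<^sub>R x))) \<longlonglongrightarrow> of_real 1"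
        unfolding gauss_def by (intro tendsto_of_real) simp
      from tendsto_mult[OF this tendsto_const[of "ft \<phi> x * chr x y"]]
      show "(\<lambda>n. complex_of_real (gauss (e n *\<^sub>R x)) * (ft \<phi> x * chr x y)) \<longlonglongrightarrow> ft \<phi> x * chr x y" by simp
    qed
    show "AE x in lborel. norm (complex_of_real (gauss (e n *\<^sub>R x)) * (ft \<phi> x * chr x y)) \<le> cmod (ft \<phi> x)" for n
      by (auto simp: norm_mult intro!: mult_left_le_one_le gauss_le_1)
  qed auto
  have "B' \<longlonglongrightarrow> (LINT v|lborel. \<phi> y * complex_of_real (gauss (v::'a)))"
    unfolding B'_def
  proof (rule integral_dominated_convergence)
    show "integrable lborel (\<lambda>v::'a. B * gauss v)" using integrable_norm[OF integrable_gauss[where 'a='a]] by simp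
    show "AE x in lborel. (\<lambda>n. \<phi> (y + e n *\<^sub>R x) * complex_of_real (gauss x)) \<longlonglongrightarrow> \<phi> y * complex_of_real (gauss x)"
    proof (rule AE_I2)
      fix x :: 'a
      have "(\<lambda>n. y + e n *\<^sub>R x) \<longlonglongrightarrow> y + 0 *\<^sub>R x" by (intro tendsto_intros elim)
      then have "(\<lambda>n. \<phi> (y + e n *\<^sub>R x)) \<longlonglongrightarrow> \<phi> y"
        using continuous_on_tendsto_compose[OF c, of "\<lambda>n. y + e n *\<^sub>R x" y] by simp
      then show "(\<lambda>n. \<phi> (y + e n *\<^sub>R x) * complex_of_real (gauss x)) \<longlonglongrightarrow> \<phi> y * complex_of_real (gauss x)"
        by (intro tendsto_intros)
    qed
    show "AE x in lborel. norm (\<phi> (y + e n *\<^sub>R x) * complex_of_real (gauss x)) \<le> B * gauss x" for n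
      using b by (auto simp: norm_mult intro!: mult_right_mono)
  qed auto
  moreover have "A n = complex_of_real (sqrt (2 * pi) ^ ?d) * B' n" for n
  proof -
    let ?g = "\<lambda>\<xi>::'a. complex_of_real (gauss (e n *\<^sub>R \<xi>))"
    have ig: "integrable lborel ?g"
      using integrable_lborel_affine[OF integrable_gauss[where 'a='a], of "e n" 0] e[of n] by simp
    have ip: "integrable (lborel \<Otimes>\<^sub>M lborel) (\<lambda>(\<xi>, z). ?g \<xi> * chr \<xi> (y - z) * \<phi> z)"
    proof (rule Bochner_Integration.integrable_bound)
      show "integrable (lborel \<Otimes>\<^sub>M lborel) (\<lambda>(\<xi>, z). ?g \<xi> * \<phi> z)"
      proof (rule lborel_pair.Fubini_integrable)
        have "(\<lambda>\<xi>. LINT z|lborel. norm (case (\<xi>, z) of (\<xi>, z) \<Rightarrow> ?g \<xi> * \<phi> z)) = (\<lambda>\<xi>. cmod (?g \<xi>) * (LINT z|lborel. cmod (\<phi> z)))"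
          by (simp add: norm_mult)
        then show "integrable lborel (\<lambda>\<xi>. LINT z|lborel. norm (case (\<xi>, z) of (\<xi>, z) \<Rightarrow> ?g \<xi> * \<phi> z))"
          using integrable_norm[OF ig] by simp
      qed (use i in auto)
    qed (auto simp: norm_mult)
    have "A n = (LINT \<xi>|lborel. (LINT z|lborel. ?g \<xi> * chr \<xi> (y - z) * \<phi> z))"
      unfolding A_def
    proof (rule Bochner_Integration.integral_cong[OF refl])
      fix \<xi> :: 'a
      have "(LINT z|lborel. ?g \<xi> * chr \<xi> (y - z) * \<phi> z) = (LINT z|lborel. (?g \<xi> * chr \<xi> y) * (\<phi> z * cnj (chr \<xi> z)))"
        using chr_add_right[of \<xi> y "- z" for z] by (simp add: chr_minus_right mult_ac)
      also have "\<dots> = ?g \<xi> * chr \<xi> y * ft \<phi> \<xi>"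
        unfolding ft_def by simp
      finally show "?g \<xi> * (ft \<phi> \<xi> * chr \<xi> y) = (LINT z|lborel. ?g \<xi> * chr \<xi> (y - z) * \<phi> z)"
        by (simp add: mult_ac)
    qed
    also have "\<dots> = (LINT z|lborel. (LINT \<xi>|lborel. ?g \<xi> * chr \<xi> (y - z) * \<phi> z))"
      using lborel_pair.Fubini_integral[OF ip] by simp
    also have "\<dots> = (LINT z|lborel. complex_of_real (sqrt (2 * pi) ^ ?d / e n ^ ?d * gauss ((y - z) /\<^sub>R e n)) * \<phi> z)"
      by (simp add: gauss_FT_scaled[OF e])
    also have "\<dots> = complex_of_real (\<bar>e n\<bar> ^ ?d) * (LINT v|lborel. complex_of_real (sqrt (2 * pi) ^ ?d / e n ^ ?d * gauss ((y - (y + e n *\<^sub>R v)) /\<^sub>R e n)) * \<phi> (y + e n *\<^sub>R v))"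
      using e[of n] by (intro integral_lborel_affine) auto
    also have "(LINT v|lborel. complex_of_real (sqrt (2 * pi) ^ ?d / e n ^ ?d * gauss ((y - (y + e n *\<^sub>R v)) /\<^sub>R e n)) * \<phi> (y + e n *\<^sub>R v))
      = (LINT v|lborel. complex_of_real (sqrt (2 * pi) ^ ?d / e n ^ ?d) * (\<phi> (y + e n *\<^sub>R v) * complex_of_real (gauss v)))"
      using e[of n] by (intro Bochner_Integration.integral_cong) (auto simp: gauss_def mult_ac)
    also have "\<dots> = complex_of_real (sqrt (2 * pi) ^ ?d / e n ^ ?d) * B' n"
      unfolding B'_def by simp
    finally show ?thesis using e[of n] by (simp add: mult.assoc[symmetric] flip: of_real_mult)
  qed
  ultimately have "(\<lambda>n. A n) \<longlonglongrightarrow> complex_of_real (sqrt (2 * pi) ^ ?d) * (LINT v|lborel. \<phi> y * complex_of_real (gauss (v::'a)))"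
    by (simp add: tendsto_mult_left)
  with limA have "(LINT \<xi>|lborel. ft \<phi> \<xi> * chr \<xi> y) = complex_of_real (sqrt (2 * pi) ^ ?d) * (LINT v|lborel. \<phi> y * complex_of_real (gauss (v::'a)))"
    by (rule LIMSEQ_unique)
  \<comment> \<open>One of the two equal factors stems from the transform of the Gaussian, the other
    one is its total mass.\<close>
  also have "\<dots> = complex_of_real (sqrt (2 * pi) ^ ?d * sqrt (2 * pi) ^ ?d) * \<phi> y"
    unfolding integral_mult_right_zero integral_gauss of_real_mult by (rule mult.left_commute[THEN trans]) (rule mult.commute)
  also have "sqrt (2 * pi) ^ ?d * sqrt (2 * pi) ^ ?d = (2 * pi) ^ ?d"
    unfolding power_mult_distrib[symmetric] by simp
  finally show ?thesis .
qed

section \<open>Schwartz functions\<close>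

lemma partial_deriv_eqI: "(\<phi> has_derivative D) (at x) \<Longrightarrow> partial_deriv i \<phi> x = D (axis i 1)"
  unfolding partial_deriv_def by (metis frechet_derivative_at)

lemma partial_derivs_Nil [simp]: "partial_derivs [] \<phi> = \<phi>"
  by (simp add: partial_derivs_def)

lemma partial_derivs_Cons: "partial_derivs (i # \<beta>) \<phi> = partial_deriv i (partial_derivs \<beta> \<phi>)"
  by (simp add: partial_derivs_def)

lemma partial_derivs_append: "partial_derivs (\<alpha> @ \<beta>) \<phi> = partial_derivs \<alpha> (partial_derivs \<beta> \<phi>)"
  by (simp add: partial_derivs_def)

lemma differentiableD: "\<phi> differentiable at x \<Longrightarrow> (\<phi> has_derivative frechet_derivative \<phi> (at x)) (at x)"
  by (simp add: frechet_derivative_works[symmetric])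

lemma schwartz_differentiable: "\<phi> \<in> schwartz \<Longrightarrow> \<phi> differentiable at x"
  unfolding schwartz_def differentiable_on_def using partial_derivs_Nil by (metis (mono_tags, lifting) UNIV_I mem_Collect_eq)

lemma schwartz_partial_derivs: "\<phi> \<in> schwartz \<Longrightarrow> partial_derivs \<beta> \<phi> \<in> schwartz"
  unfolding schwartz_def by (auto simp: partial_derivs_append[symmetric])

lemma schwartz_partial_deriv: "\<phi> \<in> schwartz \<Longrightarrow> partial_deriv i \<phi> \<in> schwartz"
  using schwartz_partial_derivs[of \<phi> "[i]"] by (simp add: partial_derivs_Cons)

lemma schwartz_continuous_on: "\<phi> \<in> schwartz \<Longrightarrow> continuous_on A \<phi>"
  by (meson schwartz_differentiable differentiable_imp_continuous_within continuous_at_imp_continuous_on)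

lemma schwartz_measurable: "\<phi> \<in> schwartz \<Longrightarrow> \<phi> \<in> borel_measurable borel"
  by (intro borel_measurable_continuous_onI schwartz_continuous_on)

lemma schwartz_seminorm_ge:
  assumes "\<phi> \<in> schwartz"
  shows "japanese x ^ k * cmod (partial_derivs \<beta> \<phi> x) \<le> schwartz_seminorm k \<beta> \<phi>"
  unfolding schwartz_seminorm_def using assms by (intro cSUP_upper) (auto simp: schwartz_def)

lemma schwartz_seminorm_le:
  "(\<And>x. japanese x ^ k * cmod (partial_derivs \<beta> \<phi> x) \<le> B) \<Longrightarrow> schwartz_seminorm k \<beta> \<phi> \<le> B"
  unfolding schwartz_seminorm_def by (intro cSUP_least) auto

lemma schwartz_seminorm_nonneg: "\<phi> \<in> schwartz \<Longrightarrow> 0 \<le> schwartz_seminorm k \<beta> \<phi>"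
  by (rule order_trans[OF _ schwartz_seminorm_ge[of _ 0]]) auto

lemma schwartz_decay:
  assumes "\<phi> \<in> schwartz"
  obtains C where "0 \<le> C" "\<And>y. cmod (\<phi> y) \<le> C * decay N y"
proof
  show "0 \<le> schwartz_seminorm N [] \<phi>" by (rule schwartz_seminorm_nonneg[OF assms])
  show "cmod (\<phi> y) \<le> schwartz_seminorm N [] \<phi> * decay N y" for y
    using schwartz_seminorm_ge[OF assms, of y N "[]"] by (simp add: decay_def field_simps)
qed

text \<open>A class closed under partial derivatives whose members are differentiable and rapidly
  decreasing consists of Schwartz functions. This replaces explicit formulas for iterated
  derivatives.\<close>

lemma schwartz_coinduct:
  assumes "P \<phi>"
    and step: "\<And>\<psi>. P \<psi> \<Longrightarrow> (\<forall>x. \<psi> differentiable at x) \<and> (\<forall>k. \<exists>C. \<forall>x. japanese x ^ k * cmod (\<psi> x) \<le> C) \<and> (\<forall>i. P (partial_deriv i \<psi>))"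
  shows "\<phi> \<in> schwartz"
proof -
  have P: "P (partial_derivs \<beta> \<phi>)" for \<beta>
    by (induction \<beta>) (use assms in \<open>auto simp: partial_derivs_Cons\<close>)
  have "partial_derivs \<beta> \<phi> differentiable_on UNIV" for \<beta>
    using step[OF P[of \<beta>]] by (simp add: differentiable_on_def)
  moreover have "bdd_above (range (\<lambda>x. japanese x ^ k * cmod (partial_derivs \<beta> \<phi> x)))" for k \<beta>
    using step[OF P[of \<beta>]] unfolding bdd_above_def by blast
  ultimately show ?thesis by (simp add: schwartz_def)
qed

lemma
  assumes "\<phi> differentiable at x" "\<psi> differentiable at x"
  shows partial_deriv_add: "partial_deriv i (\<lambda>y. \<phi> y + \<psi> y) x = partial_deriv i \<phi> x + partial_deriv i \<psi> x"
    and partial_deriv_mult: "partial_deriv i (\<lambda>y. \<phi> y * \<psi> y) x = partial_deriv i \<phi> x * \<psi> x + \<phi> x * partial_deriv i \<psi> x"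
proof -
  note d = assms[THEN differentiableD]
  show "partial_deriv i (\<lambda>y. \<phi> y + \<psi> y) x = partial_deriv i \<phi> x + partial_deriv i \<psi> x"
    by (subst partial_deriv_eqI[OF has_derivative_add[OF d]]) (simp add: partial_deriv_def)
  show "partial_deriv i (\<lambda>y. \<phi> y * \<psi> y) x = partial_deriv i \<phi> x * \<psi> x + \<phi> x * partial_deriv i \<psi> x"
    by (subst partial_deriv_eqI[OF has_derivative_mult[OF d]]) (simp add: partial_deriv_def)
qed

lemma
  assumes "\<phi> differentiable at x"
  shows partial_deriv_cmult: "partial_deriv i (\<lambda>y. c * \<phi> y) x = c * partial_deriv i \<phi> x"
    and partial_deriv_cnj: "partial_deriv i (\<lambda>y. cnj (\<phi> y)) x = cnj (partial_deriv i \<phi> x)"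
proof -
  note d = assms[THEN differentiableD]
  show "partial_deriv i (\<lambda>y. c * \<phi> y) x = c * partial_deriv i \<phi> x"
    by (subst partial_deriv_eqI[OF has_derivative_mult_right[OF d]]) (simp add: partial_deriv_def)
  show "partial_deriv i (\<lambda>y. cnj (\<phi> y)) x = cnj (partial_deriv i \<phi> x)"
    by (subst partial_deriv_eqI[OF has_derivative_cnj[OF d]]) (simp add: partial_deriv_def)
qed

lemma partial_deriv_shift:
  assumes "\<phi> differentiable at (y - x)"
  shows "partial_deriv i (\<lambda>y. \<phi> (y - x)) y = partial_deriv i \<phi> (y - x)"
    and "(\<lambda>y. \<phi> (y - x)) differentiable at y"
proof -
  have "((\<lambda>y. y - x) has_derivative (\<lambda>h. h)) (at y)" by (auto intro!: derivative_eq_intros)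
  from has_derivative_compose[OF this differentiableD[OF assms]]
  have d: "((\<lambda>y. \<phi> (y - x)) has_derivative frechet_derivative \<phi> (at (y - x))) (at y)" .
  from partial_deriv_eqI[OF d] show "partial_deriv i (\<lambda>y. \<phi> (y - x)) y = partial_deriv i \<phi> (y - x)"
    by (simp add: partial_deriv_def)
  show "(\<lambda>y. \<phi> (y - x)) differentiable at y" using d by (rule differentiableI)
qed

lemma partial_deriv_chr:
  fixes \<xi> :: "real ^ 'd"
  shows
  "partial_deriv i (chr \<xi>) y = \<i> * complex_of_real (\<xi> $ i) * chr \<xi> y"
  "chr \<xi> differentiable at y"
proof -
  have "(chr \<xi> has_derivative (\<lambda>h. \<i> * complex_of_real (\<xi> \<bullet> h) * chr \<xi> y)) (at y)"
  proof -
    have "((\<lambda>y. \<i> * complex_of_real (\<xi> \<bullet> y)) has_derivative (\<lambda>h. \<i> * complex_of_real (\<xi> \<bullet> h))) (at y)"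
      by (auto intro!: derivative_eq_intros)
    moreover have "(exp has_derivative (*) (exp w)) (at w)" for w :: complex
      using DERIV_exp[of w] by (simp add: has_field_derivative_def)
    ultimately have "((\<lambda>y. exp (\<i> * complex_of_real (\<xi> \<bullet> y))) has_derivative
        (\<lambda>h. exp (\<i> * complex_of_real (\<xi> \<bullet> y)) * (\<i> * complex_of_real (\<xi> \<bullet> h)))) (at y)"
      by (rule has_derivative_compose)
    then show ?thesis unfolding chr_def[abs_def] by (simp add: mult_ac)
  qed
  from partial_deriv_eqI[OF this] differentiableI[OF this]
  show "partial_deriv i (chr \<xi>) y = \<i> * complex_of_real (\<xi> $ i) * chr \<xi> y" "chr \<xi> differentiable at y"
    by (simp_all add: inner_axis)
qed

lemma differentiable_cnj: "\<phi> differentiable at x \<Longrightarrow> (\<lambda>y. cnj (\<phi> y)) differentiable at x"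
  using has_derivative_cnj differentiableD differentiableI by blast

lemma partial_deriv_cnj_chr:
  fixes \<xi> :: "real ^ 'd"
  shows
  "partial_deriv i (\<lambda>y. cnj (chr \<xi> y)) y = - \<i> * complex_of_real (\<xi> $ i) * cnj (chr \<xi> y)"
  "(\<lambda>y. cnj (chr \<xi> y)) differentiable at y"
  by (subst partial_deriv_cnj[OF partial_deriv_chr(2)], simp add: partial_deriv_chr(1))
     (rule differentiable_cnj[OF partial_deriv_chr(2)])

lemma schwartz_cnj:
  assumes "\<phi> \<in> schwartz" shows "(\<lambda>y. cnj (\<phi> y)) \<in> schwartz"
proof (rule schwartz_coinduct[where P="\<lambda>\<psi>. \<exists>\<phi>\<in>schwartz. \<psi> = (\<lambda>y. cnj (\<phi> y))"])
  fix \<psi> :: "real ^ 'a \<Rightarrow> complex" assume "\<exists>\<phi>\<in>schwartz. \<psi> = (\<lambda>y. cnj (\<phi> y))"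
  then obtain \<phi> where \<phi>: "\<phi> \<in> schwartz" "\<psi> = (\<lambda>y. cnj (\<phi> y))" by blast
  have "partial_deriv i \<psi> = (\<lambda>y. cnj (partial_deriv i \<phi> y))" for i
    unfolding \<phi>(2) by (rule ext) (intro partial_deriv_cnj schwartz_differentiable \<phi>(1))
  then show "(\<forall>x. \<psi> differentiable at x) \<and> (\<forall>k. \<exists>C. \<forall>x. japanese x ^ k * cmod (\<psi> x) \<le> C) \<and> (\<forall>i. \<exists>\<phi>\<in>schwartz. partial_deriv i \<psi> = (\<lambda>y. cnj (\<phi> y)))"
    using schwartz_partial_deriv[OF \<phi>(1)] schwartz_seminorm_ge[OF \<phi>(1), of _ _ "[]"] differentiable_cnj[OF schwartz_differentiable[OF \<phi>(1)]]
    unfolding \<phi>(2) by (fastforce simp: \<phi>(2))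
qed (use assms in blast)

text \<open>The Leibniz rule turns a product into a sum of two products; closing under sums
  therefore gives a class to which \<open>schwartz_coinduct\<close> applies.\<close>

inductive schwartz_products :: "(real ^ 'd \<Rightarrow> complex) \<Rightarrow> bool" where
  prod: "\<phi> \<in> schwartz \<Longrightarrow> \<psi> \<in> schwartz \<Longrightarrow> schwartz_products (\<lambda>y. \<phi> y * \<psi> y)"
| add: "schwartz_products \<Phi> \<Longrightarrow> schwartz_products \<Psi> \<Longrightarrow> schwartz_products (\<lambda>y. \<Phi> y + \<Psi> y)"

lemma schwartz_mult:
  assumes "\<phi> \<in> schwartz" "\<psi> \<in> schwartz" shows "(\<lambda>y. \<phi> y * \<psi> y) \<in> schwartz"
proof (rule schwartz_coinduct[where P=schwartz_products])
  fix \<Phi> :: "real ^ 'a \<Rightarrow> complex" assume "schwartz_products \<Phi>"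
  then show "(\<forall>x. \<Phi> differentiable at x) \<and> (\<forall>k. \<exists>C. \<forall>x. japanese x ^ k * cmod (\<Phi> x) \<le> C) \<and> (\<forall>i. schwartz_products (partial_deriv i \<Phi>))"
  proof induction
    case (prod \<phi> \<psi>)
    note d = prod[THEN schwartz_differentiable]
    have "partial_deriv i (\<lambda>y. \<phi> y * \<psi> y) = (\<lambda>y. partial_deriv i \<phi> y * \<psi> y + \<phi> y * partial_deriv i \<psi> y)" for i
      by (rule ext) (intro partial_deriv_mult d)
    then have "schwartz_products (partial_deriv i (\<lambda>y. \<phi> y * \<psi> y))" for i
      by (simp add: schwartz_products.intros schwartz_partial_deriv prod)
    moreover have "\<exists>C. \<forall>x. japanese x ^ k * cmod (\<phi> x * \<psi> x) \<le> C" for k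
    proof (intro exI allI)
      fix x
      have "(japanese x ^ k * cmod (\<phi> x)) * (japanese x ^ 0 * cmod (\<psi> x)) \<le> schwartz_seminorm k [] \<phi> * schwartz_seminorm 0 [] \<psi>"
        using schwartz_seminorm_ge[OF prod(1), of x k "[]"] schwartz_seminorm_ge[OF prod(2), of x 0 "[]"]
        by (intro mult_mono schwartz_seminorm_nonneg prod) auto
      then show "japanese x ^ k * cmod (\<phi> x * \<psi> x) \<le> schwartz_seminorm k [] \<phi> * schwartz_seminorm 0 [] \<psi>"
        by (simp add: norm_mult mult_ac)
    qed
    ultimately show ?case using d by (auto intro!: derivative_intros)
  next
    case (add \<Phi> \<Psi>)
    then have d: "\<Phi> differentiable at x" "\<Psi> differentiable at x" for x by auto
    have "partial_deriv i (\<lambda>y. \<Phi> y + \<Psi> y) = (\<lambda>y. partial_deriv i \<Phi> y + partial_deriv i \<Psi> y)" for i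
      by (rule ext) (intro partial_deriv_add d)
    moreover have "\<exists>C. \<forall>x. japanese x ^ k * cmod (\<Phi> x + \<Psi> x) \<le> C" for k
    proof -
      obtain C D where C: "\<And>x. japanese x ^ k * cmod (\<Phi> x) \<le> C" and D: "\<And>x. japanese x ^ k * cmod (\<Psi> x) \<le> D"
        using add.IH by metis
      have "japanese x ^ k * cmod (\<Phi> x + \<Psi> x) \<le> C + D" for x
        using C[of x] D[of x] mult_left_mono[OF norm_triangle_ineq[of "\<Phi> x" "\<Psi> x"], of "japanese x ^ k"]
        by (simp add: distrib_left)
      then show ?thesis by blast
    qed
    ultimately show ?case using add d by (auto simp: schwartz_products.intros intro!: derivative_intros)
  qed
qed (rule schwartz_products.prod[OF assms])

text \<open>Finite linear combinations are treated at once because the Riemann sums below have this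
  form; multiples and differences are special cases.\<close>

lemma partial_derivs_sum:
  fixes \<phi> :: "'j \<Rightarrow> real ^ 'd \<Rightarrow> complex"
  assumes "\<And>j. j \<in> J \<Longrightarrow> \<phi> j \<in> schwartz"
  shows "partial_derivs \<beta> (\<lambda>y. \<Sum>j\<in>J. c j * \<phi> j y) = (\<lambda>y. \<Sum>j\<in>J. c j * partial_derivs \<beta> (\<phi> j) y)"
proof (induction \<beta>)
  case (Cons i \<beta>)
  show ?case
  proof
    fix y
    have "((\<lambda>y. \<Sum>j\<in>J. c j * partial_derivs \<beta> (\<phi> j) y) has_derivative
      (\<lambda>h. \<Sum>j\<in>J. c j * frechet_derivative (partial_derivs \<beta> (\<phi> j)) (at y) h)) (at y)"
      using assms by (intro has_derivative_sum has_derivative_mult_right differentiableD schwartz_differentiable schwartz_partial_derivs)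
    from partial_deriv_eqI[OF this, of i]
    show "partial_derivs (i # \<beta>) (\<lambda>y. \<Sum>j\<in>J. c j * \<phi> j y) y = (\<Sum>j\<in>J. c j * partial_derivs (i # \<beta>) (\<phi> j) y)"
      by (simp add: partial_derivs_Cons Cons.IH) (simp add: partial_deriv_def)
  qed
qed simp

lemma schwartz_sum:
  fixes \<phi> :: "'j \<Rightarrow> real ^ 'd \<Rightarrow> complex"
  assumes \<phi>: "\<And>j. j \<in> J \<Longrightarrow> \<phi> j \<in> schwartz"
  shows "(\<lambda>y. \<Sum>j\<in>J. c j * \<phi> j y) \<in> schwartz"
proof -
  have "(\<lambda>y. \<Sum>j\<in>J. c j * partial_derivs \<beta> (\<phi> j) y) differentiable at x" for \<beta> x
  proof -
    have "((\<lambda>y. \<Sum>j\<in>J. c j * partial_derivs \<beta> (\<phi> j) y) has_derivative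
      (\<lambda>h. \<Sum>j\<in>J. c j * frechet_derivative (partial_derivs \<beta> (\<phi> j)) (at x) h)) (at x)"
      by (intro has_derivative_sum has_derivative_mult_right differentiableD schwartz_differentiable schwartz_partial_derivs \<phi>)
    then show ?thesis by (rule differentiableI)
  qed
  moreover have "bdd_above (range (\<lambda>x. japanese x ^ k * cmod (\<Sum>j\<in>J. c j * partial_derivs \<beta> (\<phi> j) x)))" for k \<beta>
  proof (rule bdd_aboveI2)
    fix x
    have "japanese x ^ k * cmod (\<Sum>j\<in>J. c j * partial_derivs \<beta> (\<phi> j) x) \<le> japanese x ^ k * (\<Sum>j\<in>J. cmod (c j * partial_derivs \<beta> (\<phi> j) x))"
      by (intro mult_left_mono norm_sum) auto
    also have "\<dots> = (\<Sum>j\<in>J. cmod (c j) * (japanese x ^ k * cmod (partial_derivs \<beta> (\<phi> j) x)))"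
      by (simp add: sum_distrib_left norm_mult mult_ac)
    also have "\<dots> \<le> (\<Sum>j\<in>J. cmod (c j) * schwartz_seminorm k \<beta> (\<phi> j))"
      by (intro sum_mono mult_left_mono schwartz_seminorm_ge \<phi>) auto
    finally show "japanese x ^ k * cmod (\<Sum>j\<in>J. c j * partial_derivs \<beta> (\<phi> j) x) \<le> (\<Sum>j\<in>J. cmod (c j) * schwartz_seminorm k \<beta> (\<phi> j))" .
  qed
  ultimately show ?thesis by (simp add: schwartz_def partial_derivs_sum[OF \<phi>] differentiable_on_def)
qed

lemma schwartz_add: "\<phi> \<in> schwartz \<Longrightarrow> \<psi> \<in> schwartz \<Longrightarrow> (\<lambda>y. \<phi> y + \<psi> y) \<in> schwartz"
  using schwartz_sum[of UNIV "\<lambda>b. if b then \<phi> else \<psi>" "\<lambda>_. 1"] by (simp add: UNIV_bool add.commute)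

lemma schwartz_cmult: "\<phi> \<in> schwartz \<Longrightarrow> (\<lambda>y. c * \<phi> y) \<in> schwartz"
  using schwartz_sum[of "UNIV :: unit set" "\<lambda>_. \<phi>" "\<lambda>_. c"] by simp

text \<open>The parameter is the phase space point \<open>(x, \<xi>)\<close>. The polynomial coefficients in \<open>\<xi>\<close> make the
  class closed under partial derivatives.\<close>

inductive tf_family :: "((real ^ 'd) \<times> (real ^ 'd) \<Rightarrow> real ^ 'd \<Rightarrow> complex) \<Rightarrow> bool" where
  base: "\<psi> \<in> schwartz \<Longrightarrow> tf_family (\<lambda>t y. \<psi> (y - fst t) * cnj (chr (snd t) y))"
| mult: "tf_family \<Phi> \<Longrightarrow> tf_family (\<lambda>t y. c * complex_of_real (snd t $ i) * \<Phi> t y)"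
| add: "tf_family \<Phi> \<Longrightarrow> tf_family \<Psi> \<Longrightarrow> tf_family (\<lambda>t y. \<Phi> t y + \<Psi> t y)"

lemma tf_family_differentiable: "tf_family \<Phi> \<Longrightarrow> \<Phi> t differentiable at y"
proof (induction rule: tf_family.induct)
  case (base \<psi>)
  show ?case
    by (intro differentiable_mult partial_deriv_shift(2) schwartz_differentiable base partial_deriv_cnj_chr(2))
qed (auto intro!: derivative_intros)

lemma tf_family_continuous: "tf_family \<Phi> \<Longrightarrow> continuous_on UNIV (\<lambda>z. \<Phi> (fst z) (snd z))"
proof (induction rule: tf_family.induct)
  case (base \<psi>)
  show ?case
    by (intro continuous_intros continuous_on_compose2[OF schwartz_continuous_on[OF base, of UNIV]]) auto
qed (auto intro!: continuous_intros)

text \<open>Peetre's inequality turns the translation into powers of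
  \<open>japanese (fst t)\<close>, and the polynomial coefficients contribute powers of
  \<open>japanese (snd t)\<close>. Polynomial growth is good enough because
  \<open>corr_bound\<close> outweighs it.\<close>

lemma tf_family_bound:
  "tf_family \<Phi> \<Longrightarrow> \<exists>C N. 0 \<le> C \<and> (\<forall>t y. japanese y ^ k * cmod (\<Phi> t y) \<le> C * (japanese (fst t) * japanese (snd t)) ^ N)"
proof (induction rule: tf_family.induct)
  case (base \<psi>)
  obtain C where C: "0 \<le> C" "\<And>y. cmod (\<psi> y) \<le> C * decay k y" using schwartz_decay[OF base] by metis
  have "japanese y ^ k * cmod (\<psi> (y - fst t) * cnj (chr (snd t) y)) \<le> (2 ^ k * C) * (japanese (fst t) * japanese (snd t)) ^ k" for t y
  proof -
    have "decay k (y - fst t) \<le> 2 ^ k * decay k y * japanese (fst t) ^ k"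
      using decay_Peetre[of k y "- fst t"] by simp
    then have "cmod (\<psi> (y - fst t)) \<le> C * (2 ^ k * decay k y * japanese (fst t) ^ k)"
      using C(2)[of "y - fst t"] C(1) by (meson mult_left_mono order_trans)
    then have "japanese y ^ k * cmod (\<psi> (y - fst t)) \<le> japanese y ^ k * (C * (2 ^ k * decay k y * japanese (fst t) ^ k))"
      by (intro mult_left_mono) auto
    also have "\<dots> = 2 ^ k * C * japanese (fst t) ^ k * 1" by (simp add: decay_def)
    also have "\<dots> \<le> 2 ^ k * C * japanese (fst t) ^ k * japanese (snd t) ^ k"
      using C(1) by (intro mult_left_mono one_le_power japanese_ge_1) auto
    finally show ?thesis by (simp add: norm_mult power_mult_distrib)
  qed
  then show ?case using C(1) by (intro exI[of _ "2 ^ k * C"] exI[of _ k]) auto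
next
  case (mult \<Phi> c i)
  then obtain C N where C: "0 \<le> C" "\<And>t y. japanese y ^ k * cmod (\<Phi> t y) \<le> C * (japanese (fst t) * japanese (snd t)) ^ N" by blast
  have "japanese y ^ k * cmod (c * complex_of_real (snd t $ i) * \<Phi> t y) \<le> (cmod c * C) * (japanese (fst t) * japanese (snd t)) ^ Suc N" for t y
  proof -
    have "\<bar>snd t $ i\<bar> \<le> 1 * japanese (snd t)"
      using component_le_norm_cart[of "snd t" i] norm_le_japanese[of "snd t"] by simp
    also have "\<dots> \<le> japanese (fst t) * japanese (snd t)" by (intro mult_right_mono japanese_ge_1) auto
    finally have "\<bar>snd t $ i\<bar> * (japanese y ^ k * cmod (\<Phi> t y)) \<le> (japanese (fst t) * japanese (snd t)) * (C * (japanese (fst t) * japanese (snd t)) ^ N)"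
      by (intro mult_mono C) auto
    then have "cmod c * (\<bar>snd t $ i\<bar> * (japanese y ^ k * cmod (\<Phi> t y))) \<le> cmod c * ((japanese (fst t) * japanese (snd t)) * (C * (japanese (fst t) * japanese (snd t)) ^ N))"
      by (intro mult_left_mono) auto
    then show ?thesis by (simp add: norm_mult mult_ac)
  qed
  then show ?case using C(1) by (intro exI[of _ "cmod c * C"] exI[of _ "Suc N"]) auto
next
  case (add \<Phi> \<Psi>)
  then obtain C M D N where C: "0 \<le> C" "\<And>t y. japanese y ^ k * cmod (\<Phi> t y) \<le> C * (japanese (fst t) * japanese (snd t)) ^ M"
    and D: "0 \<le> D" "\<And>t y. japanese y ^ k * cmod (\<Psi> t y) \<le> D * (japanese (fst t) * japanese (snd t)) ^ N" by metis
  have "japanese y ^ k * cmod (\<Phi> t y + \<Psi> t y) \<le> (C + D) * (japanese (fst t) * japanese (snd t)) ^ (M + N)" for t y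
  proof -
    let ?\<rho> = "japanese (fst t) * japanese (snd t)"
    have \<rho>: "1 \<le> ?\<rho>" using mult_mono[OF japanese_ge_1[of "fst t"] japanese_ge_1[of "snd t"]] by simp
    have "japanese y ^ k * cmod (\<Phi> t y + \<Psi> t y) \<le> japanese y ^ k * cmod (\<Phi> t y) + japanese y ^ k * cmod (\<Psi> t y)"
      using mult_left_mono[OF norm_triangle_ineq[of "\<Phi> t y" "\<Psi> t y"], of "japanese y ^ k"] by (simp add: distrib_left)
    also have "\<dots> \<le> C * ?\<rho> ^ M + D * ?\<rho> ^ N" by (intro add_mono C D)
    also have "\<dots> \<le> C * ?\<rho> ^ (M + N) + D * ?\<rho> ^ (M + N)"
      using C(1) D(1) \<rho> by (intro add_mono mult_left_mono power_increasing) auto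
    finally show ?thesis by (simp add: distrib_right)
  qed
  then show ?case using C(1) D(1) by (intro exI[of _ "C + D"] exI[of _ "M + N"]) auto
qed

lemma tf_family_partial_deriv: "tf_family \<Phi> \<Longrightarrow> tf_family (\<lambda>t. partial_deriv i (\<Phi> t))"
proof (induction rule: tf_family.induct)
  case (base \<psi>)
  have "partial_deriv i (\<lambda>y. \<psi> (y - fst t) * cnj (chr (snd t) y)) y =
     partial_deriv i \<psi> (y - fst t) * cnj (chr (snd t) y) + (- \<i>) * complex_of_real (snd t $ i) * (\<psi> (y - fst t) * cnj (chr (snd t) y))" for t y
    by (subst partial_deriv_mult)
       (auto simp: partial_deriv_shift partial_deriv_cnj_chr schwartz_differentiable base mult_ac)
  then have "(\<lambda>t. partial_deriv i (\<lambda>y. \<psi> (y - fst t) * cnj (chr (snd t) y))) =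
    (\<lambda>t y. partial_deriv i \<psi> (y - fst t) * cnj (chr (snd t) y) + (- \<i>) * complex_of_real (snd t $ i) * (\<psi> (y - fst t) * cnj (chr (snd t) y)))"
    by blast
  then show ?case
    using tf_family.add[OF tf_family.base tf_family.mult[OF tf_family.base], OF schwartz_partial_deriv[OF base] base, of i "- \<i>" i] by simp
next
  case (mult \<Phi> c j)
  have "(\<lambda>t. partial_deriv i (\<lambda>y. c * complex_of_real (snd t $ j) * \<Phi> t y)) = (\<lambda>t y. c * complex_of_real (snd t $ j) * partial_deriv i (\<Phi> t) y)"
    by (intro ext) (intro partial_deriv_cmult tf_family_differentiable mult)
  then show ?case using tf_family.mult[OF mult.IH] by simp
next
  case (add \<Phi> \<Psi>)
  have "(\<lambda>t. partial_deriv i (\<lambda>y. \<Phi> t y + \<Psi> t y)) = (\<lambda>t y. partial_deriv i (\<Phi> t) y + partial_deriv i (\<Psi> t) y)"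
    by (intro ext) (intro partial_deriv_add tf_family_differentiable add)
  then show ?case using tf_family.add[OF add.IH] by simp
qed

lemma tf_family_partial_derivs: "tf_family \<Phi> \<Longrightarrow> tf_family (\<lambda>t. partial_derivs \<beta> (\<Phi> t))"
  by (induction \<beta>) (auto simp: partial_derivs_Cons intro: tf_family_partial_deriv)

lemma tf_family_schwartz:
  assumes "tf_family \<Phi>" shows "\<Phi> t \<in> schwartz"
proof (rule schwartz_coinduct[where P="\<lambda>\<psi>. \<exists>\<Phi>. tf_family \<Phi> \<and> \<psi> = \<Phi> t"])
  fix \<psi> :: "real ^ 'a \<Rightarrow> complex" assume "\<exists>\<Phi>. tf_family \<Phi> \<and> \<psi> = \<Phi> t"
  then obtain \<Phi> where \<Phi>: "tf_family \<Phi>" "\<psi> = \<Phi> t" by blast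
  have "\<exists>\<Phi>. tf_family \<Phi> \<and> partial_deriv i \<psi> = \<Phi> t" for i
    using tf_family_partial_deriv[OF \<Phi>(1), of i] \<Phi>(2) by blast
  moreover have "\<exists>C. \<forall>x. japanese x ^ k * cmod (\<psi> x) \<le> C" for k
    using tf_family_bound[OF \<Phi>(1), of k] unfolding \<Phi>(2) by blast
  ultimately show "(\<forall>x. \<psi> differentiable at x) \<and> (\<forall>k. \<exists>C. \<forall>x. japanese x ^ k * cmod (\<psi> x) \<le> C) \<and> (\<forall>i. \<exists>\<Phi>. tf_family \<Phi> \<and> partial_deriv i \<psi> = \<Phi> t)"
    using tf_family_differentiable[OF \<Phi>(1)] \<Phi>(2) by blast
qed (use assms in blast)


text \<open>A mean value estimate along a coordinate axis; it dominates difference quotients when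
  limits are taken under the integral sign.\<close>

lemma cmod_diff_le_partial_deriv:
  assumes d: "\<And>y. \<psi> differentiable at y" and s: "0 < s"
    and B: "\<And>t. 0 < t \<Longrightarrow> t < s \<Longrightarrow> cmod (partial_deriv i \<psi> (y + t *\<^sub>R axis i 1)) \<le> B"
  shows "cmod (\<psi> (y + s *\<^sub>R axis i 1) - \<psi> y) \<le> B * s"
proof -
  let ?l = "\<lambda>t. y + t *\<^sub>R axis i (1::real)"
  have D: "((\<lambda>t. \<psi> (?l t)) has_derivative (\<lambda>h. frechet_derivative \<psi> (at (?l t)) (h *\<^sub>R axis i 1))) (at t)" for t
    by (rule has_derivative_compose[OF _ differentiableD[OF d]]) (auto intro!: derivative_eq_intros)
  have "\<exists>t\<in>{0<..<s}. cmod (\<psi> (?l s) - \<psi> (?l 0)) \<le> cmod (frechet_derivative \<psi> (at (?l t)) ((s - 0) *\<^sub>R axis i 1))"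
    by (rule mvt_general[OF s])
       (auto intro!: D continuous_at_imp_continuous_on has_derivative_continuous[OF D])
  then obtain t where t: "0 < t" "t < s" "cmod (\<psi> (?l s) - \<psi> y) \<le> cmod (frechet_derivative \<psi> (at (?l t)) (s *\<^sub>R axis i 1))"
    by auto
  have "frechet_derivative \<psi> (at (?l t)) (s *\<^sub>R axis i 1) = s *\<^sub>R partial_deriv i \<psi> (?l t)"
    unfolding partial_deriv_def using linear_frechet_derivative[OF d] by (rule linear_scale)
  then have "cmod (\<psi> (?l s) - \<psi> y) \<le> s * cmod (partial_deriv i \<psi> (?l t))"
    using t(3) s by simp
  also have "\<dots> \<le> s * B" using B[OF t(1,2)] s by (intro mult_left_mono) auto
  finally show ?thesis by (simp add: mult.commute)
qed

text \<open>The step sizes \<open>1 / Suc n\<close> provide a sequence, as dominated convergence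
  requires; the same limit is used to see that the derivative is measurable.\<close>

lemma partial_deriv_LIMSEQ:
  assumes d: "\<psi> differentiable at y"
  shows "(\<lambda>n. (\<psi> (y + (1 / real (Suc n)) *\<^sub>R axis i 1) - \<psi> y) * of_nat (Suc n)) \<longlonglongrightarrow> partial_deriv i \<psi> y"
proof -
  let ?l = "\<lambda>t. y + t *\<^sub>R axis i (1::real)"
  have "((\<lambda>t. \<psi> (?l t)) has_derivative (\<lambda>h. frechet_derivative \<psi> (at y) (h *\<^sub>R axis i 1))) (at 0)"
    by (rule has_derivative_compose[of ?l]) (use differentiableD[OF d] in \<open>auto intro!: derivative_eq_intros\<close>)
  then have "((\<lambda>t. \<psi> (?l t)) has_vector_derivative partial_deriv i \<psi> y) (at 0)"
    unfolding has_vector_derivative_def partial_deriv_def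
    using linear_scale[OF linear_frechet_derivative[OF d]] by simp
  then have "(\<lambda>h. cmod (\<psi> (?l (0 + h)) - \<psi> (?l 0) - h *\<^sub>R partial_deriv i \<psi> y) / norm h) \<midarrow>0\<rightarrow> 0"
    by (simp add: has_vector_derivative_def has_derivative_at)
  moreover have "filterlim (\<lambda>n. 1 / real (Suc n)) (at 0) sequentially"
    unfolding filterlim_at using LIMSEQ_Suc[OF lim_1_over_n] by auto
  ultimately have "(\<lambda>n. cmod (\<psi> (?l (0 + 1 / real (Suc n))) - \<psi> (?l 0) - (1 / real (Suc n)) *\<^sub>R partial_deriv i \<psi> y) / norm (1 / real (Suc n))) \<longlonglongrightarrow> 0"
    by (rule filterlim_compose)
  moreover have "cmod (\<psi> (?l (0 + 1 / real (Suc n))) - \<psi> (?l 0) - (1 / real (Suc n)) *\<^sub>R partial_deriv i \<psi> y) / norm (1 / real (Suc n))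
    = cmod ((\<psi> (?l (1 / real (Suc n))) - \<psi> y) * of_nat (Suc n) - partial_deriv i \<psi> y)" for n
  proof -
    have "(\<psi> (?l (1 / real (Suc n))) - \<psi> y) * of_nat (Suc n) - partial_deriv i \<psi> y
      = (\<psi> (?l (1 / real (Suc n))) - \<psi> y - (1 / real (Suc n)) *\<^sub>R partial_deriv i \<psi> y) * of_nat (Suc n)"
      by (simp add: left_diff_distrib scaleR_conv_of_real del: of_nat_Suc)
    then show ?thesis by (simp add: norm_mult del: of_nat_Suc)
  qed
  ultimately have "(\<lambda>n. cmod ((\<psi> (?l (1 / real (Suc n))) - \<psi> y) * of_nat (Suc n) - partial_deriv i \<psi> y)) \<longlonglongrightarrow> 0"
    by (simp only:)
  then show ?thesis
    by (rule LIM_zero_cancel[OF tendsto_norm_zero_cancel])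
qed

text \<open>By translation invariance every difference quotient has integral zero, and domination
  passes this to the limit. It expresses the vanishing of boundary terms in integration by
  parts.\<close>

lemma integral_partial_deriv_eq_0:
  fixes \<psi> :: "real ^ 'd \<Rightarrow> complex"
  assumes d: "\<And>y. \<psi> differentiable at y" and M: "CARD('d) < M"
    and b: "\<And>y. cmod (\<psi> y) \<le> C * decay M y" "\<And>y. cmod (partial_deriv i \<psi> y) \<le> C * decay M y"
  shows "(LINT y|lborel. partial_deriv i \<psi> y) = 0"
proof -
  have cont: "continuous_on UNIV \<psi>"
    by (meson d differentiable_imp_continuous_within continuous_at_imp_continuous_on)
  then have [measurable]: "\<psi> \<in> borel_measurable borel" by (rule borel_measurable_continuous_onI)
  have C: "0 \<le> C" using order_trans[OF norm_ge_zero b(1)[of 0]] by (meson decay_pos linorder_not_le mult_neg_pos)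
  define D where "D n y = (\<psi> (y + (1 / real (Suc n)) *\<^sub>R axis i 1) - \<psi> y) * of_nat (Suc n)" for n y
  have [measurable]: "D n \<in> borel_measurable borel" for n unfolding D_def by measurable
  have lim: "(\<lambda>n. D n y) \<longlonglongrightarrow> partial_deriv i \<psi> y" for y
    unfolding D_def by (rule partial_deriv_LIMSEQ[OF d])
  have [measurable]: "partial_deriv i \<psi> \<in> borel_measurable borel"
    by (rule borel_measurable_LIMSEQ_metric[of D]) (use lim in auto)
  have i: "integrable lborel \<psi>"
    by (rule integrable_decay_bound[where a=0, OF _ M]) (use b in auto)
  have "(LINT y|lborel. D n y) = 0" for n
  proof -
    have "integrable lborel (\<lambda>y. \<psi> ((1 / real (Suc n)) *\<^sub>R axis i 1 + 1 *\<^sub>R y))"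
      by (rule integrable_lborel_affine[OF i]) simp
    moreover have "(LINT y|lborel. \<psi> y) = complex_of_real (\<bar>1\<bar> ^ DIM(real ^ 'd)) * (LINT y|lborel. \<psi> ((1 / real (Suc n)) *\<^sub>R axis i 1 + 1 *\<^sub>R y))"
      by (rule integral_lborel_affine) auto
    ultimately show ?thesis using i unfolding D_def by (simp add: add.commute)
  qed
  moreover have "(\<lambda>n. LINT y|lborel. D n y) \<longlonglongrightarrow> (LINT y|lborel. partial_deriv i \<psi> y)"
  proof (rule integral_dominated_convergence)
    show "integrable lborel (\<lambda>y :: real ^ 'd. C * (2 ^ M * decay M y * 2 ^ M))"
      using integrable_decay[OF M] by simp
    show "AE y in lborel. cmod (D n y) \<le> C * (2 ^ M * decay M y * 2 ^ M)" for n
    proof (rule AE_I2)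
      fix y
      have "cmod (\<psi> (y + (1 / real (Suc n)) *\<^sub>R axis i 1) - \<psi> y) \<le> (C * (2 ^ M * decay M y * 2 ^ M)) * (1 / real (Suc n))"
      proof (rule cmod_diff_le_partial_deriv[OF d])
        fix t :: real assume t: "0 < t" "t < 1 / real (Suc n)"
        \<comment> \<open>Points move by at most \<open>1\<close>, where \<open>japanese\<close> is
          at most \<open>2\<close>: this is the second factor \<open>2 ^ M\<close> of the majorant,
          the first one being Peetre's constant.\<close>
        have "1 / real (Suc n) \<le> 1" by simp
        with t have "t \<le> 1" by linarith
        then have "japanese (t *\<^sub>R axis i 1 :: real ^ 'd) \<le> 2"
          using t using power_le_one[of t 2] by (simp add: japanese_def norm_axis_1 real_le_lsqrt del: power_le_one)
        then have "2 ^ M * decay M y * japanese (t *\<^sub>R axis i 1 :: real ^ 'd) ^ M \<le> 2 ^ M * decay M y * 2 ^ M"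
          by (intro mult_left_mono power_mono) auto
        with decay_Peetre[of M y "t *\<^sub>R axis i 1"] have "decay M (y + t *\<^sub>R axis i 1) \<le> 2 ^ M * decay M y * 2 ^ M"
          by linarith
        with b(2)[of "y + t *\<^sub>R axis i 1"] C
        show "cmod (partial_deriv i \<psi> (y + t *\<^sub>R axis i 1)) \<le> C * (2 ^ M * decay M y * 2 ^ M)"
          by (meson mult_left_mono order_trans)
      qed simp
      then have "cmod (\<psi> (y + (1 / real (Suc n)) *\<^sub>R axis i 1) - \<psi> y) * real (Suc n) \<le> (C * (2 ^ M * decay M y * 2 ^ M)) * (1 / real (Suc n)) * real (Suc n)"
        by (intro mult_right_mono) auto
      then show "cmod (D n y) \<le> C * (2 ^ M * decay M y * 2 ^ M)"
        unfolding D_def by (simp add: norm_mult del: of_nat_Suc)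
    qed
  qed (use lim in auto)
  ultimately show ?thesis by (simp add: LIMSEQ_const_iff)
qed

text \<open>Up to a constant the short-time Fourier transform, at \<open>(z, - \<eta>)\<close>, of
  the test function \<open>a\<close> with the conjugate of \<open>b\<close> as window. It is kept
  bilinear so that integration by parts treats \<open>a\<close> and \<open>b\<close> alike, and it
  is the coefficient in the reproducing formula.\<close>

definition corr :: "(real ^ 'd \<Rightarrow> complex) \<Rightarrow> (real ^ 'd \<Rightarrow> complex) \<Rightarrow> real ^ 'd \<Rightarrow> real ^ 'd \<Rightarrow> complex" where
  "corr a b z \<eta> = (LINT y|lborel. a y * b (y - z) * chr \<eta> y)"

text \<open>The decay of \<open>a\<close> is used twice: \<open>N\<close> orders turn the decay of
  \<open>b\<close> in \<open>y - z\<close> into decay in \<open>z\<close>, by Peetre's inequality,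
  and \<open>M\<close> orders remain for the integral over \<open>y\<close>.\<close>

lemma corr_bound_0:
  fixes a b :: "real ^ 'd \<Rightarrow> complex"
  assumes a: "a \<in> schwartz" and b: "b \<in> schwartz"
  shows "\<exists>C\<ge>0. \<forall>z y. cmod (a y * b (y - z)) \<le> C * decay N z * decay M y"
proof -
  obtain A where A: "0 \<le> A" "\<And>y. cmod (a y) \<le> A * decay (N + M) y" using schwartz_decay[OF a] by metis
  obtain B where B: "0 \<le> B" "\<And>y. cmod (b y) \<le> B * decay N y" using schwartz_decay[OF b] by metis
  have "cmod (a y * b (y - z)) \<le> (A * B * 2 ^ N) * decay N z * decay M y" for z y
  proof -
    have "decay N (y - z) \<le> 2 ^ N * decay N z * japanese y ^ N"
      using decay_Peetre[of N "- z" y] by (simp add: add.commute)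
    then have "cmod (b (y - z)) \<le> B * (2 ^ N * decay N z * japanese y ^ N)"
      using B by (meson mult_left_mono order_trans)
    then have "cmod (a y) * cmod (b (y - z)) \<le> (A * decay (N + M) y) * (B * (2 ^ N * decay N z * japanese y ^ N))"
      using A by (intro mult_mono) auto
    also have "\<dots> = (A * B * 2 ^ N) * decay N z * decay M y"
      by (simp add: decay_def power_add mult_ac)
    finally show ?thesis by (simp add: norm_mult)
  qed
  then show ?thesis using A(1) B(1) by (intro exI[of _ "A * B * 2 ^ N"]) auto
qed

lemma
  assumes a: "a \<in> schwartz" and b: "b \<in> schwartz"
  shows corr_integrable: "integrable lborel (\<lambda>y. a y * b (y - z) * chr \<eta> y)"
    and corr_measurable [measurable]: "(\<lambda>y. a y * b (y - z)) \<in> borel_measurable borel"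
proof -
  note [measurable] = a[THEN schwartz_measurable] b[THEN schwartz_measurable]
  obtain C where C: "\<And>z y. cmod (a y * b (y - z)) \<le> C * decay 0 z * decay (Suc CARD('a)) y"
    using corr_bound_0[OF a b] by metis
  show "integrable lborel (\<lambda>y. a y * b (y - z) * chr \<eta> y)"
    by (rule integrable_decay_bound[where a=0 and N="Suc CARD('a)" and C=C])
       (use C[of _ z] in \<open>auto simp: norm_mult decay_def\<close>)
  show "(\<lambda>y. a y * b (y - z)) \<in> borel_measurable borel" by measurable
qed

text \<open>Integration by parts: a factor \<open>\<eta> $ i\<close> is traded for a derivative of
  one of the two test functions.\<close>

lemma corr_ibp:
  fixes a b :: "real ^ 'd \<Rightarrow> complex"
  assumes a: "a \<in> schwartz" and b: "b \<in> schwartz"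
  shows "complex_of_real (\<eta> $ i) * corr a b z \<eta> = \<i> * (corr (partial_deriv i a) b z \<eta> + corr a (partial_deriv i b) z \<eta>)"
proof -
  note a' = schwartz_partial_deriv[OF a, of i] and b' = schwartz_partial_deriv[OF b, of i]
  let ?M = "Suc CARD('d)"
  let ?\<psi> = "\<lambda>y. a y * b (y - z) * chr \<eta> y"
  have d: "(\<lambda>y. a y * b (y - z)) differentiable at y" for y
    by (intro differentiable_mult partial_deriv_shift(2) schwartz_differentiable a b)
  have pd: "partial_deriv i ?\<psi> y = partial_deriv i a y * b (y - z) * chr \<eta> y + a y * partial_deriv i b (y - z) * chr \<eta> y
       + \<i> * complex_of_real (\<eta> $ i) * (a y * b (y - z) * chr \<eta> y)" for y
    by (subst partial_deriv_mult[OF d partial_deriv_chr(2)], subst partial_deriv_mult[OF schwartz_differentiable[OF a] partial_deriv_shift(2)[OF schwartz_differentiable[OF b]]])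
       (simp add: partial_deriv_shift[OF schwartz_differentiable[OF b]] partial_deriv_chr(1) algebra_simps)
  obtain C1 where C1: "0 \<le> C1" "\<And>z y. cmod (a y * b (y - z)) \<le> C1 * decay 0 z * decay ?M y" using corr_bound_0[OF a b] by metis
  obtain C2 where C2: "0 \<le> C2" "\<And>z y. cmod (partial_deriv i a y * b (y - z)) \<le> C2 * decay 0 z * decay ?M y" using corr_bound_0[OF a' b] by metis
  obtain C3 where C3: "0 \<le> C3" "\<And>z y. cmod (a y * partial_deriv i b (y - z)) \<le> C3 * decay 0 z * decay ?M y" using corr_bound_0[OF a b'] by metis
  define C where "C = C1 + (C2 + C3 + \<bar>\<eta> $ i\<bar> * C1)"
  have 0: "(LINT y|lborel. partial_deriv i ?\<psi> y) = 0"
  proof (rule integral_partial_deriv_eq_0)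
    show "?\<psi> differentiable at y" for y by (intro differentiable_mult d partial_deriv_chr(2))
    have m: "C1 * decay ?M y \<le> C * decay ?M y" for y :: "real ^ 'd"
      using C1(1) C2(1) C3(1) by (intro mult_right_mono) (auto simp: C_def)
    show "cmod (?\<psi> y) \<le> C * decay ?M y" for y
      using C1(2)[of y z] m[of y] by (simp add: norm_mult decay_def)
    have m2: "(C2 + C3 + \<bar>\<eta> $ i\<bar> * C1) * decay ?M y \<le> C * decay ?M y" for y :: "real ^ 'd"
      using C1(1) by (intro mult_right_mono) (auto simp: C_def)
    show "cmod (partial_deriv i ?\<psi> y) \<le> C * decay ?M y" for y
    proof -
      have "cmod (partial_deriv i ?\<psi> y) \<le> cmod (partial_deriv i a y * b (y - z)) + cmod (a y * partial_deriv i b (y - z)) + \<bar>\<eta> $ i\<bar> * cmod (a y * b (y - z))"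
        unfolding pd
        using norm_triangle_ineq[of "partial_deriv i a y * b (y - z) * chr \<eta> y + a y * partial_deriv i b (y - z) * chr \<eta> y" "\<i> * complex_of_real (\<eta> $ i) * (a y * b (y - z) * chr \<eta> y)"]
          norm_triangle_ineq[of "partial_deriv i a y * b (y - z) * chr \<eta> y" "a y * partial_deriv i b (y - z) * chr \<eta> y"]
        by (simp add: norm_mult)
      also have "\<dots> \<le> C2 * decay ?M y + C3 * decay ?M y + \<bar>\<eta> $ i\<bar> * (C1 * decay ?M y)"
        using C1(2)[of y z] C2(2)[of y z] C3(2)[of y z] by (intro add_mono mult_left_mono) (auto simp: decay_def)
      also have "\<dots> = (C2 + C3 + \<bar>\<eta> $ i\<bar> * C1) * decay ?M y" by (simp add: algebra_simps)
      finally show ?thesis using m2[of y] by linarith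
    qed
  qed simp
  have "(LINT y|lborel. partial_deriv i ?\<psi> y) = corr (partial_deriv i a) b z \<eta> + corr a (partial_deriv i b) z \<eta> + \<i> * complex_of_real (\<eta> $ i) * corr a b z \<eta>"
    unfolding pd corr_def
    using corr_integrable[OF a' b, of z \<eta>] corr_integrable[OF a b', of z \<eta>] corr_integrable[OF a b, of z \<eta>]
    by simp
  with 0 have "\<i> * (complex_of_real (\<eta> $ i) * corr a b z \<eta>) = - (corr (partial_deriv i a) b z \<eta> + corr a (partial_deriv i b) z \<eta>)"
    by (simp add: algebra_simps eq_neg_iff_add_eq_0)
  then have "- \<i> * (\<i> * (complex_of_real (\<eta> $ i) * corr a b z \<eta>)) = - \<i> * - (corr (partial_deriv i a) b z \<eta> + corr a (partial_deriv i b) z \<eta>)"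
    by simp
  moreover have "- \<i> * (\<i> * w) = w" "- \<i> * - w = \<i> * w" for w by (simp_all add: mult.assoc[symmetric])
  ultimately show ?thesis by (simp only:)
qed

text \<open>The induction runs over all pairs of test functions, since each integration by parts
  replaces one of them by a derivative. The decay in \<open>z\<close> is that of
  \<open>corr_bound_0\<close> and is carried along.\<close>

lemma corr_component_bound:
  fixes a b :: "real ^ 'd \<Rightarrow> complex"
  assumes "a \<in> schwartz" "b \<in> schwartz"
  shows "\<exists>C\<ge>0. \<forall>z \<eta>. \<bar>\<eta> $ i\<bar> ^ n * cmod (corr a b z \<eta>) \<le> C * decay N z"
  using assms
proof (induction n arbitrary: a b)
  case 0
  let ?M = "Suc CARD('d)"
  obtain C where C: "0 \<le> C" "\<And>z y. cmod (a y * b (y - z)) \<le> C * decay N z * decay ?M y"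
    using corr_bound_0[OF 0] by metis
  define I where "I = (LINT y|lborel. decay ?M (y :: real ^ 'd))"
  have I: "0 \<le> I" unfolding I_def by (intro integral_nonneg_AE) auto
  have "cmod (corr a b z \<eta>) \<le> (C * I) * decay N z" for z \<eta>
  proof -
    have "cmod (corr a b z \<eta>) \<le> (LINT y|lborel. cmod (a y * b (y - z) * chr \<eta> y))"
      unfolding corr_def by (rule integral_norm_bound)
    also have "\<dots> \<le> (LINT y|lborel. C * decay N z * decay ?M (y :: real ^ 'd))"
    proof (rule Bochner_Integration.integral_mono)
      show "integrable lborel (\<lambda>y. cmod (a y * b (y - z) * chr \<eta> y))"
        by (rule integrable_norm[OF corr_integrable[OF 0]])
      show "cmod (a y * b (y - z) * chr \<eta> y) \<le> C * decay N z * decay ?M y" for y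
        using C(2)[of y z] by (simp add: norm_mult)
    qed simp
    finally show ?thesis by (simp add: I_def mult_ac)
  qed
  then show ?case using C(1) I by (intro exI[of _ "C * I"]) auto
next
  case (Suc n)
  obtain C where C: "0 \<le> C" "\<And>z \<eta>. \<bar>\<eta> $ i\<bar> ^ n * cmod (corr (partial_deriv i a) b z \<eta>) \<le> C * decay N z"
    using Suc.IH[OF schwartz_partial_deriv[OF Suc.prems(1)] Suc.prems(2)] by metis
  obtain D where D: "0 \<le> D" "\<And>z \<eta>. \<bar>\<eta> $ i\<bar> ^ n * cmod (corr a (partial_deriv i b) z \<eta>) \<le> D * decay N z"
    using Suc.IH[OF Suc.prems(1) schwartz_partial_deriv[OF Suc.prems(2)]] by metis
  have "\<bar>\<eta> $ i\<bar> ^ Suc n * cmod (corr a b z \<eta>) \<le> (C + D) * decay N z" for z \<eta>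
  proof -
    have "\<bar>\<eta> $ i\<bar> ^ Suc n * cmod (corr a b z \<eta>) = \<bar>\<eta> $ i\<bar> ^ n * cmod (complex_of_real (\<eta> $ i) * corr a b z \<eta>)"
      by (simp add: norm_mult)
    also have "\<dots> \<le> \<bar>\<eta> $ i\<bar> ^ n * (cmod (corr (partial_deriv i a) b z \<eta>) + cmod (corr a (partial_deriv i b) z \<eta>))"
      unfolding corr_ibp[OF Suc.prems] by (intro mult_left_mono) (auto simp: norm_mult norm_triangle_ineq)
    also have "\<dots> \<le> C * decay N z + D * decay N z"
      using C(2)[of \<eta> z] D(2)[of \<eta> z] by (simp add: distrib_left)
    finally show ?thesis by (simp add: distrib_right)
  qed
  then show ?case using C(1) D(1) by (intro exI[of _ "C + D"]) auto
qed

text \<open>Reduces the weight to powers of single coordinates, which is what integration by parts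
  provides.\<close>

lemma japanese_power_le_sum:
  "japanese (\<eta> :: real ^ 'd) ^ N \<le> (1 + real CARD('d)) ^ N * (1 + (\<Sum>i\<in>UNIV. \<bar>\<eta> $ i\<bar> ^ N))"
proof -
  define m where "m = Max (range (\<lambda>i. \<bar>\<eta> $ i\<bar>))"
  have m: "\<bar>\<eta> $ i\<bar> \<le> m" for i unfolding m_def by (intro Max_ge) auto
  have "m \<in> range (\<lambda>i. \<bar>\<eta> $ i\<bar>)" unfolding m_def by (intro Max_in) auto
  then obtain i where i: "m = \<bar>\<eta> $ i\<bar>" by auto
  have "japanese \<eta> \<le> 1 + norm \<eta>" unfolding japanese_def by (rule real_le_lsqrt) (auto simp: power2_sum)
  also have "norm \<eta> \<le> (\<Sum>i\<in>UNIV. \<bar>\<eta> $ i\<bar>)" by (rule norm_le_l1_cart)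
  also have "\<dots> \<le> (\<Sum>i\<in>(UNIV :: 'd set). m)" by (intro sum_mono m)
  also have "(\<Sum>i\<in>(UNIV :: 'd set). m) = real CARD('d) * m" by simp
  also have "1 + \<dots> \<le> (1 + real CARD('d)) * max 1 m"
    using mult_left_mono[of m "max 1 m" "real CARD('d)"] max.cobounded1[of 1 m] unfolding distrib_right by linarith
  finally have "japanese \<eta> ^ N \<le> ((1 + real CARD('d)) * max 1 m) ^ N" by (intro power_mono) auto
  also have "\<dots> = (1 + real CARD('d)) ^ N * max 1 m ^ N" by (simp add: power_mult_distrib)
  also have "max 1 m ^ N \<le> 1 + m ^ N" using i by (auto simp: max_def)
  also have "m ^ N \<le> (\<Sum>i\<in>UNIV. \<bar>\<eta> $ i\<bar> ^ N)"
    unfolding i by (rule member_le_sum) auto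
  finally show ?thesis by (simp add: mult_left_mono)
qed

text \<open>Rapid decay jointly in position and frequency. It yields the convergence of the
  reproducing formula, the kernel in \<open>change_of_window\<close> and the error kernel for
  products.\<close>

lemma corr_bound:
  fixes a b :: "real ^ 'd \<Rightarrow> complex"
  assumes a: "a \<in> schwartz" and b: "b \<in> schwartz"
  shows "\<exists>C\<ge>0. \<forall>z \<eta>. cmod (corr a b z \<eta>) \<le> C * decay N z * decay N \<eta>"
proof -
  have "\<forall>i. \<exists>C\<ge>0. \<forall>z \<eta>. \<bar>\<eta> $ i\<bar> ^ N * cmod (corr a b z \<eta>) \<le> C * decay N z"
    using corr_component_bound[OF a b] by blast
  then obtain C where C: "\<And>i. 0 \<le> C i" "\<And>i z \<eta>. \<bar>\<eta> $ i\<bar> ^ N * cmod (corr a b z \<eta>) \<le> C i * decay N z"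
    by metis
  obtain D where D: "0 \<le> D" "\<And>z \<eta>. cmod (corr a b z \<eta>) \<le> D * decay N z"
    using corr_component_bound[OF a b, of _ 0 N] by auto
  let ?E = "(1 + real CARD('d)) ^ N * (D + (\<Sum>i\<in>UNIV. C i))"
  have "cmod (corr a b z \<eta>) \<le> ?E * decay N z * decay N \<eta>" for z \<eta>
  proof -
    have "japanese \<eta> ^ N * cmod (corr a b z \<eta>) \<le> (1 + real CARD('d)) ^ N * (1 + (\<Sum>i\<in>UNIV. \<bar>\<eta> $ i\<bar> ^ N)) * cmod (corr a b z \<eta>)"
      by (intro mult_right_mono japanese_power_le_sum) auto
    also have "\<dots> = (1 + real CARD('d)) ^ N * (cmod (corr a b z \<eta>) + (\<Sum>i\<in>UNIV. \<bar>\<eta> $ i\<bar> ^ N * cmod (corr a b z \<eta>)))"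
      by (simp add: algebra_simps sum_distrib_right sum_distrib_left)
    also have "\<dots> \<le> (1 + real CARD('d)) ^ N * (D * decay N z + (\<Sum>i\<in>UNIV. C i * decay N z))"
      by (intro mult_left_mono add_mono sum_mono C D) auto
    also have "\<dots> = ?E * decay N z" by (simp add: sum_distrib_right sum_distrib_left algebra_simps)
    finally show ?thesis by (simp add: decay_def field_simps)
  qed
  moreover have "0 \<le> ?E" using C(1) D(1) by (intro mult_nonneg_nonneg add_nonneg_nonneg sum_nonneg) auto
  ultimately show ?thesis by blast
qed

lemma corr_shift:
  fixes a b :: "real ^ 'd \<Rightarrow> complex"
  assumes a: "a \<in> schwartz" and b: "b \<in> schwartz"
  shows "(LINT y|lborel. a (y - x) * b (y - z) * chr \<eta> y) = chr \<eta> x * corr a b (z - x) \<eta>"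
    and "integrable lborel (\<lambda>y. a (y - x) * b (y - z) * chr \<eta> y)"
proof -
  note [measurable] = a[THEN schwartz_measurable] b[THEN schwartz_measurable]
  have "(LINT y|lborel. a (y - x) * b (y - z) * chr \<eta> y) = complex_of_real (\<bar>1\<bar> ^ DIM(real ^ 'd)) *
     (LINT y|lborel. a ((x + 1 *\<^sub>R y) - x) * b ((x + 1 *\<^sub>R y) - z) * chr \<eta> (x + 1 *\<^sub>R y))"
    by (rule integral_lborel_affine) auto
  also have "\<dots> = (LINT y|lborel. chr \<eta> x * (a y * b (y - (z - x)) * chr \<eta> y))"
    by (simp add: chr_add_right algebra_simps)
  also have "\<dots> = chr \<eta> x * corr a b (z - x) \<eta>" unfolding corr_def by simp
  finally show "(LINT y|lborel. a (y - x) * b (y - z) * chr \<eta> y) = chr \<eta> x * corr a b (z - x) \<eta>" .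
  have "integrable lborel (\<lambda>y. chr \<eta> x * (a (- x + 1 *\<^sub>R y) * b ((- x + 1 *\<^sub>R y) - (z - x)) * chr \<eta> (- x + 1 *\<^sub>R y)))"
    by (rule integrable_mult_right, rule integrable_lborel_affine[OF corr_integrable[OF a b]]) simp
  moreover have "chr \<eta> x * (a (- x + 1 *\<^sub>R y) * b ((- x + 1 *\<^sub>R y) - (z - x)) * chr \<eta> (- x + 1 *\<^sub>R y)) = a (y - x) * b (y - z) * chr \<eta> y" for y
    using chr_add_right[of \<eta> x "y - x"] by (simp add: algebra_simps)
  ultimately show "integrable lborel (\<lambda>y. a (y - x) * b (y - z) * chr \<eta> y)" by (simp only:)
qed

section \<open>Integrals of test functions\<close>

text \<open>A checkable form of continuity of \<open>\<Phi>\<close> as a map into the Schwartz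
  space: joint continuity of all derivatives, and bounds that are locally uniform in the parameter.
  Continuity in the seminorms is deduced from these below.\<close>

definition schwartz_family :: "('t::euclidean_space \<Rightarrow> real ^ 'd \<Rightarrow> complex) \<Rightarrow> bool" where
  "schwartz_family \<Phi> \<longleftrightarrow> (\<forall>t. \<Phi> t \<in> schwartz) \<and>
     (\<forall>\<beta>. continuous_on UNIV (\<lambda>z. partial_derivs \<beta> (\<Phi> (fst z)) (snd z))) \<and>
     (\<forall>k \<beta>. \<exists>M. continuous_on UNIV M \<and> (\<forall>t y. japanese y ^ k * cmod (partial_derivs \<beta> (\<Phi> t) y) \<le> M t))"

lemma tf_family_schwartz_family:
  assumes "tf_family \<Phi>" shows "schwartz_family \<Phi>"
  unfolding schwartz_family_def
proof (intro conjI allI)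
  show "\<Phi> t \<in> schwartz" for t by (rule tf_family_schwartz[OF assms])
  show "continuous_on UNIV (\<lambda>z. partial_derivs \<beta> (\<Phi> (fst z)) (snd z))" for \<beta>
    by (rule tf_family_continuous[OF tf_family_partial_derivs[OF assms]])
  fix k \<beta>
  obtain C N where C: "\<And>t y. japanese y ^ k * cmod (partial_derivs \<beta> (\<Phi> t) y) \<le> C * (japanese (fst t) * japanese (snd t)) ^ N"
    using tf_family_bound[OF tf_family_partial_derivs[OF assms, of \<beta>], of k] by metis
  show "\<exists>M. continuous_on UNIV M \<and> (\<forall>t y. japanese y ^ k * cmod (partial_derivs \<beta> (\<Phi> t) y) \<le> M t)"
    by (intro exI[of _ "\<lambda>t. C * (japanese (fst t) * japanese (snd t)) ^ N"] conjI allI C continuous_intros)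
qed

text \<open>On a large ball in \<open>y\<close> this is uniform continuity on a compact set; outside
  of it the bound with one more power of \<open>japanese y\<close> makes both terms small.\<close>

lemma schwartz_family_equicontinuous:
  assumes \<Phi>: "schwartz_family \<Phi>" and e: "0 < e"
  shows "\<exists>\<delta>>0. \<forall>t\<in>ball t0 \<delta>. \<forall>y. japanese y ^ k * cmod (partial_derivs \<beta> (\<Phi> t) y - partial_derivs \<beta> (\<Phi> t0) y) \<le> e"
proof -
  let ?D = "\<lambda>t. partial_derivs \<beta> (\<Phi> t)"
  obtain M where M: "continuous_on UNIV M" "\<And>t y. japanese y ^ Suc k * cmod (?D t y) \<le> M t"
    using \<Phi> unfolding schwartz_family_def by blast
  have M0: "0 \<le> M t" for t using order_trans[OF _ M(2)[of 0 t]] by simp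
  obtain \<delta>1 where \<delta>1: "\<delta>1 > 0" "\<And>t. dist t t0 < \<delta>1 \<Longrightarrow> dist (M t) (M t0) < 1"
    using M(1) unfolding continuous_on_iff by (metis UNIV_I zero_less_one)
  \<comment> \<open>Near \<open>t0\<close> one has \<open>M t + M t0 \<le> 2 * M t0 + 1\<close>, and
    for \<open>norm y > R\<close> the additional factor \<open>japanese y\<close> exceeds
    \<open>R\<close>.\<close>
  define R where "R = (2 * M t0 + 1) / e"
  define H where "H z = complex_of_real (japanese (snd z) ^ k) * ?D (fst z) (snd z)" for z
  have cH: "continuous_on UNIV H"
    unfolding H_def using \<Phi> unfolding schwartz_family_def by (intro continuous_intros) auto
  have "uniformly_continuous_on (cball t0 1 \<times> cball 0 R) H"
    by (rule compact_uniformly_continuous[OF continuous_on_subset[OF cH]]) (auto intro: compact_Times)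
  then obtain \<delta>2 where \<delta>2: "\<delta>2 > 0" 
    "\<And>z z'. z \<in> cball t0 1 \<times> cball 0 R \<Longrightarrow> z' \<in> cball t0 1 \<times> cball 0 R \<Longrightarrow> dist z' z < \<delta>2 \<Longrightarrow> dist (H z') (H z) < e"
    unfolding uniformly_continuous_on_def using e by metis
  define \<delta> where "\<delta> = min 1 (min \<delta>1 \<delta>2)"
  have "japanese y ^ k * cmod (?D t y - ?D t0 y) \<le> e" if t: "t \<in> ball t0 \<delta>" for t y
  proof (cases "norm y \<le> R")
    case True
    have "dist (H (t, y)) (H (t0, y)) < e"
      using t True by (intro \<delta>2) (auto simp: \<delta>_def dist_commute dist_Pair_Pair)
    then show ?thesis
      by (simp add: H_def dist_norm right_diff_distrib[symmetric] norm_mult norm_power)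
  next
    case False
    have "japanese y * (japanese y ^ k * cmod (?D t y - ?D t0 y)) \<le> japanese y ^ Suc k * (cmod (?D t y) + cmod (?D t0 y))"
      using mult_left_mono[OF norm_triangle_ineq4[of "?D t y" "?D t0 y"], of "japanese y ^ Suc k"] by (simp add: mult.assoc)
    also have "\<dots> \<le> M t + M t0" using M(2)[of y t] M(2)[of y t0] by (simp add: distrib_left)
    also have "\<dots> \<le> 2 * M t0 + 1" using \<delta>1(2)[of t] t by (auto simp: \<delta>_def dist_commute dist_real_def)
    also have "\<dots> = R * e" using e by (simp add: R_def)
    also have "\<dots> \<le> japanese y * e" using False norm_le_japanese[of y] e by (intro mult_right_mono) auto
    finally show ?thesis by simp
  qed
  moreover have "\<delta> > 0" using \<delta>1(1) \<delta>2(1) by (simp add: \<delta>_def)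
  ultimately show ?thesis by blast
qed

lemma schwartz_family_equicontinuous_finite:
  fixes L :: "'d::finite list set"
  assumes \<Phi>: "schwartz_family \<Phi>" and e: "0 < e" and "finite L"
  shows "\<exists>\<delta>>0. \<forall>t\<in>ball t0 \<delta>. \<forall>\<beta>\<in>L. \<forall>y. japanese y ^ k * cmod (partial_derivs \<beta> (\<Phi> t) y - partial_derivs \<beta> (\<Phi> t0) y) \<le> e"
  using \<open>finite L\<close>
proof induction
  case empty
  show ?case by (intro exI[of _ 1]) auto
next
  case (insert \<beta> L)
  then obtain \<delta>1 where \<delta>1: "\<delta>1 > 0" "\<forall>t\<in>ball t0 \<delta>1. \<forall>\<beta>\<in>L. \<forall>y. japanese y ^ k * cmod (partial_derivs \<beta> (\<Phi> t) y - partial_derivs \<beta> (\<Phi> t0) y) \<le> e"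
    by blast
  obtain \<delta>2 where \<delta>2: "\<delta>2 > 0" "\<forall>t\<in>ball t0 \<delta>2. \<forall>y. japanese y ^ k * cmod (partial_derivs \<beta> (\<Phi> t) y - partial_derivs \<beta> (\<Phi> t0) y) \<le> e"
    using schwartz_family_equicontinuous[OF \<Phi> e] by blast
  show ?case using \<delta>1 \<delta>2 by (intro exI[of _ "min \<delta>1 \<delta>2"]) auto
qed

lemma
  assumes "f \<in> tempered_distributions" "\<phi> \<in> schwartz"
  shows tempered_add: "\<psi> \<in> schwartz \<Longrightarrow> f (\<lambda>y. \<phi> y + \<psi> y) = f \<phi> + f \<psi>"
    and tempered_cmult: "f (\<lambda>y. c * \<phi> y) = c * f \<phi>"
proof -
  have "(\<forall>\<phi>. \<phi> \<notin> schwartz \<longrightarrow> f \<phi> = 0) \<and> (\<forall>\<phi>\<in>schwartz. \<forall>\<psi>\<in>schwartz. f (\<lambda>x. \<phi> x + \<psi> x) = f \<phi> + f \<psi>) \<and>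
     (\<forall>c. \<forall>\<phi>\<in>schwartz. f (\<lambda>x. c * \<phi> x) = c * f \<phi>) \<and>
     (\<exists>C k m. \<forall>\<phi>\<in>schwartz. cmod (f \<phi>) \<le> C * (\<Sum>\<beta> | length \<beta> \<le> m. schwartz_seminorm k \<beta> \<phi>))"
    using assms(1) unfolding tempered_distributions_def mem_Collect_eq .
  note * = this[THEN conjunct2, THEN conjunct1] this[THEN conjunct2, THEN conjunct2, THEN conjunct1]
  show "f (\<lambda>y. \<phi> y + \<psi> y) = f \<phi> + f \<psi>" if "\<psi> \<in> schwartz"
    by (rule *(1)[rule_format, OF assms(2) that])
  show "f (\<lambda>y. c * \<phi> y) = c * f \<phi>"
    by (rule *(2)[rule_format, OF assms(2)])
qed

lemma tempered_sum:
  fixes f :: "'d::finite functional"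
  assumes f: "f \<in> tempered_distributions" and \<phi>: "\<And>j. j \<in> J \<Longrightarrow> \<phi> j \<in> schwartz" and "finite J"
  shows "f (\<lambda>y. \<Sum>j\<in>J. c j * \<phi> j y) = (\<Sum>j\<in>J. c j * f (\<phi> j))"
  using \<open>finite J\<close> \<phi>
proof (induction J)
  case empty
  have "(\<lambda>y::real ^ 'd. 0) \<in> schwartz" using schwartz_sum[of "{}" "\<lambda>_ _. 0" "\<lambda>_::nat. 0"] by simp
  from tempered_cmult[OF f this, of 0] show ?case by simp
next
  case (insert j J)
  have "f (\<lambda>y. c j * \<phi> j y + (\<Sum>j\<in>J. c j * \<phi> j y)) = f (\<lambda>y. c j * \<phi> j y) + f (\<lambda>y. \<Sum>j\<in>J. c j * \<phi> j y)"
    using insert.prems by (intro tempered_add[OF f] schwartz_cmult schwartz_sum) auto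
  moreover have "f (\<lambda>y. c j * \<phi> j y) = c j * f (\<phi> j)"
    using insert.prems by (intro tempered_cmult[OF f]) auto
  ultimately show ?case using insert by simp
qed

lemma
  assumes f: "f \<in> tempered_distributions" and \<phi>: "\<phi> \<in> schwartz"
  shows tempered_diff: "\<psi> \<in> schwartz \<Longrightarrow> f (\<lambda>y. \<phi> y - \<psi> y) = f \<phi> - f \<psi>"
    and schwartz_diff: "\<psi> \<in> schwartz \<Longrightarrow> (\<lambda>y. \<phi> y - \<psi> y) \<in> schwartz"
    and partial_derivs_diff: "\<psi> \<in> schwartz \<Longrightarrow> partial_derivs \<beta> (\<lambda>y. \<phi> y - \<psi> y) = (\<lambda>y. partial_derivs \<beta> \<phi> y - partial_derivs \<beta> \<psi> y)"
proof -
  assume \<psi>: "\<psi> \<in> schwartz"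
  let ?\<phi> = "\<lambda>b. if b then \<phi> else \<psi>" and ?c = "\<lambda>b. if b then 1 else - 1 :: complex"
  show "f (\<lambda>y. \<phi> y - \<psi> y) = f \<phi> - f \<psi>"
    using tempered_sum[OF f, of UNIV ?\<phi> ?c] \<phi> \<psi> by (simp add: UNIV_bool add.commute)
  show "(\<lambda>y. \<phi> y - \<psi> y) \<in> schwartz"
    using schwartz_sum[of UNIV ?\<phi> ?c] \<phi> \<psi> by (simp add: UNIV_bool add.commute)
  show "partial_derivs \<beta> (\<lambda>y. \<phi> y - \<psi> y) = (\<lambda>y. partial_derivs \<beta> \<phi> y - partial_derivs \<beta> \<psi> y)"
    using partial_derivs_sum[of UNIV ?\<phi> \<beta> ?c] \<phi> \<psi> by (simp add: UNIV_bool add.commute)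
qed

lemma partial_derivs_cmult: "\<phi> \<in> schwartz \<Longrightarrow> partial_derivs \<beta> (\<lambda>y. c * \<phi> y) = (\<lambda>y. c * partial_derivs \<beta> \<phi> y)"
  using partial_derivs_sum[of "UNIV :: unit set" "\<lambda>_. \<phi>" \<beta> "\<lambda>_. c"] by simp

lemma finite_lists_length_le_UNIV: "finite {\<beta> :: 'd::finite list. length \<beta> \<le> m}"
  using finite_lists_length_le[of "UNIV :: 'd set" m] by simp

text \<open>Arbitrary bounds \<open>B \<beta>\<close> replace the seminorms, so that estimates can
  be inserted without computing suprema.\<close>

lemma tempered_bound:
  fixes f :: "'d::finite functional"
  assumes f: "f \<in> tempered_distributions"
  shows "\<exists>C k m. 0 \<le> C \<and> (\<forall>\<phi> B. \<phi> \<in> schwartz \<longrightarrow>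
      (\<forall>\<beta> y. length \<beta> \<le> m \<longrightarrow> japanese y ^ k * cmod (partial_derivs \<beta> \<phi> y) \<le> B \<beta>) \<longrightarrow>
      cmod (f \<phi>) \<le> C * (\<Sum>\<beta> | length \<beta> \<le> m. B \<beta>))"
proof -
  obtain C k m where *: "\<forall>\<phi>\<in>schwartz. cmod (f \<phi>) \<le> C * (\<Sum>\<beta> | length \<beta> \<le> m. schwartz_seminorm k \<beta> \<phi>)"
    using f unfolding tempered_distributions_def by blast
  show ?thesis
  proof (rule exI[of _ "\<bar>C\<bar>"], rule exI[of _ k], rule exI[of _ m], intro conjI allI impI)
    fix \<phi> :: "real ^ 'd \<Rightarrow> complex" and B assume \<phi>: "\<phi> \<in> schwartz" and B: "\<forall>\<beta> y. length \<beta> \<le> m \<longrightarrow> japanese y ^ k * cmod (partial_derivs \<beta> \<phi> y) \<le> B \<beta>"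
    have "cmod (f \<phi>) \<le> C * (\<Sum>\<beta> | length \<beta> \<le> m. schwartz_seminorm k \<beta> \<phi>)" using * \<phi> by blast
    also have "\<dots> \<le> \<bar>C\<bar> * (\<Sum>\<beta> | length \<beta> \<le> m. schwartz_seminorm k \<beta> \<phi>)"
      by (intro mult_right_mono sum_nonneg schwartz_seminorm_nonneg \<phi>) auto
    also have "\<dots> \<le> \<bar>C\<bar> * (\<Sum>\<beta> | length \<beta> \<le> m. B \<beta>)"
      by (intro mult_left_mono sum_mono schwartz_seminorm_le) (auto simp: B)
    finally show "cmod (f \<phi>) \<le> \<bar>C\<bar> * (\<Sum>\<beta> | length \<beta> \<le> m. B \<beta>)" .
  qed auto
qed

lemma tempered_family_continuous:
  fixes f :: "'d::finite functional" and \<Phi> :: "'t::euclidean_space \<Rightarrow> real ^ 'd \<Rightarrow> complex"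
  assumes f: "f \<in> tempered_distributions" and \<Phi>: "schwartz_family \<Phi>"
  shows "continuous_on UNIV (\<lambda>t. f (\<Phi> t))"
proof -
  obtain C k m where C0: "0 \<le> C" and C1: "\<forall>\<phi> B. \<phi> \<in> schwartz \<longrightarrow>
      (\<forall>\<beta> y. length \<beta> \<le> m \<longrightarrow> japanese y ^ k * cmod (partial_derivs \<beta> \<phi> y) \<le> B \<beta>) \<longrightarrow>
      cmod (f \<phi>) \<le> C * (\<Sum>\<beta> | length \<beta> \<le> m. B \<beta>)"
    using tempered_bound[OF f] by (elim exE conjE) (rule that)
  note C = C0 C1[rule_format]
  let ?n = "real (card {\<beta>::'d list. length \<beta> \<le> m})"
  have S: "\<Phi> t \<in> schwartz" for t using \<Phi> by (simp add: schwartz_family_def)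
  show ?thesis
    unfolding continuous_on_iff
  proof (intro ballI allI impI)
    fix t0 and e :: real assume e: "0 < e"
    define e' where "e' = e / (1 + C * ?n)"
    have pos: "0 < 1 + C * ?n" using C(1) by (simp add: add_pos_nonneg)
    have e': "0 < e'" using e pos by (simp add: e'_def)
    obtain \<delta> where \<delta>: "\<delta> > 0" "\<And>t \<beta> y. t\<in>ball t0 \<delta> \<Longrightarrow> length \<beta> \<le> m \<Longrightarrow> japanese y ^ k * cmod (partial_derivs \<beta> (\<Phi> t) y - partial_derivs \<beta> (\<Phi> t0) y) \<le> e'"
      using schwartz_family_equicontinuous_finite[OF \<Phi> e' finite_lists_length_le_UNIV[of m], of t0 k] by blast
    have "dist (f (\<Phi> t)) (f (\<Phi> t0)) < e" if t: "dist t t0 < \<delta>" for t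
    proof -
      have "cmod (f (\<lambda>y. \<Phi> t y - \<Phi> t0 y)) \<le> C * (\<Sum>\<beta>::'d list | length \<beta> \<le> m. e')"
        using \<delta>(2)[of t] t by (intro C(2)[of _ "\<lambda>_. e'"] schwartz_diff[OF f] S) (auto simp: partial_derivs_diff[OF f S S] dist_commute)
      then have "dist (f (\<Phi> t)) (f (\<Phi> t0)) \<le> C * ?n * e'"
        by (simp add: tempered_diff[OF f S S] dist_norm)
      also have "\<dots> < (1 + C * ?n) * e'" using e' by (simp add: distrib_right)
      also have "\<dots> = e" using pos by (simp add: e'_def)
      finally show ?thesis .
    qed
    then show "\<exists>d>0. \<forall>t\<in>UNIV. dist t t0 < d \<longrightarrow> dist (f (\<Phi> t)) (f (\<Phi> t0)) < e" using \<delta>(1) by blast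
  qed
qed

text \<open>The radius depends on the centre, as the modulus of continuity of the family does.
  Disjointness is obtained by removing from each new ball those already used.\<close>

lemma compact_measurable_partition:
  fixes K :: "'t::euclidean_space set"
  assumes K: "compact K" and \<delta>: "\<And>t. 0 < \<delta> t"
  obtains T A where "finite T" "T \<subseteq> K" "\<And>t. t \<in> T \<Longrightarrow> A t \<in> sets borel" "\<And>t. t \<in> T \<Longrightarrow> A t \<subseteq> ball t (\<delta> t)"
    "disjoint_family_on A T" "(\<Union>t\<in>T. A t) = K"
proof -
  obtain T where T: "finite T" "T \<subseteq> K" "K \<subseteq> (\<Union>t\<in>T. ball t (\<delta> t))"
  proof (rule compactE_image[OF K, of K "\<lambda>t. ball t (\<delta> t)"])
    show "K \<subseteq> (\<Union>t\<in>K. ball t (\<delta> t))" using \<delta> by (auto intro: centre_in_ball[THEN iffD2])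
  qed auto
  have "\<exists>A. (\<forall>t\<in>T. A t \<in> sets borel \<and> A t \<subseteq> ball t (\<delta> t)) \<and> disjoint_family_on A T \<and> (\<Union>t\<in>T. A t) = (\<Union>t\<in>T. ball t (\<delta> t))"
    using T(1)
  proof induction
    case empty show ?case by (simp add: disjoint_family_on_def)
  next
    case (insert s T)
    then obtain A where A: "\<forall>t\<in>T. A t \<in> sets borel \<and> A t \<subseteq> ball t (\<delta> t)" "disjoint_family_on A T" "(\<Union>t\<in>T. A t) = (\<Union>t\<in>T. ball t (\<delta> t))"
      by blast
    let ?A = "A(s := ball s (\<delta> s) - (\<Union>t\<in>T. ball t (\<delta> t)))"
    have "disjoint_family_on ?A (insert s T)"
      unfolding disjoint_family_on_def
    proof (intro ballI impI)
      fix a b assume ab: "a \<in> insert s T" "b \<in> insert s T" "a \<noteq> b"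
      have *: "A c \<inter> (ball s (\<delta> s) - (\<Union>t\<in>T. ball t (\<delta> t))) = {}" if "c \<in> T" for c
        using A(1) that by blast
      show "?A a \<inter> ?A b = {}"
      proof (cases "a = s \<or> b = s")
        case True
        then show ?thesis using ab *[of a] *[of b] by auto
      next
        case False
        then show ?thesis using ab A(2) by (auto simp: disjoint_family_on_def)
      qed
    qed
    moreover have "(\<Union>t\<in>insert s T. ?A t) = (\<Union>t\<in>insert s T. ball t (\<delta> t))"
    proof -
      have "(\<Union>t\<in>T. ?A t) = (\<Union>t\<in>T. A t)" using insert.hyps by (intro SUP_cong) auto
      then show ?thesis using A(3) by auto
    qed
    moreover have "\<forall>t\<in>insert s T. ?A t \<in> sets borel \<and> ?A t \<subseteq> ball t (\<delta> t)"
    proof -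
      have "ball s (\<delta> s) - (\<Union>t\<in>T. ball t (\<delta> t)) \<in> sets borel"
        by (rule sets.Diff; rule borel_open) (auto intro: open_UN)
      then show ?thesis using A(1) insert.hyps by auto
    qed
    ultimately show ?case by blast
  qed
  then obtain A where A: "\<forall>t\<in>T. A t \<in> sets borel \<and> A t \<subseteq> ball t (\<delta> t)" "disjoint_family_on A T" "(\<Union>t\<in>T. A t) = (\<Union>t\<in>T. ball t (\<delta> t))" by blast
  show thesis
  proof (rule that[of T "\<lambda>t. A t \<inter> K"])
    show "disjoint_family_on (\<lambda>t. A t \<inter> K) T" using A(2) unfolding disjoint_family_on_def by blast
    have "(\<Union>t\<in>T. A t \<inter> K) = (\<Union>t\<in>T. A t) \<inter> K" by auto
    also have "\<dots> = K" using T(3) unfolding A(3) by (rule Int_absorb1)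
    finally show "(\<Union>t\<in>T. A t \<inter> K) = K" .
    show "A t \<inter> K \<in> sets borel" if "t \<in> T" for t using A(1) that borel_compact[OF K] by blast
    show "A t \<inter> K \<subseteq> ball t (\<delta> t)" if "t \<in> T" for t using A(1) that by blast
  qed (use T in auto)
qed

text \<open>Oscillation controls the error on \<open>K\<close>, the majorant \<open>N\<close> that
  of the tail. The estimate is used with one and the same partition for the derivatives of
  \<open>\<Phi> t\<close> at a point and for the scalar function
  \<open>f (\<Phi> t)\<close>.\<close>

lemma integral_partition_approx:
  fixes H :: "'t::euclidean_space \<Rightarrow> complex"
  assumes K: "compact K" and T: "finite T" and A: "\<And>t. t \<in> T \<Longrightarrow> A t \<in> sets borel" "disjoint_family_on A T" "(\<Union>t\<in>T. A t) = K"
    and H: "integrable lborel H" and N: "integrable lborel N" "\<And>t. t \<notin> K \<Longrightarrow> cmod (H t) \<le> N t"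
    and e: "\<And>t s. s \<in> T \<Longrightarrow> t \<in> A s \<Longrightarrow> cmod (H t - H s) \<le> e"
  shows "cmod ((LINT t|lborel. H t) - (\<Sum>s\<in>T. complex_of_real (measure lborel (A s)) * H s)) \<le>
    e * measure lborel K + (LINT t|lborel. indicator (- K) t * N t)"
proof -
  have fin: "emeasure lborel (A s) < \<infinity>" if "s \<in> T" for s
    using emeasure_compact_finite[OF K] emeasure_mono[of "A s" K lborel] A(3) that borel_compact[OF K] by (metis UN_upper order_le_less_trans sets_lborel)
  let ?S = "\<lambda>t. \<Sum>s\<in>T. indicator (A s) t *\<^sub>R H s"
  have iS: "integrable lborel ?S"
    using A(1) fin by (intro Bochner_Integration.integrable_sum integrable_scaleR_left integrable_real_indicator) auto
  have intS: "(LINT t|lborel. ?S t) = (\<Sum>s\<in>T. complex_of_real (measure lborel (A s)) * H s)"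
    using A(1) fin by (subst Bochner_Integration.integral_sum) (auto simp: scaleR_conv_of_real)
  have Km: "K \<in> sets lborel" using borel_compact[OF K] by simp
  have iK: "integrable lborel (\<lambda>t. e * indicator K t)"
    using Km emeasure_compact_finite[OF K] by (intro integrable_mult_right integrable_real_indicator) auto
  have iN: "integrable lborel (\<lambda>t. indicator (- K) t * N t)"
    using integrable_mult_indicator[OF _ N(1), of "- K"] borel_compact[OF K] by (simp add: borel_comp)
  have le: "cmod (H t - ?S t) \<le> e * indicator K t + indicator (- K) t * N t" for t
  proof (cases "t \<in> K")
    case True
    then obtain s where s: "s \<in> T" "t \<in> A s" using A(3) by blast
    have "indicator (A r) t *\<^sub>R H r = (if r = s then H s else 0)" if "r \<in> T" for r
      using A(2) s that unfolding disjoint_family_on_def by (auto simp: indicator_def)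
    then have "?S t = H s" using s T by simp
    then show ?thesis using True e[OF s] by simp
  next
    case False
    then have "?S t = 0" using A(3) by (intro sum.neutral) (auto simp: indicator_def)
    then show ?thesis using False N(2) by simp
  qed
  have "cmod ((LINT t|lborel. H t) - (LINT t|lborel. ?S t)) = cmod (LINT t|lborel. H t - ?S t)"
    using H iS by simp
  also have "\<dots> \<le> (LINT t|lborel. cmod (H t - ?S t))" by (rule integral_norm_bound)
  also have "\<dots> \<le> (LINT t|lborel. e * indicator K t + indicator (- K) t * N t)"
    using le by (intro Bochner_Integration.integral_mono integrable_norm Bochner_Integration.integrable_diff Bochner_Integration.integrable_add H iS iK iN)
  also have "\<dots> = e * measure lborel K + (LINT t|lborel. indicator (- K) t * N t)"
    using iK iN Km by simp
  finally show ?thesis unfolding intS .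
qed

lemma integral_outside_cball:
  fixes N :: "'t::euclidean_space \<Rightarrow> real"
  assumes N: "integrable lborel N" and e: "0 < e"
  shows "\<exists>R>0. (LINT t|lborel. indicator (- cball 0 R) t * N t) < e"
proof -
  have [measurable]: "N \<in> borel_measurable borel" using borel_measurable_integrable[OF N] by simp
  have "(\<lambda>n. LINT t|lborel. indicator (- cball 0 (real (Suc n))) t * N t) \<longlonglongrightarrow> (LINT t|(lborel :: 't measure). 0)"
  proof (rule integral_dominated_convergence)
    show "integrable lborel (\<lambda>t. norm (N t))" using N by simp
    show "AE t in lborel. (\<lambda>n. indicator (- cball 0 (real (Suc n))) t * N t) \<longlonglongrightarrow> 0"
    proof (rule AE_I2)
      fix t :: 't
      have "\<forall>\<^sub>F n in sequentially. indicator (- cball 0 (real (Suc n))) t * N t = 0"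
      proof (rule eventually_sequentiallyI[of "nat \<lceil>norm t\<rceil>"])
        fix n assume "nat \<lceil>norm t\<rceil> \<le> n"
        then have "norm t \<le> real (Suc n)" by linarith
        then show "indicator (- cball 0 (real (Suc n))) t * N t = 0" by (simp add: indicator_def)
      qed
      then show "(\<lambda>n. indicator (- cball 0 (real (Suc n))) t * N t) \<longlonglongrightarrow> 0" by (rule tendsto_eventually)
    qed
    show "AE t in lborel. norm (indicator (- cball 0 (real (Suc n))) t * N t) \<le> norm (N t)" for n
      by (auto simp: indicator_def)
  qed auto
  then have "\<forall>\<^sub>F n in sequentially. (LINT t|lborel. indicator (- cball 0 (real (Suc n))) t * N t) < e"
    using e by (intro order_tendstoD(2)) auto
  then obtain n where "(LINT t|lborel. indicator (- cball 0 (real (Suc n))) t * N t) < e"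
    unfolding eventually_sequentially by blast
  then show ?thesis by (intro exI[of _ "real (Suc n)"]) auto
qed

text \<open>Here \<open>\<phi>\<close> is the integral of the family in the pointwise sense only;
  the aim is that every tempered distribution sees it as such. The majorants may depend on the
  seminorm but not on \<open>y\<close>.\<close>

locale integrable_schwartz_family =
  fixes \<Phi> :: "'t::euclidean_space \<Rightarrow> real ^ 'd \<Rightarrow> complex" and \<phi> :: "real ^ 'd \<Rightarrow> complex"
  assumes family: "schwartz_family \<Phi>"
    and dominated: "\<And>k \<beta>. \<exists>M. integrable lborel M \<and> (\<forall>t y. japanese y ^ k * cmod (partial_derivs \<beta> (\<Phi> t) y) \<le> M t)"
    and \<phi>: "\<phi> \<in> schwartz"
    and integral_eq: "\<And>y. \<phi> y = (LINT t|lborel. \<Phi> t y)"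
begin

lemma S: "\<Phi> t \<in> schwartz"
  using family by (simp add: schwartz_family_def)

lemma param_continuous: "continuous_on UNIV (\<lambda>t. partial_derivs \<beta> (\<Phi> t) y)"
proof -
  have "continuous_on UNIV (\<lambda>z. partial_derivs \<beta> (\<Phi> (fst z)) (snd z))" using family by (simp add: schwartz_family_def)
  moreover have "continuous_on UNIV (\<lambda>t::'t. (t, y))" by (intro continuous_intros)
  ultimately show ?thesis using continuous_on_compose2[of UNIV _ UNIV "\<lambda>t. (t, y)"] by fastforce
qed

lemma param_integrable: "integrable lborel (\<lambda>t. partial_derivs \<beta> (\<Phi> t) y)"
proof -
  obtain M where M: "integrable lborel M" "\<And>t y. japanese y ^ 0 * cmod (partial_derivs \<beta> (\<Phi> t) y) \<le> M t" using dominated by metis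
  show ?thesis
  proof (rule Bochner_Integration.integrable_bound[OF M(1)])
    show "AE t in lborel. cmod (partial_derivs \<beta> (\<Phi> t) y) \<le> norm (M t)"
      using M(2)[of y] by (auto intro: order_trans[OF _ abs_ge_self])
    show "(\<lambda>t. partial_derivs \<beta> (\<Phi> t) y) \<in> borel_measurable lborel"
      using borel_measurable_continuous_onI[OF param_continuous] by simp
  qed
qed

text \<open>Differentiation under the integral sign: the bound for the next derivative dominates the
  difference quotients.\<close>

lemma partial_derivs_integral: "partial_derivs \<beta> \<phi> y = (LINT t|lborel. partial_derivs \<beta> (\<Phi> t) y)"
proof (induction \<beta> arbitrary: y)
  case Nil
  show ?case by (simp add: integral_eq)
next
  case (Cons i \<beta>)
  let ?D = "\<lambda>n \<psi>. (\<psi> (y + (1 / real (Suc n)) *\<^sub>R axis i 1) - \<psi> y) * of_nat (Suc n) :: complex"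
  obtain M where M: "integrable lborel M" "\<And>t y. japanese y ^ 0 * cmod (partial_derivs (i # \<beta>) (\<Phi> t) y) \<le> M t" using dominated by metis
  have "(\<lambda>n. LINT t|lborel. ?D n (partial_derivs \<beta> (\<Phi> t))) \<longlonglongrightarrow> (LINT t|lborel. partial_derivs (i # \<beta>) (\<Phi> t) y)"
  proof (rule integral_dominated_convergence[OF _ _ M(1)])
    show "(\<lambda>t. partial_derivs (i # \<beta>) (\<Phi> t) y) \<in> borel_measurable lborel"
      using borel_measurable_continuous_onI[OF param_continuous] by simp
    show "(\<lambda>t. ?D n (partial_derivs \<beta> (\<Phi> t))) \<in> borel_measurable lborel" for n
      using borel_measurable_continuous_onI[OF param_continuous] by simp
    show "AE t in lborel. (\<lambda>n. ?D n (partial_derivs \<beta> (\<Phi> t))) \<longlonglongrightarrow> partial_derivs (i # \<beta>) (\<Phi> t) y"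
      unfolding partial_derivs_Cons
      by (intro AE_I2 partial_deriv_LIMSEQ schwartz_differentiable schwartz_partial_derivs S)
    show "AE t in lborel. norm (?D n (partial_derivs \<beta> (\<Phi> t))) \<le> M t" for n
    proof (rule AE_I2)
      fix t
      let ?\<psi> = "partial_derivs \<beta> (\<Phi> t)"
      have "cmod (?\<psi> (y + (1 / real (Suc n)) *\<^sub>R axis i 1) - ?\<psi> y) \<le> M t * (1 / real (Suc n))"
        using M(2)[of _ t]
        by (intro cmod_diff_le_partial_deriv schwartz_differentiable schwartz_partial_derivs S) (auto simp: partial_derivs_Cons)
      then have "cmod (?\<psi> (y + (1 / real (Suc n)) *\<^sub>R axis i 1) - ?\<psi> y) * real (Suc n) \<le> M t * (1 / real (Suc n)) * real (Suc n)"
        by (intro mult_right_mono) auto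
      then show "norm (?D n ?\<psi>) \<le> M t" by (simp add: norm_mult del: of_nat_Suc)
    qed
  qed
  moreover have "(LINT t|lborel. ?D n (partial_derivs \<beta> (\<Phi> t))) = ?D n (partial_derivs \<beta> \<phi>)" for n
    using param_integrable by (simp add: Cons.IH del: of_nat_Suc)
  moreover have "(\<lambda>n. ?D n (partial_derivs \<beta> \<phi>)) \<longlonglongrightarrow> partial_derivs (i # \<beta>) \<phi> y"
    unfolding partial_derivs_Cons by (intro partial_deriv_LIMSEQ schwartz_differentiable schwartz_partial_derivs \<phi>)
  ultimately show ?case using LIMSEQ_unique by (simp only:)
qed

text \<open>A tempered distribution is only defined on Schwartz functions, so the integral is first
  replaced by a finite sum over a fine partition of a large ball.\<close>

lemma
  assumes f: "f \<in> tempered_distributions"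
  shows tempered_integral: "f \<phi> = (LINT t|lborel. f (\<Phi> t))"
    and tempered_integrable: "integrable lborel (\<lambda>t. f (\<Phi> t))"
proof -
  obtain C k m where C0: "0 \<le> C" and C1: "\<forall>\<phi> B. \<phi> \<in> schwartz \<longrightarrow>
      (\<forall>\<beta> y. length \<beta> \<le> m \<longrightarrow> japanese y ^ k * cmod (partial_derivs \<beta> \<phi> y) \<le> B \<beta>) \<longrightarrow>
      cmod (f \<phi>) \<le> C * (\<Sum>\<beta> | length \<beta> \<le> m. B \<beta>)"
    using tempered_bound[OF f] by (elim exE conjE) (rule that)
  note C = C0 C1[rule_format]
  define L where "L = {\<beta>::'d list. length \<beta> \<le> m}"
  have L: "finite L" unfolding L_def by (rule finite_lists_length_le_UNIV)
  let ?n = "real (card L)"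
  obtain M where M: "\<And>\<beta>. integrable lborel (M \<beta>)" "\<And>\<beta> t y. japanese y ^ k * cmod (partial_derivs \<beta> (\<Phi> t) y) \<le> M \<beta> t"
    using dominated[of k] by metis
  have M0: "0 \<le> M \<beta> t" for \<beta> t using order_trans[OF _ M(2)[of 0 \<beta> t]] by simp
  define N where "N t = (\<Sum>\<beta>\<in>L. M \<beta> t)" for t
  have N: "integrable lborel N" unfolding N_def by (intro Bochner_Integration.integrable_sum M)
  have MN: "M \<beta> t \<le> N t" if "\<beta> \<in> L" for \<beta> t
    unfolding N_def using M0 L that by (intro member_le_sum) auto
  have fN: "cmod (f (\<Phi> t)) \<le> C * N t" for t
    unfolding N_def L_def by (rule C(2)[of _ "\<lambda>\<beta>. M \<beta> t", OF S M(2)])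
  have cf: "continuous_on UNIV (\<lambda>t. f (\<Phi> t))" by (rule tempered_family_continuous[OF f family])
  show fi: "integrable lborel (\<lambda>t. f (\<Phi> t))"
  proof (rule Bochner_Integration.integrable_bound)
    show "integrable lborel (\<lambda>t. C * N t)" using N by simp
    show "(\<lambda>t. f (\<Phi> t)) \<in> borel_measurable lborel" using borel_measurable_continuous_onI[OF cf] by simp
  qed (use fN in \<open>auto intro: order_trans[OF _ abs_ge_self]\<close>)
  define c where "c = C * (2 * ?n) + (C * ?n + C)"
  have c0: "0 \<le> c" using C(1) by (simp add: c_def)
  have "cmod (f \<phi> - (LINT t|lborel. f (\<Phi> t))) \<le> c * e" if e: "0 < e" for e
  proof -
    obtain R where R: "R > 0" "(LINT t|lborel. indicator (- cball 0 R) t * N t) < e"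
      using integral_outside_cball[OF N e] by blast
    define K where "K = cball (0::'t) R"
    have K: "compact K" by (simp add: K_def)
    define e' where "e' = e / (1 + measure lborel K)"
    have pos: "0 < 1 + measure lborel K" by (simp add: add_pos_nonneg)
    have e': "0 < e'" using e pos by (simp add: e'_def)
    have e'K: "e' * measure lborel K \<le> e"
    proof -
      have "e' * measure lborel K \<le> e' * (1 + measure lborel K)" using e' by (intro mult_left_mono) auto
      then show ?thesis using pos by (simp add: e'_def)
    qed
    obtain \<delta> where \<delta>: "\<And>t0. \<delta> t0 > 0" "\<And>t0 t \<beta> y. t\<in>ball t0 (\<delta> t0) \<Longrightarrow> \<beta> \<in> L \<Longrightarrow> japanese y ^ k * cmod (partial_derivs \<beta> (\<Phi> t) y - partial_derivs \<beta> (\<Phi> t0) y) \<le> e'"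
      using schwartz_family_equicontinuous_finite[OF family e' L, of _ k] by metis
    obtain T A where T: "finite T" "T \<subseteq> K" and A: "\<And>t. t \<in> T \<Longrightarrow> A t \<in> sets borel" "\<And>t. t \<in> T \<Longrightarrow> A t \<subseteq> ball t (\<delta> t)"
      "disjoint_family_on A T" "(\<Union>t\<in>T. A t) = K"
      using compact_measurable_partition[of K \<delta>, OF K \<delta>(1)] by blast
    let ?a = "\<lambda>s. complex_of_real (measure lborel (A s))"
    \<comment> \<open>\<open>None\<close> stands for \<open>\<phi>\<close> and \<open>Some s\<close>
      for the summand at \<open>s\<close>. Thus \<open>\<phi>\<close> minus its Riemann sum is a
      single finite linear combination of Schwartz functions.\<close>
    define J where "J = insert None (Some ` T)"
    define \<Psi> where "\<Psi> j = (case j of None \<Rightarrow> \<phi> | Some s \<Rightarrow> \<Phi> s)" for j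
    define a where "a j = (case j of None \<Rightarrow> 1 | Some s \<Rightarrow> - ?a s)" for j
    have \<Psi>: "\<Psi> j \<in> schwartz" for j by (auto simp: \<Psi>_def \<phi> S split: option.split)
    have J: "finite J" using T(1) by (simp add: J_def)
    have sumJ: "(\<Sum>j\<in>J. a j * G (\<Psi> j)) = G \<phi> - (\<Sum>s\<in>T. ?a s * G (\<Phi> s))" for G :: "_ \<Rightarrow> complex"
      using T(1) by (simp add: J_def \<Psi>_def a_def sum.reindex sum_negf)
    define \<psi> where "\<psi> = (\<lambda>y. \<Sum>j\<in>J. a j * \<Psi> j y)"
    have \<psi>: "\<psi> \<in> schwartz" unfolding \<psi>_def by (rule schwartz_sum[OF \<Psi>])
    \<comment> \<open>The seminorms of the difference are at most \<open>2 * e\<close>: one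
      \<open>e\<close> comes from the oscillation over the pieces of \<open>K\<close>, the other one
      from the tail outside \<open>K\<close>.\<close>
    have "cmod (f \<psi>) \<le> C * (\<Sum>\<beta>::'d list | length \<beta> \<le> m. 2 * e)"
    proof (intro C(2)[of _ "\<lambda>_. 2 * e"] \<psi>)
      fix \<beta> :: "'d list" and y assume \<beta>: "length \<beta> \<le> m"
      let ?H = "\<lambda>t. complex_of_real (japanese y ^ k) * partial_derivs \<beta> (\<Phi> t) y"
      have "complex_of_real (japanese y ^ k) * partial_derivs \<beta> \<psi> y = (LINT t|lborel. ?H t) - (\<Sum>s\<in>T. ?a s * ?H s)"
        unfolding \<psi>_def partial_derivs_sum[of J \<Psi> \<beta> a, OF \<Psi>] sumJ[of "\<lambda>\<psi>. partial_derivs \<beta> \<psi> y"] partial_derivs_integral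
        by (simp add: right_diff_distrib sum_distrib_left mult_ac)
      moreover have "cmod ((LINT t|lborel. ?H t) - (\<Sum>s\<in>T. ?a s * ?H s)) \<le> e' * measure lborel K + (LINT t|lborel. indicator (- K) t * N t)"
      proof (rule integral_partition_approx[OF K T(1) A(1,3,4) _ N])
        show "cmod (?H t) \<le> N t" for t
          using M(2)[of y \<beta> t] MN[of \<beta> t] \<beta> by (simp add: norm_mult norm_power L_def)
        show "cmod (?H t - ?H s) \<le> e'" if "s \<in> T" "t \<in> A s" for s t
          using \<delta>(2)[of t s \<beta> y] A(2)[OF that(1)] that \<beta> by (auto simp: norm_mult norm_power L_def right_diff_distrib[symmetric])
      qed (use param_integrable in auto)
      ultimately have "cmod (complex_of_real (japanese y ^ k) * partial_derivs \<beta> \<psi> y) \<le> 2 * e"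
        using e'K R(2) by (simp add: K_def)
      then show "japanese y ^ k * cmod (partial_derivs \<beta> \<psi> y) \<le> 2 * e" by (simp add: norm_mult norm_power)
    qed
    moreover have "f \<psi> = f \<phi> - (\<Sum>s\<in>T. ?a s * f (\<Phi> s))"
      unfolding \<psi>_def tempered_sum[of f J \<Psi> a, OF f \<Psi> J] sumJ ..
    ultimately have 1: "cmod (f \<phi> - (\<Sum>s\<in>T. ?a s * f (\<Phi> s))) \<le> C * (2 * ?n) * e" by (simp add: L_def mult_ac)
    \<comment> \<open>The same points and weights form a Riemann sum for the scalar integral, so
      both sides of the claim are close to one number.\<close>
    have "cmod ((LINT t|lborel. f (\<Phi> t)) - (\<Sum>s\<in>T. ?a s * f (\<Phi> s))) \<le> (C * ?n * e') * measure lborel K + (LINT t|lborel. indicator (- K) t * (C * N t))"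
    proof (rule integral_partition_approx[OF K T(1) A(1,3,4) fi])
      show "integrable lborel (\<lambda>t. C * N t)" using N by simp
      show "cmod (f (\<Phi> t) - f (\<Phi> s)) \<le> C * ?n * e'" if "s \<in> T" "t \<in> A s" for s t
      proof -
        have "cmod (f (\<lambda>y. \<Phi> t y - \<Phi> s y)) \<le> C * (\<Sum>\<beta>::'d list | length \<beta> \<le> m. e')"
          using \<delta>(2)[of t s] A(2)[OF that(1)] that by (intro C(2)[of _ "\<lambda>_. e'"] schwartz_diff[OF f] S) (auto simp: partial_derivs_diff[OF f S S] L_def)
        then show ?thesis by (simp add: tempered_diff[OF f S S] L_def)
      qed
    qed (use fN in auto)
    also have "(LINT t|lborel. indicator (- K) t * (C * N t)) = C * (LINT t|lborel. indicator (- K) t * N t)"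
      by (simp add: mult.left_commute)
    also have "(C * ?n * e') * measure lborel K + \<dots> \<le> (C * ?n) * e + C * e"
      using mult_left_mono[OF e'K, of "C * ?n"] C(1) R(2) by (intro add_mono mult_left_mono) (auto simp: K_def mult.assoc)
    finally have 2: "cmod ((LINT t|lborel. f (\<Phi> t)) - (\<Sum>s\<in>T. ?a s * f (\<Phi> s))) \<le> (C * ?n + C) * e" by (simp add: distrib_right)
    have "cmod (f \<phi> - (LINT t|lborel. f (\<Phi> t))) \<le> C * (2 * ?n) * e + (C * ?n + C) * e"
      by (rule norm_diff_triangle_le[OF 1]) (use 2 in \<open>simp add: norm_minus_commute\<close>)
    then show ?thesis by (simp add: c_def algebra_simps)
  qed
  note * = this
  have "cmod (f \<phi> - (LINT t|lborel. f (\<Phi> t))) \<le> 0"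
  proof (rule field_le_epsilon)
    fix e :: real assume e: "0 < e"
    have "c * (e / (1 + c)) \<le> (1 + c) * (e / (1 + c))" using e c0 by (intro mult_right_mono) auto
    also have "\<dots> = e" using c0 by (simp add: add_pos_nonneg)
    finally show "cmod (f \<phi> - (LINT t|lborel. f (\<Phi> t))) \<le> 0 + e"
      using *[of "e / (1 + c)"] e c0 by (simp add: add_pos_nonneg)
  qed
  then show "f \<phi> = (LINT t|lborel. f (\<Phi> t))" by simp
qed

end

section \<open>The reproducing formula\<close>

text \<open>The test functions at which a distribution is evaluated to form its transform. As it
  acts bilinearly, the frequency enters with the opposite sign and \<open>\<psi>\<close> will be the
  conjugate of the window.\<close>

definition tf_shift :: "(real ^ 'd \<Rightarrow> complex) \<Rightarrow> (real ^ 'd) \<times> (real ^ 'd) \<Rightarrow> real ^ 'd \<Rightarrow> complex" where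
  "tf_shift \<psi> t y = \<psi> (y - fst t) * cnj (chr (snd t) y)"

lemma tf_family_tf_shift: "\<psi> \<in> schwartz \<Longrightarrow> tf_family (tf_shift \<psi>)"
  using tf_family.base[of \<psi>] by (simp add: tf_shift_def[abs_def])

lemma tf_shift_schwartz: "\<psi> \<in> schwartz \<Longrightarrow> tf_shift \<psi> t \<in> schwartz"
  by (rule tf_family_schwartz[OF tf_family_tf_shift])

abbreviation stft_const :: "'d::finite itself \<Rightarrow> complex" where
  "stft_const _ \<equiv> complex_of_real ((2 * pi) powr (- real CARD('d) / 2))"

lemma stft_eq:
  fixes f :: "'d::finite functional"
  shows "stft g f x \<xi> = stft_const TYPE('d) * f (tf_shift (\<lambda>y. cnj (g y)) (x, \<xi>))"
  by (simp add: stft_def pairing_def modulate_def Defs.shift_def tf_shift_def[abs_def] chr_def exp_cnj mult.commute)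

lemma continuous_on_seq:
  fixes f :: "'a::euclidean_space \<Rightarrow> complex"
  assumes "\<And>X a. X \<longlonglongrightarrow> a \<Longrightarrow> (\<lambda>n. f (X n)) \<longlonglongrightarrow> f a"
  shows "continuous_on UNIV f"
  unfolding continuous_on_sequentially using assms by (auto simp: o_def)

lemma corr_continuous:
  fixes a b :: "real ^ 'd \<Rightarrow> complex"
  assumes a: "a \<in> schwartz" and b: "b \<in> schwartz"
  shows "continuous_on UNIV (\<lambda>t. corr a b (fst t) (snd t))"
proof (rule continuous_on_seq)
  fix X and t :: "(real ^ 'd) \<times> (real ^ 'd)" assume X: "X \<longlonglongrightarrow> t"
  let ?M = "Suc CARD('d)"
  obtain C where C: "0 \<le> C" "\<And>z y. cmod (a y * b (y - z)) \<le> C * decay 0 z * decay ?M y" using corr_bound_0[OF a b] by metis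
  show "(\<lambda>n. corr a b (fst (X n)) (snd (X n))) \<longlonglongrightarrow> corr a b (fst t) (snd t)"
    unfolding corr_def
  proof (rule integral_dominated_convergence)
    show "integrable lborel (\<lambda>y :: real ^ 'd. C * decay ?M y)" by simp
    have m: "(\<lambda>y. a y * b (y - z) * chr \<eta> y) \<in> borel_measurable lborel" for z \<eta>
      using corr_integrable[OF a b] by (rule borel_measurable_integrable)
    show "(\<lambda>y. a y * b (y - fst t) * chr (snd t) y) \<in> borel_measurable lborel" by (rule m)
    show "(\<lambda>y. a y * b (y - fst (X n)) * chr (snd (X n)) y) \<in> borel_measurable lborel" for n by (rule m)
    show "AE y in lborel. norm (a y * b (y - fst (X n)) * chr (snd (X n)) y) \<le> C * decay ?M y" for n
      using C(2)[of _ "fst (X n)"] by (auto simp: norm_mult decay_def)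
    show "AE y in lborel. (\<lambda>n. a y * b (y - fst (X n)) * chr (snd (X n)) y) \<longlonglongrightarrow> a y * b (y - fst t) * chr (snd t) y"
    proof (rule AE_I2)
      fix y
      have "continuous_on UNIV (\<lambda>t. a y * b (y - fst t) * chr (snd t) y)"
        by (intro continuous_intros continuous_on_compose2[OF schwartz_continuous_on[OF b, of UNIV]]) auto
      from continuous_on_tendsto_compose[OF this X] 
      show "(\<lambda>n. a y * b (y - fst (X n)) * chr (snd (X n)) y) \<longlonglongrightarrow> a y * b (y - fst t) * chr (snd t) y" by simp
    qed
  qed
qed

lemma integrable_decay_prod:
  assumes M: "CARD('d) < M"
  shows "integrable lborel (\<lambda>t :: (real ^ 'd) \<times> (real ^ 'd). decay M (fst t) * decay M (snd t))"
proof -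
  have "integrable (lborel \<Otimes>\<^sub>M lborel) (\<lambda>t :: (real ^ 'd) \<times> (real ^ 'd). decay M (fst t) * decay M (snd t))"
  proof (rule lborel_pair.Fubini_integrable)
    have "(\<lambda>x :: real ^ 'd. LINT y|lborel. norm (decay M (fst (x, y)) * decay M (snd (x, y :: real ^ 'd)))) = (\<lambda>x. decay M x * (LINT y|lborel. decay M (y :: real ^ 'd)))"
      by (simp add: abs_mult)
    then show "integrable lborel (\<lambda>x :: real ^ 'd. LINT y|lborel. norm (decay M (fst (x, y)) * decay M (snd (x, y :: real ^ 'd))))"
      using M by simp
  qed (use M in auto)
  then show ?thesis by (simp add: lborel_prod)
qed

lemma integral_reflect_complex:
  fixes f :: "'a::euclidean_space \<Rightarrow> complex"
  assumes [measurable]: "f \<in> borel_measurable borel"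
  shows "(LINT x|lborel. f (a - x)) = (LINT x|lborel. f x)"
  using integral_lborel_affine[of f "-1" a] by simp

text \<open>The squared \<open>L\<^sup>2\<close> norm of the window, as a complex number because it
  multiplies values of test functions and distributions.\<close>

definition window_const :: "(real ^ 'd \<Rightarrow> complex) \<Rightarrow> complex" where
  "window_const g = (LINT y|lborel. g y * cnj (g y))"

text \<open>Fourier inversion for \<open>\<phi>\<close> times a translate of \<open>g\<close>, integrated over the translations.\<close>

lemma schwartz_reconstruction:
  fixes \<phi> g :: "real ^ 'd \<Rightarrow> complex"
  assumes \<phi>: "\<phi> \<in> schwartz" and g: "g \<in> schwartz"
    and int: "integrable lborel (\<lambda>t. corr \<phi> g (fst t) (snd t) * tf_shift (\<lambda>y. cnj (g y)) t y)"
  shows "(LINT t|lborel. corr \<phi> g (fst t) (snd t) * tf_shift (\<lambda>y. cnj (g y)) t y) =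
    complex_of_real ((2 * pi) ^ CARD('d)) * window_const g * \<phi> y"
proof -
  let ?h = "\<lambda>x y. \<phi> y * g (y - x)"
  let ?M = "Suc CARD('d)"
  note [measurable] = \<phi>[THEN schwartz_measurable] g[THEN schwartz_measurable]
  have m: "(\<lambda>\<xi>. corr \<phi> g x \<xi>) \<in> borel_measurable borel" for x
  proof (rule borel_measurable_continuous_onI)
    have "continuous_on UNIV (\<lambda>\<xi> :: real ^ 'd. (x, \<xi>))" by (intro continuous_intros)
    from continuous_on_compose2[OF corr_continuous[OF \<phi> g] this]
    show "continuous_on UNIV (\<lambda>\<xi>. corr \<phi> g x \<xi>)" by simp
  qed
  note [measurable] = m
  \<comment> \<open>Inversion in \<open>\<xi>\<close> at a fixed position. The character in
    \<open>corr\<close> has the sign opposite to that in \<open>ft\<close>, hence the reflection of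
    \<open>\<xi>\<close>.\<close>
  have inv: "(LINT \<xi>|lborel. corr \<phi> g x \<xi> * cnj (chr \<xi> y)) = complex_of_real ((2 * pi) ^ CARD('d)) * ?h x y" for x
  proof -
    have ft: "ft (?h x) \<xi> = corr \<phi> g x (0 - \<xi>)" for \<xi>
      by (simp add: ft_def corr_def chr_minus_left)
    obtain C where C: "0 \<le> C" "\<And>z \<eta>. cmod (corr \<phi> g z \<eta>) \<le> C * decay ?M z * decay ?M \<eta>"
      using corr_bound[OF \<phi> g, of ?M] by metis
    obtain B where B: "\<And>z y. cmod (\<phi> y * g (y - z)) \<le> B * decay 0 z * decay ?M y" using corr_bound_0[OF \<phi> g] by metis
    have "(LINT \<xi>|lborel. ft (?h x) \<xi> * chr \<xi> y) = complex_of_real ((2 * pi) ^ DIM(real ^ 'd)) * ?h x y"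
    proof (rule fourier_inversion)
      show "integrable lborel (?h x)" using corr_integrable[OF \<phi> g, of x 0] by (simp add: chr_def)
      show "continuous_on UNIV (?h x)"
        by (intro continuous_intros schwartz_continuous_on \<phi> continuous_on_compose2[OF schwartz_continuous_on[OF g, of UNIV]]) auto
      show "cmod (?h x y) \<le> \<bar>B\<bar>" for y
      proof -
        have "B * decay ?M y \<le> \<bar>B\<bar> * 1" by (intro mult_mono decay_le_1) auto
        then show ?thesis using B[of y x] by (simp add: decay_def)
      qed
      show "integrable lborel (ft (?h x))"
      proof (rule integrable_decay_bound[where a=0 and N="?M" and C="C * decay ?M x"])
        show "ft (?h x) \<in> borel_measurable borel" unfolding ft by measurable
        show "cmod (ft (?h x) \<xi>) \<le> C * decay ?M x * decay ?M (0 + \<xi>)" for \<xi>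
          using C(2)[of x "- \<xi>"] by (simp add: ft)
      qed simp
    qed
    moreover have "(LINT \<xi>|lborel. ft (?h x) \<xi> * chr \<xi> y) = (LINT \<xi>|lborel. corr \<phi> g x (0 - \<xi>) * cnj (chr (0 - \<xi>) y))"
      unfolding ft by (simp add: chr_minus_left)
    moreover have "\<dots> = (LINT \<xi>|lborel. corr \<phi> g x \<xi> * cnj (chr \<xi> y))"
      by (rule integral_reflect_complex[of "\<lambda>\<xi>. corr \<phi> g x \<xi> * cnj (chr \<xi> y)" 0]) measurable
    ultimately show ?thesis by simp
  qed
  have "(LINT t|lborel. corr \<phi> g (fst t) (snd t) * tf_shift (\<lambda>y. cnj (g y)) t y) =
    (LINT x|lborel. LINT \<xi>|lborel. corr \<phi> g x \<xi> * tf_shift (\<lambda>y. cnj (g y)) (x, \<xi>) y)"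
    using lborel_pair.integral_fst'[of "\<lambda>t. corr \<phi> g (fst t) (snd t) * tf_shift (\<lambda>y. cnj (g y)) t y"] int by (simp add: lborel_prod)
  also have "\<dots> = (LINT x|lborel. cnj (g (y - x)) * (complex_of_real ((2 * pi) ^ CARD('d)) * ?h x y))"
    unfolding inv[symmetric] by (simp add: tf_shift_def integral_mult_right_zero[symmetric] mult_ac del: integral_mult_right_zero)
  also have "\<dots> = complex_of_real ((2 * pi) ^ CARD('d)) * \<phi> y * (LINT x|lborel. g (y - x) * cnj (g (y - x)))"
    by (subst integral_mult_right_zero[symmetric]) (simp add: mult_ac)
  also have "(LINT x|lborel. g (y - x) * cnj (g (y - x))) = window_const g"
    unfolding window_const_def by (rule integral_reflect_complex[of "\<lambda>x. g x * cnj (g x)"]) measurable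
  finally show ?thesis by (simp add: mult_ac)
qed

lemma corr_family:
  fixes \<phi> g \<psi> :: "real ^ 'd \<Rightarrow> complex"
  assumes \<phi>: "\<phi> \<in> schwartz" and g: "g \<in> schwartz" and \<psi>: "\<psi> \<in> schwartz"
  defines "\<Phi> \<equiv> (\<lambda>t y. corr \<phi> g (fst t) (snd t) * tf_shift \<psi> t y)"
  shows "schwartz_family \<Phi>"
    and "\<exists>M. integrable lborel M \<and> (\<forall>t y. japanese y ^ k * cmod (partial_derivs \<beta> (\<Phi> t) y) \<le> M t)"
proof -
  note T = tf_family_schwartz_family[OF tf_family_tf_shift[OF \<psi>]]
  have pd: "partial_derivs \<beta> (\<Phi> t) = (\<lambda>y. corr \<phi> g (fst t) (snd t) * partial_derivs \<beta> (tf_shift \<psi> t) y)" for t \<beta>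
    unfolding \<Phi>_def by (rule partial_derivs_cmult[OF tf_shift_schwartz[OF \<psi>]])
  show "schwartz_family \<Phi>"
    unfolding schwartz_family_def
  proof (intro conjI allI)
    show "\<Phi> t \<in> schwartz" for t unfolding \<Phi>_def by (intro schwartz_cmult tf_shift_schwartz \<psi>)
    show "continuous_on UNIV (\<lambda>z. partial_derivs \<beta> (\<Phi> (fst z)) (snd z))" for \<beta>
      unfolding pd using T corr_continuous[OF \<phi> g] 
      by (intro continuous_intros continuous_on_compose2[OF corr_continuous[OF \<phi> g], of UNIV fst]) (auto simp: schwartz_family_def)
    fix k \<beta>
    obtain M where M: "continuous_on UNIV M" "\<And>t y. japanese y ^ k * cmod (partial_derivs \<beta> (tf_shift \<psi> t) y) \<le> M t"
      using T unfolding schwartz_family_def by blast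
    show "\<exists>M. continuous_on UNIV M \<and> (\<forall>t y. japanese y ^ k * cmod (partial_derivs \<beta> (\<Phi> t) y) \<le> M t)"
    proof (intro exI[of _ "\<lambda>t. cmod (corr \<phi> g (fst t) (snd t)) * M t"] conjI allI)
      show "continuous_on UNIV (\<lambda>t. cmod (corr \<phi> g (fst t) (snd t)) * M t)"
        by (intro continuous_intros corr_continuous \<phi> g M)
      show "japanese y ^ k * cmod (partial_derivs \<beta> (\<Phi> t) y) \<le> cmod (corr \<phi> g (fst t) (snd t)) * M t" for t y
        unfolding pd using mult_left_mono[OF M(2)[of y t], of "cmod (corr \<phi> g (fst t) (snd t))"] by (simp add: norm_mult mult_ac)
    qed
  qed
  obtain C N where C: "0 \<le> C" "\<And>t y. japanese y ^ k * cmod (partial_derivs \<beta> (tf_shift \<psi> t) y) \<le> C * (japanese (fst t) * japanese (snd t)) ^ N"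
    using tf_family_bound[OF tf_family_partial_derivs[OF tf_family_tf_shift[OF \<psi>], of \<beta>], of k] by metis
  let ?M = "Suc CARD('d)"
  \<comment> \<open>\<open>N\<close> orders of decay compensate the growth of the shifted windows;
    the remaining \<open>CARD('d) + 1\<close> orders make the majorant integrable.\<close>
  obtain D where D: "0 \<le> D" "\<And>z \<eta>. cmod (corr \<phi> g z \<eta>) \<le> D * decay (N + ?M) z * decay (N + ?M) \<eta>"
    using corr_bound[OF \<phi> g, of "N + ?M"] by metis
  show "\<exists>M. integrable lborel M \<and> (\<forall>t y. japanese y ^ k * cmod (partial_derivs \<beta> (\<Phi> t) y) \<le> M t)"
  proof (intro exI[of _ "\<lambda>t. (D * C) * (decay ?M (fst t) * decay ?M (snd t))"] conjI allI)
    show "integrable lborel (\<lambda>t :: (real ^ 'd) \<times> (real ^ 'd). (D * C) * (decay ?M (fst t) * decay ?M (snd t)))"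
      by (intro integrable_mult_right integrable_decay_prod) simp
    fix t y
    have "japanese y ^ k * cmod (partial_derivs \<beta> (\<Phi> t) y) = cmod (corr \<phi> g (fst t) (snd t)) * (japanese y ^ k * cmod (partial_derivs \<beta> (tf_shift \<psi> t) y))"
      unfolding pd by (simp add: norm_mult mult_ac)
    also have "\<dots> \<le> (D * decay (N + ?M) (fst t) * decay (N + ?M) (snd t)) * (C * (japanese (fst t) * japanese (snd t)) ^ N)"
      using D(1) by (intro mult_mono[OF D(2) C(2)]) auto
    also have "\<dots> = (D * C) * (decay ?M (fst t) * decay ?M (snd t))"
      unfolding decay_add power_mult_distrib by (simp add: decay_def)
    finally show "japanese y ^ k * cmod (partial_derivs \<beta> (\<Phi> t) y) \<le> (D * C) * (decay ?M (fst t) * decay ?M (snd t))" .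
  qed
qed

text \<open>The pointwise reconstruction of \<open>\<phi>\<close>, read through \<open>f\<close>:
  the distribution passes the integral and the scalar \<open>corr\<close> and falls on a shifted
  window, which gives its transform up to a constant.\<close>

proposition
  fixes f :: "'d::finite functional"
  assumes f: "f \<in> tempered_distributions" and \<phi>: "\<phi> \<in> schwartz" and g: "g \<in> schwartz"
  shows reproducing: "complex_of_real ((2 * pi) ^ CARD('d)) * window_const g * f \<phi> =
      (LINT t|lborel. corr \<phi> g (fst t) (snd t) * f (tf_shift (\<lambda>y. cnj (g y)) t))"
    and reproducing_integrable: "integrable lborel (\<lambda>t. corr \<phi> g (fst t) (snd t) * f (tf_shift (\<lambda>y. cnj (g y)) t))"
proof -
  let ?\<psi> = "\<lambda>y. cnj (g y)"
  let ?\<Phi> = "\<lambda>t y. corr \<phi> g (fst t) (snd t) * tf_shift ?\<psi> t y"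
  let ?c = "complex_of_real ((2 * pi) ^ CARD('d)) * window_const g"
  note \<psi> = schwartz_cnj[OF g]
  have int: "integrable lborel (\<lambda>t. ?\<Phi> t y)" for y
  proof -
    obtain M where M: "integrable lborel M" "\<And>t y. japanese y ^ 0 * cmod (partial_derivs [] (?\<Phi> t) y) \<le> M t" using corr_family(2)[OF \<phi> g \<psi>, of 0 "[]"] by metis
    have c: "continuous_on UNIV (\<lambda>z. partial_derivs [] (?\<Phi> (fst z)) (snd z))" using corr_family(1)[OF \<phi> g \<psi>] unfolding schwartz_family_def by blast
    have "continuous_on UNIV (\<lambda>t :: (real ^ 'd) \<times> (real ^ 'd). (t, y))" by (intro continuous_intros)
    from continuous_on_compose2[OF c this] have "continuous_on UNIV (\<lambda>t. ?\<Phi> t y)" by simp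
    then have "(\<lambda>t. ?\<Phi> t y) \<in> borel_measurable lborel" using borel_measurable_continuous_onI by simp
    then show ?thesis
    proof (rule Bochner_Integration.integrable_bound[OF M(1)], intro AE_I2)
      show "cmod (?\<Phi> t y) \<le> norm (M t)" for t
        using M(2)[of y t] abs_ge_self[of "M t"] by simp
    qed
  qed
  interpret integrable_schwartz_family ?\<Phi> "\<lambda>y. ?c * \<phi> y"
  proof
    show "?c * \<phi> y = (LINT t|lborel. ?\<Phi> t y)" for y
      by (rule schwartz_reconstruction[OF \<phi> g int, symmetric])
  qed (use corr_family[OF \<phi> g \<psi>] schwartz_cmult[OF \<phi>] in auto)
  have eq: "f (?\<Phi> t) = corr \<phi> g (fst t) (snd t) * f (tf_shift ?\<psi> t)" for t
    by (rule tempered_cmult[OF f tf_shift_schwartz[OF \<psi>]])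
  show "?c * f \<phi> = (LINT t|lborel. corr \<phi> g (fst t) (snd t) * f (tf_shift ?\<psi> t))"
    using tempered_integral[OF f] tempered_cmult[OF f assms(2), of ?c] by (simp add: eq)
  show "integrable lborel (\<lambda>t. corr \<phi> g (fst t) (snd t) * f (tf_shift ?\<psi> t))"
    using tempered_integrable[OF f] by (simp add: eq)
qed

text \<open>Nonempty open sets are not null sets; for continuous functions this turns bounds almost
  everywhere into bounds everywhere.\<close>

lemma continuous_AE_imp:
  fixes S :: "(real ^ 'd) set"
  assumes S: "open S" and ae: "AE x in lborel. x \<notin> S"
  shows "S = {}"
proof (rule ccontr)
  assume "S \<noteq> {}"
  then have "\<not> negligible S" by (rule open_not_negligible[OF S])
  moreover have "S \<in> null_sets lborel" using ae S by (simp add: AE_iff_null_sets[symmetric])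
  ultimately show False using negligible_iff_null_sets null_sets_completionI by blast
qed

lemma window_const_neq_0:
  fixes g :: "real ^ 'd \<Rightarrow> complex"
  assumes g: "g \<in> schwartz" and y0: "g y0 \<noteq> 0"
  shows "window_const g \<noteq> 0"
proof
  assume 0: "window_const g = 0"
  note [measurable] = schwartz_measurable[OF g]
  have eq: "g y * cnj (g y) = complex_of_real ((cmod (g y))\<^sup>2)" for y
    by (simp only: complex_norm_square)
  have i: "integrable lborel (\<lambda>y. (cmod (g y))\<^sup>2)"
    using integrable_norm[OF corr_integrable[OF g schwartz_cnj[OF g], of 0 0]] by (simp add: norm_mult power2_eq_square)
  from 0 have "(LINT y|lborel. (cmod (g y))\<^sup>2) = 0" unfolding window_const_def eq by (simp only: integral_complex_of_real of_real_eq_0_iff)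
  then have "AE y in lborel. (cmod (g y))\<^sup>2 = 0" using i by (subst (asm) integral_nonneg_eq_0_iff_AE) auto
  then have "AE y in lborel. y \<notin> {y. g y \<noteq> 0}" by simp
  moreover have "open {y. g y \<noteq> 0}"
    using schwartz_continuous_on[OF g, of UNIV] by (intro open_Collect_neq continuous_intros)
  ultimately have "{y. g y \<noteq> 0} = {}" using continuous_AE_imp by blast
  then show False using y0 by blast
qed

lemma stft_continuous:
  fixes f :: "'d::finite functional"
  assumes f: "f \<in> tempered_distributions" and g: "g \<in> schwartz"
  shows "continuous_on UNIV (\<lambda>t. stft g f (fst t) (snd t))"
  unfolding stft_eq using tempered_family_continuous[OF f tf_family_schwartz_family[OF tf_family_tf_shift[OF schwartz_cnj[OF g]]]]
  by (intro continuous_intros) simp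

lemma
  fixes f :: "'d::finite functional"
  assumes f: "f \<in> tempered_distributions" and g: "g \<in> schwartz"
  shows stft_measurable_pair: "(\<lambda>(x, \<xi>). stft g f x \<xi>) \<in> borel_measurable (lborel \<Otimes>\<^sub>M lborel)"
    and stft_measurable_pair': "(\<lambda>(\<xi>, x). stft g f x \<xi>) \<in> borel_measurable (lborel \<Otimes>\<^sub>M lborel)"
    and stft_measurable1: "(\<lambda>x. stft g f x \<xi>) \<in> borel_measurable borel"
    and stft_measurable2: "(\<lambda>\<xi>. stft g f x \<xi>) \<in> borel_measurable borel"
    and stft_continuous1: "continuous_on UNIV (\<lambda>x. stft g f x \<xi>)"
proof -
  have "(\<lambda>t. stft g f (fst t) (snd t)) \<in> borel_measurable borel"
    by (rule borel_measurable_continuous_onI[OF stft_continuous[OF f g]])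
  then have *: "(\<lambda>t. stft g f (fst t) (snd t)) \<in> borel_measurable (lborel \<Otimes>\<^sub>M lborel)"
    by (simp add: lborel_prod)
  then show "(\<lambda>(x, \<xi>). stft g f x \<xi>) \<in> borel_measurable (lborel \<Otimes>\<^sub>M lborel)"
    by (simp add: split_def)
  from measurable_compose[OF measurable_pair_swap' *]
  show "(\<lambda>(\<xi>, x). stft g f x \<xi>) \<in> borel_measurable (lborel \<Otimes>\<^sub>M lborel)" by (simp add: split_def)
  show "(\<lambda>x. stft g f x \<xi>) \<in> borel_measurable borel"
    using measurable_compose[OF measurable_Pair2' *, of \<xi>] by simp
  show "(\<lambda>\<xi>. stft g f x \<xi>) \<in> borel_measurable borel"
    using measurable_compose[OF measurable_Pair1' *, of x] by simp
  have "continuous_on UNIV (\<lambda>x :: real ^ 'd. (x, \<xi>))" by (intro continuous_intros)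
  from continuous_on_compose2[OF stft_continuous[OF f g] this]
  show "continuous_on UNIV (\<lambda>x. stft g f x \<xi>)" by simp
qed

definition stft_sup :: "(real ^ 'd \<Rightarrow> complex) \<Rightarrow> 'd::finite functional \<Rightarrow> real ^ 'd \<Rightarrow> ennreal" where
  "stft_sup g f \<xi> = Lp_norm \<infinity> (\<lambda>x. ennreal (cmod (stft g f x \<xi>)))"

text \<open>The transform is continuous, so its essential supremum over positions bounds it at every
  position.\<close>

lemma
  fixes f :: "'d::finite functional"
  assumes f: "f \<in> tempered_distributions" and g: "g \<in> schwartz"
  shows stft_le_sup: "ennreal (cmod (stft g f x \<xi>)) \<le> stft_sup g f \<xi>"
    and stft_sup_measurable: "stft_sup g f \<in> borel_measurable borel"
    and nn_integral_stft_sup: "(\<integral>\<^sup>+\<xi>. stft_sup g f \<xi> \<partial>lborel) = modulation_enorm g \<infinity> 1 0 f"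
proof -
  note [measurable] = stft_measurable_pair[OF f g] stft_measurable_pair'[OF f g] stft_measurable1[OF f g]
  show "ennreal (cmod (stft g f x \<xi>)) \<le> stft_sup g f \<xi>"
  proof (cases "stft_sup g f \<xi>")
    case (real c)
    have "AE x in lborel. ennreal (cmod (stft g f x \<xi>)) \<le> stft_sup g f \<xi>"
      using esssup_AE[of "\<lambda>x. ennreal (cmod (stft g f x \<xi>))" lborel] by (simp add: stft_sup_def Lp_norm_top)
    then have "AE x in lborel. x \<notin> {x. cmod (stft g f x \<xi>) > c}" using real by (simp add: not_less ennreal_le_iff)
    moreover have "open {x. cmod (stft g f x \<xi>) > c}"
      using stft_continuous1[OF f g, of \<xi>] by (intro open_Collect_less continuous_intros)
    ultimately have "{x. cmod (stft g f x \<xi>) > c} = {}" by (intro continuous_AE_imp)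
    then show ?thesis using real by (auto simp: not_less ennreal_le_iff)
  qed simp
  show "stft_sup g f \<in> borel_measurable borel"
    unfolding stft_sup_def[abs_def]
    using measurable_Lp_norm[of \<infinity> "\<lambda>\<xi> x. ennreal (cmod (stft g f x \<xi>))" lborel] by simp
  show "(\<integral>\<^sup>+\<xi>. stft_sup g f \<xi> \<partial>lborel) = modulation_enorm g \<infinity> 1 0 f"
    by (simp add: modulation_enorm_def Lp_norm_1 stft_sup_def)
qed

section \<open>Mixed norms and the embedding\<close>

lemma nn_integral_reflect:
  fixes f :: "'a::euclidean_space \<Rightarrow> ennreal"
  assumes [measurable]: "f \<in> borel_measurable borel"
  shows "(\<integral>\<^sup>+x. f (a - x) \<partial>lborel) = (\<integral>\<^sup>+x. f x \<partial>lborel)"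
proof -
  have "(\<integral>\<^sup>+x. f x \<partial>lborel) = (\<integral>\<^sup>+x. f x \<partial>density (distr lborel borel (\<lambda>x. a + (-1) *\<^sub>R x)) (\<lambda>_. ennreal (\<bar>-1\<bar> ^ DIM('a))))"
    by (rule arg_cong[where f="\<lambda>M. nn_integral M f", OF lborel_affine]) simp
  also have "\<dots> = (\<integral>\<^sup>+x. f (a - x) \<partial>lborel)"
    by (simp add: density_1 nn_integral_distr)
  finally show ?thesis ..
qed

lemma nn_integral_translate:
  fixes f :: "'a::euclidean_space \<Rightarrow> ennreal"
  assumes [measurable]: "f \<in> borel_measurable borel"
  shows "(\<integral>\<^sup>+x. f (x - a) \<partial>lborel) = (\<integral>\<^sup>+x. f x \<partial>lborel)"
  using nn_integral_reflect[of "\<lambda>x. f (- x)" a] nn_integral_reflect[of f 0] by simp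

lemma ennreal_cmod_integral_le:
  fixes f :: "'a \<Rightarrow> complex"
  shows "ennreal (cmod (LINT x|M. f x)) \<le> (\<integral>\<^sup>+x. ennreal (cmod (f x)) \<partial>M)"
  by (cases "integrable M f") (auto simp: integral_norm_bound_ennreal not_integrable_integral_eq)

text \<open>The modulation norm for arbitrary functions on phase space, so that it can be applied to
  convolutions, which need not be transforms of distributions.\<close>

definition mixed_norm :: "ennreal \<Rightarrow> ennreal \<Rightarrow> real \<Rightarrow> (real ^ 'd \<Rightarrow> real ^ 'd \<Rightarrow> ennreal) \<Rightarrow> ennreal" where
  "mixed_norm p q s F = Lp_norm q (\<lambda>\<xi>. ennreal (japanese \<xi> powr s) * Lp_norm p (\<lambda>x. F x \<xi>))"

definition stft_abs :: "(real ^ 'd \<Rightarrow> complex) \<Rightarrow> 'd::finite functional \<Rightarrow> real ^ 'd \<Rightarrow> real ^ 'd \<Rightarrow> ennreal" where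
  "stft_abs g f x \<xi> = ennreal (cmod (stft g f x \<xi>))"

lemma modulation_enorm_eq: "modulation_enorm g p q s f = mixed_norm p q s (stft_abs g f)"
  by (simp add: modulation_enorm_def mixed_norm_def stft_abs_def)

text \<open>Frequency precedes position because \<open>measurable_Lp_norm\<close> takes its
  parameter as the left component: the inner norm is in \<open>x\<close> and has to be measurable in
  \<open>\<xi>\<close>.\<close>

abbreviation tf_measurable :: "(real ^ 'd \<Rightarrow> real ^ 'd \<Rightarrow> ennreal) \<Rightarrow> bool" where
  "tf_measurable F \<equiv> (\<lambda>(\<xi>, x). F x \<xi>) \<in> borel_measurable (lborel \<Otimes>\<^sub>M lborel)"

lemma stft_abs_measurable:
  "f \<in> tempered_distributions \<Longrightarrow> g \<in> schwartz \<Longrightarrow> tf_measurable (stft_abs g f)"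
  using stft_measurable_pair'[of f g] unfolding stft_abs_def split_def by measurable

lemma tf_measurable_section:
  assumes "tf_measurable F"
  shows "(\<lambda>x. F x \<xi>) \<in> borel_measurable borel"
  using measurable_compose[OF measurable_Pair1' assms, of \<xi>] by simp

lemma mixed_norm_mono:
  assumes p: "1 \<le> p" and q: "1 \<le> q" and F: "tf_measurable F" and G: "tf_measurable G"
    and le: "\<And>x \<xi>. F x \<xi> \<le> G x \<xi>"
  shows "mixed_norm p q s F \<le> mixed_norm p q s G"
proof -
  have [measurable]: "(\<lambda>\<xi>. Lp_norm p (\<lambda>x. F x \<xi>)) \<in> borel_measurable borel" "(\<lambda>\<xi>. Lp_norm p (\<lambda>x. G x \<xi>)) \<in> borel_measurable borel"
    using measurable_Lp_norm[OF p F] measurable_Lp_norm[OF p G] by simp_all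
  show ?thesis
    unfolding mixed_norm_def
    by (intro Lp_norm_mono q mult_left_mono p le tf_measurable_section F G) simp_all
qed

lemma mixed_norm_cmult:
  assumes p: "1 \<le> p" and q: "1 \<le> q" and F: "tf_measurable F"
  shows "mixed_norm p q s (\<lambda>x \<xi>. ennreal c * F x \<xi>) = ennreal c * mixed_norm p q s F"
proof -
  have [measurable]: "(\<lambda>\<xi>. Lp_norm p (\<lambda>x. F x \<xi>)) \<in> borel_measurable borel"
    using measurable_Lp_norm[OF p F] by simp
  show ?thesis
    unfolding mixed_norm_def Lp_norm_cmult[OF p tf_measurable_section[OF F]]
    by (subst Lp_norm_cmult[OF q, symmetric]) (simp_all add: mult_ac)
qed

lemma mixed_norm_triangle:
  assumes p: "1 \<le> p" and q: "1 \<le> q" and F: "tf_measurable F" and G: "tf_measurable G"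
  shows "mixed_norm p q s (\<lambda>x \<xi>. F x \<xi> + G x \<xi>) \<le> mixed_norm p q s F + mixed_norm p q s G"
proof -
  have FG: "tf_measurable (\<lambda>x \<xi>. F x \<xi> + G x \<xi>)"
    using borel_measurable_add[OF F G] by (simp add: split_def)
  have [measurable]: "(\<lambda>\<xi>. Lp_norm p (\<lambda>x. F x \<xi>)) \<in> borel_measurable borel" "(\<lambda>\<xi>. Lp_norm p (\<lambda>x. G x \<xi>)) \<in> borel_measurable borel"
    "(\<lambda>\<xi>. Lp_norm p (\<lambda>x. F x \<xi> + G x \<xi>)) \<in> borel_measurable borel"
    using measurable_Lp_norm[OF p F] measurable_Lp_norm[OF p G] measurable_Lp_norm[OF p FG] by simp_all
  have "mixed_norm p q s (\<lambda>x \<xi>. F x \<xi> + G x \<xi>) \<le> 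
    Lp_norm q (\<lambda>\<xi>. ennreal (japanese \<xi> powr s) * Lp_norm p (\<lambda>x. F x \<xi>) + ennreal (japanese \<xi> powr s) * Lp_norm p (\<lambda>x. G x \<xi>))"
    unfolding mixed_norm_def distrib_left[symmetric]
    by (intro Lp_norm_mono q mult_left_mono Lp_norm_triangle p tf_measurable_section F G) simp_all
  also have "\<dots> \<le> mixed_norm p q s F + mixed_norm p q s G"
    unfolding mixed_norm_def by (rule Lp_norm_triangle[OF q]) simp_all
  finally show ?thesis .
qed

definition decay_int :: "'d::finite itself \<Rightarrow> nat \<Rightarrow> ennreal" where
  "decay_int _ N = (\<integral>\<^sup>+x. ennreal (decay N (x :: real ^ 'd)) \<partial>lborel)"

lemma decay_int_finite: "CARD('d) < N \<Longrightarrow> decay_int TYPE('d::finite) N < \<infinity>"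
  unfolding decay_int_def by (rule nn_integral_decay)

definition tf_conv :: "nat \<Rightarrow> (real ^ 'd \<Rightarrow> real ^ 'd \<Rightarrow> ennreal) \<Rightarrow> real ^ 'd \<Rightarrow> real ^ 'd \<Rightarrow> ennreal" where
  "tf_conv N F x \<xi> = (\<integral>\<^sup>+\<xi>'. (\<integral>\<^sup>+x'. ennreal (decay N (\<xi> - \<xi>')) * (ennreal (decay N (x - x')) * F x' \<xi>') \<partial>lborel) \<partial>lborel)"

lemma tf_conv_measurable:
  fixes F :: "real ^ 'd \<Rightarrow> real ^ 'd \<Rightarrow> ennreal"
  assumes F: "tf_measurable F"
  shows "tf_measurable (tf_conv N F)"
proof -
  note [measurable] = F
  have [measurable]: "(\<lambda>y. F (h y) (k y)) \<in> borel_measurable M" if [measurable]: "h \<in> borel_measurable M" "k \<in> borel_measurable M" for h k and M :: "'x measure"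
  proof -
    have "(\<lambda>y. (k y, h y)) \<in> M \<rightarrow>\<^sub>M (lborel \<Otimes>\<^sub>M lborel)" by measurable
    from measurable_compose[OF this F] show ?thesis by simp
  qed
  show ?thesis unfolding tf_conv_def split_def by measurable
qed

lemma Lp_norm_tf_conv:
  fixes F :: "real ^ 'd \<Rightarrow> real ^ 'd \<Rightarrow> ennreal"
  assumes p: "1 \<le> p" and F: "tf_measurable F"
  shows "Lp_norm p (\<lambda>x. tf_conv N F x \<xi>) \<le> 
    decay_int TYPE('d) N * (\<integral>\<^sup>+\<xi>'. ennreal (decay N (\<xi> - \<xi>')) * Lp_norm p (\<lambda>x. F x \<xi>') \<partial>lborel)"
proof -
  have Fm: "(\<lambda>y. F (h y) (k y)) \<in> borel_measurable M" if [measurable]: "h \<in> borel_measurable M" "k \<in> borel_measurable M" for h k and M :: "'x measure"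
  proof -
    have "(\<lambda>y. (k y, h y)) \<in> M \<rightarrow>\<^sub>M (lborel \<Otimes>\<^sub>M lborel)" by measurable
    from measurable_compose[OF this F] show ?thesis by simp
  qed
  note [measurable] = Fm tf_measurable_section[OF F]
  have [measurable]: "(\<lambda>\<xi>. Lp_norm p (\<lambda>x. F x \<xi>)) \<in> borel_measurable borel"
    using measurable_Lp_norm[OF p F] by simp
  have eq: "tf_conv N F x \<xi> = (\<integral>\<^sup>+\<xi>'. ennreal (decay N (\<xi> - \<xi>')) * (\<integral>\<^sup>+x'. ennreal (decay N (x - x')) * F x' \<xi>' \<partial>lborel) \<partial>lborel)" for x
    unfolding tf_conv_def by (intro nn_integral_cong nn_integral_cmult) measurable
  have "Lp_norm p (\<lambda>x. tf_conv N F x \<xi>) \<le> (\<integral>\<^sup>+\<xi>'. Lp_norm p (\<lambda>x. ennreal (decay N (\<xi> - \<xi>')) * (\<integral>\<^sup>+x'. ennreal (decay N (x - x')) * F x' \<xi>' \<partial>lborel)) \<partial>lborel)"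
    unfolding eq by (rule Minkowski_integral[OF p lborel.sigma_finite_measure_axioms]) measurable
  also have "\<dots> \<le> (\<integral>\<^sup>+\<xi>'. decay_int TYPE('d) N * (ennreal (decay N (\<xi> - \<xi>')) * Lp_norm p (\<lambda>x. F x \<xi>')) \<partial>lborel)"
  proof (rule nn_integral_mono)
    fix \<xi>' :: "real ^ 'd"
    have "Lp_norm p (\<lambda>x. ennreal (decay N (\<xi> - \<xi>')) * (\<integral>\<^sup>+x'. ennreal (decay N (x - x')) * F x' \<xi>' \<partial>lborel))
       = ennreal (decay N (\<xi> - \<xi>')) * Lp_norm p (\<lambda>x. \<integral>\<^sup>+x'. ennreal (decay N (x - x')) * F x' \<xi>' \<partial>lborel)"
      by (rule Lp_norm_cmult[OF p]) measurable
    also have "\<dots> \<le> ennreal (decay N (\<xi> - \<xi>')) * (decay_int TYPE('d) N * Lp_norm p (\<lambda>x. F x \<xi>'))"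
      unfolding decay_int_def by (intro mult_left_mono Young_Lp[OF p]) auto
    finally show "Lp_norm p (\<lambda>x. ennreal (decay N (\<xi> - \<xi>')) * (\<integral>\<^sup>+x'. ennreal (decay N (x - x')) * F x' \<xi>' \<partial>lborel))
      \<le> decay_int TYPE('d) N * (ennreal (decay N (\<xi> - \<xi>')) * Lp_norm p (\<lambda>x. F x \<xi>'))" by (simp add: mult_ac)
  qed
  also have "\<dots> = decay_int TYPE('d) N * (\<integral>\<^sup>+\<xi>'. ennreal (decay N (\<xi> - \<xi>')) * Lp_norm p (\<lambda>x. F x \<xi>') \<partial>lborel)"
    by (rule nn_integral_cmult) measurable
  finally show ?thesis .
qed

text \<open>\<open>K\<close> orders of decay absorb the weight \<open>japanese r powr s\<close>;
  \<open>M\<close> orders survive.\<close>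

lemma decay_japanese_powr_le:
  assumes s: "0 \<le> s" "s \<le> real K" and C: "japanese \<xi> powr s \<le> C * japanese r powr s * B" "0 \<le> C" "0 \<le> B"
  shows "japanese \<xi> powr s * decay (M + K) r \<le> C * decay M r * B"
proof -
  have "japanese r powr s \<le> japanese r ^ K"
    using powr_mono[OF s(2) japanese_ge_1[of r]] by (simp add: powr_realpow)
  then have *: "japanese r powr s * decay (M + K) r \<le> decay M r"
    by (simp add: decay_def divide_simps power_add mult.commute)
  have "japanese \<xi> powr s * decay (M + K) r \<le> (C * japanese r powr s * B) * decay (M + K) r"
    by (intro mult_right_mono C) auto
  also have "\<dots> = (C * B) * (japanese r powr s * decay (M + K) r)" by (simp add: mult_ac)
  also have "\<dots> \<le> (C * B) * decay M r" using C by (intro mult_left_mono *) auto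
  finally show ?thesis by (simp add: mult_ac)
qed

text \<open>Young's inequality in both variables. Peetre's inequality passes the weight to the inner
  frequency at the cost of \<open>K\<close> orders of decay, which leaves order \<open>M\<close> for
  the convolution in frequency.\<close>

lemma mixed_norm_tf_conv:
  fixes F :: "real ^ 'd \<Rightarrow> real ^ 'd \<Rightarrow> ennreal"
  assumes p: "1 \<le> p" and q: "1 \<le> q" and F: "tf_measurable F" and s: "0 \<le> s" "s \<le> real K"
  shows "mixed_norm p q s (tf_conv (M + K) F) \<le> 
    ennreal (2 powr s) * (decay_int TYPE('d) (M + K) * decay_int TYPE('d) M) * mixed_norm p q s F"
proof -
  let ?A = "\<lambda>\<xi>. Lp_norm p (\<lambda>x. F x \<xi>)" and ?N = "M + K" and ?I = "decay_int TYPE('d) (M + K)"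
  have A[measurable]: "?A \<in> borel_measurable borel" using measurable_Lp_norm[OF p F] by simp
  have [measurable]: "(\<lambda>\<xi>. Lp_norm p (\<lambda>x. tf_conv (M + K) F x \<xi>)) \<in> borel_measurable borel"
    using measurable_Lp_norm[OF p tf_conv_measurable[OF F]] by simp
  have le: "ennreal (japanese \<xi> powr s) * Lp_norm p (\<lambda>x. tf_conv ?N F x \<xi>) \<le>
     (?I * ennreal (2 powr s)) * (\<integral>\<^sup>+\<xi>'. ennreal (decay M (\<xi> - \<xi>')) * (ennreal (japanese \<xi>' powr s) * ?A \<xi>') \<partial>lborel)" for \<xi>
  proof -
    have *: "japanese \<xi> powr s * decay ?N (\<xi> - \<xi>') \<le> 2 powr s * decay M (\<xi> - \<xi>') * japanese \<xi>' powr s" for \<xi>'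
    proof (rule decay_japanese_powr_le[OF s])
      have "japanese \<xi> powr s \<le> (2 * japanese (\<xi> - \<xi>') * japanese \<xi>') powr s"
        using japanese_add_le_mult[of "\<xi> - \<xi>'" \<xi>'] s by (intro powr_mono2) auto
      then show "japanese \<xi> powr s \<le> 2 powr s * japanese (\<xi> - \<xi>') powr s * japanese \<xi>' powr s"
        by (simp add: powr_mult)
    qed auto
    have "ennreal (japanese \<xi> powr s) * Lp_norm p (\<lambda>x. tf_conv ?N F x \<xi>) \<le> 
       ennreal (japanese \<xi> powr s) * (?I * (\<integral>\<^sup>+\<xi>'. ennreal (decay ?N (\<xi> - \<xi>')) * ?A \<xi>' \<partial>lborel))"
      by (intro mult_left_mono Lp_norm_tf_conv p F) simp
    also have "\<dots> = ?I * (\<integral>\<^sup>+\<xi>'. ennreal (japanese \<xi> powr s) * (ennreal (decay ?N (\<xi> - \<xi>')) * ?A \<xi>') \<partial>lborel)"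
      by (subst nn_integral_cmult) (auto simp: mult_ac)
    also have "\<dots> \<le> ?I * (\<integral>\<^sup>+\<xi>'. ennreal (2 powr s) * (ennreal (decay M (\<xi> - \<xi>')) * (ennreal (japanese \<xi>' powr s) * ?A \<xi>')) \<partial>lborel)"
    proof (intro mult_left_mono nn_integral_mono)
      fix \<xi>'
      have "ennreal (japanese \<xi> powr s) * ennreal (decay ?N (\<xi> - \<xi>')) \<le> ennreal (2 powr s) * ennreal (decay M (\<xi> - \<xi>')) * ennreal (japanese \<xi>' powr s)"
        using *[of \<xi>'] by (simp add: ennreal_mult[symmetric] ennreal_leI del: ennreal_mult)
      from mult_right_mono[OF this, of "?A \<xi>'"]
      show "ennreal (japanese \<xi> powr s) * (ennreal (decay ?N (\<xi> - \<xi>')) * ?A \<xi>') \<le> ennreal (2 powr s) * (ennreal (decay M (\<xi> - \<xi>')) * (ennreal (japanese \<xi>' powr s) * ?A \<xi>'))"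
        by (simp add: mult_ac)
    qed simp
    also have "\<dots> = (?I * ennreal (2 powr s)) * (\<integral>\<^sup>+\<xi>'. ennreal (decay M (\<xi> - \<xi>')) * (ennreal (japanese \<xi>' powr s) * ?A \<xi>') \<partial>lborel)"
      by (subst nn_integral_cmult) (auto simp: mult_ac)
    finally show ?thesis .
  qed
  have "mixed_norm p q s (tf_conv ?N F) \<le> Lp_norm q (\<lambda>\<xi>. (?I * ennreal (2 powr s)) * (\<integral>\<^sup>+\<xi>'. ennreal (decay M (\<xi> - \<xi>')) * (ennreal (japanese \<xi>' powr s) * ?A \<xi>') \<partial>lborel))"
    unfolding mixed_norm_def by (rule Lp_norm_mono[OF q _ _ le]) measurable
  also have "\<dots> \<le> (?I * ennreal (2 powr s)) * Lp_norm q (\<lambda>\<xi>. \<integral>\<^sup>+\<xi>'. ennreal (decay M (\<xi> - \<xi>')) * (ennreal (japanese \<xi>' powr s) * ?A \<xi>') \<partial>lborel)"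
    by (rule Lp_norm_cmult_le[OF q]) measurable
  also have "\<dots> \<le> (?I * ennreal (2 powr s)) * (decay_int TYPE('d) M * mixed_norm p q s F)"
    unfolding mixed_norm_def decay_int_def by (intro mult_left_mono Young_Lp[OF q]) auto
  finally show ?thesis by (simp add: mult_ac)
qed

text \<open>The reproducing formula for a time-frequency shift of \<open>\<psi>\<close>. Up to a
  phase \<open>corr\<close> then depends on differences only, so its decay is a convolution kernel.
  If \<open>\<psi>\<close> is the conjugate of \<open>g\<close>, the transform is bounded by a
  convolution of itself; \<open>\<psi> = g\<close> is the case to which complex conjugation
  leads.\<close>

lemma change_of_window:
  fixes g \<psi> :: "real ^ 'd \<Rightarrow> complex"
  assumes g: "g \<in> schwartz" and g0: "g y0 \<noteq> 0" and \<psi>: "\<psi> \<in> schwartz"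
  shows "\<exists>C\<ge>0. \<forall>f\<in>tempered_distributions. \<forall>x \<xi>.
    ennreal (cmod (f (tf_shift \<psi> (x, \<xi>)))) \<le> ennreal C * tf_conv N (stft_abs g f) x \<xi>"
proof -
  let ?c = "complex_of_real ((2 * pi) ^ CARD('d)) * window_const g"
  let ?\<gamma> = "cmod (stft_const TYPE('d))"
  have c: "cmod ?c > 0" using window_const_neq_0[OF g g0] by (simp add: norm_mult norm_power)
  obtain D where D: "0 \<le> D" "\<And>z \<eta>. cmod (corr \<psi> g z \<eta>) \<le> D * decay N z * decay N \<eta>"
    using corr_bound[OF \<psi> g, of N] by metis
  define C where "C = D / (cmod ?c * ?\<gamma>)"
  have C0: "0 \<le> C" using D(1) by (simp add: C_def)
  have "ennreal (cmod (f (tf_shift \<psi> (x, \<xi>)))) \<le> ennreal C * tf_conv N (stft_abs g f) x \<xi>" if f: "f \<in> tempered_distributions" for f x \<xi>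
  proof -
    let ?\<phi> = "tf_shift \<psi> (x, \<xi>)"
    note [measurable] = stft_measurable_pair[OF f g] stft_measurable1[OF f g]
    have corr: "cmod (corr ?\<phi> g x' \<xi>') \<le> D * decay N (x - x') * decay N (\<xi> - \<xi>')" for x' \<xi>'
    proof -
      have "corr ?\<phi> g x' \<xi>' = (LINT y|lborel. \<psi> (y - x) * g (y - x') * chr (\<xi>' - \<xi>) y)"
        unfolding corr_def tf_shift_def using chr_add_left[of \<xi>' "- \<xi>"] by (simp add: chr_minus_left mult_ac)
      also have "\<dots> = chr (\<xi>' - \<xi>) x * corr \<psi> g (x' - x) (\<xi>' - \<xi>)" by (rule corr_shift(1)[OF \<psi> g])
      finally show ?thesis using D(2)[of "x' - x" "\<xi>' - \<xi>"] by (simp add: norm_mult decay_diff_commute)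
    qed
    have F: "cmod (f (tf_shift (\<lambda>y. cnj (g y)) (x', \<xi>'))) = cmod (stft g f x' \<xi>') / ?\<gamma>" for x' \<xi>'
      unfolding stft_eq by (simp add: norm_mult)
    have "ennreal (cmod (?c * f ?\<phi>)) \<le> (\<integral>\<^sup>+t. ennreal (cmod (corr ?\<phi> g (fst t) (snd t) * f (tf_shift (\<lambda>y. cnj (g y)) t))) \<partial>lborel)"
      unfolding reproducing[OF f tf_shift_schwartz[OF \<psi>] g] by (rule ennreal_cmod_integral_le)
    also have "\<dots> \<le> (\<integral>\<^sup>+t. ennreal (D / ?\<gamma>) * (ennreal (decay N (\<xi> - snd t)) * (ennreal (decay N (x - fst t)) * ennreal (cmod (stft g f (fst t) (snd t))))) \<partial>lborel)"
    proof (rule nn_integral_mono)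
      fix t
      have "cmod (corr ?\<phi> g (fst t) (snd t) * f (tf_shift (\<lambda>y. cnj (g y)) t)) = cmod (corr ?\<phi> g (fst t) (snd t)) * (cmod (stft g f (fst t) (snd t)) / ?\<gamma>)"
        using F[of "fst t" "snd t"] by (simp add: norm_mult)
      also have "\<dots> \<le> D * decay N (x - fst t) * decay N (\<xi> - snd t) * (cmod (stft g f (fst t) (snd t)) / ?\<gamma>)"
        by (intro mult_right_mono corr) simp
      also have "\<dots> = (D / ?\<gamma>) * (decay N (\<xi> - snd t) * (decay N (x - fst t) * cmod (stft g f (fst t) (snd t))))" by (simp add: field_simps)
      finally show "ennreal (cmod (corr ?\<phi> g (fst t) (snd t) * f (tf_shift (\<lambda>y. cnj (g y)) t))) \<le> ennreal (D / ?\<gamma>) * (ennreal (decay N (\<xi> - snd t)) * (ennreal (decay N (x - fst t)) * ennreal (cmod (stft g f (fst t) (snd t)))))"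
        using D(1) by (simp add: ennreal_mult[symmetric] ennreal_leI del: ennreal_mult)
    qed
    also have "\<dots> = (\<integral>\<^sup>+t. ennreal (D / ?\<gamma>) * (ennreal (decay N (\<xi> - snd t)) * (ennreal (decay N (x - fst t)) * ennreal (cmod (stft g f (fst t) (snd t))))) \<partial>(lborel \<Otimes>\<^sub>M lborel))"
      by (simp add: lborel_prod)
    also have "\<dots> = ennreal (D / ?\<gamma>) * (\<integral>\<^sup>+t. ennreal (decay N (\<xi> - snd t)) * (ennreal (decay N (x - fst t)) * ennreal (cmod (stft g f (fst t) (snd t)))) \<partial>(lborel \<Otimes>\<^sub>M lborel))"
      using stft_measurable_pair[OF f g] by (intro nn_integral_cmult) (simp add: split_def)
    also have "(\<integral>\<^sup>+t. ennreal (decay N (\<xi> - snd t)) * (ennreal (decay N (x - fst t)) * ennreal (cmod (stft g f (fst t) (snd t)))) \<partial>(lborel \<Otimes>\<^sub>M lborel)) = tf_conv N (stft_abs g f) x \<xi>"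
      unfolding tf_conv_def stft_abs_def
      using stft_measurable_pair[OF f g]
      by (subst lborel_pair.nn_integral_snd[symmetric]) (simp_all add: split_def)
    finally have "ennreal (1 / cmod ?c) * ennreal (cmod (?c * f ?\<phi>)) \<le> ennreal (1 / cmod ?c) * (ennreal (D / ?\<gamma>) * tf_conv N (stft_abs g f) x \<xi>)"
      by (intro mult_left_mono) auto
    moreover have "ennreal (1 / cmod ?c) * ennreal (cmod (?c * f ?\<phi>)) = ennreal (cmod (f ?\<phi>))"
    proof -
      have "ennreal (1 / r) * ennreal (r * a) = ennreal a" if "0 < r" "0 \<le> a" for r a
        using that by (simp add: ennreal_mult[symmetric] del: ennreal_mult)
      from this[OF c norm_ge_zero] show ?thesis by (simp only: norm_mult[of ?c])
    qed
    moreover have "ennreal (1 / cmod ?c) * (ennreal (D / ?\<gamma>) * tf_conv N (stft_abs g f) x \<xi>) = ennreal C * tf_conv N (stft_abs g f) x \<xi>"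
      using D(1) c by (simp only: mult.assoc[symmetric] ennreal_mult'[symmetric] C_def divide_nonneg_nonneg norm_ge_zero zero_le_one) (simp add: mult.commute)
    ultimately show ?thesis by simp
  qed
  then show ?thesis using C0 by blast
qed

lemma stft_le_tf_conv:
  fixes g :: "real ^ 'd \<Rightarrow> complex"
  assumes g: "g \<in> schwartz" and g0: "g y0 \<noteq> 0"
  shows "\<exists>C\<ge>0. \<forall>f\<in>tempered_distributions. \<forall>x \<xi>. stft_abs g f x \<xi> \<le> ennreal C * tf_conv N (stft_abs g f) x \<xi>"
proof -
  obtain C where C: "C \<ge> 0" "\<And>f x \<xi>. f \<in> tempered_distributions \<Longrightarrow> ennreal (cmod (f (tf_shift (\<lambda>y. cnj (g y)) (x, \<xi>)))) \<le> ennreal C * tf_conv N (stft_abs g f) x \<xi>"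
    using change_of_window[OF g g0 schwartz_cnj[OF g], of N] by metis
  let ?\<gamma> = "cmod (stft_const TYPE('d))"
  have "stft_abs g f x \<xi> \<le> ennreal (?\<gamma> * C) * tf_conv N (stft_abs g f) x \<xi>" if f: "f \<in> tempered_distributions" for f x \<xi>
  proof -
    have "stft_abs g f x \<xi> = ennreal ?\<gamma> * ennreal (cmod (f (tf_shift (\<lambda>y. cnj (g y)) (x, \<xi>))))"
      unfolding stft_abs_def stft_eq norm_mult by (rule ennreal_mult) auto
    also have "\<dots> \<le> ennreal ?\<gamma> * (ennreal C * tf_conv N (stft_abs g f) x \<xi>)"
      by (intro mult_left_mono C f) auto
    finally show ?thesis using C(1) by (simp add: ennreal_mult mult.assoc)
  qed
  then show ?thesis using C(1) by (intro exI[of _ "?\<gamma> * C"]) auto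
qed

proposition modulation_embedding:
  fixes g :: "real ^ 'd \<Rightarrow> complex"
  assumes g: "g \<in> schwartz" and g0: "g y0 \<noteq> 0" and p: "1 \<le> p" and q: "1 \<le> q" and s: "0 \<le> s"
    and qs: "(q > 1 \<and> s > real CARD('d) * (1 - enn2real (1 / q))) \<or> q = 1"
  shows "\<exists>C\<ge>0. \<forall>f\<in>tempered_distributions. modulation_enorm g \<infinity> 1 0 f \<le> ennreal C * modulation_enorm g p q s f"
proof -
  let ?N = "Suc CARD('d)"
  obtain C1 where C1: "C1 \<ge> 0" "\<And>f x \<xi>. f\<in>tempered_distributions \<Longrightarrow> stft_abs g f x \<xi> \<le> ennreal C1 * tf_conv ?N (stft_abs g f) x \<xi>"
    using stft_le_tf_conv[OF g g0, of ?N] by metis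
  obtain C2 where C2: "C2 \<ge> 0" "\<And>h. h \<in> borel_measurable borel \<Longrightarrow> (\<integral>\<^sup>+x. ennreal (decay ?N (x :: real ^ 'd)) * h x \<partial>lborel) \<le> ennreal C2 * Lp_norm p h"
    using integral_weight_le_Lp[OF p, of "\<lambda>x :: real ^ 'd. ennreal (decay ?N x)"] nn_integral_decay[of ?N, where 'd='d] decay_le_1 by auto
  obtain C3 where C3: "C3 \<ge> 0" "\<And>A. A \<in> borel_measurable borel \<Longrightarrow> (\<integral>\<^sup>+\<xi>. A \<xi> \<partial>lborel) \<le> ennreal C3 * Lp_norm q (\<lambda>\<xi> :: real ^ 'd. ennreal (japanese \<xi> powr s) * A \<xi>)"
    using integral_le_weighted_Lp[OF q s qs] by blast
  obtain W where W: "decay_int TYPE('d) ?N = ennreal W" "0 \<le> W"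
    using decay_int_finite[of ?N, where 'd='d] by (cases "decay_int TYPE('d) ?N") auto
  have "modulation_enorm g \<infinity> 1 0 f \<le> ennreal (C1 * C2 * W * C3) * modulation_enorm g p q s f" if f: "f \<in> tempered_distributions" for f
  proof -
    define A where "A \<xi> = Lp_norm p (\<lambda>x. stft_abs g f x \<xi>)" for \<xi>
    have F: "tf_measurable (stft_abs g f)" by (rule stft_abs_measurable[OF f g])
    note [measurable] = tf_measurable_section[OF F]
    have [measurable]: "A \<in> borel_measurable borel" unfolding A_def[abs_def] using measurable_Lp_norm[OF p F] by simp
    have "stft_abs g f x \<xi> \<le> ennreal (C1 * C2) * (\<integral>\<^sup>+\<xi>'. ennreal (decay ?N (\<xi> - \<xi>')) * A \<xi>' \<partial>lborel)" for x \<xi>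
    proof -
      \<comment> \<open>Reflection and translation centre the kernel at the origin without
        increasing the norm, so that one constant \<open>C2\<close> serves all
        \<open>x\<close>.\<close>
      have *: "(\<integral>\<^sup>+x'. ennreal (decay ?N (x - x')) * stft_abs g f x' \<xi>' \<partial>lborel) \<le> ennreal C2 * A \<xi>'" for \<xi>'
      proof -
        have "(\<integral>\<^sup>+x'. ennreal (decay ?N (x - x')) * stft_abs g f x' \<xi>' \<partial>lborel) = (\<integral>\<^sup>+t. ennreal (decay ?N (x - (x - t))) * stft_abs g f (x - t) \<xi>' \<partial>lborel)"
          by (rule nn_integral_reflect[of "\<lambda>x'. ennreal (decay ?N (x - x')) * stft_abs g f x' \<xi>'" x, symmetric]) measurable
        also have "\<dots> \<le> ennreal C2 * Lp_norm p (\<lambda>t. stft_abs g f (x - t) \<xi>')"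
          using C2(2)[of "\<lambda>t. stft_abs g f (x - t) \<xi>'"] by simp
        also have "\<dots> \<le> ennreal C2 * A \<xi>'"
          unfolding A_def using Lp_norm_affine_le[OF p, of "\<lambda>t. stft_abs g f t \<xi>'" "-1" x] by (intro mult_left_mono) auto
        finally show ?thesis .
      qed
      have "ennreal (decay ?N (\<xi> - \<xi>')) * (\<integral>\<^sup>+x'. ennreal (decay ?N (x - x')) * stft_abs g f x' \<xi>' \<partial>lborel) \<le> ennreal C2 * (ennreal (decay ?N (\<xi> - \<xi>')) * A \<xi>')" for \<xi>'
        using mult_left_mono[OF *[of \<xi>'], of "ennreal (decay ?N (\<xi> - \<xi>'))"] by (simp add: mult.left_commute)
      then have "tf_conv ?N (stft_abs g f) x \<xi> \<le> (\<integral>\<^sup>+\<xi>'. ennreal C2 * (ennreal (decay ?N (\<xi> - \<xi>')) * A \<xi>') \<partial>lborel)"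
        unfolding tf_conv_def by (intro nn_integral_mono) (simp add: nn_integral_cmult)
      also have "\<dots> = ennreal C2 * (\<integral>\<^sup>+\<xi>'. ennreal (decay ?N (\<xi> - \<xi>')) * A \<xi>' \<partial>lborel)"
        by (rule nn_integral_cmult) measurable
      finally have "ennreal C1 * tf_conv ?N (stft_abs g f) x \<xi> \<le> ennreal C1 * \<dots>" by (intro mult_left_mono) auto
      with C1(2)[OF f, of x \<xi>] C1(1) C2(1) show ?thesis by (simp add: ennreal_mult mult.assoc)
    qed
    then have "stft_sup g f \<xi> \<le> ennreal (C1 * C2) * (\<integral>\<^sup>+\<xi>'. ennreal (decay ?N (\<xi> - \<xi>')) * A \<xi>' \<partial>lborel)" for \<xi>
      unfolding stft_sup_def using tf_measurable_section[OF F, of \<xi>] by (simp add: Lp_norm_top_le_iff stft_abs_def)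
    then have "modulation_enorm g \<infinity> 1 0 f \<le> (\<integral>\<^sup>+\<xi>. ennreal (C1 * C2) * (\<integral>\<^sup>+\<xi>'. ennreal (decay ?N (\<xi> - \<xi>')) * A \<xi>' \<partial>lborel) \<partial>lborel)"
      unfolding nn_integral_stft_sup[OF f g, symmetric] by (intro nn_integral_mono)
    also have "\<dots> = ennreal (C1 * C2) * (\<integral>\<^sup>+\<xi>. (\<integral>\<^sup>+\<xi>'. ennreal (decay ?N (\<xi> - \<xi>')) * A \<xi>' \<partial>lborel) \<partial>lborel)"
      by (rule nn_integral_cmult) measurable
    \<comment> \<open>After the exchange the kernel is integrated over \<open>\<xi>\<close> and
      gives \<open>W\<close>, whatever \<open>\<xi>'\<close> is.\<close>
    also have "(\<integral>\<^sup>+\<xi>. (\<integral>\<^sup>+\<xi>'. ennreal (decay ?N (\<xi> - \<xi>')) * A \<xi>' \<partial>lborel) \<partial>lborel) = (\<integral>\<^sup>+\<xi>'. (\<integral>\<^sup>+\<xi>. ennreal (decay ?N (\<xi> - \<xi>')) * A \<xi>' \<partial>lborel) \<partial>lborel)"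
      by (rule lborel_pair.Fubini'[symmetric]) measurable
    also have "\<dots> = (\<integral>\<^sup>+\<xi>'. ennreal W * A \<xi>' \<partial>lborel)"
      using nn_integral_translate[of "\<lambda>\<xi> :: real ^ 'd. ennreal (decay ?N \<xi>)"] W by (simp add: nn_integral_multc decay_int_def)
    also have "\<dots> = ennreal W * (\<integral>\<^sup>+\<xi>. A \<xi> \<partial>lborel)" by (rule nn_integral_cmult) measurable
    also have "(\<integral>\<^sup>+\<xi>. A \<xi> \<partial>lborel) \<le> ennreal C3 * modulation_enorm g p q s f"
      unfolding modulation_enorm_eq mixed_norm_def using C3(2)[of A] by (simp add: A_def)
    finally show ?thesis using C1(1) C2(1) C3(1) W(2) by (simp add: ennreal_mult mult.assoc mult_left_mono)
  qed
  then show ?thesis using C1(1) C2(1) C3(1) W(2) by (intro exI[of _ "C1 * C2 * W * C3"]) auto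
qed

section \<open>Representation by bounded continuous functions\<close>

lemma apply_bcontfun_measurable [measurable]:
  "apply_bcontfun (u :: 'a::euclidean_space \<Rightarrow>\<^sub>C complex) \<in> borel_measurable borel"
  by (intro borel_measurable_continuous_onI continuous_on_apply_bcontfun continuous_on_id)

lemma bcontfun_mult_schwartz_integrable:
  fixes u :: "(real ^ 'd) \<Rightarrow>\<^sub>C complex"
  assumes \<phi>: "\<phi> \<in> schwartz"
  shows "integrable lborel (\<lambda>y. apply_bcontfun u y * \<phi> y)"
proof -
  note [measurable] = schwartz_measurable[OF \<phi>]
  obtain C where C: "0 \<le> C" "\<And>y. cmod (\<phi> y) \<le> C * decay (Suc CARD('d)) y" using schwartz_decay[OF \<phi>] by metis
  show ?thesis
  proof (rule integrable_decay_bound[where a=0 and N="Suc CARD('d)" and C="norm u * C"])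
    show "cmod (apply_bcontfun u y * \<phi> y) \<le> norm u * C * decay (Suc CARD('d)) (0 + y)" for y
      using mult_mono[OF norm_bounded[of u y] C(2)[of y]] by (simp add: norm_mult mult.assoc)
  qed auto
qed

lemma distr_of_fun_apply:
  "\<phi> \<in> schwartz \<Longrightarrow> distr_of_fun u \<phi> = (LINT y|lborel. u y * \<phi> y)"
  by (simp add: distr_of_fun_def)

lemma distr_of_fun_tempered:
  fixes u :: "(real ^ 'd) \<Rightarrow>\<^sub>C complex"
  shows "distr_of_fun (apply_bcontfun u) \<in> tempered_distributions"
proof -
  let ?f = "distr_of_fun (apply_bcontfun u)" and ?M = "Suc CARD('d)"
  have "?f \<phi> = 0" if "\<phi> \<notin> schwartz" for \<phi> using that by (simp add: distr_of_fun_def)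
  moreover have "?f (\<lambda>x. \<phi> x + \<psi> x) = ?f \<phi> + ?f \<psi>" if "\<phi> \<in> schwartz" "\<psi> \<in> schwartz" for \<phi> \<psi>
    using bcontfun_mult_schwartz_integrable[OF that(1), of u] bcontfun_mult_schwartz_integrable[OF that(2), of u]
    by (simp add: distr_of_fun_apply that schwartz_add distrib_left)
  moreover have "?f (\<lambda>x. c * \<phi> x) = c * ?f \<phi>" if "\<phi> \<in> schwartz" for c \<phi>
    using that by (simp add: distr_of_fun_apply schwartz_cmult mult.left_commute)
  moreover have "cmod (?f \<phi>) \<le> (norm u * (LINT y|lborel. decay ?M (y :: real ^ 'd))) * (\<Sum>\<beta> | length \<beta> \<le> 0. schwartz_seminorm ?M \<beta> \<phi>)"
    if \<phi>: "\<phi> \<in> schwartz" for \<phi>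
  proof -
    have "cmod (?f \<phi>) \<le> (LINT y|lborel. cmod (apply_bcontfun u y * \<phi> y))"
      unfolding distr_of_fun_apply[OF \<phi>] by (rule integral_norm_bound)
    also have "\<dots> \<le> (LINT y|lborel. norm u * schwartz_seminorm ?M [] \<phi> * decay ?M (y :: real ^ 'd))"
    proof (rule Bochner_Integration.integral_mono)
      show "integrable lborel (\<lambda>y. cmod (apply_bcontfun u y * \<phi> y))"
        by (rule integrable_norm[OF bcontfun_mult_schwartz_integrable[OF \<phi>]])
      fix y :: "real ^ 'd"
      have "cmod (\<phi> y) \<le> schwartz_seminorm ?M [] \<phi> * decay ?M y"
        using schwartz_seminorm_ge[OF \<phi>, of y ?M "[]"] by (simp add: decay_def field_simps)
      then show "cmod (apply_bcontfun u y * \<phi> y) \<le> norm u * schwartz_seminorm ?M [] \<phi> * decay ?M y"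
        using mult_mono[OF norm_bounded[of u y]] by (simp add: norm_mult mult.assoc)
    qed simp
    finally show ?thesis by (simp add: mult_ac)
  qed
  ultimately show ?thesis unfolding tempered_distributions_def by blast
qed

lemma stft_distr_of_fun:
  fixes u :: "real ^ 'd \<Rightarrow> complex"
  assumes g: "g \<in> schwartz"
  shows "stft g (distr_of_fun u) x \<xi> = stft_const TYPE('d) * ft (\<lambda>y. u y * cnj (g (y - x))) \<xi>"
  by (simp add: stft_eq distr_of_fun_apply tf_shift_schwartz schwartz_cnj g ft_def tf_shift_def mult.assoc)

lemma shift_schwartz: "\<psi> \<in> schwartz \<Longrightarrow> (\<lambda>y. \<psi> (y - x)) \<in> schwartz"
  using tf_shift_schwartz[of \<psi> "(x, 0)"] by (simp add: tf_shift_def[abs_def] chr_def)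

text \<open>For fixed \<open>z\<close> the transform is, up to a constant, the Fourier transform of
  \<open>u\<close> times the conjugate window at \<open>z\<close>, so integrability in frequency
  allows to recover the windowed function. Uniqueness and the product estimate both rest on
  this.\<close>

lemma bcontfun_window_inversion:
  fixes u :: "(real ^ 'd) \<Rightarrow>\<^sub>C complex"
  assumes g: "g \<in> schwartz"
    and ih: "integrable lborel (\<lambda>\<xi>. stft g (distr_of_fun (apply_bcontfun u)) z \<xi>)"
  shows "(LINT \<xi>|lborel. stft g (distr_of_fun (apply_bcontfun u)) z \<xi> * chr \<xi> y) =
    stft_const TYPE('d) * complex_of_real ((2 * pi) ^ CARD('d)) * (apply_bcontfun u y * cnj (g (y - z)))"
proof -
  let ?h = "\<lambda>y. apply_bcontfun u y * cnj (g (y - z))" and ?\<gamma> = "stft_const TYPE('d)"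
  note \<psi> = shift_schwartz[OF schwartz_cnj[OF g], of z]
  obtain C where C: "0 \<le> C" "\<And>y. cmod (cnj (g (y - z))) \<le> C * decay 0 y" using schwartz_decay[OF \<psi>] by metis
  have "integrable lborel (\<lambda>\<xi>. (1 / ?\<gamma>) * stft g (distr_of_fun (apply_bcontfun u)) z \<xi>)" using ih by (rule integrable_mult_right)
  then have i: "integrable lborel (ft ?h)" unfolding stft_distr_of_fun[OF g] by simp
  have "(LINT \<xi>|lborel. ft ?h \<xi> * chr \<xi> y) = complex_of_real ((2 * pi) ^ DIM(real ^ 'd)) * ?h y"
  proof (rule fourier_inversion[OF bcontfun_mult_schwartz_integrable[OF \<psi>] _ _ i])
    show "continuous_on UNIV ?h" by (intro continuous_on_mult schwartz_continuous_on[OF \<psi>] continuous_on_apply_bcontfun continuous_on_id)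
    show "cmod (?h y) \<le> norm u * C" for y
      using mult_mono[OF norm_bounded[of u y] C(2)[of y]] by (simp add: norm_mult decay_def)
  qed
  then have "?\<gamma> * (LINT \<xi>|lborel. ft ?h \<xi> * chr \<xi> y) = ?\<gamma> * (complex_of_real ((2 * pi) ^ DIM(real ^ 'd)) * ?h y)" by simp
  then show ?thesis unfolding stft_distr_of_fun[OF g] by (simp add: mult.assoc)
qed

text \<open>The transform of the difference vanishes and is thus trivially integrable, so by
  inversion all windowed versions of the difference vanish.\<close>

lemma distr_of_fun_inject:
  fixes g :: "real ^ 'd \<Rightarrow> complex" and u v :: "(real ^ 'd) \<Rightarrow>\<^sub>C complex"
  assumes g: "g \<in> schwartz" and g0: "g y0 \<noteq> 0"
    and eq: "distr_of_fun (apply_bcontfun u) = distr_of_fun (apply_bcontfun v)"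
  shows "u = v"
proof -
  let ?w = "u - v"
  have "distr_of_fun (apply_bcontfun ?w) \<phi> = 0" for \<phi>
  proof (cases "\<phi> \<in> schwartz")
    case True
    have "distr_of_fun (apply_bcontfun ?w) \<phi> = distr_of_fun (apply_bcontfun u) \<phi> - distr_of_fun (apply_bcontfun v) \<phi>"
      using bcontfun_mult_schwartz_integrable[OF True, of u] bcontfun_mult_schwartz_integrable[OF True, of v]
      by (simp add: distr_of_fun_apply True left_diff_distrib)
    then show ?thesis by (simp add: eq)
  qed (simp add: distr_of_fun_def)
  then have 0: "stft g (distr_of_fun (apply_bcontfun ?w)) z \<xi> = 0" for z \<xi> by (simp add: stft_eq)
  \<comment> \<open>The window is placed so that its nonzero value \<open>g y0\<close> sits at
    \<open>y\<close>.\<close>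
  have "apply_bcontfun ?w y * cnj (g (y - (y - y0))) = 0" for y
    using bcontfun_window_inversion[OF g, of ?w "y - y0" y] unfolding 0 by simp
  then have "apply_bcontfun ?w y = 0" for y using g0 by simp
  then show ?thesis by (intro bcontfun_eqI) simp
qed

lemma nn_integral_schwartz_finite:
  fixes g :: "real ^ 'd \<Rightarrow> complex"
  assumes g: "g \<in> schwartz"
  shows "(\<integral>\<^sup>+y. ennreal (cmod (g y)) \<partial>lborel) < \<infinity>"
proof -
  obtain C where C: "0 \<le> C" "\<And>y. cmod (g y) \<le> C * decay (Suc CARD('d)) y" using schwartz_decay[OF g] by metis
  have "(\<integral>\<^sup>+y. ennreal (cmod (g y)) \<partial>lborel) \<le> (\<integral>\<^sup>+y. ennreal C * ennreal (decay (Suc CARD('d)) (y :: real ^ 'd)) \<partial>lborel)"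
    using C by (intro nn_integral_mono) (simp add: ennreal_mult[symmetric] ennreal_leI del: ennreal_mult)
  also have "\<dots> < \<infinity>" using nn_integral_decay[of "Suc CARD('d)", where 'd='d] by (simp add: nn_integral_cmult ennreal_mult_less_top)
  finally show ?thesis .
qed

text \<open>The representing function is read off the reproducing formula:
  \<open>u z = c \<integral>\<integral> V f (x, \<xi>) g (z - x) e\<^sup>i\<^sup>\<xi>\<^sup>z\<close>, where the absolute convergence of the
  integral is exactly what the norm of \<open>M\<^sub>\<infinity>\<^sub>,\<^sub>1\<close> provides.\<close>

proposition bounded_continuous_representation:
  fixes g :: "real ^ 'd \<Rightarrow> complex"
  assumes g: "g \<in> schwartz" and g0: "g y0 \<noteq> 0"
  shows "\<exists>C\<ge>0. \<forall>f\<in>tempered_distributions. modulation_enorm g \<infinity> 1 0 f < \<infinity> \<longrightarrow>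
    (\<exists>u :: (real ^ 'd) \<Rightarrow>\<^sub>C complex. distr_of_fun (apply_bcontfun u) = f \<and> norm u \<le> C * enn2real (modulation_enorm g \<infinity> 1 0 f))"
proof -
  let ?c = "complex_of_real ((2 * pi) ^ CARD('d)) * window_const g"
  let ?\<gamma> = "cmod (stft_const TYPE('d))"
  have c: "?c \<noteq> 0" using window_const_neq_0[OF g g0] by simp
  obtain I where I: "(\<integral>\<^sup>+y. ennreal (cmod (g y)) \<partial>lborel) = ennreal I" "0 \<le> I"
    using nn_integral_schwartz_finite[OF g] by (cases "\<integral>\<^sup>+y. ennreal (cmod (g y)) \<partial>lborel") auto
  define C where "C = I / (?\<gamma> * cmod ?c)"
  have C0: "0 \<le> C" using I by (simp add: C_def)
  note [measurable] = schwartz_measurable[OF g]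
  have "\<exists>u :: (real ^ 'd) \<Rightarrow>\<^sub>C complex. distr_of_fun (apply_bcontfun u) = f \<and> norm u \<le> C * enn2real (modulation_enorm g \<infinity> 1 0 f)"
    if f: "f \<in> tempered_distributions" and fin: "modulation_enorm g \<infinity> 1 0 f < \<infinity>" for f
  proof -
    define F where "F t = f (tf_shift (\<lambda>y. cnj (g y)) t)" for t
    \<comment> \<open>The integrand of the formula for \<open>u z\<close>, where \<open>F\<close> is
      the transform up to its normalisation.\<close>
    define H where "H z t = F t * (g (z - fst t) * chr (snd t) z)" for z t
    obtain A where A: "modulation_enorm g \<infinity> 1 0 f = ennreal A" "0 \<le> A" using fin by (cases "modulation_enorm g \<infinity> 1 0 f") auto
    have sup_int: "(\<integral>\<^sup>+\<xi>. stft_sup g f \<xi> \<partial>lborel) = ennreal A" by (simp only: nn_integral_stft_sup[OF f g] A)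
    note [measurable] = stft_sup_measurable[OF f g]
    have F: "ennreal (cmod (F t)) \<le> ennreal (1 / ?\<gamma>) * stft_sup g f (snd t)" for t
    proof -
      have "cmod (F t) = (1 / ?\<gamma>) * cmod (stft g f (fst t) (snd t))" unfolding stft_eq F_def by (simp add: norm_mult)
      then have "ennreal (cmod (F t)) = ennreal (1 / ?\<gamma>) * ennreal (cmod (stft g f (fst t) (snd t)))" by (simp only: ennreal_mult' norm_ge_zero divide_nonneg_nonneg zero_le_one)
      also have "\<dots> \<le> ennreal (1 / ?\<gamma>) * stft_sup g f (snd t)" by (intro mult_left_mono stft_le_sup f g) auto
      finally show ?thesis .
    qed
    have cF: "continuous_on UNIV F" unfolding F_def
      by (rule tempered_family_continuous[OF f tf_family_schwartz_family[OF tf_family_tf_shift[OF schwartz_cnj[OF g]]]])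
    have cH: "continuous_on UNIV (\<lambda>w. H (fst w) (snd w))"
      unfolding H_def
      by (intro continuous_intros continuous_on_compose2[OF cF, of UNIV snd] continuous_on_compose2[OF schwartz_continuous_on[OF g, of UNIV]]) auto
    have Hm: "(\<lambda>w. H (fst w) (snd w)) \<in> borel_measurable (lborel \<Otimes>\<^sub>M lborel)"
      using borel_measurable_continuous_onI[OF cH] by (simp add: lborel_prod)
    have Hm1[measurable]: "H z \<in> borel_measurable borel" for z
      using measurable_compose[OF measurable_Pair1' Hm, of z] by simp
    \<comment> \<open>Uniform in \<open>z\<close>: once the transform is replaced by its supremum
      over positions, the integral over \<open>x\<close> is the \<open>L\<^sup>1\<close> norm
      \<open>I\<close> of the window and that over \<open>\<xi>\<close> is the norm \<open>A\<close>
      of \<open>f\<close>.\<close>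
    have bound: "(\<integral>\<^sup>+t. ennreal (cmod (H z t)) \<partial>lborel) \<le> ennreal (I * A / ?\<gamma>)" for z
    proof -
      have "(\<integral>\<^sup>+t. ennreal (cmod (H z t)) \<partial>lborel) \<le> (\<integral>\<^sup>+t. (ennreal (1 / ?\<gamma>) * stft_sup g f (snd t)) * ennreal (cmod (g (z - fst t))) \<partial>(lborel \<Otimes>\<^sub>M lborel))"
        unfolding lborel_prod
      proof (rule nn_integral_mono)
        fix t
        have "ennreal (cmod (H z t)) = ennreal (cmod (F t)) * ennreal (cmod (g (z - fst t)))"
          unfolding H_def by (simp add: norm_mult ennreal_mult)
        also have "\<dots> \<le> (ennreal (1 / ?\<gamma>) * stft_sup g f (snd t)) * ennreal (cmod (g (z - fst t)))"
          by (intro mult_right_mono F) simp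
        finally show "ennreal (cmod (H z t)) \<le> (ennreal (1 / ?\<gamma>) * stft_sup g f (snd t)) * ennreal (cmod (g (z - fst t)))" .
      qed
      also have "\<dots> = (\<integral>\<^sup>+\<xi>. (\<integral>\<^sup>+x. (ennreal (1 / ?\<gamma>) * stft_sup g f \<xi>) * ennreal (cmod (g (z - x))) \<partial>lborel) \<partial>lborel)"
        by (subst lborel_pair.nn_integral_snd[symmetric]) simp_all
      also have "\<dots> = (\<integral>\<^sup>+\<xi>. (ennreal (1 / ?\<gamma>) * stft_sup g f \<xi>) * ennreal I \<partial>lborel)"
        using nn_integral_reflect[of "\<lambda>x. ennreal (cmod (g x))" z] by (simp add: nn_integral_cmult I)
      also have "\<dots> = ennreal (1 / ?\<gamma>) * ennreal A * ennreal I"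
        by (subst nn_integral_multc, simp, subst nn_integral_cmult) (simp_all add: sup_int)
      also have "\<dots> = ennreal (I * A / ?\<gamma>)" using I A by (simp add: ennreal_mult[symmetric] mult_ac del: ennreal_mult)
      finally show ?thesis .
    qed
    have Hi: "integrable lborel (H z)" for z
      using bound[of z] by (intro integrableI_bounded) (auto simp: le_less_trans)
    define u where "u z = (LINT t|lborel. H z t) / ?c" for z
    have ub: "cmod (u z) \<le> C * A" for z
    proof -
      have "ennreal (cmod (LINT t|lborel. H z t)) \<le> ennreal (I * A / ?\<gamma>)"
        using ennreal_cmod_integral_le[of lborel "H z"] bound[of z] by (rule order_trans)
      then have "cmod (LINT t|lborel. H z t) \<le> I * A / ?\<gamma>" using I A by (simp add: ennreal_le_iff)
      then have "cmod (LINT t|lborel. H z t) / cmod ?c \<le> I * A / ?\<gamma> / cmod ?c" by (rule divide_right_mono) simp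
      then show ?thesis unfolding u_def norm_divide C_def by (simp add: mult_ac)
    qed
    have uc: "continuous_on UNIV u"
    proof (rule continuous_on_seq)
      fix X and z :: "real ^ 'd" assume X: "X \<longlonglongrightarrow> z"
      let ?M = "Suc CARD('d)"
      obtain G where G: "0 \<le> G" "\<And>y. cmod (g y) \<le> G * decay ?M y" using schwartz_decay[OF g] by metis
      have "\<forall>\<^sub>F n in sequentially. dist (X n) z < 1" using X by (rule tendstoD) simp
      then obtain n0 where n0: "\<And>n. n \<ge> n0 \<Longrightarrow> dist (X n) z < 1" unfolding eventually_sequentially by blast
      \<comment> \<open>A majorant for all points near \<open>z\<close>: Peetre's inequality with a
        displacement of norm at most \<open>1\<close> gives \<open>2 ^ M * 2 ^ M = 4 ^ M\<close>. As
        \<open>enn2real\<close> sends an infinite supremum to \<open>0\<close>, the majorant is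
        valid almost everywhere only, by \<open>ae\<close>.\<close>
      define N :: "(real ^ 'd) \<times> (real ^ 'd) \<Rightarrow> real" where "N t = (G * 4 ^ ?M / ?\<gamma>) * (decay ?M (z - fst t) * enn2real (stft_sup g f (snd t)))" for t
      have N0: "0 \<le> N t" for t unfolding N_def using G(1) by simp
      have Nm: "N \<in> borel_measurable (lborel \<Otimes>\<^sub>M lborel)" unfolding N_def by measurable
      have "(\<integral>\<^sup>+t. ennreal (N t) \<partial>lborel) \<le> (\<integral>\<^sup>+t. ennreal (G * 4 ^ ?M / ?\<gamma>) * (ennreal (decay ?M (z - fst t)) * stft_sup g f (snd t)) \<partial>(lborel \<Otimes>\<^sub>M lborel))"
        unfolding lborel_prod
      proof (intro nn_integral_mono)
        fix t :: "(real ^ 'd) \<times> (real ^ 'd)"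
        have "ennreal (N t) = ennreal (G * 4 ^ ?M / ?\<gamma>) * (ennreal (decay ?M (z - fst t)) * ennreal (enn2real (stft_sup g f (snd t))))"
          unfolding N_def using G(1) by (subst ennreal_mult; simp add: ennreal_mult del: power_Suc)
        moreover have "ennreal (enn2real (stft_sup g f (snd t))) \<le> stft_sup g f (snd t)" by (cases "stft_sup g f (snd t)") auto
        ultimately show "ennreal (N t) \<le> ennreal (G * 4 ^ ?M / ?\<gamma>) * (ennreal (decay ?M (z - fst t)) * stft_sup g f (snd t))"
          by (simp only:) (intro mult_left_mono; simp)
      qed
      also have "\<dots> = (\<integral>\<^sup>+\<xi>. (\<integral>\<^sup>+x. ennreal (G * 4 ^ ?M / ?\<gamma>) * (ennreal (decay ?M (z - x)) * stft_sup g f \<xi>) \<partial>lborel) \<partial>lborel)"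
        by (subst lborel_pair.nn_integral_snd[symmetric]) simp_all
      also have "\<dots> = ennreal (G * 4 ^ ?M / ?\<gamma>) * (decay_int TYPE('d) ?M * ennreal A)"
        using nn_integral_reflect[of "\<lambda>x :: real ^ 'd. ennreal (decay ?M x)" z]
        by (simp add: nn_integral_cmult nn_integral_multc decay_int_def sup_int del: power_Suc)
      also have "\<dots> < \<infinity>" using decay_int_finite[of ?M, where 'd='d] by (simp add: ennreal_mult_less_top del: power_Suc)
      finally have Ni: "integrable lborel N"
        using N0 Nm by (intro integrableI_bounded) (simp_all add: lborel_prod)
      have "AE \<xi> in lborel. stft_sup g f \<xi> \<noteq> \<infinity>"
        by (rule nn_integral_PInf_AE) (simp_all add: sup_int)
      then have "AE t :: (real ^ 'd) \<times> (real ^ 'd) in lborel \<Otimes>\<^sub>M lborel. stft_sup g f (snd t) \<noteq> \<infinity>"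
      proof (intro lborel_pair.AE_pair_measure)
        have "Measurable.pred (lborel \<Otimes>\<^sub>M lborel) (\<lambda>t :: (real ^ 'd) \<times> (real ^ 'd). stft_sup g f (snd t) \<noteq> \<infinity>)" by measurable
        then show "{t \<in> space ((lborel :: (real ^ 'd) measure) \<Otimes>\<^sub>M lborel). stft_sup g f (snd t) \<noteq> \<infinity>} \<in> sets (lborel \<Otimes>\<^sub>M lborel)" by (rule predE)
      qed simp
      then have ae: "AE t :: (real ^ 'd) \<times> (real ^ 'd) in lborel. stft_sup g f (snd t) \<noteq> \<infinity>" by (simp only: lborel_prod)
      have "(\<lambda>n. LINT t|lborel. H (X (n + n0)) t) \<longlonglongrightarrow> (LINT t|lborel. H z t)"
      proof (rule integral_dominated_convergence[OF _ _ Ni])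
        show "AE t in lborel. (\<lambda>n. H (X (n + n0)) t) \<longlonglongrightarrow> H z t"
        proof (rule AE_I2)
          fix t :: "(real ^ 'd) \<times> (real ^ 'd)"
          have "(\<lambda>n. (X (n + n0), t)) \<longlonglongrightarrow> (z, t)" using LIMSEQ_ignore_initial_segment[OF X, of n0] by (intro tendsto_intros)
          from continuous_on_tendsto_compose[OF cH this] show "(\<lambda>n. H (X (n + n0)) t) \<longlonglongrightarrow> H z t" by simp
        qed
        show "AE t in lborel. norm (H (X (n + n0)) t) \<le> N t" for n
          using ae
        proof eventually_elim
          fix t :: "(real ^ 'd) \<times> (real ^ 'd)" assume t: "stft_sup g f (snd t) \<noteq> \<infinity>"
          let ?d = "X (n + n0) - z"
          have "norm ?d \<le> 1" using n0[of "n + n0"] by (simp add: dist_norm)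
          then have "japanese ?d \<le> 2" unfolding japanese_def using power_mono[of "norm ?d" 1 2] by (intro real_le_lsqrt) auto
          then have "japanese ?d ^ ?M \<le> 2 ^ ?M" by (intro power_mono) auto
          then have *: "2 ^ ?M * decay ?M (z - fst t) * japanese ?d ^ ?M \<le> 2 ^ ?M * decay ?M (z - fst t) * 2 ^ ?M"
            by (intro mult_left_mono) auto
          have "decay ?M (X (n + n0) - fst t) \<le> 2 ^ ?M * decay ?M (z - fst t) * japanese ?d ^ ?M"
            using decay_Peetre[of ?M "z - fst t" ?d] by (simp del: power_Suc)
          also note *
          also have "2 ^ ?M * decay ?M (z - fst t) * 2 ^ ?M = (2 ^ ?M * 2 ^ ?M) * decay ?M (z - fst t)" by (simp only: mult_ac)
          also have "(2::real) ^ ?M * 2 ^ ?M = 4 ^ ?M" unfolding power_mult_distrib[symmetric] by simp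
          finally have 1: "cmod (g (X (n + n0) - fst t)) \<le> G * (4 ^ ?M * decay ?M (z - fst t))"
            using G(2)[of "X (n + n0) - fst t"] G(1) by (meson mult_left_mono order_trans)
          have "ennreal (cmod (F t)) \<le> ennreal (1 / ?\<gamma> * enn2real (stft_sup g f (snd t)))"
            using F[of t] t by (cases "stft_sup g f (snd t)") (simp_all add: ennreal_mult[symmetric] del: ennreal_mult)
          then have 2: "cmod (F t) \<le> 1 / ?\<gamma> * enn2real (stft_sup g f (snd t))" by (subst (asm) ennreal_le_iff) auto
          have "cmod (F t) * cmod (g (X (n + n0) - fst t)) \<le> (1 / ?\<gamma> * enn2real (stft_sup g f (snd t))) * (G * (4 ^ ?M * decay ?M (z - fst t)))"
            by (rule mult_mono[OF 2 1]) auto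
          then show "norm (H (X (n + n0)) t) \<le> N t" unfolding H_def N_def by (simp add: norm_mult mult_ac del: power_Suc)
        qed
      qed simp_all
      then have "(\<lambda>n. LINT t|lborel. H (X n) t) \<longlonglongrightarrow> (LINT t|lborel. H z t)" by (rule LIMSEQ_offset)
      then show "(\<lambda>n. u (X n)) \<longlonglongrightarrow> u z" unfolding u_def using c by (intro tendsto_intros)
    qed
    have "u \<in> bcontfun" using uc ub by (rule bcontfun_normI)
    then have app: "apply_bcontfun (Bcontfun u) = u" by (rule Bcontfun_inverse)
    have "distr_of_fun u \<phi> = f \<phi>" for \<phi>
    proof (cases "\<phi> \<in> schwartz")
      case True
      note [measurable] = schwartz_measurable[OF True]
      \<comment> \<open>Absolute convergence follows from the bound uniform in \<open>z\<close> and
        the integrability of \<open>\<phi>\<close>; it permits exchanging the pairing with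
        \<open>\<phi>\<close> and the integral over phase space.\<close>
      have i2: "integrable (lborel \<Otimes>\<^sub>M lborel) (\<lambda>(z, t). \<phi> z * H z t)"
      proof (rule integrableI_bounded)
        show "(\<lambda>(z, t). \<phi> z * H z t) \<in> borel_measurable (lborel \<Otimes>\<^sub>M lborel)"
          using Hm unfolding split_def by measurable
        have "(\<integral>\<^sup>+w. ennreal (norm (case w of (z, t) \<Rightarrow> \<phi> z * H z t)) \<partial>(lborel \<Otimes>\<^sub>M lborel)) = (\<integral>\<^sup>+z. (\<integral>\<^sup>+t. ennreal (cmod (\<phi> z * H z t)) \<partial>lborel) \<partial>lborel)"
          using Hm by (subst lborel.nn_integral_fst[symmetric]) (simp_all add: split_def)
        also have "\<dots> = (\<integral>\<^sup>+z. ennreal (cmod (\<phi> z)) * (\<integral>\<^sup>+t. ennreal (cmod (H z t)) \<partial>lborel) \<partial>lborel)"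
          by (intro nn_integral_cong) (simp add: norm_mult ennreal_mult nn_integral_cmult)
        also have "\<dots> \<le> (\<integral>\<^sup>+z. ennreal (cmod (\<phi> z)) * ennreal (I * A / ?\<gamma>) \<partial>lborel)"
          by (intro nn_integral_mono mult_left_mono bound) simp
        also have "\<dots> < \<infinity>" using nn_integral_schwartz_finite[OF True] by (simp add: nn_integral_multc ennreal_mult_less_top)
        finally show "(\<integral>\<^sup>+w. ennreal (norm (case w of (z, t) \<Rightarrow> \<phi> z * H z t)) \<partial>(lborel \<Otimes>\<^sub>M lborel)) < \<infinity>" .
      qed
      have "?c * f \<phi> = (LINT t|lborel. (LINT z|lborel. \<phi> z * H z t))"
        unfolding reproducing[OF f True g]
      proof (rule Bochner_Integration.integral_cong[OF refl])
        fix t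
        show "corr \<phi> g (fst t) (snd t) * f (tf_shift (\<lambda>y. cnj (g y)) t) = (LINT z|lborel. \<phi> z * H z t)"
          unfolding corr_def H_def F_def by (subst integral_mult_left_zero[symmetric]) (simp add: mult_ac)
      qed
      also have "\<dots> = (LINT z|lborel. (LINT t|lborel. \<phi> z * H z t))"
        using lborel_pair.Fubini_integral[OF i2] .
      also have "\<dots> = (LINT z|lborel. ?c * (u z * \<phi> z))"
        using c by (intro Bochner_Integration.integral_cong) (auto simp: u_def)
      also have "\<dots> = ?c * (LINT z|lborel. u z * \<phi> z)" by (rule integral_mult_right_zero)
      finally have "?c * f \<phi> = ?c * distr_of_fun u \<phi>" by (simp only: distr_of_fun_apply[OF True])
      then show ?thesis using c by simp
    next
      case False
      then show ?thesis using f by (simp add: distr_of_fun_def tempered_distributions_def)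
    qed
    then have "distr_of_fun (apply_bcontfun (Bcontfun u)) = f" unfolding app by blast
    moreover have "norm (Bcontfun u) \<le> C * enn2real (modulation_enorm g \<infinity> 1 0 f)"
      using ub A by (intro norm_bound) (simp add: app)
    ultimately show ?thesis by blast
  qed
  then show ?thesis using C0 by blast
qed

section \<open>Products\<close>

text \<open>A factor written as an inversion integral becomes, by Fubini, a superposition of
  modulations of \<open>G\<close>. This is applied to the two factors of a product one after the
  other, which is why the integrability of the product is part of the conclusion.\<close>

lemma fourier_integral_swap:
  fixes G A :: "'a::euclidean_space \<Rightarrow> complex"
  assumes G: "integrable lborel G" and A: "integrable lborel A"
  shows "ennreal (cmod (LINT y|lborel. G y * (LINT \<eta>|lborel. A \<eta> * chr \<eta> y) * chr \<theta> y)) \<le>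
    (\<integral>\<^sup>+\<eta>. ennreal (cmod (A \<eta>)) * ennreal (cmod (LINT y|lborel. G y * chr (\<eta> + \<theta>) y)) \<partial>lborel)"
    and "integrable lborel (\<lambda>y. G y * (LINT \<eta>|lborel. A \<eta> * chr \<eta> y))"
proof -
  have [measurable]: "G \<in> borel_measurable borel" "A \<in> borel_measurable borel"
    using borel_measurable_integrable[OF G] borel_measurable_integrable[OF A] by simp_all
  have i: "integrable (lborel \<Otimes>\<^sub>M lborel) (\<lambda>(y, \<eta>). G y * A \<eta> * chr \<eta> y * chr \<theta> y)"
  proof (rule lborel_pair.Fubini_integrable)
    have "(\<lambda>y. LINT \<eta>|lborel. norm (case (y, \<eta>) of (y, \<eta>) \<Rightarrow> G y * A \<eta> * chr \<eta> y * chr \<theta> y)) = (\<lambda>y. cmod (G y) * (LINT \<eta>|lborel. cmod (A \<eta>)))"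
      by (simp add: norm_mult)
    then show "integrable lborel (\<lambda>y. LINT \<eta>|lborel. norm (case (y, \<eta>) of (y, \<eta>) \<Rightarrow> G y * A \<eta> * chr \<eta> y * chr \<theta> y))"
      using integrable_norm[OF G] by simp
    have "integrable lborel (\<lambda>\<eta>. (G y * chr \<theta> y) * (A \<eta> * chr y \<eta>))" for y
      by (intro integrable_mult_right integrable_mult_chr A)
    then show "AE y in lborel. integrable lborel (\<lambda>\<eta>. case (y, \<eta>) of (y, \<eta>) \<Rightarrow> G y * A \<eta> * chr \<eta> y * chr \<theta> y)"
      by (intro AE_I2) (simp add: mult_ac chr_commute)
  qed simp
  have "(LINT y|lborel. G y * (LINT \<eta>|lborel. A \<eta> * chr \<eta> y) * chr \<theta> y) = (LINT y|lborel. (LINT \<eta>|lborel. G y * A \<eta> * chr \<eta> y * chr \<theta> y))"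
  proof (rule Bochner_Integration.integral_cong[OF refl])
    fix y
    have "G y * (LINT \<eta>|lborel. A \<eta> * chr \<eta> y) * chr \<theta> y = (LINT \<eta>|lborel. (G y * chr \<theta> y) * (A \<eta> * chr \<eta> y))"
      by simp
    then show "G y * (LINT \<eta>|lborel. A \<eta> * chr \<eta> y) * chr \<theta> y = (LINT \<eta>|lborel. G y * A \<eta> * chr \<eta> y * chr \<theta> y)"
      by (simp add: mult_ac)
  qed
  also have "\<dots> = (LINT \<eta>|lborel. (LINT y|lborel. G y * A \<eta> * chr \<eta> y * chr \<theta> y))"
    using lborel_pair.Fubini_integral[OF i] by simp
  also have "\<dots> = (LINT \<eta>|lborel. A \<eta> * (LINT y|lborel. G y * chr (\<eta> + \<theta>) y))"
  proof (rule Bochner_Integration.integral_cong[OF refl])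
    fix \<eta>
    have "A \<eta> * (LINT y|lborel. G y * chr (\<eta> + \<theta>) y) = (LINT y|lborel. A \<eta> * (G y * chr (\<eta> + \<theta>) y))" by simp
    then show "(LINT y|lborel. G y * A \<eta> * chr \<eta> y * chr \<theta> y) = A \<eta> * (LINT y|lborel. G y * chr (\<eta> + \<theta>) y)"
      by (simp add: chr_add_left mult_ac)
  qed
  finally show "ennreal (cmod (LINT y|lborel. G y * (LINT \<eta>|lborel. A \<eta> * chr \<eta> y) * chr \<theta> y)) \<le>
    (\<integral>\<^sup>+\<eta>. ennreal (cmod (A \<eta>)) * ennreal (cmod (LINT y|lborel. G y * chr (\<eta> + \<theta>) y)) \<partial>lborel)"
    using ennreal_cmod_integral_le[of lborel "\<lambda>\<eta>. A \<eta> * (LINT y|lborel. G y * chr (\<eta> + \<theta>) y)"] by (simp add: norm_mult ennreal_mult)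
  have [measurable]: "(\<lambda>y. LINT \<eta>|lborel. A \<eta> * chr \<eta> y) \<in> borel_measurable borel"
    using lborel.borel_measurable_lebesgue_integral[of "\<lambda>y \<eta>. A \<eta> * chr \<eta> y" lborel] by simp
  show "integrable lborel (\<lambda>y. G y * (LINT \<eta>|lborel. A \<eta> * chr \<eta> y))"
  proof (rule Bochner_Integration.integrable_bound)
    show "integrable lborel (\<lambda>y. (LINT \<eta>|lborel. cmod (A \<eta>)) * cmod (G y))" using G by simp
    have "cmod (LINT \<eta>|lborel. A \<eta> * chr \<eta> y) \<le> (LINT \<eta>|lborel. cmod (A \<eta>))" for y
      using integral_norm_bound[of lborel "\<lambda>\<eta>. A \<eta> * chr \<eta> y"] by (simp add: norm_mult)
    then show "AE y in lborel. norm (G y * (LINT \<eta>|lborel. A \<eta> * chr \<eta> y)) \<le> norm ((LINT \<eta>|lborel. cmod (A \<eta>)) * cmod (G y))"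
      by (intro AE_I2) (auto simp: norm_mult mult.commute intro!: mult_mono order_trans[OF _ abs_ge_self])
  qed simp
qed

text \<open>Both transforms are taken at the same position, since one window localises both factors;
  only the frequencies are convolved.\<close>

definition prod_conv :: "nat \<Rightarrow> (real ^ 'd \<Rightarrow> real ^ 'd \<Rightarrow> ennreal) \<Rightarrow> (real ^ 'd \<Rightarrow> real ^ 'd \<Rightarrow> ennreal) \<Rightarrow> real ^ 'd \<Rightarrow> real ^ 'd \<Rightarrow> ennreal" where
  "prod_conv N U V x \<xi> = (\<integral>\<^sup>+z. (\<integral>\<^sup>+\<eta>. (\<integral>\<^sup>+\<zeta>.
     ennreal (decay N (\<xi> - (\<eta> + \<zeta>))) * (ennreal (decay N (x - z)) * (U z \<eta> * V z \<zeta>)) \<partial>lborel) \<partial>lborel) \<partial>lborel)"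

lemma stft_integrable:
  fixes f :: "'d::finite functional"
  assumes f: "f \<in> tempered_distributions" and g: "g \<in> schwartz" and fin: "modulation_enorm g \<infinity> 1 0 f < \<infinity>"
  shows "integrable lborel (\<lambda>\<xi>. stft g f x \<xi>)"
proof (rule integrableI_bounded)
  have "(\<integral>\<^sup>+\<xi>. ennreal (cmod (stft g f x \<xi>)) \<partial>lborel) \<le> (\<integral>\<^sup>+\<xi>. stft_sup g f \<xi> \<partial>lborel)"
    by (intro nn_integral_mono stft_le_sup f g)
  then show "(\<integral>\<^sup>+\<xi>. ennreal (norm (stft g f x \<xi>)) \<partial>lborel) < \<infinity>" using fin by (simp only: nn_integral_stft_sup[OF f g] le_less_trans)
qed (use stft_measurable2[OF f g] in simp)

text \<open>With \<open>\<kappa> = \<parallel>g\<^sup>2\<parallel>\<^sup>2\<close>, one has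
  \<open>\<kappa> u v g\<^sub>x\<^sup>* = \<integral> (u g\<^sub>z\<^sup>*) (v g\<^sub>z\<^sup>*) (g\<^sub>z\<^sup>2 g\<^sub>x\<^sup>*) dz\<close>, where \<open>g\<^sub>z = g (\<cdot> - z)\<close> and the star is conjugation.
  The Fourier transforms of the first two factors are the two short-time Fourier transforms and that
  of the third one decays rapidly, so no change of window from \<open>g\<^sup>2\<close> to \<open>g\<close> is needed.\<close>

lemma stft_mult_le:
  fixes g :: "real ^ 'd \<Rightarrow> complex"
  assumes g: "g \<in> schwartz" and g0: "g y0 \<noteq> 0"
  shows "\<exists>C\<ge>0. \<forall>u v :: (real ^ 'd) \<Rightarrow>\<^sub>C complex.
    modulation_enorm g \<infinity> 1 0 (distr_of_fun (apply_bcontfun u)) < \<infinity> \<longrightarrow>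
    modulation_enorm g \<infinity> 1 0 (distr_of_fun (apply_bcontfun v)) < \<infinity> \<longrightarrow>
    (\<forall>x \<xi>. stft_abs g (distr_of_fun (\<lambda>y. apply_bcontfun u y * apply_bcontfun v y)) x \<xi> \<le>
      ennreal C * prod_conv N (stft_abs g (distr_of_fun (apply_bcontfun u))) (stft_abs g (distr_of_fun (apply_bcontfun v))) x \<xi>)"
proof -
  let ?\<gamma> = "stft_const TYPE('d)"
  let ?c = "?\<gamma> * complex_of_real ((2 * pi) ^ CARD('d))"
  let ?\<psi> = "\<lambda>y. cnj (g y)"
  note \<psi> = schwartz_cnj[OF g]
  define g2 where "g2 y = g y * g y" for y
  have g2: "g2 \<in> schwartz" unfolding g2_def[abs_def] by (rule schwartz_mult[OF g g])
  define \<kappa> where "\<kappa> = window_const g2"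
  have \<kappa>: "\<kappa> \<noteq> 0" unfolding \<kappa>_def using g0 by (intro window_const_neq_0[OF g2, of y0]) (simp add: g2_def)
  have c: "?c \<noteq> 0" by simp
  obtain D where D: "0 \<le> D" "\<And>z \<eta>. cmod (corr g2 ?\<psi> z \<eta>) \<le> D * decay N z * decay N \<eta>"
    using corr_bound[OF g2 \<psi>, of N] by metis
  define C where "C = cmod (?\<gamma> / \<kappa> / (?c * ?c)) * D"
  have C0: "0 \<le> C" using D(1) by (simp add: C_def)
  note [measurable] = schwartz_measurable[OF g] schwartz_measurable[OF g2]
  have "stft_abs g (distr_of_fun (\<lambda>y. apply_bcontfun u y * apply_bcontfun v y)) x \<xi> \<le>
      ennreal C * prod_conv N (stft_abs g (distr_of_fun (apply_bcontfun u))) (stft_abs g (distr_of_fun (apply_bcontfun v))) x \<xi>"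
    if fu: "modulation_enorm g \<infinity> 1 0 (distr_of_fun (apply_bcontfun u)) < \<infinity>" and fv: "modulation_enorm g \<infinity> 1 0 (distr_of_fun (apply_bcontfun v)) < \<infinity>"
    for u v :: "(real ^ 'd) \<Rightarrow>\<^sub>C complex" and x \<xi>
  proof -
    let ?u = "apply_bcontfun u" and ?v = "apply_bcontfun v"
    define U where "U z \<eta> = stft g (distr_of_fun ?u) z \<eta>" for z \<eta>
    define V where "V z \<eta> = stft g (distr_of_fun ?v) z \<eta>" for z \<eta>
    have Ui: "integrable lborel (U z)" for z unfolding U_def by (rule stft_integrable[OF distr_of_fun_tempered g fu])
    have Vi: "integrable lborel (V z)" for z unfolding V_def by (rule stft_integrable[OF distr_of_fun_tempered g fv])
    have uU: "(LINT \<eta>|lborel. U z \<eta> * chr \<eta> y) = ?c * (?u y * ?\<psi> (y - z))" for z y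
      unfolding U_def by (rule bcontfun_window_inversion[OF g Ui[of z, unfolded U_def[abs_def]]])
    have vV: "(LINT \<eta>|lborel. V z \<eta> * chr \<eta> y) = ?c * (?v y * ?\<psi> (y - z))" for z y
      unfolding V_def by (rule bcontfun_window_inversion[OF g Vi[of z, unfolded V_def[abs_def]]])
    \<comment> \<open>\<open>P\<close> is the integrand of the transform of the product at
      \<open>(x, \<xi>)\<close>, and the translates of \<open>k\<close> integrate over
      \<open>z\<close> to the constant \<open>\<kappa>\<close>.\<close>
    define P where "P y = ?u y * ?v y * ?\<psi> (y - x) * chr (- \<xi>) y" for y
    define k where "k y = g2 y * cnj (g2 y)" for y
    have [measurable]: "P \<in> borel_measurable borel" "k \<in> borel_measurable borel" unfolding P_def k_def by measurable
    have Pi: "integrable lborel P"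
    proof -
      have "integrable lborel (\<lambda>y. (?u y * ?v y) * ?\<psi> (y - x))"
      proof (rule Bochner_Integration.integrable_bound)
        show "integrable lborel (\<lambda>y. norm u * (?v y * ?\<psi> (y - x)))"
          by (intro integrable_mult_right bcontfun_mult_schwartz_integrable shift_schwartz \<psi>)
        show "AE y in lborel. cmod (?u y * ?v y * ?\<psi> (y - x)) \<le> cmod (norm u * (?v y * ?\<psi> (y - x)))"
          using norm_bounded[of u] by (intro AE_I2) (auto simp: norm_mult mult.assoc intro!: mult_right_mono)
      qed simp
      from integrable_mult_chr(1)[OF this, of "- \<xi>"] show ?thesis by (simp add: P_def[abs_def])
    qed
    have ki: "integrable lborel k"
      unfolding k_def[abs_def] using corr_integrable[OF g2 schwartz_cnj[OF g2], of 0 0] by (simp add: chr_def)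
    have Pk: "integrable (lborel \<Otimes>\<^sub>M lborel) (\<lambda>(y, z). P y * k (y - z))"
    proof (rule lborel_pair.Fubini_integrable)
      have *: "(LINT z|lborel. cmod (k (y - z))) = (LINT z|lborel. cmod (k z))" for y
        using integral_reflect_complex[of "\<lambda>z. complex_of_real (cmod (k z))" y] by simp
      have "(\<lambda>y. LINT z|lborel. norm (case (y, z) of (y, z) \<Rightarrow> P y * k (y - z))) = (\<lambda>y. cmod (P y) * (LINT z|lborel. cmod (k z)))"
        by (simp add: norm_mult *)
      then show "integrable lborel (\<lambda>y. LINT z|lborel. norm (case (y, z) of (y, z) \<Rightarrow> P y * k (y - z)))" using integrable_norm[OF Pi] by simp
      have "integrable lborel (\<lambda>z. P y * k (y + (-1) *\<^sub>R z))" for y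
        by (intro integrable_mult_right integrable_lborel_affine ki) simp
      then show "AE y in lborel. integrable lborel (\<lambda>z. case (y, z) of (y, z) \<Rightarrow> P y * k (y - z))" by simp
    qed simp
    have "(LINT y|lborel. P y) * \<kappa> = (LINT y|lborel. (LINT z|lborel. P y * k (y - z)))"
    proof -
      have "(LINT z|lborel. k (y - z)) = \<kappa>" for y
        unfolding \<kappa>_def window_const_def using integral_reflect_complex[of k y] by (simp add: k_def)
      then show ?thesis by simp
    qed
    also have "\<dots> = (LINT z|lborel. (LINT y|lborel. P y * k (y - z)))"
      using lborel_pair.Fubini_integral[OF Pk] by simp
    finally have 1: "(LINT y|lborel. P y) * \<kappa> = (LINT z|lborel. (LINT y|lborel. P y * k (y - z)))" .
    have 2: "ennreal (cmod (LINT y|lborel. P y * k (y - z))) \<le> ennreal (cmod (1 / (?c * ?c)) * D) * (\<integral>\<^sup>+\<eta>. (\<integral>\<^sup>+\<zeta>.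
     ennreal (decay N (\<xi> - (\<eta> + \<zeta>))) * (ennreal (decay N (x - z)) * (ennreal (cmod (U z \<eta>)) * ennreal (cmod (V z \<zeta>)))) \<partial>lborel) \<partial>lborel)" for z
    proof -
      \<comment> \<open>The part of the integrand without \<open>u\<close> and \<open>v\<close>. Its
        Fourier transform is a \<open>corr\<close>, hence decays in \<open>x - z\<close> and in
        frequency.\<close>
      define G where "G y = g2 (y - z) * ?\<psi> (y - x)" for y
      have Gi: "integrable lborel G" unfolding G_def[abs_def] using corr_shift(2)[OF g2 \<psi>, of z x 0] by (simp add: chr_def)
      have Gc: "ennreal (cmod (LINT y|lborel. G y * chr \<theta> y)) \<le> ennreal D * (ennreal (decay N (x - z)) * ennreal (decay N \<theta>))" for \<theta>
      proof -
        have "cmod (LINT y|lborel. G y * chr \<theta> y) = cmod (corr g2 ?\<psi> (x - z) \<theta>)"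
          unfolding G_def corr_shift(1)[OF g2 \<psi>] by (simp add: norm_mult)
        then show ?thesis using D(1) D(2)[of "x - z" \<theta>] by (simp add: ennreal_mult[symmetric] ennreal_leI mult.assoc del: ennreal_mult)
      qed
      let ?IU = "\<lambda>y. LINT \<eta>|lborel. U z \<eta> * chr \<eta> y" and ?IV = "\<lambda>y. LINT \<zeta>|lborel. V z \<zeta> * chr \<zeta> y"
      \<comment> \<open>The conjugate of \<open>g2 (y - z)\<close> is split into one conjugate
        window for \<open>u\<close> and one for \<open>v\<close>; each windowed function is its
        inversion integral divided by \<open>?c\<close>.\<close>
      have "P y * k (y - z) = (1 / (?c * ?c)) * (G y * ?IV y * ?IU y * chr (- \<xi>) y)" for y
        unfolding uU vV P_def k_def G_def g2_def by simp
      then have "(LINT y|lborel. P y * k (y - z)) = (1 / (?c * ?c)) * (LINT y|lborel. G y * ?IV y * ?IU y * chr (- \<xi>) y)"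
        by simp
      then have "ennreal (cmod (LINT y|lborel. P y * k (y - z))) = ennreal (cmod (1 / (?c * ?c))) * ennreal (cmod (LINT y|lborel. G y * ?IV y * ?IU y * chr (- \<xi>) y))"
        by (simp only: norm_mult[of "1 / (?c * ?c)"]) (rule ennreal_mult; simp)
      also have "\<dots> \<le> ennreal (cmod (1 / (?c * ?c))) * (\<integral>\<^sup>+\<eta>. ennreal (cmod (U z \<eta>)) * ennreal (cmod (LINT y|lborel. G y * ?IV y * chr (\<eta> + - \<xi>) y)) \<partial>lborel)"
        by (intro mult_left_mono fourier_integral_swap(1) fourier_integral_swap(2) Gi Vi Ui) simp
      also have "\<dots> \<le> ennreal (cmod (1 / (?c * ?c))) * (\<integral>\<^sup>+\<eta>. ennreal (cmod (U z \<eta>)) * (\<integral>\<^sup>+\<zeta>. ennreal (cmod (V z \<zeta>)) * ennreal (cmod (LINT y|lborel. G y * chr (\<zeta> + (\<eta> + - \<xi>)) y)) \<partial>lborel) \<partial>lborel)"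
        by (intro mult_left_mono nn_integral_mono fourier_integral_swap(1) Gi Vi) simp_all
      also have "\<dots> \<le> ennreal (cmod (1 / (?c * ?c))) * (\<integral>\<^sup>+\<eta>. ennreal (cmod (U z \<eta>)) * (\<integral>\<^sup>+\<zeta>. ennreal (cmod (V z \<zeta>)) * (ennreal D * (ennreal (decay N (x - z)) * ennreal (decay N (\<zeta> + (\<eta> + - \<xi>))))) \<partial>lborel) \<partial>lborel)"
        by (intro mult_left_mono nn_integral_mono Gc) simp_all
      also have "\<dots> = ennreal (cmod (1 / (?c * ?c))) * (\<integral>\<^sup>+\<eta>. (\<integral>\<^sup>+\<zeta>. ennreal D * (ennreal (decay N (\<xi> - (\<eta> + \<zeta>))) * (ennreal (decay N (x - z)) * (ennreal (cmod (U z \<eta>)) * ennreal (cmod (V z \<zeta>))))) \<partial>lborel) \<partial>lborel)"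
      proof -
        have "decay N (\<zeta> + (\<eta> + - \<xi>)) = decay N (\<xi> - (\<eta> + \<zeta>))" for \<zeta> \<eta>
          using decay_diff_commute[of N "\<eta> + \<zeta>" \<xi>] by (simp add: algebra_simps)
        moreover have [measurable]: "V z \<in> borel_measurable borel" using borel_measurable_integrable[OF Vi[of z]] by simp
        ultimately show ?thesis by (subst nn_integral_cmult[symmetric]) (simp_all add: mult_ac)
      qed
      also have "\<dots> = ennreal (cmod (1 / (?c * ?c))) * (ennreal D * (\<integral>\<^sup>+\<eta>. (\<integral>\<^sup>+\<zeta>. ennreal (decay N (\<xi> - (\<eta> + \<zeta>))) * (ennreal (decay N (x - z)) * (ennreal (cmod (U z \<eta>)) * ennreal (cmod (V z \<zeta>)))) \<partial>lborel) \<partial>lborel))"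
      proof -
        have [measurable]: "V z \<in> borel_measurable borel" "U z \<in> borel_measurable borel" using borel_measurable_integrable[OF Vi[of z]] borel_measurable_integrable[OF Ui[of z]] by simp_all
        show ?thesis by (simp add: nn_integral_cmult)
      qed
      finally show ?thesis using D(1) by (simp only: ennreal_mult'[OF norm_ge_zero] mult.assoc)
    qed
    have "stft g (distr_of_fun (\<lambda>y. ?u y * ?v y)) x \<xi> = ?\<gamma> * (LINT y|lborel. P y)"
      unfolding stft_distr_of_fun[OF g] ft_def P_def by (simp add: chr_minus_left)
    also have "(LINT y|lborel. P y) = (1 / \<kappa>) * (LINT z|lborel. (LINT y|lborel. P y * k (y - z)))"
      using 1 \<kappa> by (simp add: field_simps)
    finally have "stft_abs g (distr_of_fun (\<lambda>y. ?u y * ?v y)) x \<xi> = ennreal (cmod (?\<gamma> / \<kappa>)) * ennreal (cmod (LINT z|lborel. (LINT y|lborel. P y * k (y - z))))"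
      unfolding stft_abs_def by (subst ennreal_mult[symmetric]) (simp_all add: norm_mult norm_divide)
    also have "\<dots> \<le> ennreal (cmod (?\<gamma> / \<kappa>)) * (\<integral>\<^sup>+z. ennreal (cmod (LINT y|lborel. P y * k (y - z))) \<partial>lborel)"
      by (intro mult_left_mono ennreal_cmod_integral_le) simp
    also have "\<dots> \<le> ennreal (cmod (?\<gamma> / \<kappa>)) * (\<integral>\<^sup>+z. ennreal (cmod (1 / (?c * ?c)) * D) * (\<integral>\<^sup>+\<eta>. (\<integral>\<^sup>+\<zeta>.
     ennreal (decay N (\<xi> - (\<eta> + \<zeta>))) * (ennreal (decay N (x - z)) * (ennreal (cmod (U z \<eta>)) * ennreal (cmod (V z \<zeta>)))) \<partial>lborel) \<partial>lborel) \<partial>lborel)"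
      by (intro mult_left_mono nn_integral_mono 2) simp
    also have "\<dots> = ennreal (cmod (?\<gamma> / \<kappa>)) * (ennreal (cmod (1 / (?c * ?c)) * D) * prod_conv N (stft_abs g (distr_of_fun ?u)) (stft_abs g (distr_of_fun ?v)) x \<xi>)"
    proof -
      have Um[measurable]: "(\<lambda>y. U (h y) (k y)) \<in> borel_measurable M" if [measurable]: "h \<in> borel_measurable M" "k \<in> borel_measurable M" for h k and M :: "'x measure"
      proof -
        have "(\<lambda>y. (h y, k y)) \<in> M \<rightarrow>\<^sub>M (lborel \<Otimes>\<^sub>M lborel)" by measurable
        from measurable_compose[OF this stft_measurable_pair[OF distr_of_fun_tempered g, of u]] show ?thesis by (simp add: U_def)
      qed
      have Vm[measurable]: "(\<lambda>y. V (h y) (k y)) \<in> borel_measurable M" if [measurable]: "h \<in> borel_measurable M" "k \<in> borel_measurable M" for h k and M :: "'x measure"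
      proof -
        have "(\<lambda>y. (h y, k y)) \<in> M \<rightarrow>\<^sub>M (lborel \<Otimes>\<^sub>M lborel)" by measurable
        from measurable_compose[OF this stft_measurable_pair[OF distr_of_fun_tempered g, of v]] show ?thesis by (simp add: V_def)
      qed
      show ?thesis unfolding prod_conv_def stft_abs_def U_def[symmetric] V_def[symmetric]
        by (subst nn_integral_cmult) simp_all
    qed
    also have "\<dots> = ennreal C * prod_conv N (stft_abs g (distr_of_fun ?u)) (stft_abs g (distr_of_fun ?v)) x \<xi>"
      using D(1) by (simp add: C_def mult.assoc[symmetric] ennreal_mult[symmetric] norm_mult norm_divide del: ennreal_mult)
    finally show ?thesis .
  qed
  then show ?thesis using C0 by blast
qed

text \<open>Young's inequality for three factors with exponents \<open>1\<close>, \<open>q\<close>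
  and \<open>1\<close>: Minkowski's inequality over \<open>\<zeta>\<close> leaves translates of the
  convolution \<open>T\<close> of the kernel with \<open>X\<close>.\<close>

lemma nn_integral_conv2:
  fixes X Y :: "real ^ 'd \<Rightarrow> ennreal"
  assumes q: "1 \<le> q" and [measurable]: "X \<in> borel_measurable borel" "Y \<in> borel_measurable borel"
  shows "Lp_norm q (\<lambda>\<xi>. \<integral>\<^sup>+\<zeta>. (\<integral>\<^sup>+\<eta>. ennreal (decay M (\<xi> - (\<eta> + \<zeta>))) * (X \<eta> * Y \<zeta>) \<partial>lborel) \<partial>lborel) \<le>
    decay_int TYPE('d) M * Lp_norm q X * (\<integral>\<^sup>+\<zeta>. Y \<zeta> \<partial>lborel)"
proof -
  define T where "T \<xi> = (\<integral>\<^sup>+\<eta>. ennreal (decay M (\<xi> - \<eta>)) * X \<eta> \<partial>lborel)" for \<xi> :: "real ^ 'd"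
  have [measurable]: "T \<in> borel_measurable borel" unfolding T_def[abs_def] by measurable
  have "(\<integral>\<^sup>+\<eta>. ennreal (decay M (\<xi> - (\<eta> + \<zeta>))) * (X \<eta> * Y \<zeta>) \<partial>lborel) = Y \<zeta> * T (\<xi> - \<zeta>)" for \<xi> \<zeta>
    unfolding T_def by (subst nn_integral_cmult[symmetric]) (simp_all add: mult_ac diff_diff_eq add.commute)
  then have "Lp_norm q (\<lambda>\<xi>. \<integral>\<^sup>+\<zeta>. (\<integral>\<^sup>+\<eta>. ennreal (decay M (\<xi> - (\<eta> + \<zeta>))) * (X \<eta> * Y \<zeta>) \<partial>lborel) \<partial>lborel)
     = Lp_norm q (\<lambda>\<xi>. \<integral>\<^sup>+\<zeta>. Y \<zeta> * T (\<xi> - \<zeta>) \<partial>lborel)" by simp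
  also have "\<dots> \<le> (\<integral>\<^sup>+\<zeta>. Lp_norm q (\<lambda>\<xi>. Y \<zeta> * T (\<xi> - \<zeta>)) \<partial>lborel)"
    by (rule Minkowski_integral[OF q lborel.sigma_finite_measure_axioms]) measurable
  also have "\<dots> \<le> (\<integral>\<^sup>+\<zeta>. (decay_int TYPE('d) M * Lp_norm q X) * Y \<zeta> \<partial>lborel)"
  proof (rule nn_integral_mono)
    fix \<zeta>
    have "Lp_norm q (\<lambda>\<xi>. Y \<zeta> * T (\<xi> - \<zeta>)) \<le> Y \<zeta> * Lp_norm q (\<lambda>\<xi>. T (\<xi> - \<zeta>))"
      by (rule Lp_norm_cmult_le[OF q]) measurable
    also have "\<dots> \<le> Y \<zeta> * Lp_norm q T"
      using Lp_norm_affine_le[OF q, of T 1 "- \<zeta>"] by (intro mult_left_mono) auto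
    also have "\<dots> \<le> Y \<zeta> * (decay_int TYPE('d) M * Lp_norm q X)"
      unfolding T_def[abs_def] decay_int_def by (intro mult_left_mono Young_Lp[OF q]) auto
    finally show "Lp_norm q (\<lambda>\<xi>. Y \<zeta> * T (\<xi> - \<zeta>)) \<le> (decay_int TYPE('d) M * Lp_norm q X) * Y \<zeta>" by (simp add: mult_ac)
  qed
  also have "\<dots> = (decay_int TYPE('d) M * Lp_norm q X) * (\<integral>\<^sup>+\<zeta>. Y \<zeta> \<partial>lborel)" by (rule nn_integral_cmult) measurable
  finally show ?thesis .
qed

lemma tf_measurable_compose:
  fixes F :: "real ^ 'd \<Rightarrow> real ^ 'd \<Rightarrow> ennreal" and M :: "'x measure"
  assumes F: "tf_measurable F" and [measurable]: "h \<in> borel_measurable M" "k \<in> borel_measurable M"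
  shows "(\<lambda>y. F (h y) (k y)) \<in> borel_measurable M"
proof -
  have "(\<lambda>y. (k y, h y)) \<in> M \<rightarrow>\<^sub>M (lborel \<Otimes>\<^sub>M lborel)" by measurable
  from measurable_compose[OF this F] show ?thesis by simp
qed

lemma prod_conv_measurable:
  fixes U V :: "real ^ 'd \<Rightarrow> real ^ 'd \<Rightarrow> ennreal"
  assumes U: "tf_measurable U" and V: "tf_measurable V"
  shows "tf_measurable (prod_conv N U V)"
proof -
  note [measurable] = tf_measurable_compose[OF U] tf_measurable_compose[OF V]
  show ?thesis unfolding prod_conv_def split_def by measurable
qed

text \<open>In practice \<open>a\<close> and \<open>b\<close> are the functions
  \<open>stft_sup\<close>. Being independent of the position, they can be pulled out of the norm in
  \<open>z\<close>, and they enter the result through their integrals over frequency only.\<close>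

lemma mixed_norm_prod_conv:
  fixes U V :: "real ^ 'd \<Rightarrow> real ^ 'd \<Rightarrow> ennreal"
  assumes p: "1 \<le> p" and q: "1 \<le> q" and U: "tf_measurable U" and V: "tf_measurable V"
    and s: "0 \<le> s" "s \<le> real K" 
    and a[measurable]: "a \<in> borel_measurable borel" "\<And>z \<eta>. U z \<eta> \<le> a \<eta>"
    and b[measurable]: "b \<in> borel_measurable borel" "\<And>z \<eta>. V z \<eta> \<le> b \<eta>"
  shows "mixed_norm p q s (prod_conv (M + K) U V) \<le>
    decay_int TYPE('d) (M + K) * ennreal (4 powr s) * decay_int TYPE('d) M *
     (mixed_norm p q s U * (\<integral>\<^sup>+\<zeta>. b \<zeta> \<partial>lborel) + (\<integral>\<^sup>+\<eta>. a \<eta> \<partial>lborel) * mixed_norm p q s V)"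
proof -
  let ?N = "M + K" and ?I = "decay_int TYPE('d) (M + K)"
  note Um = tf_measurable_compose[OF U] and Vm = tf_measurable_compose[OF V]
  note [measurable] = Um Vm
  define A where "A \<eta> = ennreal (japanese \<eta> powr s) * Lp_norm p (\<lambda>x. U x \<eta>)" for \<eta>
  define B where "B \<eta> = ennreal (japanese \<eta> powr s) * Lp_norm p (\<lambda>x. V x \<eta>)" for \<eta>
  have [measurable]: "(\<lambda>\<eta>. Lp_norm p (\<lambda>x. U x \<eta>)) \<in> borel_measurable borel" "(\<lambda>\<eta>. Lp_norm p (\<lambda>x. V x \<eta>)) \<in> borel_measurable borel"
    using measurable_Lp_norm[OF p U] measurable_Lp_norm[OF p V] by simp_all
  have [measurable]: "A \<in> borel_measurable borel" "B \<in> borel_measurable borel" unfolding A_def[abs_def] B_def[abs_def] by measurable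
  have [measurable]: "(\<lambda>\<xi>. Lp_norm p (\<lambda>x. prod_conv ?N U V x \<xi>)) \<in> borel_measurable borel"
    using measurable_Lp_norm[OF p prod_conv_measurable[OF U V]] by simp
  have L: "Lp_norm p (\<lambda>x. prod_conv ?N U V x \<xi>) \<le> ?I * (\<integral>\<^sup>+\<zeta>. (\<integral>\<^sup>+\<eta>. ennreal (decay ?N (\<xi> - (\<eta> + \<zeta>))) * Lp_norm p (\<lambda>z. U z \<eta> * V z \<zeta>) \<partial>lborel) \<partial>lborel)" for \<xi>
  proof -
    have [measurable]: "(\<lambda>(\<zeta>, \<eta>). Lp_norm p (\<lambda>z. U z \<eta> * V z \<zeta>)) \<in> borel_measurable (lborel \<Otimes>\<^sub>M lborel)"
      unfolding split_def by (rule measurable_Lp_norm[OF p]) measurable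
    \<comment> \<open>The integral over positions is moved innermost, where Young's inequality in
      \<open>x\<close> applies at fixed frequencies.\<close>
    have eq: "prod_conv ?N U V x \<xi> = (\<integral>\<^sup>+\<zeta>. (\<integral>\<^sup>+\<eta>. ennreal (decay ?N (\<xi> - (\<eta> + \<zeta>))) * (\<integral>\<^sup>+z. ennreal (decay ?N (x - z)) * (U z \<eta> * V z \<zeta>) \<partial>lborel) \<partial>lborel) \<partial>lborel)" for x
    proof -
      have "prod_conv ?N U V x \<xi> = (\<integral>\<^sup>+\<eta>. (\<integral>\<^sup>+z. (\<integral>\<^sup>+\<zeta>. ennreal (decay ?N (\<xi> - (\<eta> + \<zeta>))) * (ennreal (decay ?N (x - z)) * (U z \<eta> * V z \<zeta>)) \<partial>lborel) \<partial>lborel) \<partial>lborel)"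
        unfolding prod_conv_def by (rule lborel_pair.Fubini') measurable
      also have "\<dots> = (\<integral>\<^sup>+\<eta>. (\<integral>\<^sup>+\<zeta>. (\<integral>\<^sup>+z. ennreal (decay ?N (\<xi> - (\<eta> + \<zeta>))) * (ennreal (decay ?N (x - z)) * (U z \<eta> * V z \<zeta>)) \<partial>lborel) \<partial>lborel) \<partial>lborel)"
        by (intro nn_integral_cong lborel_pair.Fubini') measurable
      also have "\<dots> = (\<integral>\<^sup>+\<zeta>. (\<integral>\<^sup>+\<eta>. (\<integral>\<^sup>+z. ennreal (decay ?N (\<xi> - (\<eta> + \<zeta>))) * (ennreal (decay ?N (x - z)) * (U z \<eta> * V z \<zeta>)) \<partial>lborel) \<partial>lborel) \<partial>lborel)"
        by (rule lborel_pair.Fubini') measurable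
      finally show ?thesis by (simp add: nn_integral_cmult)
    qed
    have "Lp_norm p (\<lambda>x. prod_conv ?N U V x \<xi>) \<le> (\<integral>\<^sup>+\<zeta>. Lp_norm p (\<lambda>x. \<integral>\<^sup>+\<eta>. ennreal (decay ?N (\<xi> - (\<eta> + \<zeta>))) * (\<integral>\<^sup>+z. ennreal (decay ?N (x - z)) * (U z \<eta> * V z \<zeta>) \<partial>lborel) \<partial>lborel) \<partial>lborel)"
      unfolding eq by (rule Minkowski_integral[OF p lborel.sigma_finite_measure_axioms]) measurable
    also have "\<dots> \<le> (\<integral>\<^sup>+\<zeta>. (\<integral>\<^sup>+\<eta>. Lp_norm p (\<lambda>x. ennreal (decay ?N (\<xi> - (\<eta> + \<zeta>))) * (\<integral>\<^sup>+z. ennreal (decay ?N (x - z)) * (U z \<eta> * V z \<zeta>) \<partial>lborel)) \<partial>lborel) \<partial>lborel)"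
      by (intro nn_integral_mono Minkowski_integral[OF p lborel.sigma_finite_measure_axioms]) measurable
    also have "\<dots> \<le> (\<integral>\<^sup>+\<zeta>. (\<integral>\<^sup>+\<eta>. ?I * (ennreal (decay ?N (\<xi> - (\<eta> + \<zeta>))) * Lp_norm p (\<lambda>z. U z \<eta> * V z \<zeta>)) \<partial>lborel) \<partial>lborel)"
    proof (intro nn_integral_mono)
      fix \<zeta> \<eta> :: "real ^ 'd"
      have "Lp_norm p (\<lambda>x. ennreal (decay ?N (\<xi> - (\<eta> + \<zeta>))) * (\<integral>\<^sup>+z. ennreal (decay ?N (x - z)) * (U z \<eta> * V z \<zeta>) \<partial>lborel))
        \<le> ennreal (decay ?N (\<xi> - (\<eta> + \<zeta>))) * Lp_norm p (\<lambda>x. \<integral>\<^sup>+z. ennreal (decay ?N (x - z)) * (U z \<eta> * V z \<zeta>) \<partial>lborel)"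
        by (rule Lp_norm_cmult_le[OF p]) measurable
      also have "\<dots> \<le> ennreal (decay ?N (\<xi> - (\<eta> + \<zeta>))) * (?I * Lp_norm p (\<lambda>z. U z \<eta> * V z \<zeta>))"
        unfolding decay_int_def by (intro mult_left_mono Young_Lp[OF p]) auto
      finally show "Lp_norm p (\<lambda>x. ennreal (decay ?N (\<xi> - (\<eta> + \<zeta>))) * (\<integral>\<^sup>+z. ennreal (decay ?N (x - z)) * (U z \<eta> * V z \<zeta>) \<partial>lborel))
        \<le> ?I * (ennreal (decay ?N (\<xi> - (\<eta> + \<zeta>))) * Lp_norm p (\<lambda>z. U z \<eta> * V z \<zeta>))" by (simp add: mult_ac)
    qed
    also have "\<dots> = ?I * (\<integral>\<^sup>+\<zeta>. (\<integral>\<^sup>+\<eta>. ennreal (decay ?N (\<xi> - (\<eta> + \<zeta>))) * Lp_norm p (\<lambda>z. U z \<eta> * V z \<zeta>) \<partial>lborel) \<partial>lborel)"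
      by (simp add: nn_integral_cmult)
    finally show ?thesis .
  qed
  have UV1: "Lp_norm p (\<lambda>z. U z \<eta> * V z \<zeta>) \<le> b \<zeta> * Lp_norm p (\<lambda>z. U z \<eta>)" for \<eta> \<zeta>
  proof -
    have "Lp_norm p (\<lambda>z. U z \<eta> * V z \<zeta>) \<le> Lp_norm p (\<lambda>z. b \<zeta> * U z \<eta>)"
      using mult_left_mono[OF b(2)] by (intro Lp_norm_mono p) (simp_all add: mult.commute[of "b \<zeta>"])
    also have "\<dots> \<le> b \<zeta> * Lp_norm p (\<lambda>z. U z \<eta>)" by (rule Lp_norm_cmult_le[OF p]) measurable
    finally show ?thesis .
  qed
  have UV2: "Lp_norm p (\<lambda>z. U z \<eta> * V z \<zeta>) \<le> a \<eta> * Lp_norm p (\<lambda>z. V z \<zeta>)" for \<eta> \<zeta>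
  proof -
    have "Lp_norm p (\<lambda>z. U z \<eta> * V z \<zeta>) \<le> Lp_norm p (\<lambda>z. a \<eta> * V z \<zeta>)"
      using mult_right_mono[OF a(2)] by (intro Lp_norm_mono p) simp_all
    also have "\<dots> \<le> a \<eta> * Lp_norm p (\<lambda>z. V z \<zeta>)" by (rule Lp_norm_cmult_le[OF p]) measurable
    finally show ?thesis .
  qed
  let ?k = "\<lambda>\<xi> \<eta> \<zeta>. ennreal (decay M (\<xi> - (\<eta> + \<zeta>)))"
  have pt: "ennreal (japanese \<xi> powr s) * (ennreal (decay ?N (\<xi> - (\<eta> + \<zeta>))) * Lp_norm p (\<lambda>z. U z \<eta> * V z \<zeta>))
     \<le> ennreal (4 powr s) * (?k \<xi> \<eta> \<zeta> * (A \<eta> * b \<zeta>) + ?k \<xi> \<eta> \<zeta> * (B \<zeta> * a \<eta>))" for \<xi> \<eta> \<zeta>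
  proof -
    let ?L = "Lp_norm p (\<lambda>z. U z \<eta> * V z \<zeta>)"
    have "japanese \<xi> powr s * decay ?N (\<xi> - (\<eta> + \<zeta>)) \<le> 4 powr s * decay M (\<xi> - (\<eta> + \<zeta>)) * (japanese \<eta> powr s + japanese \<zeta> powr s)"
      using japanese_powr_sum_le[OF s(1), of "\<xi> - (\<eta> + \<zeta>)" \<eta> \<zeta>] by (intro decay_japanese_powr_le[OF s]) (auto simp: algebra_simps)
    then have "ennreal (japanese \<xi> powr s) * ennreal (decay ?N (\<xi> - (\<eta> + \<zeta>))) \<le> ennreal (4 powr s) * (?k \<xi> \<eta> \<zeta> * (ennreal (japanese \<eta> powr s) + ennreal (japanese \<zeta> powr s)))"
      by (simp add: ennreal_mult[symmetric] ennreal_plus[symmetric] ennreal_leI mult.assoc del: ennreal_mult ennreal_plus)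
    from mult_right_mono[OF this, of ?L]
    have "ennreal (japanese \<xi> powr s) * (ennreal (decay ?N (\<xi> - (\<eta> + \<zeta>))) * ?L) \<le> ennreal (4 powr s) * (?k \<xi> \<eta> \<zeta> * (ennreal (japanese \<eta> powr s) * ?L) + ?k \<xi> \<eta> \<zeta> * (ennreal (japanese \<zeta> powr s) * ?L))"
      by (simp add: distrib_left distrib_right mult_ac)
    also have "\<dots> \<le> ennreal (4 powr s) * (?k \<xi> \<eta> \<zeta> * (ennreal (japanese \<eta> powr s) * (b \<zeta> * Lp_norm p (\<lambda>z. U z \<eta>))) + ?k \<xi> \<eta> \<zeta> * (ennreal (japanese \<zeta> powr s) * (a \<eta> * Lp_norm p (\<lambda>z. V z \<zeta>))))"
      by (intro mult_left_mono add_mono UV1 UV2) simp_all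
    finally show ?thesis by (simp add: A_def B_def mult_ac)
  qed
  define S1 where "S1 \<xi> = (\<integral>\<^sup>+\<zeta>. (\<integral>\<^sup>+\<eta>. ?k \<xi> \<eta> \<zeta> * (A \<eta> * b \<zeta>) \<partial>lborel) \<partial>lborel)" for \<xi>
  define S2 where "S2 \<xi> = (\<integral>\<^sup>+\<eta>. (\<integral>\<^sup>+\<zeta>. ?k \<xi> \<eta> \<zeta> * (B \<zeta> * a \<eta>) \<partial>lborel) \<partial>lborel)" for \<xi>
  have [measurable]: "S1 \<in> borel_measurable borel" "S2 \<in> borel_measurable borel" unfolding S1_def[abs_def] S2_def[abs_def] by measurable
  have [measurable]: "(\<lambda>(\<zeta>, \<eta>). Lp_norm p (\<lambda>z. U z \<eta> * V z \<zeta>)) \<in> borel_measurable (lborel \<Otimes>\<^sub>M lborel)"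
    unfolding split_def by (rule measurable_Lp_norm[OF p]) measurable
  have "ennreal (japanese \<xi> powr s) * Lp_norm p (\<lambda>x. prod_conv ?N U V x \<xi>) \<le> (?I * ennreal (4 powr s)) * (S1 \<xi> + S2 \<xi>)" for \<xi>
  proof -
    have "ennreal (japanese \<xi> powr s) * Lp_norm p (\<lambda>x. prod_conv ?N U V x \<xi>) \<le> 
       ennreal (japanese \<xi> powr s) * (?I * (\<integral>\<^sup>+\<zeta>. (\<integral>\<^sup>+\<eta>. ennreal (decay ?N (\<xi> - (\<eta> + \<zeta>))) * Lp_norm p (\<lambda>z. U z \<eta> * V z \<zeta>) \<partial>lborel) \<partial>lborel))"
      by (intro mult_left_mono L) simp
    also have "\<dots> = ?I * (\<integral>\<^sup>+\<zeta>. (\<integral>\<^sup>+\<eta>. ennreal (japanese \<xi> powr s) * (ennreal (decay ?N (\<xi> - (\<eta> + \<zeta>))) * Lp_norm p (\<lambda>z. U z \<eta> * V z \<zeta>)) \<partial>lborel) \<partial>lborel)"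
      by (simp add: nn_integral_cmult mult.left_commute)
    also have "\<dots> \<le> ?I * (\<integral>\<^sup>+\<zeta>. (\<integral>\<^sup>+\<eta>. ennreal (4 powr s) * (?k \<xi> \<eta> \<zeta> * (A \<eta> * b \<zeta>) + ?k \<xi> \<eta> \<zeta> * (B \<zeta> * a \<eta>)) \<partial>lborel) \<partial>lborel)"
      by (intro mult_left_mono nn_integral_mono pt) simp
    also have "\<dots> = ?I * (ennreal (4 powr s) * (S1 \<xi> + (\<integral>\<^sup>+\<zeta>. (\<integral>\<^sup>+\<eta>. ?k \<xi> \<eta> \<zeta> * (B \<zeta> * a \<eta>) \<partial>lborel) \<partial>lborel)))"
      unfolding S1_def by (simp add: nn_integral_cmult nn_integral_add)
    \<comment> \<open>In the second summand the frequencies exchange their roles: the outer integral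
      in \<open>nn_integral_conv2\<close> belongs to the factor measured in
      \<open>L\<^sup>1\<close>, which is now \<open>a\<close>.\<close>
    also have "(\<integral>\<^sup>+\<zeta>. (\<integral>\<^sup>+\<eta>. ?k \<xi> \<eta> \<zeta> * (B \<zeta> * a \<eta>) \<partial>lborel) \<partial>lborel) = S2 \<xi>"
      unfolding S2_def by (rule lborel_pair.Fubini') measurable
    finally show ?thesis by (simp add: mult.assoc)
  qed
  then have "mixed_norm p q s (prod_conv ?N U V) \<le> Lp_norm q (\<lambda>\<xi>. (?I * ennreal (4 powr s)) * (S1 \<xi> + S2 \<xi>))"
    unfolding mixed_norm_def by (intro Lp_norm_mono q) measurable
  also have "\<dots> \<le> (?I * ennreal (4 powr s)) * Lp_norm q (\<lambda>\<xi>. S1 \<xi> + S2 \<xi>)"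
    by (rule Lp_norm_cmult_le[OF q]) measurable
  also have "\<dots> \<le> (?I * ennreal (4 powr s)) * (Lp_norm q S1 + Lp_norm q S2)"
    by (intro mult_left_mono Lp_norm_triangle q) simp_all
  also have "\<dots> \<le> (?I * ennreal (4 powr s)) * (decay_int TYPE('d) M * Lp_norm q A * (\<integral>\<^sup>+\<zeta>. b \<zeta> \<partial>lborel) + decay_int TYPE('d) M * Lp_norm q B * (\<integral>\<^sup>+\<zeta>. a \<zeta> \<partial>lborel))"
  proof (intro mult_left_mono add_mono)
    show "Lp_norm q S1 \<le> decay_int TYPE('d) M * Lp_norm q A * (\<integral>\<^sup>+\<zeta>. b \<zeta> \<partial>lborel)"
      unfolding S1_def[abs_def] by (rule nn_integral_conv2[OF q]) measurable
    show "Lp_norm q S2 \<le> decay_int TYPE('d) M * Lp_norm q B * (\<integral>\<^sup>+\<zeta>. a \<zeta> \<partial>lborel)"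
      using nn_integral_conv2[OF q, of B a M] unfolding S2_def[abs_def] by (simp add: add.commute)
  qed simp
  also have "\<dots> = ?I * ennreal (4 powr s) * decay_int TYPE('d) M * (mixed_norm p q s U * (\<integral>\<^sup>+\<zeta>. b \<zeta> \<partial>lborel) + (\<integral>\<^sup>+\<eta>. a \<eta> \<partial>lborel) * mixed_norm p q s V)"
    unfolding mixed_norm_def A_def[abs_def, symmetric] B_def[abs_def, symmetric] by (simp add: distrib_left mult_ac)
  finally show ?thesis .
qed

section \<open>The algebra norms\<close>

lemma liminf_cmult_ennreal_ge:
  fixes a :: "nat \<Rightarrow> ennreal"
  shows "c * liminf a \<le> liminf (\<lambda>m. c * a m)"
proof -
  have "c * liminf a = (SUP n. c * (INF m\<in>{n..}. a m))"
    unfolding liminf_SUP_INF by (rule SUP_mult_left_ennreal)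
  also have "\<dots> \<le> liminf (\<lambda>m. c * a m)"
    unfolding liminf_SUP_INF by (intro SUP_mono' INF_greatest mult_left_mono INF_lower) auto
  finally show ?thesis .
qed

text \<open>Tail infima of \<open>k\<close> lie below all later members, so the version with a
  constant bound applies to them, with the liminf of the norms as that bound.\<close>

lemma Lp_norm_le_liminf:
  fixes h :: "real ^ 'd \<Rightarrow> ennreal"
  assumes p: "1 \<le> p" and [measurable]: "h \<in> borel_measurable borel" "\<And>m. k m \<in> borel_measurable borel"
    and le: "\<And>x. h x \<le> liminf (\<lambda>m. k m x)"
  shows "Lp_norm p h \<le> liminf (\<lambda>m. Lp_norm p (k m))"
proof (rule Lp_norm_liminf_le[OF p, of h "\<lambda>n x. INF m\<in>{n..}. k m x" 0])
  show "AE x in lborel. h x \<le> liminf (\<lambda>n. INF m\<in>{n..}. k m x)"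
  proof (rule AE_I2)
    fix x
    have "(INF m\<in>{n..}. k m x) \<le> liminf (\<lambda>n. INF m\<in>{n..}. k m x)" for n
      unfolding liminf_SUP_INF[of "\<lambda>n. INF m\<in>{n..}. k m x"]
      by (rule SUP_upper2[of n]) (auto intro!: INF_greatest INF_lower)
    then have "liminf (\<lambda>m. k m x) \<le> liminf (\<lambda>n. INF m\<in>{n..}. k m x)"
      unfolding liminf_SUP_INF[of "\<lambda>m. k m x"] by (rule SUP_least)
    then show "h x \<le> liminf (\<lambda>n. INF m\<in>{n..}. k m x)" using le[of x] by (rule order_trans[rotated])
  qed
  fix n
  have "Lp_norm p (\<lambda>x. INF m\<in>{n..}. k m x) \<le> (INF m\<in>{n..}. Lp_norm p (k m))"
    by (intro INF_greatest Lp_norm_mono p INF_lower) auto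
  also have "\<dots> \<le> liminf (\<lambda>m. Lp_norm p (k m))" unfolding liminf_SUP_INF by (rule SUP_upper) simp
  finally show "Lp_norm p (\<lambda>x. INF m\<in>{n..}. k m x) \<le> liminf (\<lambda>m. Lp_norm p (k m))" .
qed auto

text \<open>Fatou's lemma in position at each frequency, and once more in frequency.\<close>

lemma mixed_norm_liminf:
  fixes F :: "real ^ 'd \<Rightarrow> real ^ 'd \<Rightarrow> ennreal"
  assumes p: "1 \<le> p" and q: "1 \<le> q" and F: "tf_measurable F" and G: "\<And>m. tf_measurable (G m)"
    and lim: "\<And>x \<xi>. (\<lambda>m. G m x \<xi>) \<longlonglongrightarrow> F x \<xi>" and c: "\<And>m. m0 \<le> m \<Longrightarrow> mixed_norm p q s (G m) \<le> c"
  shows "mixed_norm p q s F \<le> c"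
  unfolding mixed_norm_def
proof (rule Lp_norm_liminf_le[OF q])
  have [measurable]: "(\<lambda>\<xi>. Lp_norm p (\<lambda>x. F x \<xi>)) \<in> borel_measurable borel" using measurable_Lp_norm[OF p F] by simp
  have [measurable]: "(\<lambda>\<xi>. Lp_norm p (\<lambda>x. G m x \<xi>)) \<in> borel_measurable borel" for m using measurable_Lp_norm[OF p G] by simp
  show "(\<lambda>\<xi>. ennreal (japanese \<xi> powr s) * Lp_norm p (\<lambda>x. F x \<xi>)) \<in> borel_measurable borel" by measurable
  show "(\<lambda>\<xi>. ennreal (japanese \<xi> powr s) * Lp_norm p (\<lambda>x. G m x \<xi>)) \<in> borel_measurable borel" for m by measurable
  show "Lp_norm q (\<lambda>\<xi>. ennreal (japanese \<xi> powr s) * Lp_norm p (\<lambda>x. G m x \<xi>)) \<le> c" if "m0 \<le> m" for m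
    using c[OF that] unfolding mixed_norm_def .
  show "AE \<xi> in lborel. ennreal (japanese \<xi> powr s) * Lp_norm p (\<lambda>x. F x \<xi>) \<le> liminf (\<lambda>m. ennreal (japanese \<xi> powr s) * Lp_norm p (\<lambda>x. G m x \<xi>))"
  proof (rule AE_I2)
    fix \<xi>
    have "Lp_norm p (\<lambda>x. F x \<xi>) \<le> liminf (\<lambda>m. Lp_norm p (\<lambda>x. G m x \<xi>))"
    proof (rule Lp_norm_le_liminf[OF p tf_measurable_section[OF F] tf_measurable_section[OF G]])
      show "F x \<xi> \<le> liminf (\<lambda>m. G m x \<xi>)" for x
        using lim_imp_Liminf[OF _ lim[of x \<xi>]] by simp
    qed
    then have "ennreal (japanese \<xi> powr s) * Lp_norm p (\<lambda>x. F x \<xi>) \<le> ennreal (japanese \<xi> powr s) * liminf (\<lambda>m. Lp_norm p (\<lambda>x. G m x \<xi>))"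
      by (rule mult_left_mono) simp
    also have "\<dots> \<le> liminf (\<lambda>m. ennreal (japanese \<xi> powr s) * Lp_norm p (\<lambda>x. G m x \<xi>))" by (rule liminf_cmult_ennreal_ge)
    finally show "ennreal (japanese \<xi> powr s) * Lp_norm p (\<lambda>x. F x \<xi>) \<le> liminf (\<lambda>m. ennreal (japanese \<xi> powr s) * Lp_norm p (\<lambda>x. G m x \<xi>))" .
  qed
qed

section \<open>The algebra operations on bounded continuous functions\<close>

definition bc_mult :: "((real ^ 'd) \<Rightarrow>\<^sub>C complex) \<Rightarrow> ((real ^ 'd) \<Rightarrow>\<^sub>C complex) \<Rightarrow> (real ^ 'd) \<Rightarrow>\<^sub>C complex" where
  "bc_mult u v = Bcontfun (\<lambda>x. apply_bcontfun u x * apply_bcontfun v x)"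

definition bc_scale :: "complex \<Rightarrow> ((real ^ 'd) \<Rightarrow>\<^sub>C complex) \<Rightarrow> (real ^ 'd) \<Rightarrow>\<^sub>C complex" where
  "bc_scale c u = Bcontfun (\<lambda>x. c * apply_bcontfun u x)"

definition bc_cnj :: "((real ^ 'd) \<Rightarrow>\<^sub>C complex) \<Rightarrow> (real ^ 'd) \<Rightarrow>\<^sub>C complex" where
  "bc_cnj u = Bcontfun (\<lambda>x. cnj (apply_bcontfun u x))"

lemma apply_bc_mult [simp]: "apply_bcontfun (bc_mult u v) = (\<lambda>x. apply_bcontfun u x * apply_bcontfun v x)"
  unfolding bc_mult_def
  by (rule Bcontfun_inverse, rule bcontfun_normI[where b="norm u * norm v"])
     (auto intro!: continuous_on_mult mult_mono norm_bounded simp: norm_mult)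

lemma apply_bc_scale [simp]: "apply_bcontfun (bc_scale c u) = (\<lambda>x. c * apply_bcontfun u x)"
  unfolding bc_scale_def
  by (rule Bcontfun_inverse, rule bcontfun_normI[where b="cmod c * norm u"])
     (auto intro!: continuous_on_mult mult_mono norm_bounded simp: norm_mult)

lemma apply_bc_cnj [simp]: "apply_bcontfun (bc_cnj u) = (\<lambda>x. cnj (apply_bcontfun u x))"
  unfolding bc_cnj_def
  by (rule Bcontfun_inverse, rule bcontfun_normI[where b="norm u"])
     (auto intro!: continuous_on_cnj norm_bounded)

abbreviation dis :: "((real ^ 'd) \<Rightarrow>\<^sub>C complex) \<Rightarrow> 'd::finite functional" where
  "dis u \<equiv> distr_of_fun (apply_bcontfun u)"

lemma dis_add: "dis (u + v) = dis u + dis v"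
proof
  show "dis (u + v) \<phi> = (dis u + dis v) \<phi>" for \<phi>
  proof (cases "\<phi> \<in> schwartz")
    case True
    then show ?thesis
      using bcontfun_mult_schwartz_integrable[OF True, of u] bcontfun_mult_schwartz_integrable[OF True, of v]
      by (simp add: distr_of_fun_apply distrib_right)
  qed (simp add: distr_of_fun_def)
qed

lemma dis_scale: "dis (bc_scale c u) = scale_distr c (dis u)"
  by (auto simp: distr_of_fun_def scale_distr_def fun_eq_iff mult.assoc)

lemma dis_diff: "dis (u - v) = dis u - dis v"
  using dis_add[of "u - v" v] by simp

lemma dis_0: "dis 0 = 0"
  using dis_diff[of 0 0] by simp

lemma stft_add: "stft g (f + h) x \<xi> = stft g f x \<xi> + stft g h x \<xi>"
  by (simp add: stft_eq distrib_left)

lemma stft_scale: "stft g (scale_distr c f) x \<xi> = c * stft g f x \<xi>"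
  by (simp add: stft_eq scale_distr_def)

text \<open>For the last claim of the theorem: once the embedding holds, the sum of the two norms is
  equivalent to the first one alone. The algebraic axioms carry over unchanged, completeness and
  boundedness through the equivalence.\<close>

lemma equiv_norm_banach_star_algebra:
  assumes B: "banach_star_algebra_on sc X n1 m st"
    and nonneg: "\<And>x. x \<in> X \<Longrightarrow> 0 \<le> n2 x"
    and le: "\<And>x. x \<in> X \<Longrightarrow> n2 x \<le> n1 x" "\<And>x. x \<in> X \<Longrightarrow> n1 x \<le> C * n2 x" "0 \<le> C"
    and tri: "\<And>x y. x \<in> X \<Longrightarrow> y \<in> X \<Longrightarrow> n2 (x + y) \<le> n2 x + n2 y"
    and scl: "\<And>x c. x \<in> X \<Longrightarrow> n2 (sc c x) = cmod c * n2 x"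
  shows "banach_star_algebra_on sc X n2 m st"
proof -
  interpret B: banach_star_algebra_on sc X n1 m st by fact
  show ?thesis
  proof
    show "B.subspace X" by (rule B.subspace_X)
    show "0 \<le> n2 x" if "x \<in> X" for x by (rule nonneg[OF that])
    show "n2 x = 0 \<longleftrightarrow> x = 0" if x: "x \<in> X" for x
      using nonneg[OF x] le(1)[OF x] le(2)[OF x] B.nrm_nonneg[OF x] B.nrm_eq_0_iff[OF x] by auto
    show "\<exists>x\<in>X. (\<lambda>n::nat. n2 (u n - x)) \<longlonglongrightarrow> 0"
      if u: "\<And>n. u n \<in> X" and cau: "\<And>e. e > 0 \<Longrightarrow> \<exists>N. \<forall>m\<ge>N. \<forall>n\<ge>N. n2 (u m - u n) < e" for u
    proof -
      have c1: "\<exists>N. \<forall>m\<ge>N. \<forall>n\<ge>N. n1 (u m - u n) < e" if e: "e > 0" for e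
      proof -
        \<comment> \<open>\<open>C\<close> may vanish, hence the denominator
          \<open>C + 1\<close>.\<close>
        have "e / (C + 1) > 0" using e le(3) by simp
        then obtain N where N: "\<forall>m\<ge>N. \<forall>n\<ge>N. n2 (u m - u n) < e / (C + 1)" using cau by blast
        have "n1 (u m - u n) < e" if "m \<ge> N" "n \<ge> N" for m n
        proof -
          have X: "u m - u n \<in> X" by (intro B.subspace_diff B.subspace_X u)
          have "n1 (u m - u n) \<le> C * n2 (u m - u n)" by (rule le(2)[OF X])
          also have "\<dots> \<le> C * (e / (C + 1))" using N that le(3) by (intro mult_left_mono) (auto intro: less_imp_le)
          also have "\<dots> < e" using e le(3) by (simp add: field_simps)
          finally show ?thesis .
        qed
        then show ?thesis by blast
      qed
      obtain x where x: "x \<in> X" "(\<lambda>n. n1 (u n - x)) \<longlonglongrightarrow> 0"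
        by (rule bexE[OF B.nrm_complete[of u, OF u c1]])
      have X: "u n - x \<in> X" for n by (intro B.subspace_diff B.subspace_X u x)
      have "(\<lambda>n. n2 (u n - x)) \<longlonglongrightarrow> 0"
      proof (rule tendsto_sandwich[OF _ _ tendsto_const x(2)])
        show "\<forall>\<^sub>F n in sequentially. 0 \<le> n2 (u n - x)" by (intro always_eventually allI nonneg X)
        show "\<forall>\<^sub>F n in sequentially. n2 (u n - x) \<le> n1 (u n - x)" by (intro always_eventually allI le(1) X)
      qed
      then show ?thesis using x(1) by blast
    qed
    obtain K where K: "\<forall>x\<in>X. \<forall>y\<in>X. n1 (m x y) \<le> K * n1 x * n1 y" using B.mult_bounded by blast
    have "n2 (m x y) \<le> (\<bar>K\<bar> * C * C) * n2 x * n2 y" if x: "x \<in> X" and y: "y \<in> X" for x y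
    proof -
      have "n2 (m x y) \<le> K * (n1 x * n1 y)" using K x y le(1)[OF B.mult_closed[OF x y]] by (force simp: mult.assoc)
      also have "\<dots> \<le> \<bar>K\<bar> * (n1 x * n1 y)" by (intro mult_right_mono mult_nonneg_nonneg B.nrm_nonneg x y) simp
      also have "\<dots> \<le> \<bar>K\<bar> * ((C * n2 x) * (C * n2 y))"
        by (intro mult_left_mono mult_mono le x y mult_nonneg_nonneg nonneg B.nrm_nonneg) simp
      finally show ?thesis by (simp add: mult_ac)
    qed
    then show "\<exists>C. \<forall>x\<in>X. \<forall>y\<in>X. n2 (m x y) \<le> C * n2 x * n2 y" by blast
    obtain L where L: "\<forall>x\<in>X. n1 (st x) \<le> L * n1 x" using B.star_bounded by blast
    have "n2 (st x) \<le> (\<bar>L\<bar> * C) * n2 x" if x: "x \<in> X" for x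
    proof -
      have "n2 (st x) \<le> L * n1 x" using L x le(1)[OF B.star_closed[OF x]] by force
      also have "\<dots> \<le> \<bar>L\<bar> * n1 x" by (intro mult_right_mono B.nrm_nonneg x) simp
      also have "\<dots> \<le> \<bar>L\<bar> * (C * n2 x)" by (intro mult_left_mono le x) simp
      finally show ?thesis by (simp add: mult_ac)
    qed
    then show "\<exists>C. \<forall>x\<in>X. n2 (st x) \<le> C * n2 x" by blast
  qed (use tri scl B.mult_closed B.mult_assoc B.mult_add_left B.mult_add_right B.mult_scale_left B.mult_scale_right
      B.star_closed B.star_add B.star_scale B.star_mult B.star_star in auto)
qed

section \<open>Norm estimates for a fixed nonzero window\<close>

locale stft_window =
  fixes g :: "real ^ 'd \<Rightarrow> complex" and y0
  assumes g: "g \<in> schwartz" and g0: "g y0 \<noteq> 0"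
begin

abbreviation M1 :: "'d functional set" where "M1 \<equiv> modulation_space g \<infinity> 1 0"

abbreviation E1 :: "'d functional \<Rightarrow> ennreal" where "E1 \<equiv> modulation_enorm g \<infinity> 1 0"

lemma Cb_rep_dis: "Cb_rep (dis u) = (u :: (real ^ 'd) \<Rightarrow>\<^sub>C complex)"
  unfolding Cb_rep_def
proof (rule the_equality)
  fix v :: "(real ^ 'd) \<Rightarrow>\<^sub>C complex" assume "dis v = dis u"
  then show "v = u" by (rule distr_of_fun_inject[OF g g0])
qed (rule refl)

lemma M1_cases:
  assumes "f \<in> M1" obtains u where "f = dis u" "E1 (dis u) < \<infinity>"
  using bounded_continuous_representation[OF g g0] assms by (auto simp: modulation_space_def)

lemma distr_mult_dis: "distr_mult (dis u) (dis v) = dis (bc_mult u (v :: (real ^ 'd) \<Rightarrow>\<^sub>C complex))"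
  by (simp add: distr_mult_def Cb_rep_dis)

lemma distr_cnj_dis: "distr_cnj (dis u) = dis (bc_cnj (u :: (real ^ 'd) \<Rightarrow>\<^sub>C complex))"
  by (simp add: distr_cnj_def Cb_rep_dis)

lemma Cb_bound: "\<exists>C\<ge>0. \<forall>u. E1 (dis u) < \<infinity> \<longrightarrow> norm u \<le> C * enn2real (E1 (dis u))"
proof -
  obtain C where C: "C \<ge> 0" "\<forall>f\<in>tempered_distributions. E1 f < \<infinity> \<longrightarrow>
    (\<exists>u. dis u = f \<and> norm u \<le> C * enn2real (E1 f))"
    using bounded_continuous_representation[OF g g0] by blast
  have "norm u \<le> C * enn2real (E1 (dis u))" if "E1 (dis u) < \<infinity>" for u
    using C(2) that distr_of_fun_tempered[of u] distr_of_fun_inject[OF g g0] by metis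
  then show ?thesis using C(1) by blast
qed

text \<open>The constant is the \<open>L\<^sup>1\<close> norm of the window times the normalisation.
  Hence the transforms of a uniformly convergent sequence converge at every point of phase
  space.\<close>

lemma stft_uniform_bound: "\<exists>K\<ge>0. \<forall>u x \<xi>. cmod (stft g (dis u) x \<xi>) \<le> K * norm u"
proof -
  note [measurable] = schwartz_measurable[OF g]
  define I where "I = (LINT y|lborel. cmod (g y))"
  have gi: "integrable lborel (\<lambda>y. cmod (g (y - x)))" for x
    using bcontfun_mult_schwartz_integrable[OF shift_schwartz[OF g, of x], of "const_bcontfun 1"] by (simp add: integrable_norm)
  have I: "(LINT y|lborel. cmod (g (y - x))) = I" for x
  proof -
    have "(LINT y|lborel. complex_of_real (cmod (g y))) = (LINT y|lborel. complex_of_real (cmod (g (y - x))))"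
      using integral_lborel_affine[of "\<lambda>y. complex_of_real (cmod (g y))" 1 "- x"] by simp
    then show ?thesis unfolding I_def by simp
  qed
  have I0: "0 \<le> I" unfolding I_def by simp
  let ?\<gamma> = "stft_const TYPE('d)"
  have "cmod (stft g (dis u) x \<xi>) \<le> (cmod ?\<gamma> * I) * norm u" for u x \<xi>
  proof -
    have "cmod (ft (\<lambda>y. apply_bcontfun u y * cnj (g (y - x))) \<xi>) \<le> (LINT y|lborel. cmod (apply_bcontfun u y * cnj (g (y - x)) * cnj (chr \<xi> y)))"
      unfolding ft_def by (rule integral_norm_bound)
    also have "\<dots> \<le> (LINT y|lborel. norm u * cmod (g (y - x)))"
    proof (rule Bochner_Integration.integral_mono)
      show "integrable lborel (\<lambda>y. norm u * cmod (g (y - x)))" using gi by simp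
      show "integrable lborel (\<lambda>y. cmod (apply_bcontfun u y * cnj (g (y - x)) * cnj (chr \<xi> y)))"
        by (intro integrable_norm integrable_mult_chr bcontfun_mult_schwartz_integrable shift_schwartz[OF schwartz_cnj[OF g]])
      show "cmod (apply_bcontfun u y * cnj (g (y - x)) * cnj (chr \<xi> y)) \<le> norm u * cmod (g (y - x))" for y
        using norm_bounded[of u y] by (simp add: norm_mult mult_right_mono)
    qed
    also have "\<dots> = norm u * I" by (simp add: I)
    finally have "cmod ?\<gamma> * cmod (ft (\<lambda>y. apply_bcontfun u y * cnj (g (y - x))) \<xi>) \<le> cmod ?\<gamma> * (norm u * I)"
      by (rule mult_left_mono) simp
    then show ?thesis unfolding stft_distr_of_fun[OF g] norm_mult by (simp add: mult_ac)
  qed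
  then show ?thesis using I0 by (intro exI[of _ "cmod ?\<gamma> * I"]) auto
qed

lemma stft_abs_dis_measurable: "tf_measurable (stft_abs g (dis u))"
  by (rule stft_abs_measurable[OF distr_of_fun_tempered g])

end

locale modulation_norms = stft_window g y0 for g :: "real ^ 'd \<Rightarrow> complex" and y0 +
  fixes p q :: ennreal and s :: real
  assumes p: "1 \<le> p" and q: "1 \<le> q" and s: "0 \<le> s"
begin

abbreviation E :: "((real ^ 'd) \<Rightarrow>\<^sub>C complex) \<Rightarrow> ennreal" where
  "E u \<equiv> modulation_enorm g p q s (dis u)"

lemma E_add: "E (u + v) \<le> E u + E v"
proof -
  note m = stft_abs_dis_measurable
  have m2: "tf_measurable (\<lambda>x \<xi>. stft_abs g (dis u) x \<xi> + stft_abs g (dis v) x \<xi>)"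
    using borel_measurable_add[OF m[of u] m[of v]] by (simp add: split_def)
  have "E (u + v) \<le> mixed_norm p q s (\<lambda>x \<xi>. stft_abs g (dis u) x \<xi> + stft_abs g (dis v) x \<xi>)"
    unfolding modulation_enorm_eq
  proof (rule mixed_norm_mono[OF p q m m2])
    fix x \<xi>
    let ?a = "stft g (dis u) x \<xi>" and ?b = "stft g (dis v) x \<xi>"
    have "ennreal (cmod (?a + ?b)) \<le> ennreal (cmod ?a + cmod ?b)" by (rule ennreal_leI[OF norm_triangle_ineq])
    also have "\<dots> = ennreal (cmod ?a) + ennreal (cmod ?b)" by (rule ennreal_plus) simp_all
    finally show "stft_abs g (dis (u + v)) x \<xi> \<le> stft_abs g (dis u) x \<xi> + stft_abs g (dis v) x \<xi>"
      unfolding stft_abs_def dis_add stft_add .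
  qed
  also have "\<dots> \<le> E u + E v" unfolding modulation_enorm_eq by (rule mixed_norm_triangle[OF p q m m])
  finally show ?thesis .
qed

lemma E_scale: "E (bc_scale c u) = ennreal (cmod c) * E u"
proof -
  have "stft_abs g (dis (bc_scale c u)) = (\<lambda>x \<xi>. ennreal (cmod c) * stft_abs g (dis u) x \<xi>)"
    unfolding stft_abs_def dis_scale stft_scale by (simp add: norm_mult ennreal_mult)
  then show ?thesis unfolding modulation_enorm_eq by (simp add: mixed_norm_cmult[OF p q stft_abs_dis_measurable])
qed

lemma E_diff_commute: "E (u - v) = E (v - u)"
proof -
  have "u - v = bc_scale (- 1) (v - u)" by (rule bcontfun_eqI) simp
  then show ?thesis using E_scale[of "- 1" "v - u"] by simp
qed

lemma E_0: "E 0 = 0"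
proof -
  have "(0 :: (real ^ 'd) \<Rightarrow>\<^sub>C complex) = bc_scale 0 0" by (rule bcontfun_eqI) simp
  then show ?thesis using E_scale[of 0 0] by simp
qed

lemma E_mult: "\<exists>C\<ge>0. \<forall>u v. E1 (dis u) < \<infinity> \<longrightarrow> E1 (dis v) < \<infinity> \<longrightarrow>
  E (bc_mult u v) \<le> ennreal C * (E u * E1 (dis v) + E1 (dis u) * E v)"
proof -
  let ?M = "Suc CARD('d)"
  \<comment> \<open>\<open>K\<close> rounds \<open>s\<close> up, as decay has integer orders; the
    \<open>?M\<close> further orders are for integrability.\<close>
  define K where "K = nat \<lceil>s\<rceil>"
  have K: "s \<le> real K" unfolding K_def by linarith
  obtain C where C0: "C \<ge> 0" and C1: "\<forall>u v :: (real ^ 'd) \<Rightarrow>\<^sub>C complex. E1 (dis u) < \<infinity> \<longrightarrow> E1 (dis v) < \<infinity> \<longrightarrow>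
    (\<forall>x \<xi>. stft_abs g (distr_of_fun (\<lambda>y. apply_bcontfun u y * apply_bcontfun v y)) x \<xi> \<le>
      ennreal C * prod_conv (?M + K) (stft_abs g (dis u)) (stft_abs g (dis v)) x \<xi>)"
    using stft_mult_le[OF g g0, of "?M + K"] by (elim exE conjE) (rule that)
  note C = C0 C1[rule_format, folded apply_bc_mult]
  define D where "D = decay_int TYPE('d) (?M + K) * ennreal (4 powr s) * decay_int TYPE('d) ?M"
  have "D < \<infinity>" unfolding D_def using decay_int_finite[of "?M + K", where 'd='d] decay_int_finite[of ?M, where 'd='d] by (simp add: ennreal_mult_less_top)
  then obtain D' where D': "D = ennreal D'" "0 \<le> D'" by (cases D) auto
  have "E (bc_mult u v) \<le> ennreal (C * D') * (E u * E1 (dis v) + E1 (dis u) * E v)"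
    if fu: "E1 (dis u) < \<infinity>" and fv: "E1 (dis v) < \<infinity>" for u v
  proof -
    let ?U = "stft_abs g (dis u)" and ?V = "stft_abs g (dis v)"
    note m = stft_abs_dis_measurable[of u] stft_abs_dis_measurable[of v]
    have m2: "tf_measurable (\<lambda>x \<xi>. ennreal C * prod_conv (?M + K) ?U ?V x \<xi>)"
      using prod_conv_measurable[OF m, of "?M + K"] unfolding split_def by measurable
    have "E (bc_mult u v) \<le> mixed_norm p q s (\<lambda>x \<xi>. ennreal C * prod_conv (?M + K) ?U ?V x \<xi>)"
      unfolding modulation_enorm_eq by (rule mixed_norm_mono[OF p q stft_abs_dis_measurable m2 C(2)[OF fu fv]])
    also have "\<dots> = ennreal C * mixed_norm p q s (prod_conv (?M + K) ?U ?V)"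
      by (rule mixed_norm_cmult[OF p q prod_conv_measurable[OF m]])
    also have "\<dots> \<le> ennreal C * (D * (mixed_norm p q s ?U * (\<integral>\<^sup>+\<zeta>. stft_sup g (dis v) \<zeta> \<partial>lborel) + (\<integral>\<^sup>+\<eta>. stft_sup g (dis u) \<eta> \<partial>lborel) * mixed_norm p q s ?V))"
      unfolding D_def
      by (intro mult_left_mono mixed_norm_prod_conv[OF p q m s K] stft_sup_measurable distr_of_fun_tempered g)
         (auto simp: stft_abs_def intro: stft_le_sup distr_of_fun_tempered g)
    finally show ?thesis
      unfolding nn_integral_stft_sup[OF distr_of_fun_tempered g] modulation_enorm_eq[symmetric] D'(1)
      using C(1) D'(2) by (simp only: ennreal_mult mult.assoc)
  qed
  then show ?thesis using C(1) D'(2) by (intro exI[of _ "C * D'"]) auto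
qed

text \<open>Conjugation of \<open>u\<close> reflects the frequency, conjugates the value and
  replaces the window by its conjugate. The weight is even and the modulus is unaffected, so only
  the change of window costs a constant.\<close>

lemma E_cnj: "\<exists>C\<ge>0. \<forall>u. E (bc_cnj u) \<le> ennreal C * E u"
proof -
  let ?M = "Suc CARD('d)" and ?\<gamma> = "stft_const TYPE('d)"
  define K where "K = nat \<lceil>s\<rceil>"
  have K: "s \<le> real K" unfolding K_def by linarith
  obtain C where C: "C \<ge> 0" "\<And>f x \<xi>. f\<in>tempered_distributions \<Longrightarrow>
    ennreal (cmod (f (tf_shift g (x, \<xi>)))) \<le> ennreal C * tf_conv (?M + K) (stft_abs g f) x \<xi>"
    using change_of_window[OF g g0 g, of "?M + K"] by metis
  define D where "D = ennreal (2 powr s) * (decay_int TYPE('d) (?M + K) * decay_int TYPE('d) ?M)"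
  have "D < \<infinity>" unfolding D_def using decay_int_finite[of "?M + K", where 'd='d] decay_int_finite[of ?M, where 'd='d] by (simp add: ennreal_mult_less_top)
  then obtain D' where D': "D = ennreal D'" "0 \<le> D'" by (cases D) auto
  have "E (bc_cnj u) \<le> ennreal (cmod ?\<gamma> * C * D') * E u" for u
  proof -
    let ?F = "tf_conv (?M + K) (stft_abs g (dis u))"
    note m = stft_abs_dis_measurable[of u]
    have Fm: "tf_measurable ?F" by (rule tf_conv_measurable[OF m])
    have st: "stft_abs g (dis (bc_cnj u)) x \<xi> \<le> ennreal (cmod ?\<gamma> * C) * ?F x (- \<xi>)" for x \<xi>
    proof -
      have "stft g (dis (bc_cnj u)) x \<xi> = ?\<gamma> * cnj (dis u (tf_shift g (x, - \<xi>)))"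
      proof -
        have "ft (\<lambda>y. apply_bcontfun (bc_cnj u) y * cnj (g (y - x))) \<xi> = (LINT y|lborel. cnj (apply_bcontfun u y * tf_shift g (x, - \<xi>) y))"
          unfolding ft_def by (simp add: tf_shift_def chr_minus_left mult.assoc)
        also have "\<dots> = cnj (LINT y|lborel. apply_bcontfun u y * tf_shift g (x, - \<xi>) y)" by (rule Bochner_Integration.integral_cnj)
        finally show ?thesis
          unfolding stft_distr_of_fun[OF g] distr_of_fun_apply[OF tf_shift_schwartz[OF g]] by (simp only:)
      qed
      then have "stft_abs g (dis (bc_cnj u)) x \<xi> = ennreal (cmod ?\<gamma>) * ennreal (cmod (dis u (tf_shift g (x, - \<xi>))))"
        unfolding stft_abs_def by (simp only: norm_mult complex_mod_cnj) (rule ennreal_mult; simp)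
      also have "\<dots> \<le> ennreal (cmod ?\<gamma>) * (ennreal C * ?F x (- \<xi>))"
        by (intro mult_left_mono C distr_of_fun_tempered) simp
      finally show ?thesis using C(1) by (simp only: ennreal_mult norm_ge_zero mult.assoc)
    qed
    have Fm': "tf_measurable (\<lambda>x \<xi>. ?F x (- \<xi>))"
      unfolding split_def by (rule tf_measurable_compose[OF Fm]) measurable
    have Fm'': "tf_measurable (\<lambda>x \<xi>. ennreal (cmod ?\<gamma> * C) * ?F x (- \<xi>))"
      using Fm' unfolding split_def by measurable
    have [measurable]: "(\<lambda>\<xi>. Lp_norm p (\<lambda>x. ?F x \<xi>)) \<in> borel_measurable borel" using measurable_Lp_norm[OF p Fm] by simp
    have "E (bc_cnj u) \<le> mixed_norm p q s (\<lambda>x \<xi>. ennreal (cmod ?\<gamma> * C) * ?F x (- \<xi>))"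
      unfolding modulation_enorm_eq by (rule mixed_norm_mono[OF p q stft_abs_dis_measurable Fm'' st])
    also have "\<dots> = ennreal (cmod ?\<gamma> * C) * mixed_norm p q s (\<lambda>x \<xi>. ?F x (- \<xi>))"
      by (rule mixed_norm_cmult[OF p q Fm'])
    also have "\<dots> \<le> ennreal (cmod ?\<gamma> * C) * mixed_norm p q s ?F"
    proof (intro mult_left_mono)
      have hm: "(\<lambda>\<xi>. ennreal (japanese \<xi> powr s) * Lp_norm p (\<lambda>x. ?F x \<xi>)) \<in> borel_measurable borel" by measurable
      show "mixed_norm p q s (\<lambda>x \<xi>. ?F x (- \<xi>)) \<le> mixed_norm p q s ?F"
        unfolding mixed_norm_def using Lp_norm_affine_le[OF q hm, of "-1" 0] by simp
    qed simp
    also have "\<dots> \<le> ennreal (cmod ?\<gamma> * C) * (D * E u)"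
      unfolding D_def modulation_enorm_eq by (intro mult_left_mono mixed_norm_tf_conv[OF p q m s K]) simp
    finally show ?thesis unfolding D'(1) using C(1) D'(2) by (simp only: ennreal_mult mult_nonneg_nonneg norm_ge_zero mult.assoc)
  qed
  then show ?thesis using C(1) D'(2) by (intro exI[of _ "cmod ?\<gamma> * C * D'"]) auto
qed

text \<open>Lower semicontinuity of the norm under uniform convergence. The fixed \<open>v\<close>
  will be a member of the sequence, which gives convergence in norm and not merely a finite norm of
  the limit.\<close>

lemma E_limit:
  assumes w: "w \<longlonglongrightarrow> l" and c: "\<And>m. m0 \<le> m \<Longrightarrow> E (w m - v) \<le> c"
  shows "E (l - v) \<le> c"
proof -
  obtain K where K: "K \<ge> 0" "\<And>u x \<xi>. cmod (stft g (dis u) x \<xi>) \<le> K * norm u" using stft_uniform_bound by metis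
  show ?thesis
    unfolding modulation_enorm_eq
  proof (rule mixed_norm_liminf[OF p q stft_abs_dis_measurable stft_abs_dis_measurable])
    show "mixed_norm p q s (stft_abs g (dis (w m - v))) \<le> c" if "m0 \<le> m" for m
      using c[OF that] unfolding modulation_enorm_eq .
    fix x \<xi>
    have "(\<lambda>m. stft g (dis (w m - l)) x \<xi>) \<longlonglongrightarrow> 0"
    proof (rule Lim_null_comparison)
      show "\<forall>\<^sub>F m in sequentially. cmod (stft g (dis (w m - l)) x \<xi>) \<le> K * norm (w m - l)" by (intro always_eventually allI K(2))
      show "(\<lambda>m. K * norm (w m - l)) \<longlonglongrightarrow> 0"
        using tendsto_mult_right_zero[OF tendsto_norm_zero[OF LIM_zero[OF w]]] .
    qed
    then have "(\<lambda>m. stft g (dis (w m - l)) x \<xi> + stft g (dis (l - v)) x \<xi>) \<longlonglongrightarrow> 0 + stft g (dis (l - v)) x \<xi>"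
      by (intro tendsto_add tendsto_const)
    moreover have "stft g (dis (w m - l)) x \<xi> + stft g (dis (l - v)) x \<xi> = stft g (dis (w m - v)) x \<xi>" for m
      unfolding stft_add[symmetric] dis_add[symmetric] by simp
    ultimately have "(\<lambda>m. stft g (dis (w m - v)) x \<xi>) \<longlonglongrightarrow> stft g (dis (l - v)) x \<xi>" by simp
    then show "(\<lambda>m. stft_abs g (dis (w m - v)) x \<xi>) \<longlonglongrightarrow> stft_abs g (dis (l - v)) x \<xi>"
      unfolding stft_abs_def by (intro tendsto_ennrealI tendsto_norm)
  qed
qed

end

text \<open>In what follows the argument of \<open>dis\<close> has to stay an expression in \<open>+\<close>, \<open>bc_mult\<close> etc.\<close>

declare plus_bcontfun.rep_eq [simp del] minus_bcontfun.rep_eq [simp del] zero_bcontfun.rep_eq [simp del]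
  apply_bc_mult [simp del] apply_bc_scale [simp del] apply_bc_cnj [simp del]

lemma bc_mult_assoc: "bc_mult (bc_mult u v) w = bc_mult u (bc_mult v w)"
  by (rule bcontfun_eqI) (simp add: apply_bc_mult mult.assoc)

lemma bc_mult_add_left: "bc_mult (u + v) w = bc_mult u w + bc_mult v w"
  by (rule bcontfun_eqI) (simp add: apply_bc_mult plus_bcontfun.rep_eq distrib_right)

lemma bc_mult_add_right: "bc_mult u (v + w) = bc_mult u v + bc_mult u w"
  by (rule bcontfun_eqI) (simp add: apply_bc_mult plus_bcontfun.rep_eq distrib_left)

lemma bc_mult_scale_left: "bc_mult (bc_scale c u) v = bc_scale c (bc_mult u v)"
  by (rule bcontfun_eqI) (simp add: apply_bc_mult apply_bc_scale mult.assoc)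

lemma bc_mult_scale_right: "bc_mult u (bc_scale c v) = bc_scale c (bc_mult u v)"
  by (rule bcontfun_eqI) (simp add: apply_bc_mult apply_bc_scale mult.left_commute)

lemma bc_cnj_add: "bc_cnj (u + v) = bc_cnj u + bc_cnj v"
  by (rule bcontfun_eqI) (simp add: apply_bc_cnj plus_bcontfun.rep_eq)

lemma bc_cnj_scale: "bc_cnj (bc_scale c u) = bc_scale (cnj c) (bc_cnj u)"
  by (rule bcontfun_eqI) (simp add: apply_bc_cnj apply_bc_scale)

lemma bc_cnj_mult: "bc_cnj (bc_mult u v) = bc_mult (bc_cnj v) (bc_cnj u)"
  by (rule bcontfun_eqI) (simp add: apply_bc_cnj apply_bc_mult mult.commute)

lemma bc_cnj_cnj: "bc_cnj (bc_cnj u) = u"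
  by (rule bcontfun_eqI) (simp add: apply_bc_cnj)

section \<open>The intersection as a Banach star-algebra\<close>

context modulation_norms
begin

text \<open>The norm of \<open>M\<^sub>\<infinity>\<^sub>,\<^sub>1\<close> is an instance of the
  norms considered, so each estimate serves both summands of the intersection norm.\<close>

interpretation one: modulation_norms g y0 \<infinity> 1 0
  by unfold_locales auto

text \<open>The side of the representing functions: closure properties are shown here, where the
  operations are pointwise, and are transported by \<open>dis\<close>.\<close>

definition Y :: "((real ^ 'd) \<Rightarrow>\<^sub>C complex) set" where
  "Y = {u. E u < \<infinity> \<and> E1 (dis u) < \<infinity>}"

definition X :: "'d functional set" where
  "X = modulation_space g p q s \<inter> M1"

definition nrm :: "'d functional \<Rightarrow> real" where
  "nrm f = modulation_norm g p q s f + modulation_norm g \<infinity> 1 0 f"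

lemma X_cases: assumes "f \<in> X" obtains u where "f = dis u" "u \<in> Y"
proof -
  have "f \<in> M1" using assms by (simp add: X_def)
  then obtain u where u: "f = dis u" "E1 (dis u) < \<infinity>" by (rule M1_cases)
  have "E u < \<infinity>" using assms unfolding X_def modulation_space_def u(1) by blast
  with u(2) have "u \<in> Y" unfolding Y_def by blast
  with u(1) show thesis by (rule that)
qed

lemma dis_in_X: "u \<in> Y \<Longrightarrow> dis u \<in> X"
  by (auto simp: X_def Y_def modulation_space_def distr_of_fun_tempered)

lemma nrm_dis: "nrm (dis u) = enn2real (E u) + enn2real (E1 (dis u))"
  by (simp add: nrm_def modulation_norm_def)

lemma Y_add: "u \<in> Y \<Longrightarrow> v \<in> Y \<Longrightarrow> u + v \<in> Y"
  using E_add[of u v] one.E_add[of u v] by (auto simp: Y_def intro: le_less_trans)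

lemma Y_scale: "u \<in> Y \<Longrightarrow> bc_scale c u \<in> Y"
  unfolding Y_def mem_Collect_eq E_scale one.E_scale by (simp add: ennreal_mult_less_top)

lemma Y_0: "0 \<in> Y"
  unfolding Y_def mem_Collect_eq E_0 one.E_0 by simp

lemma Y_diff: "u \<in> Y \<Longrightarrow> v \<in> Y \<Longrightarrow> u - v \<in> Y"
proof -
  assume "u \<in> Y" "v \<in> Y"
  then have "u + bc_scale (- 1) v \<in> Y" by (intro Y_add Y_scale)
  moreover have "u + bc_scale (- 1) v = u - v"
    by (rule bcontfun_eqI) (simp add: plus_bcontfun.rep_eq minus_bcontfun.rep_eq apply_bc_scale)
  ultimately show ?thesis by simp
qed

lemma Y_mult: "u \<in> Y \<Longrightarrow> v \<in> Y \<Longrightarrow> bc_mult u v \<in> Y"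
proof -
  assume u: "u \<in> Y" and v: "v \<in> Y"
  obtain C where C: "E (bc_mult u v) \<le> ennreal C * (E u * E1 (dis v) + E1 (dis u) * E v)"
    using E_mult u v unfolding Y_def by blast
  obtain D where D: "E1 (dis (bc_mult u v)) \<le> ennreal D * (E1 (dis u) * E1 (dis v) + E1 (dis u) * E1 (dis v))"
    using one.E_mult u v unfolding Y_def by blast
  have "ennreal C * (E u * E1 (dis v) + E1 (dis u) * E v) < \<infinity>" "ennreal D * (E1 (dis u) * E1 (dis v) + E1 (dis u) * E1 (dis v)) < \<infinity>"
    using u v by (auto simp: Y_def ennreal_mult_less_top)
  then show ?thesis unfolding Y_def using C D le_less_trans by blast
qed

lemma Y_cnj: "u \<in> Y \<Longrightarrow> bc_cnj u \<in> Y"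
proof -
  assume u: "u \<in> Y"
  obtain C where C: "E (bc_cnj u) \<le> ennreal C * E u" using E_cnj by blast
  obtain D where D: "E1 (dis (bc_cnj u)) \<le> ennreal D * E1 (dis u)" using one.E_cnj by blast
  have "ennreal C * E u < \<infinity>" "ennreal D * E1 (dis u) < \<infinity>"
    using u by (auto simp: Y_def ennreal_mult_less_top)
  then show ?thesis unfolding Y_def using C D le_less_trans by blast
qed

lemma nrm_triangle_dis:
  assumes u: "u \<in> Y" and v: "v \<in> Y"
  shows "nrm (dis (u + v)) \<le> nrm (dis u) + nrm (dis v)"
proof -
  have "enn2real (E (u + v)) \<le> enn2real (E u + E v)" using u v E_add by (intro enn2real_mono) (auto simp: Y_def)
  moreover have "enn2real (E1 (dis (u + v))) \<le> enn2real (E1 (dis u) + E1 (dis v))" using u v one.E_add by (intro enn2real_mono) (auto simp: Y_def)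
  ultimately show ?thesis using u v by (simp add: nrm_dis enn2real_plus Y_def)
qed

lemma nrm_scale_dis: "nrm (dis (bc_scale c u)) = cmod c * nrm (dis u)"
  unfolding nrm_dis E_scale one.E_scale by (simp add: enn2real_mult distrib_left)

lemma E_le_nrm: "u \<in> Y \<Longrightarrow> nrm (dis u) \<le> e \<Longrightarrow> E u \<le> ennreal e \<and> E1 (dis u) \<le> ennreal e"
proof -
  assume u: "u \<in> Y" and n: "nrm (dis u) \<le> e"
  have "enn2real (E u) \<le> e" "enn2real (E1 (dis u)) \<le> e"
    using n enn2real_nonneg[of "E u"] enn2real_nonneg[of "E1 (dis u)"] unfolding nrm_dis by linarith+
  then have "ennreal (enn2real (E u)) \<le> ennreal e" "ennreal (enn2real (E1 (dis u))) \<le> ennreal e" by (auto intro: ennreal_leI)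
  then show ?thesis using u by (simp add: Y_def less_top)
qed

lemma complete_X:
  assumes f: "\<And>n. f n \<in> X" and cau: "\<And>e. e > 0 \<Longrightarrow> \<exists>N. \<forall>m\<ge>N. \<forall>n\<ge>N. nrm (f m - f n) < e"
  shows "\<exists>x\<in>X. (\<lambda>n::nat. nrm (f n - x)) \<longlonglongrightarrow> 0"
proof -
  have "\<forall>n. \<exists>u\<in>Y. f n = dis u" using X_cases[OF f] by metis
  then obtain w where w: "\<And>n. w n \<in> Y" "\<And>n. f n = dis (w n)" by metis
  have cau': "\<exists>N. \<forall>m\<ge>N. \<forall>n\<ge>N. nrm (dis (w m - w n)) < e" if "e > 0" for e
    using cau[OF that] unfolding w(2) dis_diff .
  obtain C where C: "C \<ge> 0" "\<And>u. E1 (dis u) < \<infinity> \<Longrightarrow> norm u \<le> C * enn2real (E1 (dis u))" using Cb_bound by blast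
  \<comment> \<open>The \<open>M\<^sub>\<infinity>\<^sub>,\<^sub>1\<close> part of the norm
    dominates the supremum norm, for which bounded continuous functions are complete; this produces
    the candidate \<open>l\<close>.\<close>
  have "Cauchy w"
  proof (rule CauchyI)
    fix e :: real assume e: "0 < e"
    then have "0 < e / (C + 1)" using C(1) by simp
    then obtain N where N: "\<And>m n. m \<ge> N \<Longrightarrow> n \<ge> N \<Longrightarrow> nrm (dis (w m - w n)) < e / (C + 1)" using cau' by blast
    have "norm (w m - w n) < e" if "m \<ge> N" "n \<ge> N" for m n
    proof -
      have y: "w m - w n \<in> Y" by (intro Y_diff w)
      have "norm (w m - w n) \<le> C * enn2real (E1 (dis (w m - w n)))" using y C(2) unfolding Y_def by blast
      also have "\<dots> \<le> C * (e / (C + 1))"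
      proof (rule mult_left_mono[OF _ C(1)])
        show "enn2real (E1 (dis (w m - w n))) \<le> e / (C + 1)"
          using N[OF that] enn2real_nonneg[of "E (w m - w n)"] unfolding nrm_dis by linarith
      qed
      also have "\<dots> < e" using e C(1) by (simp add: field_simps)
      finally show ?thesis .
    qed
    then show "\<exists>M. \<forall>m\<ge>M. \<forall>n\<ge>M. norm (w m - w n) < e" by blast
  qed
  then obtain l where l: "w \<longlonglongrightarrow> l" using Cauchy_convergent convergent_def by blast
  have lim: "\<exists>N. \<forall>n\<ge>N. E (l - w n) \<le> ennreal e \<and> E1 (dis (l - w n)) \<le> ennreal e" if e: "e > 0" for e
  proof -
    obtain N where N: "\<And>m n. m \<ge> N \<Longrightarrow> n \<ge> N \<Longrightarrow> nrm (dis (w m - w n)) < e" using cau'[OF e] by blast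
    have "E (w m - w n) \<le> ennreal e \<and> E1 (dis (w m - w n)) \<le> ennreal e" if "m \<ge> N" "n \<ge> N" for m n
      using N[OF that] by (intro E_le_nrm Y_diff w) simp
    then have "E (l - w n) \<le> ennreal e \<and> E1 (dis (l - w n)) \<le> ennreal e" if "n \<ge> N" for n
      using that E_limit[OF l, of N "w n" "ennreal e"] one.E_limit[OF l, of N "w n" "ennreal e"] by blast
    then show ?thesis by blast
  qed
  \<comment> \<open>The limit differs from some member of the sequence by an element of finite
    norm.\<close>
  have lY: "l \<in> Y"
  proof -
    obtain N where "E (l - w N) \<le> ennreal 1" "E1 (dis (l - w N)) \<le> ennreal 1" using lim[OF zero_less_one] by blast
    then have "l - w N \<in> Y" unfolding Y_def mem_Collect_eq infinity_ennreal_def using le_less_trans[OF _ ennreal_less_top] by blast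
    then have "(l - w N) + w N \<in> Y" by (rule Y_add[OF _ w(1)])
    then show ?thesis by simp
  qed
  have "(\<lambda>n. nrm (f n - dis l)) \<longlonglongrightarrow> 0"
  proof (rule LIMSEQ_I)
    fix e :: real assume e: "0 < e"
    \<comment> \<open>Each of the two summands of the norm is at most \<open>e / 3\<close>, which
      leaves the sum strictly below \<open>e\<close>.\<close>
    obtain N where N: "\<And>n. n \<ge> N \<Longrightarrow> E (l - w n) \<le> ennreal (e / 3) \<and> E1 (dis (l - w n)) \<le> ennreal (e / 3)"
      using lim[of "e / 3"] e by auto
    have "norm (nrm (f n - dis l) - 0) < e" if "n \<ge> N" for n
    proof -
      have eq: "nrm (f n - dis l) = enn2real (E (l - w n)) + enn2real (E1 (dis (l - w n)))"
        unfolding w(2) dis_diff[symmetric] nrm_dis E_diff_commute[of "w n" l] one.E_diff_commute[of "w n" l] ..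
      have "enn2real (E (l - w n)) \<le> e / 3" "enn2real (E1 (dis (l - w n))) \<le> e / 3"
        using N[OF that] e by (intro enn2real_leI; simp)+
      then show ?thesis
        unfolding eq using e enn2real_nonneg[of "E (l - w n)"] enn2real_nonneg[of "E1 (dis (l - w n))"] by simp
    qed
    then show "\<exists>no. \<forall>n\<ge>no. norm (nrm (f n - dis l) - 0) < e" by blast
  qed
  then show ?thesis using dis_in_X[OF lY] by blast
qed

lemma mult_bounded_X: "\<exists>C. \<forall>x\<in>X. \<forall>y\<in>X. nrm (distr_mult x y) \<le> C * nrm x * nrm y"
proof -
  obtain C where C: "C \<ge> 0" "\<And>u v. E1 (dis u) < \<infinity> \<Longrightarrow> E1 (dis v) < \<infinity> \<Longrightarrow> E (bc_mult u v) \<le> ennreal C * (E u * E1 (dis v) + E1 (dis u) * E v)"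
    using E_mult by blast
  obtain D where D: "D \<ge> 0" "\<And>u v. E1 (dis u) < \<infinity> \<Longrightarrow> E1 (dis v) < \<infinity> \<Longrightarrow> E1 (dis (bc_mult u v)) \<le> ennreal D * (E1 (dis u) * E1 (dis v) + E1 (dis u) * E1 (dis v))"
    using one.E_mult by blast
  have "nrm (distr_mult x y) \<le> (2 * C + 2 * D) * nrm x * nrm y" if "x \<in> X" "y \<in> X" for x y
  proof -
    from that obtain u v where u: "x = dis u" "u \<in> Y" and v: "y = dis v" "v \<in> Y" by (metis X_cases)
    obtain a a1 where a: "E u = ennreal a" "0 \<le> a" "E1 (dis u) = ennreal a1" "0 \<le> a1"
      using u(2) unfolding Y_def by (cases "E u"; cases "E1 (dis u)") auto
    obtain b b1 where b: "E v = ennreal b" "0 \<le> b" "E1 (dis v) = ennreal b1" "0 \<le> b1"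
      using v(2) unfolding Y_def by (cases "E v"; cases "E1 (dis v)") auto
    have fin: "E1 (dis u) < \<infinity>" "E1 (dis v) < \<infinity>" using u(2) v(2) by (auto simp: Y_def)
    have "E (bc_mult u v) \<le> ennreal (C * (a * b1 + a1 * b))"
      using C(2)[OF fin] unfolding a b using C(1) a b by (simp add: ennreal_mult[symmetric] ennreal_plus[symmetric] del: ennreal_mult ennreal_plus)
    then have 1: "enn2real (E (bc_mult u v)) \<le> C * (a * b1 + a1 * b)" using C(1) a b by (intro enn2real_leI) auto
    have "E1 (dis (bc_mult u v)) \<le> ennreal (D * (a1 * b1 + a1 * b1))"
      using D(2)[OF fin] unfolding a b using D(1) a b by (simp add: ennreal_mult[symmetric] ennreal_plus[symmetric] del: ennreal_mult ennreal_plus)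
    then have 2: "enn2real (E1 (dis (bc_mult u v))) \<le> D * (a1 * b1 + a1 * b1)" using D(1) a b by (intro enn2real_leI) auto
    \<comment> \<open>All three products are terms of the expanded product of the two norms, and
      each estimate contains two of them, whence \<open>2 * C + 2 * D\<close>.\<close>
    have P: "a * b1 \<le> (a + a1) * (b + b1)" "a1 * b \<le> (a + a1) * (b + b1)" "a1 * b1 \<le> (a + a1) * (b + b1)"
      using a b by (auto intro!: mult_mono)
    have "C * (a * b1 + a1 * b) \<le> C * (2 * ((a + a1) * (b + b1)))" "D * (a1 * b1 + a1 * b1) \<le> D * (2 * ((a + a1) * (b + b1)))"
      using P C(1) D(1) by (intro mult_left_mono; simp)+
    with 1 2 have "nrm (dis (bc_mult u v)) \<le> C * (2 * ((a + a1) * (b + b1))) + D * (2 * ((a + a1) * (b + b1)))"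
      unfolding nrm_dis by linarith
    also have "\<dots> = (2 * C + 2 * D) * nrm x * nrm y"
      unfolding u(1) v(1) nrm_dis a b using a b by (simp add: algebra_simps)
    finally show ?thesis unfolding u(1) v(1) distr_mult_dis .
  qed
  then show ?thesis by blast
qed

lemma star_bounded_X: "\<exists>C. \<forall>x\<in>X. nrm (distr_cnj x) \<le> C * nrm x"
proof -
  obtain C where C: "C \<ge> 0" "\<And>u. E (bc_cnj u) \<le> ennreal C * E u" using E_cnj by blast
  obtain D where D: "D \<ge> 0" "\<And>u. E1 (dis (bc_cnj u)) \<le> ennreal D * E1 (dis u)" using one.E_cnj by blast
  have "nrm (distr_cnj x) \<le> (C + D) * nrm x" if "x \<in> X" for x
  proof -
    from that obtain u where u: "x = dis u" "u \<in> Y" by (metis X_cases)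
    obtain a a1 where a: "E u = ennreal a" "0 \<le> a" "E1 (dis u) = ennreal a1" "0 \<le> a1"
      using u(2) unfolding Y_def by (cases "E u"; cases "E1 (dis u)") auto
    have 1: "enn2real (E (bc_cnj u)) \<le> C * a"
      using C(2)[of u] C(1) a by (intro enn2real_leI) (auto simp: ennreal_mult)
    have 2: "enn2real (E1 (dis (bc_cnj u))) \<le> D * a1"
      using D(2)[of u] D(1) a by (intro enn2real_leI) (auto simp: ennreal_mult)
    have "C * a \<le> C * (a + a1)" "D * a1 \<le> D * (a + a1)" using C(1) D(1) a by (intro mult_left_mono; simp)+
    with 1 2 have "nrm (dis (bc_cnj u)) \<le> C * (a + a1) + D * (a + a1)" unfolding nrm_dis by linarith
    also have "\<dots> = (C + D) * nrm x" unfolding u(1) nrm_dis a using a by (simp add: distrib_right)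
    finally show ?thesis unfolding u(1) distr_cnj_dis .
  qed
  then show ?thesis by blast
qed

lemma banach_star_algebra_X: "banach_star_algebra_on scale_distr X nrm distr_mult distr_cnj"
proof -
  interpret V: vector_space "scale_distr :: complex \<Rightarrow> 'd functional \<Rightarrow> 'd functional"
    by unfold_locales (auto simp: scale_distr_def fun_eq_iff algebra_simps)
  \<comment> \<open>Every element of \<open>X\<close> is some \<open>dis u\<close>; these equations
    move all operations inside \<open>dis\<close>, where the algebraic axioms are pointwise
    identities.\<close>
  note eqs = dis_add[symmetric] dis_scale[symmetric] distr_mult_dis distr_cnj_dis
  obtain C where C: "C \<ge> 0" "\<And>u. E1 (dis u) < \<infinity> \<Longrightarrow> norm u \<le> C * enn2real (E1 (dis u))" using Cb_bound by blast
  show ?thesis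
  proof
    show "V.subspace X"
    proof (rule V.subspaceI)
      show "0 \<in> X" using dis_in_X[OF Y_0] by (simp only: dis_0)
      show "x + y \<in> X" if "x \<in> X" "y \<in> X" for x y
        using that by (elim X_cases) (simp only: eqs dis_in_X Y_add)
      show "scale_distr c x \<in> X" if "x \<in> X" for c x
        using that by (elim X_cases) (simp only: eqs dis_in_X Y_scale)
    qed
    show "0 \<le> nrm x" for x by (simp add: nrm_def modulation_norm_def)
    show "nrm x = 0 \<longleftrightarrow> x = 0" if "x \<in> X" for x
    proof -
      from that obtain u where u: "x = dis u" "u \<in> Y" by (metis X_cases)
      \<comment> \<open>Definiteness is inherited from the supremum norm, which the
        \<open>M\<^sub>\<infinity>\<^sub>,\<^sub>1\<close> summand dominates.\<close>
      have "u = 0" if "nrm (dis u) = 0"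
      proof -
        have "enn2real (E1 (dis u)) = 0"
          using that enn2real_nonneg[of "E u"] enn2real_nonneg[of "E1 (dis u)"] unfolding nrm_dis by linarith
        then show ?thesis using C(2)[of u] u(2) by (simp add: Y_def)
      qed
      moreover have "nrm (dis 0) = 0" unfolding nrm_dis E_0 one.E_0 by simp
      ultimately show ?thesis unfolding u(1) using dis_0 by metis
    qed
    show "nrm (x + y) \<le> nrm x + nrm y" if "x \<in> X" "y \<in> X" for x y
      using that by (elim X_cases) (simp only: eqs nrm_triangle_dis)
    show "nrm (scale_distr c x) = cmod c * nrm x" if "x \<in> X" for x c
      using that by (elim X_cases) (simp only: eqs nrm_scale_dis)
    show "\<exists>x\<in>X. (\<lambda>n::nat. nrm (f n - x)) \<longlonglongrightarrow> 0"
      if "\<And>n. f n \<in> X" "\<And>e. e > 0 \<Longrightarrow> \<exists>N. \<forall>m\<ge>N. \<forall>n\<ge>N. nrm (f m - f n) < e" for f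
      by (rule complete_X[OF that])
    show "distr_mult x y \<in> X" if "x \<in> X" "y \<in> X" for x y
      using that by (elim X_cases) (simp only: eqs dis_in_X Y_mult)
    show "distr_mult (distr_mult x y) z = distr_mult x (distr_mult y z)" if "x \<in> X" "y \<in> X" "z \<in> X" for x y z
      using that by (elim X_cases) (simp only: eqs bc_mult_assoc)
    show "distr_mult (x + y) z = distr_mult x z + distr_mult y z" if "x \<in> X" "y \<in> X" "z \<in> X" for x y z
      using that by (elim X_cases) (simp only: eqs bc_mult_add_left)
    show "distr_mult x (y + z) = distr_mult x y + distr_mult x z" if "x \<in> X" "y \<in> X" "z \<in> X" for x y z
      using that by (elim X_cases) (simp only: eqs bc_mult_add_right)
    show "distr_mult (scale_distr c x) y = scale_distr c (distr_mult x y)" if "x \<in> X" "y \<in> X" for x y c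
      using that by (elim X_cases) (simp only: eqs bc_mult_scale_left)
    show "distr_mult x (scale_distr c y) = scale_distr c (distr_mult x y)" if "x \<in> X" "y \<in> X" for x y c
      using that by (elim X_cases) (simp only: eqs bc_mult_scale_right)
    show "\<exists>C. \<forall>x\<in>X. \<forall>y\<in>X. nrm (distr_mult x y) \<le> C * nrm x * nrm y" by (rule mult_bounded_X)
    show "distr_cnj x \<in> X" if "x \<in> X" for x
      using that by (elim X_cases) (simp only: eqs dis_in_X Y_cnj)
    show "distr_cnj (x + y) = distr_cnj x + distr_cnj y" if "x \<in> X" "y \<in> X" for x y
      using that by (elim X_cases) (simp only: eqs bc_cnj_add)
    show "distr_cnj (scale_distr c x) = scale_distr (cnj c) (distr_cnj x)" if "x \<in> X" for x c
      using that by (elim X_cases) (simp only: eqs bc_cnj_scale)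
    show "distr_cnj (distr_mult x y) = distr_mult (distr_cnj y) (distr_cnj x)" if "x \<in> X" "y \<in> X" for x y
      using that by (elim X_cases) (simp only: eqs bc_cnj_mult)
    show "distr_cnj (distr_cnj x) = x" if "x \<in> X" for x
      using that by (elim X_cases) (simp only: eqs bc_cnj_cnj)
    show "\<exists>C. \<forall>x\<in>X. nrm (distr_cnj x) \<le> C * nrm x" by (rule star_bounded_X)
  qed
qed

end

theorem theorem2:
  fixes g :: "real ^ 'd \<Rightarrow> complex" and p q :: ennreal and s :: real
  assumes "g \<in> schwartz - {\<lambda>x. 0}"
    and "1 \<le> p" and "1 \<le> q" and "0 \<le> s"
  shows
    "((\<forall>f \<in> modulation_space g \<infinity> 1 0. \<exists>!u :: (real ^ 'd) \<Rightarrow>\<^sub>C complex. distr_of_fun (apply_bcontfun u) = f) \<and>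
      (\<exists>C. \<forall>f \<in> modulation_space g \<infinity> 1 0. norm (Cb_rep f) \<le> C * modulation_norm g \<infinity> 1 0 f)) \<and>
     banach_star_algebra_on scale_distr
       (modulation_space g p q s \<inter> modulation_space g \<infinity> 1 0)
       (\<lambda>f. modulation_norm g p q s f + modulation_norm g \<infinity> 1 0 f)
       distr_mult distr_cnj \<and>
     ((q > 1 \<and> s > real CARD('d) * (1 - enn2real (1 / q))) \<or> q = 1 \<longrightarrow>
       continuously_embedded
         (modulation_space g p q s) (modulation_norm g p q s)
         (modulation_space g \<infinity> 1 0) (modulation_norm g \<infinity> 1 0) \<and>
       banach_star_algebra_on scale_distr
         (modulation_space g p q s) (modulation_norm g p q s)
         distr_mult distr_cnj)"
proof -
  from assms(1) obtain y0 where y0: "g y0 \<noteq> 0" by auto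
  interpret modulation_norms g y0 p q s
    using assms y0 by unfold_locales auto
  have "\<exists>!u :: (real ^ 'd) \<Rightarrow>\<^sub>C complex. dis u = f" if "f \<in> M1" for f
    using that by (elim M1_cases) (auto intro: distr_of_fun_inject[OF g g0])
  moreover have "\<exists>C. \<forall>f \<in> M1. norm (Cb_rep f) \<le> C * modulation_norm g \<infinity> 1 0 f"
  proof -
    obtain C where C: "\<And>u. E1 (dis u) < \<infinity> \<Longrightarrow> norm u \<le> C * enn2real (E1 (dis u))" using Cb_bound by blast
    have "norm (Cb_rep f) \<le> C * modulation_norm g \<infinity> 1 0 f" if "f \<in> M1" for f
      using that by (elim M1_cases) (simp only: Cb_rep_dis modulation_norm_def C)
    then show ?thesis by blast
  qed
  moreover have alg: "banach_star_algebra_on scale_distr (modulation_space g p q s \<inter> M1)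
       (\<lambda>f. modulation_norm g p q s f + modulation_norm g \<infinity> 1 0 f) distr_mult distr_cnj"
    using banach_star_algebra_X unfolding X_def nrm_def[abs_def] .
  moreover have "continuously_embedded (modulation_space g p q s) (modulation_norm g p q s) M1 (modulation_norm g \<infinity> 1 0) \<and>
       banach_star_algebra_on scale_distr (modulation_space g p q s) (modulation_norm g p q s) distr_mult distr_cnj"
    if qs: "(q > 1 \<and> s > real CARD('d) * (1 - enn2real (1 / q))) \<or> q = 1"
  proof -
    let ?MS = "modulation_space g p q s" and ?n = "modulation_norm g p q s"
    obtain C where C: "C \<ge> 0" "\<And>f. f \<in> tempered_distributions \<Longrightarrow> E1 f \<le> ennreal C * modulation_enorm g p q s f"
      using modulation_embedding[OF g g0 p q s qs] by blast
    have sub: "?MS \<subseteq> M1"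
    proof
      fix f assume f: "f \<in> ?MS"
      then have "ennreal C * modulation_enorm g p q s f < \<infinity>" by (auto simp: modulation_space_def ennreal_mult_less_top)
      then show "f \<in> M1" using f C(2)[of f] by (auto simp: modulation_space_def intro: le_less_trans)
    qed
    have le: "modulation_norm g \<infinity> 1 0 f \<le> C * ?n f" if f: "f \<in> ?MS" for f
    proof -
      obtain a where a: "modulation_enorm g p q s f = ennreal a" "0 \<le> a"
        using f by (cases "modulation_enorm g p q s f") (auto simp: modulation_space_def)
      have "E1 f \<le> ennreal (C * a)" using C(1) C(2)[of f] f a by (simp add: modulation_space_def ennreal_mult)
      then show ?thesis unfolding modulation_norm_def a using C(1) a by (simp add: enn2real_leI)
    qed
    \<comment> \<open>By the embedding the intersection is the whole space as a set, so that only
      the norm remains to be exchanged.\<close>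
    have XM: "X = ?MS" using sub by (auto simp: X_def)
    have "banach_star_algebra_on scale_distr ?MS ?n distr_mult distr_cnj"
    proof (rule equiv_norm_banach_star_algebra[where C="1 + C"])
      show "banach_star_algebra_on scale_distr ?MS nrm distr_mult distr_cnj" using banach_star_algebra_X unfolding XM .
      show n0: "0 \<le> ?n f" for f by (simp add: modulation_norm_def)
      show "?n f \<le> nrm f" for f by (simp add: nrm_def modulation_norm_def)
      show "nrm f \<le> (1 + C) * ?n f" if "f \<in> ?MS" for f using le[OF that] by (simp add: nrm_def distrib_right)
      \<comment> \<open>The triangle inequality and the homogeneity of a single summand do not
        follow from those of the sum; they come from the estimates for \<open>E\<close>, applied to
        the representing functions.\<close>
      show "?n (f + h) \<le> ?n f + ?n h" if fh: "f \<in> ?MS" "h \<in> ?MS" for f h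
      proof -
        from fh obtain u v where u: "f = dis u" "u \<in> Y" and v: "h = dis v" "v \<in> Y" unfolding XM[symmetric] by (metis X_cases)
        have "enn2real (E (u + v)) \<le> enn2real (E u + E v)" using u v E_add by (intro enn2real_mono) (auto simp: Y_def)
        also have "\<dots> = enn2real (E u) + enn2real (E v)" using u v by (intro enn2real_plus) (auto simp: Y_def)
        finally show ?thesis unfolding u(1) v(1) modulation_norm_def dis_add .
      qed
      show "?n (scale_distr c f) = cmod c * ?n f" if f: "f \<in> ?MS" for f c
      proof -
        from f obtain u where u: "f = dis u" unfolding XM[symmetric] by (metis X_cases)
        show ?thesis unfolding u modulation_norm_def dis_scale[symmetric] E_scale by (simp add: enn2real_mult)
      qed
    qed (use C(1) in simp)
    moreover have "continuously_embedded ?MS ?n M1 (modulation_norm g \<infinity> 1 0)"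
      unfolding continuously_embedded_def using sub le by blast
    ultimately show ?thesis by blast
  qed
  ultimately show ?thesis by blast
qed

end
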